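(* Let $n\ge 1$ be an integer, let $q\in\mathbb{C}^*$ with $|q|<1$, and let $\varepsilon\in\mathbb{C}$ with $0<|\varepsilon|<1$. Suppose that $|a_i|<1$ $(i=1,2,3)$, $|b_j|<1$ $(j=1,2,3)$ and $|t|<1$, and that the balancing condition $q=a_1a_2a_3b_1b_2b_3t^{2n-2}$ holds. Then for every $v\in\mathbb{C}^*$, $$ \begin{aligned} &\frac{1}{n!}\int_{\mathbb{T}^{n}} \prod_{i=1}^{n} \bigg[ \frac{(\varepsilon^{2}z_{i}^{2};q)_{\infty}\, \theta(t^{n-1}a_{1}a_{2}vz_{i}^{-1}, vz_{i},a_{3}z_{i}^{-1};q)} {(q\varepsilon^{2}z_{i}^{2};q)_{\infty}\prod_{j=1}^{3}(a_j\varepsilon^{2} z_{i},a_jz_{i}^{-1};q)_{\infty}} \prod_{k=1}^{3}\frac{(qb_{k}^{-1}\varepsilon^{2} z_{i};q)_{\infty}}{(b_{k}z_{i};q)_{\infty}} \bigg]\\ &\qquad\times\prod_{1\le j< k\le n} \frac{(\varepsilon^{2} z_{j}z_{k};q)_{\infty}}{(q\varepsilon^{2} z_{j}z_{k};q)_{\infty}} \frac{(z_{j}/z_{k},z_{k}/z_{j};q)_{\infty}} {(tz_{j}/z_{k},tz_{k}/z_{j};q)_{\infty}} \frac{(qt^{-1}\varepsilon^{2} z_{j}z_{k};q)_{\infty}} {(t\varepsilon^{2} z_{j}z_{k};q)_{\infty}} \,\varpi(z)\\ &\quad = \prod_{i=1}^{n}\frac{(t;q)_{\infty}\prod_{l=1}^{2}\theta(t^{i-1}a_{l}v;q)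 \prod_{k=1}^3\theta(t^{i-1}a_3b_k;q) \prod_{1\le j<k\le 3}(qt^{-(i-1)}b_{j}^{-1}b_{k}^{-1}\varepsilon^{2};q)_{\infty}} {(q,t^{i};q)_{\infty} \prod_{1\le j<k\le 3}(t^{i-1}a_{j}a_{k}\varepsilon^{2};q)_{\infty} \prod_{j,k=1}^{3}(t^{i-1}a_{j}b_{k};q)_{\infty}}. \end{aligned} $$
   Context: Notation: $(u;q)_\infty=\prod_{i=0}^\infty(1-q^iu)$, $(u_1,\ldots,u_m;q)_\infty=(u_1;q)_\infty\cdots(u_m;q)_\infty$, $\theta(u;q)=(u,q/u;q)_\infty$ for $u\in\mathbb{C}^*$, $\theta(u_1,\ldots,u_m;q)=\theta(u_1;q)\cdots\theta(u_m;q)$. Quotients of the form $(u;q)_\infty/(qu;q)_\infty$ are understood as $1-u$. The measure is $\varpi(z)=\frac{1}{(2\pi\sqrt{-1})^n}\frac{dz_1}{z_1}\cdots\frac{dz_n}{z_n}$, and $\mathbb{T}^n=\{(z_1,\ldots,z_n)\in\mathbb{C}^n : |z_i|=1\ (i=1,\ldots,n)\}$ is the $n$-fold product of the unit circle, each traversed in the positive direction. *)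

theory Defs
  imports "HOL-Analysis.Analysis" "HOL-Complex_Analysis.Complex_Analysis"
begin

text \<open>\<open>qpoch [u\<^sub>1, \<dots>, u\<^sub>m] q\<close> is $(u_1, \ldots, u_m; q)_\infty$. The infinite product is only
  meaningful for $|q| < 1$; \<^const>\<open>prodinf\<close> gives the value 0 when a factor vanishes.\<close>

definition qpoch_inf :: "complex \<Rightarrow> complex \<Rightarrow> complex" where
  "qpoch_inf u q = (\<Prod>i. 1 - q ^ i * u)"

definition qpoch :: "complex list \<Rightarrow> complex \<Rightarrow> complex" where
  "qpoch us q = (\<Prod>u\<leftarrow>us. qpoch_inf u q)"

definition theta :: "complex list \<Rightarrow> complex \<Rightarrow> complex" where
  "theta us q = (\<Prod>u\<leftarrow>us. qpoch [u, q / u] q)"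

text \<open>The integral over the \<open>n\<close>-fold product of the positively oriented unit circle against
  $\frac{1}{(2\pi\sqrt{-1})^n}\frac{dz_1}{z_1}\cdots\frac{dz_n}{z_n}$: the form is pulled back to
  $[0,1]^n$ along $z_i = \gamma(x_i)$, where $\gamma$ is \<open>circlepath 0 1\<close>, so that
  $dz_i = \gamma'(x_i)\,dx_i$. The integrand is a function of $z$ with coordinates
  \<open>z 1, \<dots>, z n\<close> and has to depend on these coordinates only.\<close>

definition torus_integral :: "nat \<Rightarrow> ((nat \<Rightarrow> complex) \<Rightarrow> complex) \<Rightarrow> complex" where
  "torus_integral n f =
     1 / (2 * complex_of_real pi * \<i>) ^ n *
     (LINT x | PiM {1..n} (\<lambda>_. restrict_space lborel {0..1}).
        f (\<lambda>i. circlepath 0 1 (x i)) *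
        (\<Prod>i=1..n. vector_derivative (circlepath 0 1) (at (x i)) / circlepath 0 1 (x i)))"

definition index_pairs :: "nat \<Rightarrow> (nat \<times> nat) set" where
  "index_pairs n = {(j, k). 1 \<le> j \<and> j < k \<and> k \<le> n}"

end

theory Submission
  imports Defs "HOL-Probability.Infinite_Product_Measure"
begin

text \<open>
  Put \<open>e = \<epsilon>\<^sup>2\<close> and \<open>b\<^sub>4 = a\<^sub>3 e\<close>; the integrand becomes symmetric in \<open>b\<^sub>1, \<dots>, b\<^sub>4\<close>, with the balancing condition
  \<open>q e = a\<^sub>1 a\<^sub>2 b\<^sub>1 b\<^sub>2 b\<^sub>3 b\<^sub>4 t\<^bsup>2n-2\<^esup>\<close>. Moving one contour from \<open>z\<^sub>i\<close> to \<open>q z\<^sub>i\<close> yields relations between integrals,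
  and a suitable combination of them is a two-term \<open>q\<close>-difference equation in \<open>(b\<^sub>3, b\<^sub>4)\<close>. The
  claimed right-hand side satisfies the same equation, so the quotient is invariant under
  \<open>(b\<^sub>3, b\<^sub>4) \<mapsto> (b\<^sub>3 / q, q b\<^sub>4)\<close>; along \<open>(b\<^sub>3 / u, b\<^sub>4 u)\<close> it is holomorphic in an annulus that contains a
  fundamental domain of \<open>u \<mapsto> q u\<close>, so it is constant by the maximum principle. After rescaling
  the variables one may let \<open>a\<^sub>1\<close> and \<open>b\<^sub>3\<close> tend to \<open>1\<close>: the contours are pinched, and the leading term is
  a residue times the integral in \<open>n - 1\<close> variables with \<open>a\<^sub>1 = b\<^sub>3 = t\<close>. Induction on \<open>n\<close> determines
  the constant, and analytic continuation removes the size restrictions on the parameters.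
\<close>

section \<open>Infinite products and theta functions\<close>

text \<open>When \<open>z\<^sub>i\<close> moves to \<open>q z\<^sub>i\<close>, the two theta factors
  change by a quantity in which \<open>v\<close> cancels. So every relation between integrals holds
  for fixed \<open>v\<close>, and \<open>v\<close> enters the evaluation only through residues. A
  contour shift in one variable may be multiplied by any function of the other variables. The
  difficulty is to choose these multipliers so that the sum of all shifts collapses to two
  integrals. Multiplying \<open>b\<^sub>l\<close> by \<open>q\<close> multiplies the weight by a
  constant-free product of \<open>x\<^sub>i - jouk e b\<^sub>l\<close> and of the
  \<open>z\<^sub>i\<close>, while the shifts add up to a Lagrange sum. Both are affine in every
  \<open>x\<^sub>i\<close>, and such symmetric functions are determined by their values at finite
  geometric progressions of ratio \<open>t\<close> that start at \<open>b\<^sub>3\<close> and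
  \<open>b\<^sub>4\<close>, where almost all terms vanish. Balancing acts twice: it makes the two
  ends of a shift mirror images under \<open>g \<mapsto> e / g\<close>, and it lowers a degree by
  one, without which affinity would fail. In the pinching limit
  \<open>a\<^sub>1 = b\<^sub>3 = r\<close> is real, and \<open>1 - r\<^sup>2\<close> is both the
  normalisation of a Poisson kernel and the factor of the right-hand side that tends to 0.\<close>

locale qbase =
  fixes q :: complex
  assumes q_nz: "q \<noteq> 0" and q_lt: "norm q < 1"
begin

abbreviation qp :: "complex \<Rightarrow> complex" where "qp u \<equiv> qpoch_inf u q"

lemma abs_convergent_qp: "abs_convergent_prod (\<lambda>i. 1 - q ^ i * u)"
  unfolding abs_convergent_prod_conv_summable
  using q_lt by (auto simp: norm_mult norm_power intro!: summable_mult2 summable_geometric)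

lemma convergent_qp: "convergent_prod (\<lambda>i. 1 - q ^ i * u)"
  by (rule abs_convergent_prod_imp_convergent_prod[OF abs_convergent_qp])

lemma qp_LIMSEQ: "(\<lambda>N. \<Prod>i<N. 1 - q ^ i * u) \<longlonglongrightarrow> qp u"
  using convergent_prod_LIMSEQ[OF convergent_qp[of u]] unfolding qpoch_inf_def
  by - (rule LIMSEQ_imp_Suc, simp only: lessThan_Suc_atMost)

lemma qp_rec: "qp u = (1 - u) * qp (q * u)"
proof -
  have "(\<lambda>N. (1 - u) * (\<Prod>i<N. 1 - q ^ i * (q * u))) \<longlonglongrightarrow> (1 - u) * qp (q * u)"
    by (intro tendsto_intros qp_LIMSEQ)
  also have "(\<lambda>N. (1 - u) * (\<Prod>i<N. 1 - q ^ i * (q * u))) = (\<lambda>N. \<Prod>i<Suc N. 1 - q ^ i * u)"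
    by (subst prod.lessThan_Suc_shift) (simp add: mult_ac)
  finally have "(\<lambda>N. \<Prod>i<N. 1 - q ^ i * u) \<longlonglongrightarrow> (1 - u) * qp (q * u)"
    by (rule LIMSEQ_imp_Suc)
  thus ?thesis using qp_LIMSEQ LIMSEQ_unique by blast
qed

lemma qp_nonzero:
  assumes "norm u < 1" shows "qp u \<noteq> 0"
  unfolding qpoch_inf_def
proof (rule prodinf_nonzero[OF convergent_qp])
  fix i
  have "norm (q ^ i * u) \<le> 1 * norm u"
    unfolding norm_mult norm_power using q_lt by (intro mult_right_mono power_le_one) auto
  hence "norm (q ^ i * u) < 1" using assms by simp
  thus "1 - q ^ i * u \<noteq> 0" by auto
qed

lemma qp_uniform: "uniformly_convergent_on (cball 0 R) (\<lambda>N u. \<Prod>i<N. 1 - q ^ i * u)"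
proof -
  have "uniformly_convergent_on (cball 0 R) (\<lambda>N u. \<Prod>n<N. 1 + - (q ^ n * u))"
  proof (rule uniformly_convergent_on_prod)
    show "uniformly_convergent_on (cball 0 R) (\<lambda>N x. \<Sum>n<N. norm (- (q ^ n * x)))"
    proof (rule Weierstrass_m_test')
      show "norm (norm (- (q ^ n * x))) \<le> norm q ^ n * R" if "x \<in> cball 0 R" for n x
        using that by (auto simp: norm_mult norm_power intro!: mult_left_mono)
      show "summable (\<lambda>n. norm q ^ n * R)"
        using q_lt by (intro summable_mult2 summable_geometric) auto
    qed
  qed (auto intro!: continuous_intros)
  thus ?thesis by simp
qed

lemma qp_holomorphic: "qp holomorphic_on UNIV"
proof (rule holomorphic_uniform_sequence)
  show "(\<lambda>u. \<Prod>i<N. 1 - q ^ i * u) holomorphic_on UNIV" for N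
    by (intro holomorphic_intros)
  fix x :: complex
  obtain l where l: "uniform_limit (cball 0 (norm x + 1)) (\<lambda>N u. \<Prod>i<N. 1 - q ^ i * u) l sequentially"
    using qp_uniform unfolding uniformly_convergent_on_def by blast
  have "l u = qp u" if "u \<in> cball 0 (norm x + 1)" for u
    using tendsto_uniform_limitI[OF l that] qp_LIMSEQ LIMSEQ_unique by blast
  hence "uniform_limit (cball 0 (norm x + 1)) (\<lambda>N u. \<Prod>i<N. 1 - q ^ i * u) qp sequentially"
    using l by (subst uniform_limit_cong'[where g = "\<lambda>N u. \<Prod>i<N. 1 - q ^ i * u" and i = l]) auto
  hence "uniform_limit (cball x 1) (\<lambda>N u. \<Prod>i<N. 1 - q ^ i * u) qp sequentially"
  proof (rule uniform_limit_on_subset)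
    show "cball x 1 \<subseteq> cball 0 (norm x + 1)"
      by (simp add: cball_subset_cball_iff dist_norm)
  qed
  thus "\<exists>d>0. cball x d \<subseteq> UNIV \<and> uniform_limit (cball x d) (\<lambda>N u. \<Prod>i<N. 1 - q ^ i * u) qp sequentially"
    by (intro exI[of _ 1]) auto
qed auto

lemma qp_holo [holomorphic_intros]: "f holomorphic_on S \<Longrightarrow> (\<lambda>x. qp (f x)) holomorphic_on S"
  using holomorphic_on_compose[of f S qp] holomorphic_on_subset[OF qp_holomorphic]
  by (auto simp: o_def)

lemma qp_cont [continuous_intros]: "continuous_on S f \<Longrightarrow> continuous_on S (\<lambda>x. qp (f x))"
  by (rule continuous_on_compose2[OF holomorphic_on_imp_continuous_on[OF qp_holomorphic]]) auto

definition th :: "complex \<Rightarrow> complex" where "th u = qp u * qp (q / u)"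

lemma theta_th: "theta us q = (\<Prod>u\<leftarrow>us. th u)"
  unfolding theta_def th_def qpoch_def by simp

text \<open>Passing from \<open>u\<close> to \<open>q * u\<close> removes the factor
  \<open>1 - u\<close> from one product and adds \<open>1 - 1 / u\<close> to the other. This
  quasi-periodicity makes the theta factors of the integrand compatible with contour shifts.\<close>

lemma th_shift: assumes "u \<noteq> 0" shows "th (q * u) = - th u / u"
proof -
  have "th (q * u) * u = qp (q * u) * (qp (inverse u) * u)"
    using q_nz assms by (simp add: th_def field_simps)
  also have "qp (inverse u) = (1 - inverse u) * qp (q / u)"
    by (subst qp_rec) (simp add: field_simps)
  also have "qp (q * u) * ((1 - inverse u) * qp (q / u) * u) = - th u"
    unfolding th_def by (subst (2) qp_rec) (use assms in \<open>simp add: field_simps\<close>)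
  finally show ?thesis using assms by (simp add: field_simps)
qed

lemma th_holo [holomorphic_intros]:
  "f holomorphic_on S \<Longrightarrow> (\<And>x. x \<in> S \<Longrightarrow> f x \<noteq> 0) \<Longrightarrow> (\<lambda>x. th (f x)) holomorphic_on S"
  unfolding th_def by (intro holomorphic_intros) auto

lemma th_cont [continuous_intros]:
  "continuous_on S f \<Longrightarrow> (\<And>x. x \<in> S \<Longrightarrow> f x \<noteq> 0) \<Longrightarrow> continuous_on S (\<lambda>x. th (f x))"
  unfolding th_def by (intro continuous_intros) auto

end

section \<open>Integrals over the torus\<close>

abbreviation unit_interval_measure :: "real measure" where
  "unit_interval_measure \<equiv> restrict_space lborel {0..1}"

abbreviation circ :: "real \<Rightarrow> complex" where "circ \<equiv> circlepath 0 1"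

text \<open>All coordinates are constrained, not only those of an index set, so that one compact
  space serves integrals in any number of variables.\<close>

definition Tor :: "(nat \<Rightarrow> complex) set" where "Tor = {z. \<forall>i. norm (z i) = 1}"

text \<open>On \<open>z = circ x\<close> the form \<open>dz / (2 pi i z)\<close> is
  \<open>dx\<close>, so \<open>CI\<close> and \<open>TI\<close> are plain averages without a
  prefactor.\<close>

definition CI :: "(complex \<Rightarrow> complex) \<Rightarrow> complex" where
  "CI f = (LINT x|unit_interval_measure. f (circ x))"

definition TI :: "nat set \<Rightarrow> ((nat \<Rightarrow> complex) \<Rightarrow> complex) \<Rightarrow> complex" where
  "TI I F = (LINT x|PiM I (\<lambda>_. unit_interval_measure). F (\<lambda>i. circ (x i)))"

lemma prob_space_unit_interval: "prob_space unit_interval_measure"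
  by (rule prob_spaceI) (simp add: space_restrict_space emeasure_restrict_space)

interpretation UI: prob_space unit_interval_measure by (rule prob_space_unit_interval)

interpretation UP: product_prob_space "\<lambda>_. unit_interval_measure" UNIV by unfold_locales

lemma prob_space_PiM_unit: "prob_space (PiM I (\<lambda>_. unit_interval_measure))"
  by (rule prob_space_PiM) (rule prob_space_unit_interval)

lemma norm_circ [simp]: "norm (circ x) = 1"
  by (simp add: circlepath)

lemma circ_0: "circ 0 = 1" and circ_1: "circ 1 = 1"
  unfolding circlepath by simp_all

lemma continuous_circ [continuous_intros]: "continuous_on S f \<Longrightarrow> continuous_on S (\<lambda>x. circ (f x))"
  unfolding circlepath by (intro continuous_intros)

lemma circ_in_Tor [simp]: "(\<lambda>i. circ (x i)) \<in> Tor" by (simp add: Tor_def)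

lemma Tor_upd: "z \<in> Tor \<Longrightarrow> norm w = 1 \<Longrightarrow> z(i := w) \<in> Tor" by (simp add: Tor_def)

lemma Tor_nz: "z \<in> Tor \<Longrightarrow> z i \<noteq> 0" unfolding Tor_def by (metis (mono_tags) mem_Collect_eq norm_zero zero_neq_one)

lemma Tor_norm: "z \<in> Tor \<Longrightarrow> norm (z i) = 1" unfolding Tor_def by auto

lemma continuous_coord [continuous_intros]: "continuous_on S (\<lambda>z::nat \<Rightarrow> complex. z i)"
  by (rule continuous_on_subset[OF continuous_on_product_coordinates]) auto

lemma continuous_snd_coord [continuous_intros]:
  "continuous_on S (\<lambda>p::'a::topological_space \<times> (nat \<Rightarrow> complex). snd p i)"
  by (rule continuous_on_product_then_coordinatewise) (intro continuous_intros)

lemma compact_Tor: "compact Tor"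
proof -
  have "compactin (product_topology (\<lambda>_::nat. euclidean) UNIV) (PiE UNIV (\<lambda>_. sphere (0::complex) 1))"
    by (subst compactin_PiE) (auto simp: compactin_euclidean_iff)
  moreover have "PiE UNIV (\<lambda>_. sphere (0::complex) 1) = Tor"
    by (simp add: Tor_def PiE_UNIV_domain Pi_def)
  ultimately show ?thesis
    by (simp add: euclidean_product_topology compactin_euclidean_iff)
qed

lemma Tor_bounded:
  assumes "continuous_on Tor F"
  obtains B where "B > 0" "\<And>z. z \<in> Tor \<Longrightarrow> norm (F z :: complex) \<le> B"
proof -
  have "bounded (F ` Tor)"
    by (intro compact_imp_bounded compact_continuous_image assms compact_Tor)
  thus ?thesis using that unfolding bounded_pos by auto
qed

text \<open>\<open>F\<close> lives on functions of all naturals, the product measure on extensional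
  functions over \<open>I\<close>. The coordinatewise map \<open>?\<phi>\<close> goes into a
  countable product of Borel spaces, whose sigma-algebra is the Borel one, and \<open>?G\<close>
  extends \<open>F\<close> by 0 off the closed set \<open>Tor\<close>. Outside \<open>I\<close> a
  point is \<open>undefined\<close>, which explains \<open>circ undefined\<close>.\<close>

lemma Tor_measurable:
  assumes "continuous_on Tor (F :: (nat \<Rightarrow> complex) \<Rightarrow> complex)"
  shows "(\<lambda>x. F (\<lambda>i. circ (x i))) \<in> borel_measurable (PiM I (\<lambda>_. unit_interval_measure))"
proof -
  let ?\<phi> = "\<lambda>x i. if i \<in> I then circ (x i) else circ undefined"
  let ?G = "\<lambda>z. indicator Tor z *\<^sub>R F z"
  have circ_meas: "circ \<in> borel_measurable unit_interval_measure"
    by (intro measurable_restrict_space1)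
      (simp add: borel_measurable_continuous_onI continuous_circ)
  have "?\<phi> \<in> measurable (PiM I (\<lambda>_. unit_interval_measure)) (PiM UNIV (\<lambda>_. borel))"
  proof (rule measurable_PiM_single')
    fix i
    show "(\<lambda>x. ?\<phi> x i) \<in> borel_measurable (PiM I (\<lambda>_. unit_interval_measure))"
    proof (cases "i \<in> I")
      case True
      have "(\<lambda>x. circ (x i)) \<in> borel_measurable (PiM I (\<lambda>_. unit_interval_measure))"
        by (rule measurable_compose[OF measurable_component_singleton[OF True] circ_meas])
      thus ?thesis using True by simp
    qed simp
  qed (auto simp: space_PiM)
  hence m: "?\<phi> \<in> borel_measurable (PiM I (\<lambda>_. unit_interval_measure))"
    using measurable_cong_sets[OF refl sets_PiM_equal_borel] by blast
  have "Tor \<in> sets borel"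
    by (intro borel_closed compact_imp_closed compact_Tor)
  hence "?G \<in> borel_measurable borel"
    by (intro borel_measurable_continuous_on_indicator assms)
  hence "(\<lambda>x. ?G (?\<phi> x)) \<in> borel_measurable (PiM I (\<lambda>_. unit_interval_measure))"
    using measurable_compose[OF m] by blast
  moreover have "?G (?\<phi> x) = F (\<lambda>i. circ (x i))" if "x \<in> space (PiM I (\<lambda>_. unit_interval_measure))" for x
  proof -
    have "?\<phi> x = (\<lambda>i. circ (x i))"
      using that by (auto simp: space_PiM PiE_def extensional_def)
    thus ?thesis by simp
  qed
  ultimately show ?thesis
    by (subst measurable_cong[where g = "\<lambda>x. ?G (?\<phi> x)"]) auto
qed

lemma Tor_integrable:
  assumes "continuous_on Tor (F :: (nat \<Rightarrow> complex) \<Rightarrow> complex)"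
  shows "integrable (PiM I (\<lambda>_. unit_interval_measure)) (\<lambda>x. F (\<lambda>i. circ (x i)))"
proof -
  interpret prob_space "PiM I (\<lambda>_. unit_interval_measure)" by (rule prob_space_PiM_unit)
  obtain B where "\<And>z. z \<in> Tor \<Longrightarrow> norm (F z) \<le> B" using Tor_bounded[OF assms] by blast
  thus ?thesis
    by (intro integrable_const_bound[where B = B] Tor_measurable assms) auto
qed

lemma TI_cong: "(\<And>z. z \<in> Tor \<Longrightarrow> F z = G z) \<Longrightarrow> TI I F = TI I G"
  unfolding TI_def by (intro Bochner_Integration.integral_cong) auto

lemma CI_cong: "(\<And>w. norm w = 1 \<Longrightarrow> f w = g w) \<Longrightarrow> CI f = CI g"
  unfolding CI_def by (intro Bochner_Integration.integral_cong) auto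

lemma TI_cmult: "TI I (\<lambda>z. c * F z) = c * TI I F"
  unfolding TI_def by simp

lemma TI_sum:
  assumes "\<And>a. a \<in> A \<Longrightarrow> continuous_on Tor (F a)"
  shows "TI I (\<lambda>z. \<Sum>a\<in>A. F a z) = (\<Sum>a\<in>A. TI I (F a))"
  unfolding TI_def by (rule Bochner_Integration.integral_sum) (intro Tor_integrable assms)

lemma TI_diff:
  assumes "continuous_on Tor F" "continuous_on Tor G"
  shows "TI I (\<lambda>z. F z - G z) = TI I F - TI I G"
  unfolding TI_def by (rule Bochner_Integration.integral_diff) (intro Tor_integrable assms)+

lemma TI_empty: "TI {} F = F (\<lambda>_. circ undefined)"
  unfolding TI_def by (simp add: PiM_empty lebesgue_integral_count_space_finite)

lemma TI_insert:
  assumes "finite I" "i \<notin> I" "continuous_on Tor F"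
  shows "TI (insert i I) F = TI I (\<lambda>z. CI (\<lambda>w. F (z(i := w))))"
proof -
  have "TI (insert i I) F = (LINT x|PiM I (\<lambda>_. unit_interval_measure).
          LINT y|unit_interval_measure. F (\<lambda>j. circ ((x(i := y)) j)))"
    unfolding TI_def
    by (rule UP.product_integral_insert[OF assms(1,2) Tor_integrable[OF assms(3)]])
  also have "(\<lambda>x y. F (\<lambda>j. circ ((x(i := y)) j))) = (\<lambda>x y. F ((\<lambda>j. circ (x j))(i := circ y)))"
    by (intro ext arg_cong[of _ _ F]) auto
  finally show ?thesis unfolding TI_def CI_def .
qed

lemma CI_const [simp]: "CI (\<lambda>_. c) = c" unfolding CI_def using UI.prob_space by (simp add: space_restrict_space)

lemma CI_eq_integral:
  assumes "continuous_on (sphere 0 1) f"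
  shows "CI f = integral {0..1} (\<lambda>x. f (circ x))" "(\<lambda>x. f (circ x)) integrable_on {0..1}"
proof -
  have c: "continuous_on {0..1} (\<lambda>x. f (circ x))"
    by (rule continuous_on_compose2[OF assms]) (auto intro!: continuous_intros)
  have "CI f = set_lebesgue_integral lborel {0..1} (\<lambda>x. f (circ x))"
    unfolding CI_def set_lebesgue_integral_def by (rule integral_restrict_space) simp
  also have "\<dots> = integral {0..1} (\<lambda>x. f (circ x))"
    by (intro set_borel_integral_eq_integral borel_integrable_atLeastAtMost' c)
  finally show "CI f = integral {0..1} (\<lambda>x. f (circ x))" .
  show "(\<lambda>x. f (circ x)) integrable_on {0..1}"
    by (rule integrable_continuous_real[OF c])
qed

lemma has_vector_derivative_scaled_circ:
  "((\<lambda>x. c * circ x) has_vector_derivative (2 * pi * \<i> * (c * circ x))) (at x within S)"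
proof -
  have "((\<lambda>w. c * exp (2 * of_real pi * \<i> * w)) has_field_derivative
      2 * pi * \<i> * (c * exp (2 * of_real pi * \<i> * of_real x))) (at (of_real x))"
    by (auto intro!: derivative_eq_intros)
  thus ?thesis unfolding circlepath of_real_1 mult_1 add_0_left
    by (rule has_vector_derivative_real_field)
qed

lemma CI_scaled_contour:
  assumes "continuous_on (sphere 0 (norm c)) f" "c \<noteq> 0"
  shows "CI (\<lambda>z. f (c * z)) = contour_integral (\<lambda>x. c * circ x) (\<lambda>w. f w / w) / (2 * pi * \<i>)"
proof -
  note d = has_vector_derivative_scaled_circ
  have "contour_integral (\<lambda>x. c * circ x) (\<lambda>w. f w / w)
     = integral {0..1} (\<lambda>x. f (c * circ x) / (c * circ x) * vector_derivative (\<lambda>x. c * circ x) (at x))"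
    by (simp add: contour_integral_integral)
  also have "\<dots> = integral {0..1} (\<lambda>x. f (c * circ x) * (2 * pi * \<i>))"
  proof (rule integral_cong)
    fix x :: real assume "x \<in> {0..1}"
    hence "vector_derivative (\<lambda>x. c * circ x) (at x) = 2 * pi * \<i> * (c * circ x)"
      by (intro vector_derivative_at d)
    thus "f (c * circ x) / (c * circ x) * vector_derivative (\<lambda>x. c * circ x) (at x) = f (c * circ x) * (2 * pi * \<i>)"
      using assms(2) by (simp add: circlepath)
  qed
  also have "\<dots> = CI (\<lambda>z. f (c * z)) * (2 * pi * \<i>)"
    by (subst CI_eq_integral)
      (auto intro!: continuous_on_compose2[OF assms(1)] continuous_intros simp: norm_mult)
  finally show ?thesis by simp
qed

text \<open>With \<open>\<omega>\<close> a logarithm of \<open>c\<close>, the loops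
  \<open>exp (s * \<omega>) * circ\<close> for \<open>s\<close> between 0 and 1 lead from
  \<open>circ\<close> to \<open>c * circ\<close> inside the annulus, contracting and rotating at
  once. Cauchy's theorem then applies to \<open>f w / w\<close>.\<close>

lemma CI_shift:
  assumes S: "open S" "{w. norm c \<le> norm w \<and> norm w \<le> 1} \<subseteq> S" and f: "f holomorphic_on S"
    and c: "c \<noteq> 0" "norm c \<le> 1"
  shows "CI (\<lambda>z. f (c * z)) = CI f"
proof -
  obtain \<omega> where \<omega>: "exp \<omega> = c" using c(1) exp_Ln by blast
  have re: "Re \<omega> \<le> 0" using c(2) \<omega> by (metis norm_exp_eq_Re exp_le_one_iff)
  let ?h = "\<lambda>p::real \<times> real. exp (of_real (fst p) * \<omega>) * circ (snd p)"
  have ann: "?h p \<in> S - {0}" if "p \<in> {0..1} \<times> {0..1}" for p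
  proof -
    have "norm (?h p) = exp (fst p * Re \<omega>)" by (simp add: norm_mult)
    moreover have "exp (fst p * Re \<omega>) \<le> 1" using that re by (auto simp: mult_nonneg_nonpos)
    moreover have "norm c \<le> exp (fst p * Re \<omega>)"
    proof -
      have "fst p * Re \<omega> \<ge> 1 * Re \<omega>" using that re by (intro mult_right_mono_neg) auto
      thus ?thesis using \<omega> by (metis exp_le_cancel_iff mult_1 norm_exp_eq_Re)
    qed
    ultimately show ?thesis using S(2) by (auto simp: circlepath)
  qed
  have hom: "homotopic_loops (S - {0}) circ (\<lambda>x. c * circ x)"
    unfolding homotopic_loops
  proof (intro exI[of _ ?h] conjI ballI)
    show "continuous_on ({0..1} \<times> {0..1}) ?h" by (intro continuous_intros)
    show "?h \<in> ({0..1} \<times> {0..1}) \<rightarrow> S - {0}" by (rule Pi_I) (rule ann)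
  next
    fix t :: real
    show "pathfinish (?h \<circ> Pair t) = pathstart (?h \<circ> Pair t)"
      unfolding pathfinish_def pathstart_def o_def fst_conv snd_conv circ_0 circ_1 ..
  next
    fix x :: real
    show "?h (0, x) = circ x" by (simp only: fst_conv snd_conv of_real_0 mult_zero_left exp_zero mult_1)
    show "?h (1, x) = c * circ x" by (simp only: fst_conv snd_conv of_real_1 mult_1 \<omega>)
  qed
  have "contour_integral circ (\<lambda>w. f w / w) = contour_integral (\<lambda>x. c * circ x) (\<lambda>w. f w / w)"
  proof (rule Cauchy_theorem_homotopic_loops[OF hom])
    show "open (S - {0})" using S(1) by (simp add: open_delete)
    show "(\<lambda>w. f w / w) holomorphic_on S - {0}"
      by (intro holomorphic_intros holomorphic_on_subset[OF f]) auto
    have "(\<lambda>x. c * circ x) C1_differentiable_on {0..1}"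
      unfolding C1_differentiable_on_def
      by (intro exI[of _ "\<lambda>x. 2 * pi * \<i> * (c * circ x)"] conjI ballI)
         (intro has_vector_derivative_scaled_circ continuous_intros)+
    thus "valid_path (\<lambda>x. c * circ x)"
      unfolding valid_path_def by (rule C1_differentiable_imp_piecewise)
  qed auto
  moreover have cont: "continuous_on (sphere 0 (norm c)) f" "continuous_on (sphere 0 (norm (1::complex))) f"
    by (rule holomorphic_on_imp_continuous_on[OF holomorphic_on_subset[OF f]], use S(2) c in auto)+
  ultimately show ?thesis
    using CI_scaled_contour[OF cont(1) c(1)] CI_scaled_contour[of 1 f] cont(2) by simp
qed

lemma AE_circ_ne_1: "AE x in unit_interval_measure. circ x \<noteq> 1"
proof -
  have "circ x \<noteq> 1" if "x \<in> {0..1}" "x \<noteq> 0" "x \<noteq> 1" for x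
  proof
    assume "circ x = 1"
    hence "exp (2 * of_real pi * \<i> * of_real x) = 1" by (simp add: circlepath)
    then obtain k :: int where k: "Im (2 * of_real pi * \<i> * of_real x) = of_int (2 * k) * pi"
      using exp_eq_1 by auto
    hence "x = of_int k" by simp
    thus False using that by auto
  qed
  moreover have "AE x in lborel. x \<noteq> (0::real)" "AE x in lborel. x \<noteq> (1::real)"
    by (rule AE_lborel_singleton)+
  ultimately have "AE x in lborel. x \<in> {0..1} \<longrightarrow> circ x \<noteq> 1"
    by (auto elim!: eventually_elim2)
  thus ?thesis by (subst AE_restrict_space_iff) auto
qed

lemma AE_torus_ne_1:
  assumes "finite I"
  shows "AE x in PiM I (\<lambda>_. unit_interval_measure). \<forall>i\<in>I. circ (x i) \<noteq> 1"
proof (rule AE_finite_allI[OF assms])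
  fix i assume "i \<in> I"
  thus "AE x in PiM I (\<lambda>_. unit_interval_measure). circ (x i) \<noteq> 1"
    by (intro AE_PiM_component[where P = "\<lambda>x. circ x \<noteq> 1"] prob_space_unit_interval AE_circ_ne_1)
qed

text \<open>Dominated convergence in which pointwise limits are required only where no coordinate
  equals 1. The kernels of the pinching limit are singular at the excluded points, a null
  set.\<close>

lemma TI_tendsto:
  assumes "finite I" "\<And>n. continuous_on Tor (F n)" "continuous_on Tor G"
    and B: "\<And>n z. z \<in> Tor \<Longrightarrow> norm (F n z) \<le> B"
    and lim: "\<And>z. z \<in> Tor \<Longrightarrow> (\<And>i. i \<in> I \<Longrightarrow> z i \<noteq> 1) \<Longrightarrow> (\<lambda>n. F n z) \<longlonglongrightarrow> G z"
  shows "(\<lambda>n. TI I (F n)) \<longlonglongrightarrow> TI I G"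
  unfolding TI_def
proof (rule integral_dominated_convergence[where w = "\<lambda>_. B"])
  interpret prob_space "PiM I (\<lambda>_. unit_interval_measure)" by (rule prob_space_PiM_unit)
  show "integrable (PiM I (\<lambda>_. unit_interval_measure)) (\<lambda>_. B)" by simp
  show "AE x in PiM I (\<lambda>_. unit_interval_measure). (\<lambda>n. F n (\<lambda>i. circ (x i))) \<longlonglongrightarrow> G (\<lambda>i. circ (x i))"
    using AE_torus_ne_1[OF assms(1)] by eventually_elim (auto intro!: lim)
qed (auto intro!: Tor_measurable assms)

text \<open>Differentiation under the integral: the difference quotients converge pointwise by
  holomorphy in \<open>w\<close>, and a Cauchy estimate on half the radius bounds them uniformly in
  \<open>z\<close>, so that dominated convergence applies.\<close>

lemma TI_holomorphic:
  assumes \<Omega>: "open \<Omega>" and cont: "continuous_on (\<Omega> \<times> Tor) (\<lambda>p. F (fst p) (snd p))"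
    and hol: "\<And>z. z \<in> Tor \<Longrightarrow> (\<lambda>w. F w z) holomorphic_on \<Omega>"
  shows "(\<lambda>w. TI I (F w)) holomorphic_on \<Omega>"
proof -
  let ?M = "PiM I (\<lambda>_. unit_interval_measure)"
  interpret prob_space ?M by (rule prob_space_PiM_unit)
  have contF: "continuous_on Tor (F w)" if "w \<in> \<Omega>" for w
    using that by (intro continuous_on_compose2[OF cont, of _ "\<lambda>z. (w, z)", simplified]) (auto intro!: continuous_intros)
  have "\<exists>f'. ((\<lambda>w. TI I (F w)) has_field_derivative f') (at w0)" if w0: "w0 \<in> \<Omega>" for w0
  proof -
    obtain r where r: "r > 0" "cball w0 r \<subseteq> \<Omega>" using \<Omega> w0 open_contains_cball by blast
    have "compact (cball w0 r \<times> Tor)" by (intro compact_Times compact_Tor compact_cball)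
    hence "bounded ((\<lambda>p. F (fst p) (snd p)) ` (cball w0 r \<times> Tor))"
      by (intro compact_imp_bounded compact_continuous_image continuous_on_subset[OF cont]) (use r in auto)
    then obtain B where B: "\<And>w z. w \<in> cball w0 r \<Longrightarrow> z \<in> Tor \<Longrightarrow> norm (F w z) \<le> B"
      unfolding bounded_iff by fastforce
    define D where "D = (\<lambda>z. deriv (\<lambda>w. F w z) w0)"
    have fd: "((\<lambda>w. F w z) has_field_derivative deriv (\<lambda>w. F w z) w) (at w)" if "z \<in> Tor" "w \<in> \<Omega>" for w z
      using hol[OF that(1)] \<Omega> that(2) by (intro holomorphic_derivI)
    have db: "norm (deriv (\<lambda>w. F w z) w) \<le> B / (r/2)" if z: "z \<in> Tor" and w: "w \<in> cball w0 (r/2)" for w z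
    proof -
      have sub: "cball w (r/2) \<subseteq> cball w0 r"
        using w by (simp add: cball_subset_cball_iff dist_commute)
      have "norm ((deriv ^^ 1) (\<lambda>w. F w z) w) \<le> fact 1 * B / (r/2)^1"
      proof (rule Cauchy_inequality)
        show "(\<lambda>w. F w z) holomorphic_on ball w (r/2)"
          using hol[OF z] by (rule holomorphic_on_subset) (use sub r ball_subset_cball in blast)
        show "continuous_on (cball w (r/2)) (\<lambda>w. F w z)"
          by (rule holomorphic_on_imp_continuous_on[OF holomorphic_on_subset[OF hol[OF z]]])
             (use sub r in blast)
        show "norm (F x z) \<le> B" if "norm (w - x) = r/2" for x
          using that sub by (intro B z) (auto simp: dist_norm subset_iff)
      qed (use r in auto)
      thus ?thesis by simp
    qed
    have quot: "norm ((F (w0 + h) z - F w0 z) / h) \<le> B / (r/2)"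
      if "z \<in> Tor" "norm h \<le> r/2" "h \<noteq> 0" for h z
    proof -
      have "norm (F (w0 + h) z - F w0 z) \<le> B / (r/2) * norm ((w0 + h) - w0)"
      proof (rule field_differentiable_bound[of "cball w0 (r/2)"])
        fix w assume w: "w \<in> cball w0 (r/2)"
        hence "w \<in> \<Omega>" using r by (intro subsetD[OF r(2)]) auto
        thus "((\<lambda>w. F w z) has_field_derivative deriv (\<lambda>w. F w z) w) (at w within cball w0 (r/2))"
          using fd that(1) has_field_derivative_at_within by blast
        show "norm (deriv (\<lambda>w. F w z) w) \<le> B / (r/2)" by (rule db[OF that(1) w])
      qed (use that r in \<open>auto simp: dist_norm\<close>)
      thus ?thesis using that(3) by (simp add: norm_divide field_simps)
    qed
    have seq: "(\<lambda>n. (TI I (F (w0 + h n)) - TI I (F w0)) / h n) \<longlonglongrightarrow> (LINT x|?M. D (\<lambda>i. circ (x i)))"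
      if h: "h \<longlonglongrightarrow> 0" "\<And>n. h n \<noteq> 0" "\<And>n. norm (h n) \<le> r/2" for h
    proof -
      have inO: "w0 + h n \<in> \<Omega>" for n
        using h(3)[of n] r by (intro subsetD[OF r(2)]) (auto simp: dist_norm)
      have mD: "(\<lambda>n. (F (w0 + h n) z - F w0 z) / h n) \<longlonglongrightarrow> D z" if "z \<in> Tor" for z
      proof -
        have "((\<lambda>h. (F (w0 + h) z - F w0 z) / h) \<longlongrightarrow> D z) (at 0)"
          using fd[OF that w0] unfolding D_def DERIV_def .
        thus ?thesis using h(1,2) unfolding tendsto_at_iff_sequentially o_def by auto
      qed
      have meas: "(\<lambda>x. (F (w0 + h n) (\<lambda>i. circ (x i)) - F w0 (\<lambda>i. circ (x i))) / h n) \<in> borel_measurable ?M" for n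
        by (intro borel_measurable_divide borel_measurable_diff Tor_measurable contF inO w0) auto
      have "(\<lambda>n. LINT x|?M. (F (w0 + h n) (\<lambda>i. circ (x i)) - F w0 (\<lambda>i. circ (x i))) / h n)
              \<longlonglongrightarrow> (LINT x|?M. D (\<lambda>i. circ (x i)))"
      proof (rule integral_dominated_convergence[where w = "\<lambda>_. B / (r/2)"])
        show "(\<lambda>x. D (\<lambda>i. circ (x i))) \<in> borel_measurable ?M"
          by (rule borel_measurable_LIMSEQ_metric[OF meas]) (auto intro: mD)
        show "AE x in ?M. norm ((F (w0 + h n) (\<lambda>i. circ (x i)) - F w0 (\<lambda>i. circ (x i))) / h n) \<le> B / (r/2)" for n
          by (intro AE_I2 quot h circ_in_Tor)
      qed (auto intro!: AE_I2 mD meas)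
      also have "(\<lambda>n. LINT x|?M. (F (w0 + h n) (\<lambda>i. circ (x i)) - F w0 (\<lambda>i. circ (x i))) / h n)
          = (\<lambda>n. (TI I (F (w0 + h n)) - TI I (F w0)) / h n)"
        unfolding TI_def
        by (intro ext, subst Bochner_Integration.integral_divide_zero,
            subst Bochner_Integration.integral_diff) (auto intro!: Tor_integrable contF inO w0)
      finally show ?thesis .
    qed
    have "((\<lambda>h. (TI I (F (w0 + h)) - TI I (F w0)) / h) \<longlongrightarrow> (LINT x|?M. D (\<lambda>i. circ (x i)))) (at 0)"
      unfolding tendsto_at_iff_sequentially o_def
    proof (intro allI impI)
      fix X :: "nat \<Rightarrow> complex" assume X: "\<forall>i. X i \<in> UNIV - {0}" "X \<longlonglongrightarrow> 0"
      have "eventually (\<lambda>n. norm (X n) < r/2) sequentially"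
        using order_tendstoD(2)[OF tendsto_norm_zero[OF X(2)], of "r/2"] r(1) by simp
      then obtain N where N: "\<And>n. n \<ge> N \<Longrightarrow> norm (X n) < r/2" unfolding eventually_sequentially by blast
      have "(\<lambda>n. (TI I (F (w0 + X (n + N))) - TI I (F w0)) / X (n + N)) \<longlonglongrightarrow> (LINT x|?M. D (\<lambda>i. circ (x i)))"
      proof (rule seq)
        show "(\<lambda>n. X (n + N)) \<longlonglongrightarrow> 0" using X(2) by (rule LIMSEQ_ignore_initial_segment)
        show "norm (X (n + N)) \<le> r/2" for n using N[of "n + N"] by simp
      qed (use X in auto)
      thus "(\<lambda>n. (TI I (F (w0 + X n)) - TI I (F w0)) / X n) \<longlonglongrightarrow> (LINT x|?M. D (\<lambda>i. circ (x i)))"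
        by (rule LIMSEQ_offset)
    qed
    thus ?thesis unfolding DERIV_def by blast
  qed
  thus ?thesis using \<Omega> by (simp add: holomorphic_on_open)
qed

lemma CI_norm_le:
  assumes "continuous_on (sphere 0 1) f" "continuous_on (sphere 0 1) g"
    and "\<And>w. norm w = 1 \<Longrightarrow> norm (f w) \<le> Re (g w)" "\<And>w. norm w = 1 \<Longrightarrow> g w \<in> \<real>"
  shows "norm (CI f) \<le> norm (CI g)"
proof -
  have "norm (CI f) \<le> integral {0..1} (\<lambda>x. Re (g (circ x)))"
    unfolding CI_eq_integral[OF assms(1)]
    by (rule integral_norm_bound_integral)
       (auto intro!: assms integrable_continuous_real continuous_on_compose2[OF assms(1)]
          continuous_on_compose2[OF assms(2)] continuous_intros)
  also have "\<dots> = Re (CI g)"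
    unfolding CI_eq_integral[OF assms(2)]
    using integral_linear[OF CI_eq_integral(2)[OF assms(2)] bounded_linear_Re] by (simp add: o_def)
  also have "\<dots> \<le> norm (CI g)" by (rule complex_Re_le_cmod)
  finally show ?thesis .
qed

lemma continuous_fun_upd:
  fixes f :: "'a :: topological_space \<Rightarrow> nat \<Rightarrow> complex"
  assumes "continuous_on S f" "continuous_on S g"
  shows "continuous_on S (\<lambda>x. (f x)(i := g x))"
proof (rule continuous_on_coordinatewise_then_product)
  show "continuous_on S (\<lambda>x. ((f x)(i := g x)) j)" for j
    using assms continuous_on_product_then_coordinatewise[OF assms(1)] by (cases "j = i") auto
qed

lemma CI_param_continuous:
  assumes "continuous_on Tor F"
  shows "continuous_on Tor (\<lambda>z. CI (\<lambda>w. F (z(i := w))))"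
proof -
  have inT: "z(i := circ x) \<in> Tor" if "z \<in> Tor" for z x using that by (intro Tor_upd) auto
  have "continuous_on (Tor \<times> cbox 0 1) (\<lambda>(z, x). F (z(i := circ x)))"
    unfolding split_beta
    by (rule continuous_on_compose2[OF assms continuous_fun_upd])
       (auto intro!: continuous_on_fst continuous_on_snd continuous_on_id continuous_circ inT)
  hence "continuous_on Tor (\<lambda>z. integral (cbox 0 1) (\<lambda>x. F (z(i := circ x))))"
    by (rule integral_continuous_on_param)
  also have "?this \<longleftrightarrow> ?thesis"
  proof (rule continuous_on_cong[OF refl])
    fix z assume z: "z \<in> Tor"
    have "continuous_on (sphere 0 1) (\<lambda>w. F (z(i := w)))"
      by (rule continuous_on_compose2[OF assms continuous_fun_upd])
         (use z in \<open>auto intro!: continuous_on_id Tor_upd\<close>)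
    thus "integral (cbox 0 1) (\<lambda>x. F (z(i := circ x))) = CI (\<lambda>w. F (z(i := w)))"
      by (simp add: CI_eq_integral)
  qed
  finally show ?thesis .
qed

section \<open>Poisson kernels and pinched contours\<close>

text \<open>Written as a rational function rather than with a modulus, since this is the form in
  which the factors of the integrand with \<open>a1 = b 3 = \<rho>\<close> occur. On the unit circle
  it is the usual positive kernel.\<close>

definition poisson :: "real \<Rightarrow> complex \<Rightarrow> complex" where
  "poisson \<rho> w = (1 - (of_real \<rho>)\<^sup>2) / ((1 - of_real \<rho> / w) * (1 - of_real \<rho> * w))"

lemma poisson_denominator:
  fixes w :: complex
  assumes "norm w = 1"
  shows "(1 - of_real \<rho> / w) * (1 - of_real \<rho> * w) = of_real ((norm (1 - of_real \<rho> * w))\<^sup>2)"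
proof -
  have "1 / w = cnj w" using assms by (metis complex_div_cnj complex_cnj_cnj div_by_1 mult_1 of_real_1 one_power2)
  hence "1 - of_real \<rho> / w = cnj (1 - of_real \<rho> * w)"
    by (metis complex_cnj_complex_of_real complex_cnj_diff complex_cnj_mult complex_cnj_one mult.right_neutral times_divide_eq_right)
  thus ?thesis using complex_norm_square[of "1 - of_real \<rho> * w"] by (simp only: mult.commute)
qed

lemma poisson_real:
  assumes "norm w = 1"
  shows "poisson \<rho> w = of_real ((1 - \<rho>\<^sup>2) / (norm (1 - of_real \<rho> * w))\<^sup>2)"
  unfolding poisson_def poisson_denominator[OF assms] by simp

lemma one_minus_rho_nz:
  fixes w :: complex
  assumes "0 < \<rho>" "\<rho> < 1" "norm w = 1"
  shows "1 - of_real \<rho> * w \<noteq> 0" "1 - of_real \<rho> / w \<noteq> 0"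
proof -
  have "norm (of_real \<rho> * w) < 1" "norm (of_real \<rho> / w) < 1" using assms by (auto simp: norm_mult norm_divide)
  thus "1 - of_real \<rho> * w \<noteq> 0" "1 - of_real \<rho> / w \<noteq> 0" by auto
qed

lemma continuous_poisson:
  assumes "0 < \<rho>" "\<rho> < 1"
  shows "continuous_on (sphere 0 1) (poisson \<rho>)"
proof -
  have "continuous_on (sphere 0 1) (\<lambda>w::complex. (1 - (of_real \<rho>)\<^sup>2) / ((1 - of_real \<rho> / w) * (1 - of_real \<rho> * w)))"
    by (intro continuous_intros ballI no_zero_divisors one_minus_rho_nz[OF assms]) auto
  thus ?thesis unfolding poisson_def[abs_def] .
qed

text \<open>On the circle, dividing by \<open>u\<close> turns the kernel into
  \<open>?f u / (u - \<rho>)\<close>, where \<open>?f\<close> is holomorphic near the closed disc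
  and takes the value 1 at \<open>\<rho>\<close>; Cauchy's formula finishes.\<close>

lemma CI_poisson:
  assumes "0 < \<rho>" "\<rho> < 1"
  shows "CI (poisson \<rho>) = 1"
proof -
  let ?f = "\<lambda>u::complex. (1 - (of_real \<rho>)\<^sup>2) / (1 - of_real \<rho> * u)"
  have nz: "1 - of_real \<rho> * u \<noteq> 0" if "norm u \<le> 1" for u :: complex
  proof -
    have "norm (of_real \<rho> * u) \<le> \<rho> * 1" unfolding norm_mult using that assms by (intro mult_mono) auto
    thus ?thesis using assms by auto
  qed
  have "((\<lambda>u. ?f u / (u - of_real \<rho>)) has_contour_integral 2 * of_real pi * \<i> * ?f (of_real \<rho>)) circ"
    by (rule Cauchy_integral_circlepath) (use assms nz in \<open>auto intro!: continuous_intros holomorphic_intros simp: nz\<close>)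
  moreover have "?f (of_real \<rho>) = 1"
    using nz[of "of_real \<rho>"] assms by (simp add: power2_eq_square del: of_real_mult)
  ultimately have "contour_integral circ (\<lambda>u. ?f u / (u - of_real \<rho>)) = 2 * of_real pi * \<i>"
    by (simp add: contour_integral_unique)
  also have "contour_integral circ (\<lambda>u. ?f u / (u - of_real \<rho>)) = contour_integral circ (\<lambda>u. poisson \<rho> u / u)"
  proof (rule contour_integral_eq)
    fix u assume "u \<in> path_image circ"
    hence "norm u = 1" by simp
    moreover from this have "u \<noteq> 0" by auto
    ultimately show "?f u / (u - of_real \<rho>) = poisson \<rho> u / u"
      using one_minus_rho_nz[OF assms, of u] unfolding poisson_def by (simp add: divide_simps)
  qed
  finally show ?thesis
    using CI_scaled_contour[of 1 "poisson \<rho>"] continuous_poisson[OF assms] by simp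
qed

lemma CI_poisson_le:
  assumes \<rho>: "0 < \<rho>" "\<rho> < 1" and h: "continuous_on (sphere 0 1) h" "\<And>w. norm w = 1 \<Longrightarrow> norm (h w) \<le> B"
  shows "norm (CI (\<lambda>w. poisson \<rho> w * h w)) \<le> B"
proof -
  have "norm (h 1) \<le> B" by (rule h) simp
  hence B: "B \<ge> 0" by (meson norm_ge_zero order_trans)
  have pos: "0 \<le> (1 - \<rho>\<^sup>2) / (norm (1 - of_real \<rho> * w))\<^sup>2" for w :: complex
    using \<rho> by (auto intro!: divide_nonneg_nonneg simp: power_le_one)
  have "norm (CI (\<lambda>w. poisson \<rho> w * h w)) \<le> norm (CI (\<lambda>w. poisson \<rho> w * of_real B))"
  proof (rule CI_norm_le)
    fix w :: complex assume w: "norm w = 1"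
    show "norm (poisson \<rho> w * h w) \<le> Re (poisson \<rho> w * of_real B)"
      unfolding poisson_real[OF w] norm_mult norm_of_real abs_of_nonneg[OF pos]
        of_real_mult[symmetric] Re_complex_of_real by (intro mult_left_mono pos h w)
    show "poisson \<rho> w * of_real B \<in> \<real>" unfolding poisson_real[OF w] by simp
  qed (intro continuous_intros continuous_poisson \<rho> h)+
  also have "CI (\<lambda>w. poisson \<rho> w * of_real B) = CI (poisson \<rho>) * of_real B"
    unfolding CI_def by simp
  finally show ?thesis using CI_poisson[OF \<rho>] B by simp
qed

text \<open>The Poisson kernel as an approximate identity at \<open>w = 1\<close>. The function
  \<open>h\<close> itself depends on the radius, hence the joint limit at \<open>(1, 1)\<close>; a
  bound along the sequence controls the rest of the circle.\<close>

lemma CI_poisson_tendsto: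
  assumes r0: "0 < r0" and \<rho>': "\<And>n. \<rho> n \<in> {r0..<1}" and \<rho>1: "\<rho> \<longlonglongrightarrow> 1"
    and h: "\<And>n. continuous_on (sphere 0 1) (h (\<rho> n))" "\<And>n w. norm w = 1 \<Longrightarrow> norm (h (\<rho> n) w) \<le> B"
    and lim: "((\<lambda>p. h (fst p) (snd p)) \<longlongrightarrow> l) (at (1, 1) within {r0..<1} \<times> sphere 0 1)"
  shows "(\<lambda>n. CI (\<lambda>w. poisson (\<rho> n) w * h (\<rho> n) w)) \<longlonglongrightarrow> l"
proof (rule LIMSEQ_I)
  fix e :: real assume e: "e > 0"
  have \<rho>: "0 < \<rho> n" "\<rho> n < 1" for n using \<rho>'[of n] r0 by auto
  have "norm (h (\<rho> 0) 1) \<le> B" by (rule h) simp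
  hence B: "B \<ge> 0" by (meson norm_ge_zero order_trans)
  obtain d where d: "d > 0" "\<And>r w. r \<in> {r0..<1} \<Longrightarrow> norm w = 1 \<Longrightarrow> dist (r, w) (1, 1) < d \<Longrightarrow> dist (h r w) l < e / 2"
    using lim e unfolding Lim_within by (metis (no_types, lifting) SigmaI dist_0_norm fst_conv atLeastLessThan_iff half_gt_zero
      less_irrefl mem_sphere snd_conv zero_less_dist_iff prod.inject)
  define K where "K = B + norm l"
  have K: "K \<ge> 0" unfolding K_def using B by simp
  have "(\<lambda>n. (1 - (\<rho> n)\<^sup>2) * (4 / (d/2)\<^sup>2) * K) \<longlonglongrightarrow> (1 - 1\<^sup>2) * (4 / (d/2)\<^sup>2) * K"
    by (intro tendsto_intros \<rho>1)
  hence "eventually (\<lambda>n. (1 - (\<rho> n)\<^sup>2) * (4 / (d/2)\<^sup>2) * K < e / 2) sequentially"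
    using e by (intro order_tendstoD(2)) auto
  moreover have "eventually (\<lambda>n. 1 - d / 4 < \<rho> n) sequentially"
    using d(1) by (intro order_tendstoD(1)[OF \<rho>1]) auto
  ultimately have "eventually (\<lambda>n. norm (CI (\<lambda>w. poisson (\<rho> n) w * h (\<rho> n) w) - l) < e) sequentially"
  proof eventually_elim
    case (elim n)
    note r = \<rho>[of n]
    \<comment> \<open>The first summand dominates where \<open>(\<rho> n, w)\<close> is within
      \<open>d\<close> of \<open>(1, 1)\<close>. Elsewhere \<open>1 - \<rho> n < d / 4\<close>
      forces \<open>norm (1 - \<rho> n * w) \<ge> d / 2\<close>, so the kernel is of the order of
      \<open>1 - (\<rho> n)\<^sup>2\<close> and the second summand dominates.\<close>
    let ?g = "\<lambda>w. poisson (\<rho> n) w * of_real (e/2) + of_real ((1 - (\<rho> n)\<^sup>2) * (4 / (d/2)\<^sup>2) * K)"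
    have cP: "continuous_on (sphere 0 1) (poisson (\<rho> n))" by (rule continuous_poisson[OF r])
    have iP: "integrable unit_interval_measure (\<lambda>x. f (circ x))" if "continuous_on (sphere 0 1) f" for f :: "complex \<Rightarrow> complex"
    proof -
      have "set_integrable lborel {0..1} (\<lambda>x. f (circ x))"
        by (intro borel_integrable_atLeastAtMost' continuous_on_compose2[OF that] continuous_intros) auto
      thus ?thesis by (simp add: set_integrable_def integrable_restrict_space)
    qed
    have "CI (\<lambda>w. poisson (\<rho> n) w * (h (\<rho> n) w - l)) = CI (\<lambda>w. poisson (\<rho> n) w * h (\<rho> n) w) - CI (\<lambda>w. poisson (\<rho> n) w * l)"
      unfolding CI_def right_diff_distrib
      by (rule Bochner_Integration.integral_diff) (intro iP continuous_intros cP h)+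
    also have "CI (\<lambda>w. poisson (\<rho> n) w * l) = CI (poisson (\<rho> n)) * l"
      unfolding CI_def by simp
    finally have eq: "CI (\<lambda>w. poisson (\<rho> n) w * h (\<rho> n) w) - l = CI (\<lambda>w. poisson (\<rho> n) w * (h (\<rho> n) w - l))"
      using CI_poisson[OF r] by simp
    have pos: "0 \<le> (1 - (\<rho> n)\<^sup>2) / (norm (1 - of_real (\<rho> n) * w))\<^sup>2" for w :: complex
      using r by (auto intro!: divide_nonneg_nonneg simp: power_le_one)
    have pos': "0 \<le> 1 - (\<rho> n)\<^sup>2" using r by (simp add: power_le_one)
    have "norm (CI (\<lambda>w. poisson (\<rho> n) w * (h (\<rho> n) w - l))) \<le> norm (CI ?g)"
    proof (rule CI_norm_le)
      fix w :: complex assume w: "norm w = 1"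
      show "?g w \<in> \<real>" unfolding poisson_real[OF w] by simp
      let ?P = "(1 - (\<rho> n)\<^sup>2) / (norm (1 - of_real (\<rho> n) * w))\<^sup>2"
      have "?P * norm (h (\<rho> n) w - l) \<le> ?P * (e/2) + (1 - (\<rho> n)\<^sup>2) * (4 / (d/2)\<^sup>2) * K"
      proof (cases "dist (\<rho> n, w) (1, 1) < d")
        case True
        hence "norm (h (\<rho> n) w - l) \<le> e/2" using d(2)[of "\<rho> n" w] \<rho>'[of n] w by (simp add: dist_norm)
        hence "?P * norm (h (\<rho> n) w - l) \<le> ?P * (e/2)" by (intro mult_left_mono pos)
        thus ?thesis using pos' K by (smt (verit) divide_nonneg_nonneg mult_nonneg_nonneg zero_le_power2)
      next
        case False
        have "dist (\<rho> n, w) (1, 1) \<le> dist (\<rho> n) 1 + dist w 1" by (simp add: dist_Pair_Pair sqrt_sum_squares_le_sum)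
        hence "d \<le> (1 - \<rho> n) + norm (1 - w)" using False r by (simp add: dist_norm norm_minus_commute)
        moreover have "norm (1 - w) \<le> norm (1 - of_real (\<rho> n) * w) + (1 - \<rho> n)"
        proof -
          have "1 - w = (1 - of_real (\<rho> n) * w) + (- of_real (1 - \<rho> n) * w)" by (simp add: algebra_simps)
          also have "norm \<dots> \<le> norm (1 - of_real (\<rho> n) * w) + norm (- of_real (1 - \<rho> n) * w)" by (rule norm_triangle_ineq)
          also have "norm (- of_real (1 - \<rho> n) * w) = 1 - \<rho> n"
            unfolding norm_mult norm_minus_cancel norm_of_real using w r by simp
          finally show ?thesis .
        qed
        ultimately have "d / 2 \<le> norm (1 - of_real (\<rho> n) * w)" using elim(2) by linarith
        hence "(d/2)\<^sup>2 \<le> (norm (1 - of_real (\<rho> n) * w))\<^sup>2" using d(1) by (intro power_mono) auto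
        hence "?P \<le> (1 - (\<rho> n)\<^sup>2) / (d/2)\<^sup>2" using pos' d(1) by (intro divide_left_mono mult_pos_pos) (auto intro: less_le_trans)
        also have "\<dots> \<le> (1 - (\<rho> n)\<^sup>2) * (4 / (d/2)\<^sup>2)" using pos' by (simp add: divide_right_mono)
        finally have P: "?P \<le> (1 - (\<rho> n)\<^sup>2) * (4 / (d/2)\<^sup>2)" .
        have "norm (h (\<rho> n) w - l) \<le> K" unfolding K_def
          using norm_triangle_ineq4[of "h (\<rho> n) w" l] h(2)[OF w, of n] by linarith
        hence "?P * norm (h (\<rho> n) w - l) \<le> (1 - (\<rho> n)\<^sup>2) * (4 / (d/2)\<^sup>2) * K"
          using P pos[of w] pos' by (intro mult_mono) auto
        moreover have "0 \<le> ?P * (e/2)" using pos[of w] e by (intro mult_nonneg_nonneg) auto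
        ultimately show ?thesis by linarith
      qed
      thus "norm (poisson (\<rho> n) w * (h (\<rho> n) w - l)) \<le> Re (?g w)"
        unfolding poisson_real[OF w] norm_mult norm_of_real abs_of_nonneg[OF pos]
          of_real_mult[symmetric] of_real_add[symmetric] Re_complex_of_real .
    qed (intro continuous_intros cP h)+
    also have "CI ?g = CI (poisson (\<rho> n)) * of_real (e/2) + of_real ((1 - (\<rho> n)\<^sup>2) * (4 / (d/2)\<^sup>2) * K)"
    proof -
      have "CI ?g = CI (\<lambda>w. poisson (\<rho> n) w * of_real (e/2)) + CI (\<lambda>_. of_real ((1 - (\<rho> n)\<^sup>2) * (4 / (d/2)\<^sup>2) * K))"
        unfolding CI_def by (rule Bochner_Integration.integral_add) (intro iP continuous_intros cP)+
      thus ?thesis by (simp add: CI_def)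
    qed
    also have "\<dots> = of_real (e/2 + (1 - (\<rho> n)\<^sup>2) * (4 / (d/2)\<^sup>2) * K)" using CI_poisson[OF r] by simp
    also have "norm \<dots> = e/2 + (1 - (\<rho> n)\<^sup>2) * (4 / (d/2)\<^sup>2) * K"
      unfolding norm_of_real using e pos' K by (intro abs_of_nonneg add_nonneg_nonneg mult_nonneg_nonneg) auto
    finally show ?case using elim(1) unfolding eq by linarith
  qed
  thus "\<exists>no. \<forall>n\<ge>no. norm (CI (\<lambda>w. poisson (\<rho> n) w * h (\<rho> n) w) - l) < e"
    by (simp add: eventually_sequentially)
qed

section \<open>Products over pairs of variables, and coordinatewise operations on the torus\<close>

definition pairs :: "nat set \<Rightarrow> (nat \<times> nat) set" where
  "pairs I = {(j, k). j \<in> I \<and> k \<in> I \<and> j < k}"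

lemma finite_pairs [simp]: "finite I \<Longrightarrow> finite (pairs I)"
  by (rule finite_subset[of _ "I \<times> I"]) (auto simp: pairs_def)

lemma pairs_empty [simp]: "pairs {} = {}" by (simp add: pairs_def)

text \<open>The new pairs are \<open>(min m j, max m j)\<close>; the symmetry of \<open>f\<close>
  makes it irrelevant where \<open>m\<close> stands in the order of the indices.\<close>

lemma prod_pairs_insert:
  fixes f :: "nat \<Rightarrow> nat \<Rightarrow> 'a::comm_monoid_mult"
  assumes "finite I" "m \<notin> I" and sym: "\<And>j k. f j k = f k j"
  shows "(\<Prod>(j, k)\<in>pairs (insert m I). f j k) = (\<Prod>j\<in>I. f m j) * (\<Prod>(j, k)\<in>pairs I. f j k)"
proof -
  let ?g = "\<lambda>j. (min m j, max m j)"
  have eq: "pairs (insert m I) = ?g ` I \<union> pairs I"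
    using assms(2) by (auto simp: pairs_def image_iff min_def max_def) (metis less_irrefl less_le_not_le nle_le)+
  have disj: "?g ` I \<inter> pairs I = {}"
    using assms(2) by (auto simp: pairs_def min_def max_def split: if_splits)
  have inj: "inj_on ?g I"
    by (auto simp: inj_on_def min_def max_def split: if_splits)
  have "(\<Prod>(j, k)\<in>pairs (insert m I). f j k) = (\<Prod>(j, k)\<in>?g ` I. f j k) * (\<Prod>(j, k)\<in>pairs I. f j k)"
    unfolding eq by (rule prod.union_disjoint) (use assms disj in auto)
  also have "(\<Prod>(j, k)\<in>?g ` I. f j k) = (\<Prod>j\<in>I. f m j)"
    by (subst prod.reindex[OF inj]) (auto intro!: prod.cong simp: min_def max_def sym)
  finally show ?thesis .
qed

lemma prod_pairs_remove:
  fixes f :: "nat \<Rightarrow> nat \<Rightarrow> 'a::comm_monoid_mult"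
  assumes "finite I" "m \<in> I" "\<And>j k. f j k = f k j"
  shows "(\<Prod>(j, k)\<in>pairs I. f j k) = (\<Prod>j\<in>I - {m}. f m j) * (\<Prod>(j, k)\<in>pairs (I - {m}). f j k)"
  using prod_pairs_insert[of "I - {m}" m f] assms by (simp add: insert_absorb)

text \<open>Fubini isolates coordinate \<open>i\<close>, and \<open>CI_shift\<close> acts on each
  fibre. The function \<open>f\<close> on an annulus restricts to \<open>F\<close> on the unit
  circle and to \<open>G\<close> on the circle of radius \<open>norm c\<close>: the integrand
  \<open>G\<close> is an analytic continuation of \<open>F\<close>, not \<open>F\<close> at another
  point of the torus.\<close>

lemma TI_shift:
  assumes "finite I" "i \<in> I" and cont: "continuous_on Tor F" "continuous_on Tor G"
    and c: "c \<noteq> 0" "norm c \<le> 1"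
    and hol: "\<And>z. z \<in> Tor \<Longrightarrow> \<exists>S f. open S \<and> {w. norm c \<le> norm w \<and> norm w \<le> 1} \<subseteq> S \<and> f holomorphic_on S \<and>
       (\<forall>w. norm w = 1 \<longrightarrow> f w = F (z(i := w)) \<and> f (c * w) = G (z(i := w)))"
  shows "TI I F = TI I G"
proof -
  have I: "insert i (I - {i}) = I" using assms(2) by auto
  have "TI (insert i (I - {i})) F = TI (I - {i}) (\<lambda>z. CI (\<lambda>w. F (z(i := w))))"
    by (rule TI_insert) (use assms in auto)
  also have "\<dots> = TI (I - {i}) (\<lambda>z. CI (\<lambda>w. G (z(i := w))))"
  proof (rule TI_cong)
    fix z assume z: "z \<in> Tor"
    obtain S f where S: "open S" "{w. norm c \<le> norm w \<and> norm w \<le> 1} \<subseteq> S" "f holomorphic_on S"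
      and f: "\<And>w. norm w = 1 \<Longrightarrow> f w = F (z(i := w))" "\<And>w. norm w = 1 \<Longrightarrow> f (c * w) = G (z(i := w))"
      using hol[OF z] by blast
    have "CI (\<lambda>w. F (z(i := w))) = CI f" by (rule CI_cong) (simp add: f)
    also have "\<dots> = CI (\<lambda>w. f (c * w))" by (rule CI_shift[OF S c, symmetric])
    also have "\<dots> = CI (\<lambda>w. G (z(i := w)))" by (rule CI_cong) (simp add: f)
    finally show "CI (\<lambda>w. F (z(i := w))) = CI (\<lambda>w. G (z(i := w)))" .
  qed
  also have "\<dots> = TI (insert i (I - {i})) G"
    by (rule TI_insert[symmetric]) (use assms in auto)
  finally show ?thesis unfolding I .
qed

text \<open>The coordinates are rotated one at a time; \<open>R A\<close> is the state in which
  those in \<open>A\<close> have been rotated. As \<open>norm c = 1\<close>, holomorphy near the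
  unit circle is enough for each step.\<close>

lemma TI_rotate:
  assumes "finite I" and cont: "continuous_on Tor F" and c: "norm c = 1"
    and hol: "\<And>z i. z \<in> Tor \<Longrightarrow> i \<in> I \<Longrightarrow> \<exists>S. open S \<and> sphere 0 1 \<subseteq> S \<and> (\<lambda>w. F (z(i := w))) holomorphic_on S"
  shows "TI I (\<lambda>z. F (\<lambda>i. if i \<in> I then c * z i else z i)) = TI I F"
proof -
  define R where "R = (\<lambda>A (z :: nat \<Rightarrow> complex) i. if i \<in> A then c * z i else z i)"
  have RT: "R A z \<in> Tor" if "z \<in> Tor" for A z
    using that c by (auto simp: R_def Tor_def norm_mult)
  have contR: "continuous_on Tor (\<lambda>z. F (R A z))" for A
  proof (rule continuous_on_compose2[OF cont])
    show "continuous_on Tor (R A)"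
    proof (rule continuous_on_coordinatewise_then_product)
      show "continuous_on Tor (\<lambda>z. R A z i)" for i
        unfolding R_def by (cases "i \<in> A") (auto intro!: continuous_intros)
    qed
  qed (use RT in auto)
  have "TI I (\<lambda>z. F (R A z)) = TI I F" if "A \<subseteq> I" for A
    using finite_subset[OF that assms(1)] that
  proof (induction A rule: finite_induct)
    case empty
    show ?case by (simp add: R_def)
  next
    case (insert i A)
    have "TI I (\<lambda>z. F (R A z)) = TI I (\<lambda>z. F (R (insert i A) z))"
    proof (rule TI_shift[where i = i and c = c])
      fix z assume z: "z \<in> Tor"
      obtain S where S: "open S" "sphere 0 1 \<subseteq> S" "(\<lambda>w. F ((R A z)(i := w))) holomorphic_on S"
        using hol[OF RT[OF z], of i A] insert by auto
      show "\<exists>S f. open S \<and> {w. norm c \<le> norm w \<and> norm w \<le> 1} \<subseteq> S \<and> f holomorphic_on S \<and>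
        (\<forall>w. norm w = 1 \<longrightarrow> f w = F (R A (z(i := w))) \<and> f (c * w) = F (R (insert i A) (z(i := w))))"
      proof (intro exI conjI allI impI)
        fix w :: complex assume "norm w = 1"
        have "(R A z)(i := w) = R A (z(i := w))" "(R A z)(i := c * w) = R (insert i A) (z(i := w))"
          using insert(2) by (auto simp: R_def)
        thus "F ((R A z)(i := w)) = F (R A (z(i := w)))"
          "F ((R A z)(i := c * w)) = F (R (insert i A) (z(i := w)))" by simp_all
      qed (use S c in auto)
    qed (use insert assms contR in auto)
    thus ?case using insert by simp
  qed
  from this[of I] show ?thesis by (simp add: R_def)
qed

text \<open>The inner integral over coordinate \<open>i\<close> converges by the approximate
  identity, and it is bounded by \<open>B\<close> because the kernel has mass 1; the outer integral
  follows by dominated convergence.\<close>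

lemma TI_poisson_tendsto:
  assumes "finite I" "i \<notin> I" and \<rho>: "0 < r0" "\<And>n. \<rho> n \<in> {r0..<1}" "\<rho> \<longlonglongrightarrow> 1"
    and H: "\<And>n. continuous_on Tor (H (\<rho> n))" "\<And>n z. z \<in> Tor \<Longrightarrow> norm (H (\<rho> n) z) \<le> B"
    and L: "continuous_on Tor L"
    and lim: "\<And>z. z \<in> Tor \<Longrightarrow> (\<And>j. j \<in> I \<Longrightarrow> z j \<noteq> 1) \<Longrightarrow>
      ((\<lambda>p. H (fst p) (z(i := snd p))) \<longlongrightarrow> L z) (at (1, 1) within {r0..<1} \<times> sphere 0 1)"
  shows "(\<lambda>n. TI (insert i I) (\<lambda>z. poisson (\<rho> n) (z i) * H (\<rho> n) z)) \<longlonglongrightarrow> TI I L"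
proof -
  have \<rho>': "0 < \<rho> n" "\<rho> n < 1" for n using \<rho>(1) \<rho>(2)[of n] by auto
  have contP: "continuous_on Tor (\<lambda>z. poisson (\<rho> n) (z i))" for n
    by (rule continuous_on_compose2[OF continuous_poisson[OF \<rho>']])
       (auto intro!: continuous_coord simp: Tor_norm)
  have contH: "continuous_on (sphere 0 1) (\<lambda>w. H (\<rho> n) (z(i := w)))" if "z \<in> Tor" for n z
    by (rule continuous_on_compose2[OF H(1) continuous_fun_upd])
       (use that in \<open>auto intro!: Tor_upd\<close>)
  have "TI (insert i I) (\<lambda>z. poisson (\<rho> n) (z i) * H (\<rho> n) z)
      = TI I (\<lambda>z. CI (\<lambda>w. poisson (\<rho> n) w * H (\<rho> n) (z(i := w))))" for n
    using TI_insert[OF assms(1,2), of "\<lambda>z. poisson (\<rho> n) (z i) * H (\<rho> n) z"]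
      continuous_on_mult[OF contP H(1)] by simp
  moreover have "(\<lambda>n. TI I (\<lambda>z. CI (\<lambda>w. poisson (\<rho> n) w * H (\<rho> n) (z(i := w))))) \<longlonglongrightarrow> TI I L"
  proof (rule TI_tendsto[OF assms(1) _ L])
    show "continuous_on Tor (\<lambda>z. CI (\<lambda>w. poisson (\<rho> n) w * H (\<rho> n) (z(i := w))))" for n
      using CI_param_continuous[OF continuous_on_mult[OF contP H(1)], of n i] by simp
    show "norm (CI (\<lambda>w. poisson (\<rho> n) w * H (\<rho> n) (z(i := w)))) \<le> B" if "z \<in> Tor" for n z
      by (rule CI_poisson_le[OF \<rho>' contH[OF that]]) (intro H Tor_upd that)
    show "(\<lambda>n. CI (\<lambda>w. poisson (\<rho> n) w * H (\<rho> n) (z(i := w)))) \<longlonglongrightarrow> L z"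
      if z: "z \<in> Tor" "\<And>j. j \<in> I \<Longrightarrow> z j \<noteq> 1" for z
    proof (rule CI_poisson_tendsto[where h = "\<lambda>r w. H r (z(i := w))", OF \<rho> contH[OF z(1)] _ lim[OF z]])
      show "norm (H (\<rho> n) (z(i := w))) \<le> B" if "norm w = 1" for n w
        by (intro H Tor_upd z that)
    qed auto
  qed
  ultimately show ?thesis by simp
qed

section \<open>Simultaneous pinching of all contours at 1\<close>

definition pden :: "real \<Rightarrow> complex \<Rightarrow> complex" where
  "pden \<rho> w = (1 - of_real \<rho> / w) * (1 - of_real \<rho> * w)"

text \<open>On the torus this is the squared modulus of the Vandermonde determinant: each factor
  equals the square of \<open>norm (z j - z k)\<close>.\<close>

definition vdm :: "nat set \<Rightarrow> (nat \<Rightarrow> complex) \<Rightarrow> complex" where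
  "vdm J z = (\<Prod>(j, k)\<in>pairs J. (1 - z j / z k) * (1 - z k / z j))"

lemma vdm_remove:
  assumes "finite I" "m \<in> I"
  shows "vdm I z = (\<Prod>j\<in>I - {m}. (1 - z m / z j) * (1 - z j / z m)) * vdm (I - {m}) z"
  unfolding vdm_def by (rule prod_pairs_remove[OF assms]) (simp add: mult.commute)

lemma vdm_continuous: "continuous_on Tor (vdm I)"
  unfolding vdm_def[abs_def] split_beta by (intro continuous_intros) (auto simp: Tor_nz)

lemma inverse_sum_factor:
  fixes x :: "nat \<Rightarrow> 'a :: field"
  assumes "finite I" "i \<in> I" "\<And>j. j \<in> I \<Longrightarrow> x j \<noteq> 0"
  shows "1 + (\<Sum>j\<in>I - {i}. x i / x j) = x i * (\<Sum>j\<in>I. 1 / x j)"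
  using assms by (subst (2) sum.remove[of _ i]) (auto simp: distrib_left sum_distrib_left)

text \<open>Let \<open>P\<close> be the product and \<open>T\<close> the sum of all
  \<open>1 / x j\<close>. The left side is \<open>P / T\<close>, the same for every
  \<open>i\<close>; the right side is \<open>P * x m\<close>, and \<open>T \<ge> 1 / x m\<close>.
  This allows the index to be changed to a better one.\<close>

lemma inverse_prod_over_sum_le:
  fixes x :: "nat \<Rightarrow> real"
  assumes "finite I" "i \<in> I" "m \<in> I" "\<And>j. j \<in> I \<Longrightarrow> x j > 0"
  shows "(\<Prod>j\<in>I - {i}. 1 / x j) / (1 + (\<Sum>j\<in>I - {i}. x i / x j)) \<le> (\<Prod>j\<in>I - {m}. 1 / x j)"
proof -
  define T where "T = (\<Sum>j\<in>I. 1 / x j)"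
  define P where "P = (\<Prod>j\<in>I. 1 / x j)"
  have P: "P = 1 / x l * (\<Prod>j\<in>I - {l}. 1 / x j)" if "l \<in> I" for l
    unfolding P_def using assms that by (intro prod.remove)
  have Ppos: "P > 0" unfolding P_def using assms by (intro prod_pos) auto
  have Tm: "T \<ge> 1 / x m" unfolding T_def
    by (rule member_le_sum[where f = "\<lambda>j. 1 / x j"]) (use assms in \<open>auto intro: less_imp_le\<close>)
  have xi: "x i > 0" "x m > 0" using assms by auto
  have "(\<Prod>j\<in>I - {i}. 1 / x j) / (1 + (\<Sum>j\<in>I - {i}. x i / x j)) = (x i * P) / (x i * T)"
  proof -
    have "1 + (\<Sum>j\<in>I - {i}. x i / x j) = x i * T"
      unfolding T_def by (rule inverse_sum_factor) (use assms in force)+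
    moreover have "(\<Prod>j\<in>I - {i}. 1 / x j) = x i * P" using P[OF assms(2)] xi by simp
    ultimately show ?thesis by simp
  qed
  also have "\<dots> = P / T" using xi by simp
  also have "\<dots> \<le> P / (1 / x m)"
    using Tm xi Ppos by (intro divide_left_mono mult_pos_pos) (auto intro: less_le_trans[OF _ Tm])
  also have "\<dots> = (\<Prod>j\<in>I - {m}. 1 / x j)" using P[OF assms(3)] xi by simp
  finally show ?thesis .
qed

lemma norm_vdm_factor:
  fixes u v :: complex
  assumes "norm u = 1" "norm v = 1"
  shows "norm ((1 - u / v) * (1 - v / u)) = (norm (u - v))\<^sup>2"
proof -
  have nz: "u \<noteq> 0" "v \<noteq> 0" using assms by auto
  have "norm (1 - u / v) = norm (v - u) / norm v" using nz by (simp add: divide_simps flip: norm_divide)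
  moreover have "norm (1 - v / u) = norm (u - v) / norm u" using nz by (simp add: divide_simps flip: norm_divide)
  ultimately show ?thesis using assms by (simp add: norm_mult norm_minus_commute power2_eq_square)
qed

text \<open>Let \<open>m\<close> be the coordinate for which \<open>norm (1 - \<rho> * z m)\<close>
  is least. The triangle inequality gives
  \<open>r0 * norm (z m - z j) \<le> 2 * norm (1 - \<rho> * z j)\<close>, so every kernel with
  \<open>j \<noteq> m\<close> is absorbed by the factor of \<open>vdm\<close> that belongs to
  \<open>m\<close> and \<open>j\<close>; \<open>inverse_prod_over_sum_le\<close> replaces
  \<open>i\<close> by this \<open>m\<close>.\<close>

lemma pinch_bound:
  assumes "finite I" "i \<in> I" "z \<in> Tor" and \<rho>: "0 < r0" "r0 \<le> \<rho>" "\<rho> < 1"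
  shows "(\<Prod>j\<in>I - {i}. 1 / (norm (1 - of_real \<rho> * z j))\<^sup>2)
      / (1 + (\<Sum>j\<in>I - {i}. (norm (1 - of_real \<rho> * z i))\<^sup>2 / (norm (1 - of_real \<rho> * z j))\<^sup>2)) * norm (vdm I z)
    \<le> (4 / r0\<^sup>2) ^ (card I - 1) * 4 ^ card (pairs I)"
proof -
  define x where "x = (\<lambda>j. (norm (1 - of_real \<rho> * z j))\<^sup>2)"
  have x: "x j > 0" for j
    unfolding x_def using one_minus_rho_nz(1)[of \<rho> "z j"] \<rho> Tor_norm[OF assms(3)] by auto
  obtain m where m: "m \<in> I" "\<And>j. j \<in> I \<Longrightarrow> x m \<le> x j"
    using arg_min_if_finite(1)[OF assms(1), of x] arg_min_least[OF assms(1), of _ x] assms(2) by blast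
  have dist: "(norm (z m - z j))\<^sup>2 \<le> 4 / r0\<^sup>2 * x j" if j: "j \<in> I" for j
  proof -
    have dm: "norm (1 - of_real \<rho> * z m) \<le> norm (1 - of_real \<rho> * z j)"
      using m(2)[OF j] unfolding x_def by (rule power2_le_imp_le) simp
    have "\<rho> * norm (z m - z j) = norm ((1 - of_real \<rho> * z j) - (1 - of_real \<rho> * z m))"
      using \<rho> by (simp add: norm_mult flip: right_diff_distrib)
    also have "\<dots> \<le> norm (1 - of_real \<rho> * z j) + norm (1 - of_real \<rho> * z m)" by (rule norm_triangle_ineq4)
    also have "\<dots> \<le> 2 * norm (1 - of_real \<rho> * z j)" using dm by simp
    finally have "r0 * norm (z m - z j) \<le> 2 * norm (1 - of_real \<rho> * z j)"
      using \<rho> by (meson mult_right_mono norm_ge_zero order_trans)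
    hence "(r0 * norm (z m - z j))\<^sup>2 \<le> (2 * norm (1 - of_real \<rho> * z j))\<^sup>2"
      using \<rho> by (intro power_mono) auto
    thus ?thesis using \<rho> unfolding x_def by (simp add: power_mult_distrib field_simps)
  qed
  have four: "norm ((1 - z j / z k) * (1 - z k / z j)) \<le> 4" for j k
  proof -
    have "norm (z j - z k) \<le> 2"
      using norm_triangle_ineq4[of "z j" "z k"] Tor_norm[OF assms(3)] by simp
    hence "(norm (z j - z k))\<^sup>2 \<le> 2\<^sup>2" by (intro power_mono) auto
    thus ?thesis by (simp add: norm_vdm_factor Tor_norm[OF assms(3)])
  qed
  have V': "norm (vdm (I - {m}) z) \<le> 4 ^ card (pairs I)"
  proof -
    have "norm (vdm (I - {m}) z) = (\<Prod>(j, k)\<in>pairs (I - {m}). norm ((1 - z j / z k) * (1 - z k / z j)))"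
      unfolding vdm_def by (simp add: prod_norm split_beta)
    also have "\<dots> \<le> (\<Prod>_\<in>pairs (I - {m}). 4)" using four by (intro prod_mono) auto
    also have "\<dots> = 4 ^ card (pairs (I - {m}))" by simp
    also have "\<dots> \<le> 4 ^ card (pairs I)"
      by (intro power_increasing card_mono finite_pairs assms) (auto simp: pairs_def)
    finally show ?thesis .
  qed
  have vd: "norm (vdm I z) = (\<Prod>j\<in>I - {m}. (norm (z m - z j))\<^sup>2) * norm (vdm (I - {m}) z)"
    unfolding vdm_remove[OF assms(1) m(1)] norm_mult[of "prod _ _"] prod_norm[symmetric]
    by (simp only: norm_vdm_factor Tor_norm[OF assms(3)])
  have "(\<Prod>j\<in>I - {i}. 1 / x j) / (1 + (\<Sum>j\<in>I - {i}. x i / x j)) * norm (vdm I z)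
     \<le> (\<Prod>j\<in>I - {m}. 1 / x j) * norm (vdm I z)"
    by (intro mult_right_mono inverse_prod_over_sum_le assms m x) auto
  also have "(\<Prod>j\<in>I - {m}. 1 / x j) * norm (vdm I z)
     = (\<Prod>j\<in>I - {m}. (norm (z m - z j))\<^sup>2 / x j) * norm (vdm (I - {m}) z)"
    unfolding vd by (simp add: prod_dividef)
  also have "\<dots> \<le> (\<Prod>j\<in>I - {m}. 4 / r0\<^sup>2) * 4 ^ card (pairs I)"
  proof (intro mult_mono prod_mono V' conjI)
    fix j assume "j \<in> I - {m}"
    thus "(norm (z m - z j))\<^sup>2 / x j \<le> 4 / r0\<^sup>2"
      using dist[of j] x[of j] by (simp add: pos_divide_le_eq)
    show "0 \<le> (norm (z m - z j))\<^sup>2 / x j" using x[of j] by simp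
  qed (auto intro!: prod_nonneg)
  also have "\<dots> = (4 / r0\<^sup>2) ^ (card I - 1) * 4 ^ card (pairs I)"
    using assms(1) m(1) by (simp add: card_Diff_singleton)
  finally show ?thesis unfolding x_def .
qed

text \<open>As \<open>\<rho>\<close> tends to \<open>1\<close>, the factor \<open>1 / pden \<rho> (z i)\<close> concentrates at \<open>z i = 1\<close>. The weights
  \<open>(1 / pden \<rho> (z i)) / (\<Sum>j\<in>I. 1 / pden \<rho> (z j))\<close> form a partition of unity that attributes each region to the
  coordinate closest to \<open>1\<close>, and the vanishing of \<open>vdm\<close> on the diagonals keeps the remaining kernels bounded.\<close>

lemma TI_pinch:
  assumes I: "finite I" "I \<noteq> {}" and \<rho>: "0 < r0" "\<And>n. \<rho> n \<in> {r0..<1}" "\<rho> \<longlonglongrightarrow> 1"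
    and S: "continuous_on ({r0..1} \<times> Tor) (\<lambda>p. S (fst p) (snd p))"
  shows "(\<lambda>n. (1 - (of_real (\<rho> n))\<^sup>2) * TI I (\<lambda>z. (\<Prod>i\<in>I. 1 / pden (\<rho> n) (z i)) * vdm I z * S (\<rho> n) z))
    \<longlonglongrightarrow> (\<Sum>i\<in>I. TI (I - {i}) (\<lambda>z. vdm (I - {i}) z * S 1 (z(i := 1))))"
proof -
  have \<rho>': "0 < \<rho> n" "r0 \<le> \<rho> n" "\<rho> n < 1" "\<rho> n \<in> {r0..1}" for n using \<rho>(1) \<rho>(2)[of n] by auto
  have r1: "r0 < 1" using \<rho>'(2,3)[of 0] by linarith
  \<comment> \<open>The weight of \<open>i\<close> is cleared of \<open>pden r (z i)\<close>. In
    this form its denominator tends to 1 at \<open>r = 1\<close>, \<open>z i = 1\<close>, where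
    \<open>pden\<close> vanishes.\<close>
  define H where "H = (\<lambda>i r z. (\<Prod>j\<in>I - {i}. 1 / pden r (z j)) * vdm I z * S r z / (1 + (\<Sum>j\<in>I - {i}. pden r (z i) / pden r (z j))))"
  have pd: "pden r (z j) = of_real ((norm (1 - of_real r * z j))\<^sup>2)" if "z \<in> Tor" for r z j
    unfolding pden_def by (rule poisson_denominator[OF Tor_norm[OF that]])
  have pdpos: "(norm (1 - of_real (\<rho> n) * z j))\<^sup>2 > 0" if "z \<in> Tor" for n z j
    using one_minus_rho_nz(1)[of "\<rho> n" "z j"] \<rho>' Tor_norm[OF that] by auto
  have pdnz: "pden (\<rho> n) (z j) \<noteq> 0" if "z \<in> Tor" for n z j
    unfolding pd[OF that] of_real_eq_0_iff using pdpos[OF that, of n j] by linarith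
  have den: "1 + (\<Sum>j\<in>I - {i}. pden r (z i) / pden r (z j)) = of_real (1 + (\<Sum>j\<in>I - {i}. (norm (1 - of_real r * z i))\<^sup>2 / (norm (1 - of_real r * z j))\<^sup>2))"
    if "z \<in> Tor" for r z i unfolding pd[OF that] by simp
  have denpos: "1 + (\<Sum>j\<in>I - {i}. (norm (1 - of_real r * z i))\<^sup>2 / (norm (1 - of_real r * z j))\<^sup>2) > 0" for r z i
    by (intro add_pos_nonneg sum_nonneg) auto
  have dennz: "1 + (\<Sum>j\<in>I - {i}. pden r (z i) / pden r (z j)) \<noteq> 0" if "z \<in> Tor" for r z i
    unfolding den[OF that] of_real_eq_0_iff using denpos[of r z i] by linarith
  have contS: "continuous_on Tor (S r)" if "r \<in> {r0..1}" for r
    using that by (intro continuous_on_compose2[OF S, of _ "\<lambda>z. (r, z)", simplified]) (auto intro!: continuous_intros)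
  have contp: "continuous_on Tor (\<lambda>z. pden r (z j))" for r j
    unfolding pden_def by (intro continuous_intros) (auto simp: Tor_nz)
  have contH: "continuous_on Tor (H i (\<rho> n))" for i n
    unfolding H_def
    by (intro continuous_intros contp vdm_continuous contS \<rho>' ballI pdnz dennz)
  have contL: "continuous_on Tor (\<lambda>z. vdm (I - {i}) z * S 1 (z(i := 1)))" for i
    using r1 by (intro continuous_on_mult vdm_continuous continuous_on_compose2[OF contS continuous_fun_upd])
      (auto intro!: Tor_upd)
  have split: "(1 - (of_real (\<rho> n))\<^sup>2) * ((\<Prod>i\<in>I. 1 / pden (\<rho> n) (z i)) * vdm I z * S (\<rho> n) z)
      = (\<Sum>i\<in>I. poisson (\<rho> n) (z i) * H i (\<rho> n) z)" if z: "z \<in> Tor" for n z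
  proof -
    define T where "T = (\<Sum>j\<in>I. 1 / pden (\<rho> n) (z j))"
    have den': "1 + (\<Sum>j\<in>I - {i}. pden (\<rho> n) (z i) / pden (\<rho> n) (z j)) = pden (\<rho> n) (z i) * T" if "i \<in> I" for i
      unfolding T_def by (rule inverse_sum_factor) (use I that pdnz[OF z] in auto)
    have T: "T \<noteq> 0" using I(2) den' dennz[OF z] by fastforce
    have "poisson (\<rho> n) (z i) * H i (\<rho> n) z
        = (1 - (of_real (\<rho> n))\<^sup>2) * ((\<Prod>i\<in>I. 1 / pden (\<rho> n) (z i)) * vdm I z * S (\<rho> n) z) * (1 / pden (\<rho> n) (z i)) / T"
      if i: "i \<in> I" for i
      unfolding H_def den'[OF i] prod.remove[OF I(1) i] poisson_def pden_def[symmetric]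
      using T pdnz[OF z] by simp
    hence "(\<Sum>i\<in>I. poisson (\<rho> n) (z i) * H i (\<rho> n) z)
        = (1 - (of_real (\<rho> n))\<^sup>2) * ((\<Prod>i\<in>I. 1 / pden (\<rho> n) (z i)) * vdm I z * S (\<rho> n) z) * T / T"
      unfolding T_def by (simp add: sum_distrib_left sum_divide_distrib)
    thus ?thesis using T by simp
  qed
  have contPH: "continuous_on Tor (\<lambda>z. poisson (\<rho> n) (z i) * H i (\<rho> n) z)" for i n
    by (intro continuous_on_mult contH continuous_on_compose2[OF continuous_poisson[OF \<rho>'(1,3)]])
       (auto intro!: continuous_coord simp: Tor_norm)
  have eq: "(1 - (of_real (\<rho> n))\<^sup>2) * TI I (\<lambda>z. (\<Prod>i\<in>I. 1 / pden (\<rho> n) (z i)) * vdm I z * S (\<rho> n) z)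
     = (\<Sum>i\<in>I. TI I (\<lambda>z. poisson (\<rho> n) (z i) * H i (\<rho> n) z))" for n
    unfolding TI_cmult[symmetric] TI_sum[OF contPH, symmetric] by (rule TI_cong) (rule split)
  have "compact ({r0..1} \<times> Tor)" by (intro compact_Times compact_Tor compact_Icc)
  hence "bounded ((\<lambda>p. S (fst p) (snd p)) ` ({r0..1} \<times> Tor))"
    by (intro compact_imp_bounded compact_continuous_image S)
  then obtain B where B: "\<And>r z. r \<in> {r0..1} \<Longrightarrow> z \<in> Tor \<Longrightarrow> norm (S r z) \<le> B"
    unfolding bounded_iff by fastforce
  have boundH: "norm (H i (\<rho> n) z) \<le> (4 / r0\<^sup>2) ^ (card I - 1) * 4 ^ card (pairs I) * B"
    if i: "i \<in> I" and z: "z \<in> Tor" for i n z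
  proof -
    have "norm (H i (\<rho> n) z) = (\<Prod>j\<in>I - {i}. 1 / (norm (1 - of_real (\<rho> n) * z j))\<^sup>2)
      / (1 + (\<Sum>j\<in>I - {i}. (norm (1 - of_real (\<rho> n) * z i))\<^sup>2 / (norm (1 - of_real (\<rho> n) * z j))\<^sup>2)) * norm (vdm I z) * norm (S (\<rho> n) z)"
    proof -
      have "norm (1 + (\<Sum>j\<in>I - {i}. pden (\<rho> n) (z i) / pden (\<rho> n) (z j)))
        = 1 + (\<Sum>j\<in>I - {i}. (norm (1 - of_real (\<rho> n) * z i))\<^sup>2 / (norm (1 - of_real (\<rho> n) * z j))\<^sup>2)"
        unfolding den[OF z] norm_of_real by (rule abs_of_pos[OF denpos])
      moreover have "norm (1 / pden (\<rho> n) (z j)) = 1 / (norm (1 - of_real (\<rho> n) * z j))\<^sup>2" for j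
        unfolding pd[OF z] norm_divide norm_of_real by simp
      ultimately show ?thesis
        unfolding H_def norm_divide[of "_ * S _ _"] norm_mult[of _ "S _ _"] norm_mult[of _ "vdm _ _"] prod_norm[symmetric] by simp
    qed
    also have "\<dots> \<le> (4 / r0\<^sup>2) ^ (card I - 1) * 4 ^ card (pairs I) * B"
      by (intro mult_mono pinch_bound I i z \<rho> \<rho>' B) auto
    finally show ?thesis .
  qed
  have lim: "(\<lambda>n. TI (insert i (I - {i})) (\<lambda>z. poisson (\<rho> n) (z i) * H i (\<rho> n) z)) \<longlonglongrightarrow>
     TI (I - {i}) (\<lambda>z. vdm (I - {i}) z * S 1 (z(i := 1)))" if i: "i \<in> I" for i
  proof (rule TI_poisson_tendsto[where H = "H i" and \<rho> = \<rho>, OF _ _ \<rho> contH _ contL])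
    show "norm (H i (\<rho> n) z) \<le> (4 / r0\<^sup>2) ^ (card I - 1) * 4 ^ card (pairs I) * B" if "z \<in> Tor" for n z
      by (rule boundH[OF i that])
    fix z assume z: "z \<in> Tor" and z1: "\<And>j. j \<in> I - {i} \<Longrightarrow> z j \<noteq> 1"
    let ?F = "at (1, 1) within {r0..<1} \<times> sphere (0::complex) 1"
    \<comment> \<open>Coordinate \<open>i\<close> is split off from \<open>vdm\<close>, so that the
      joint limit in radius and coordinate can be read off factor by factor.\<close>
    define K where "K = (\<lambda>p. (\<Prod>j\<in>I - {i}. 1 / pden (fst p) (z j)) *
       ((\<Prod>j\<in>I - {i}. (1 - snd p / z j) * (1 - z j / snd p)) * vdm (I - {i}) z) * S (fst p) (z(i := snd p)) /
        (1 + (\<Sum>j\<in>I - {i}. pden (fst p) (snd p) / pden (fst p) (z j))))"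
    have HK: "H i (fst p) (z(i := snd p)) = K p" for p
      unfolding H_def K_def vdm_remove[OF I(1) i]
      by (intro arg_cong2[where f = "(/)"] arg_cong2[where f = "(*)"] prod.cong arg_cong2[where f = "(+)"] sum.cong refl)
         (auto simp: vdm_def pairs_def intro!: prod.cong)
    have f1: "((\<lambda>p. fst p) \<longlongrightarrow> (1::real)) ?F" and f2: "((\<lambda>p. snd p) \<longlongrightarrow> (1::complex)) ?F"
      by (auto intro!: tendsto_eq_intros)
    have zj: "z j \<noteq> 0" for j using Tor_nz[OF z] .
    have p1: "pden 1 (z j) \<noteq> 0" if "j \<in> I - {i}" for j
      using z1[OF that] zj[of j] unfolding pden_def by (auto simp: divide_simps)
    have tS: "((\<lambda>p. S (fst p) (z(i := snd p))) \<longlongrightarrow> S 1 (z(i := 1))) ?F"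
    proof -
      have "continuous_on ({r0..1} \<times> sphere 0 1) (\<lambda>p. S (fst p) (z(i := snd p)))"
        by (rule continuous_on_compose2[OF S, of _ "\<lambda>p. (fst p, z(i := snd p))", simplified])
           (auto intro!: continuous_on_Pair continuous_fun_upd continuous_on_fst continuous_on_snd continuous_on_id Tor_upd z)
      hence "((\<lambda>p. S (fst p) (z(i := snd p))) \<longlongrightarrow> S (fst (1, 1)) (z(i := snd (1, 1)))) (at (1, 1) within {r0..1} \<times> sphere 0 1)"
        using r1 unfolding continuous_on_def by fastforce
      moreover have "{r0..<1} \<times> sphere 0 1 \<subseteq> {r0..1} \<times> sphere (0::complex) 1" by auto
      ultimately have "((\<lambda>p. S (fst p) (z(i := snd p))) \<longlongrightarrow> S (fst (1, 1)) (z(i := snd (1, 1)))) ?F"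
        by (rule tendsto_within_subset)
      thus ?thesis by (simp only: fst_conv snd_conv)
    qed
    have "(K \<longlongrightarrow> (\<Prod>j\<in>I - {i}. 1 / pden 1 (z j)) *
       ((\<Prod>j\<in>I - {i}. (1 - 1 / z j) * (1 - z j / 1)) * vdm (I - {i}) z) * S 1 (z(i := 1)) /
        (1 + (\<Sum>j\<in>I - {i}. pden 1 1 / pden 1 (z j)))) ?F"
      unfolding K_def pden_def using p1 zj unfolding pden_def
      by (intro tendsto_intros f1 f2 tS) auto
    also have "1 + (\<Sum>j\<in>I - {i}. pden 1 1 / pden 1 (z j)) = 1" by (simp add: pden_def)
    also have "(\<Prod>j\<in>I - {i}. 1 / pden 1 (z j)) *
       ((\<Prod>j\<in>I - {i}. (1 - 1 / z j) * (1 - z j / 1)) * vdm (I - {i}) z) * S 1 (z(i := 1)) / 1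
       = vdm (I - {i}) z * S 1 (z(i := 1)) * ((\<Prod>j\<in>I - {i}. 1 / pden 1 (z j)) * (\<Prod>j\<in>I - {i}. (1 - 1 / z j) * (1 - z j / 1)))"
      by simp
    \<comment> \<open>At radius 1 and \<open>z i = 1\<close> the factor of \<open>vdm\<close> for
      \<open>i\<close> and \<open>j\<close> is exactly \<open>pden 1 (z j)\<close>.\<close>
    also have "(\<Prod>j\<in>I - {i}. 1 / pden 1 (z j)) * (\<Prod>j\<in>I - {i}. (1 - 1 / z j) * (1 - z j / 1)) = 1"
      unfolding prod.distrib[symmetric]
    proof (rule prod.neutral, rule ballI)
      fix j assume j: "j \<in> I - {i}"
      show "1 / pden 1 (z j) * ((1 - 1 / z j) * (1 - z j / 1)) = 1"
        using p1[OF j] unfolding pden_def by simp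
    qed
    finally show "((\<lambda>p. H i (fst p) (z(i := snd p))) \<longlongrightarrow> vdm (I - {i}) z * S 1 (z(i := 1))) ?F"
      unfolding HK mult_1_right .
  qed (use I in auto)
  have ins: "insert i (I - {i}) = I" if "i \<in> I" for i using that by auto
  show ?thesis unfolding eq
    by (intro tendsto_sum) (use lim ins in auto)
qed

section \<open>Interpolation at chains\<close>

text \<open>A symmetric function of \<open>n\<close> distinct points that is affine in each of them,
  encoded as a function of \<open>n\<close>-element sets. \<open>Z\<close> collects forbidden
  points: the degenerate ones and, in inductions, the points already fixed.\<close>

definition set_affine :: "nat \<Rightarrow> complex set \<Rightarrow> (complex set \<Rightarrow> complex) \<Rightarrow> bool" where
  "set_affine n Z F \<longleftrightarrow> (\<forall>B. finite B \<and> Suc (card B) = n \<and> B \<inter> Z = {} \<longrightarrow>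
     (\<exists>c0 c1. \<forall>x. x \<notin> B \<longrightarrow> x \<notin> Z \<longrightarrow> F (insert x B) = c0 + c1 * x))"

definition chain :: "(nat \<Rightarrow> complex) \<Rightarrow> (nat \<Rightarrow> complex) \<Rightarrow> nat \<Rightarrow> nat \<Rightarrow> complex set" where
  "chain A B s r = A ` {..<s} \<union> B ` {..<r}"

definition chain_generic :: "(nat \<Rightarrow> complex) \<Rightarrow> (nat \<Rightarrow> complex) \<Rightarrow> nat \<Rightarrow> bool" where
  "chain_generic A B n \<longleftrightarrow> inj_on A {..<n} \<and> inj_on B {..<n} \<and> (\<forall>i<n. \<forall>j<n. A i \<noteq> B j)"

lemma chain_Suc_left: "chain A B (Suc s) r = insert (A 0) (chain (A \<circ> Suc) B s r)"
  by (auto simp: chain_def lessThan_Suc_eq_insert_0 image_image)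

lemma chain_Suc_right: "chain A B s (Suc r) = insert (B 0) (chain A (B \<circ> Suc) s r)"
  by (auto simp: chain_def lessThan_Suc_eq_insert_0 image_image)

lemma finite_chain [simp]: "finite (chain A B s r)" by (simp add: chain_def)

lemma set_affine_insert:
  assumes "set_affine (Suc n) Z F" "a \<notin> Z"
  shows "set_affine n (insert a Z) (\<lambda>B. F (insert a B))"
  unfolding set_affine_def
proof (intro allI impI)
  fix B assume B: "finite B \<and> Suc (card B) = n \<and> B \<inter> insert a Z = {}"
  hence "finite (insert a B) \<and> Suc (card (insert a B)) = Suc n \<and> insert a B \<inter> Z = {}"
    using assms(2) by auto
  then obtain c0 c1 where c: "\<And>x. x \<notin> insert a B \<Longrightarrow> x \<notin> Z \<Longrightarrow> F (insert x (insert a B)) = c0 + c1 * x"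
    using assms(1) unfolding set_affine_def by meson
  show "\<exists>c0 c1. \<forall>x. x \<notin> B \<longrightarrow> x \<notin> insert a Z \<longrightarrow> F (insert a (insert x B)) = c0 + c1 * x"
    by (intro exI[of _ c0] exI[of _ c1]) (auto simp: insert_commute[of a] c)
qed

text \<open>A set that contains \<open>A 0\<close> or \<open>B 0\<close> is handled by induction:
  with that point fixed, the function of the remaining ones vanishes at the chains of the shortened
  sequence. Any other set is reached by moving one of its points: an affine function that vanishes
  at both \<open>A 0\<close> and \<open>B 0\<close> is zero.\<close>

lemma set_affine_unique:
  assumes "set_affine n Z F" "chain_generic A B n"
    and "\<And>i. i < n \<Longrightarrow> A i \<notin> Z" "\<And>i. i < n \<Longrightarrow> B i \<notin> Z"
    and "\<And>s r. s + r = n \<Longrightarrow> F (chain A B s r) = 0"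
    and "finite X" "card X = n" "X \<inter> Z = {}"
  shows "F X = 0"
  using assms
proof (induction n arbitrary: F Z A B X)
  case 0
  thus ?case by (simp add: chain_def)
next
  case (Suc n)
  note gen = Suc.prems(2)[unfolded chain_generic_def]
  have inj: "inj_on A {..<Suc n}" "inj_on B {..<Suc n}" using gen by auto
  have A0: "A (Suc i) \<noteq> A 0" "B (Suc i) \<noteq> B 0" if "i < n" for i
    using inj_onD[OF inj(1), of "Suc i" 0] inj_onD[OF inj(2), of "Suc i" 0] that by auto
  have AB: "A i \<noteq> B j" if "i \<le> n" "j \<le> n" for i j using gen that by auto
  have caseA: "F Y = 0" if Y: "A 0 \<in> Y" "finite Y" "card Y = Suc n" "Y \<inter> Z = {}" for Y
  proof -
    have "F (insert (A 0) (Y - {A 0})) = 0"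
    proof (rule Suc.IH[where F = "\<lambda>B. F (insert (A 0) B)" and X = "Y - {A 0}" and Z = "insert (A 0) Z" and A = "A \<circ> Suc" and B = B])
      show "set_affine n (insert (A 0) Z) (\<lambda>B. F (insert (A 0) B))"
        by (intro set_affine_insert Suc.prems) simp
      show "chain_generic (A \<circ> Suc) B n"
        using gen unfolding chain_generic_def by (auto simp: inj_on_def)
      show "F (insert (A 0) (chain (A \<circ> Suc) B s r)) = 0" if "s + r = n" for s r
        using Suc.prems(5)[of "Suc s" r] that by (simp add: chain_Suc_left)
      show "(A \<circ> Suc) i \<notin> insert (A 0) Z" if "i < n" for i
        using A0(1)[OF that] Suc.prems(3)[of "Suc i"] that by auto
      show "B i \<notin> insert (A 0) Z" if "i < n" for i
        using AB[of 0 i] Suc.prems(4)[of i] that by auto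
    qed (use Y in \<open>auto simp: card_Diff_singleton\<close>)
    thus ?thesis using Y by (simp add: insert_absorb)
  qed
  have caseB: "F Y = 0" if Y: "B 0 \<in> Y" "finite Y" "card Y = Suc n" "Y \<inter> Z = {}" for Y
  proof -
    have "F (insert (B 0) (Y - {B 0})) = 0"
    proof (rule Suc.IH[where F = "\<lambda>B'. F (insert (B 0) B')" and X = "Y - {B 0}" and Z = "insert (B 0) Z" and A = A and B = "B \<circ> Suc"])
      show "set_affine n (insert (B 0) Z) (\<lambda>B'. F (insert (B 0) B'))"
        by (intro set_affine_insert Suc.prems) simp
      show "chain_generic A (B \<circ> Suc) n"
        using gen unfolding chain_generic_def by (auto simp: inj_on_def)
      show "F (insert (B 0) (chain A (B \<circ> Suc) s r)) = 0" if "s + r = n" for s r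
        using Suc.prems(5)[of s "Suc r"] that by (simp add: chain_Suc_right)
      show "(B \<circ> Suc) i \<notin> insert (B 0) Z" if "i < n" for i
        using A0(2)[OF that] Suc.prems(4)[of "Suc i"] that by auto
      show "A i \<notin> insert (B 0) Z" if "i < n" for i
        using AB[of i 0] Suc.prems(3)[of i] that by auto
    qed (use Y in \<open>auto simp: card_Diff_singleton\<close>)
    thus ?thesis using Y by (simp add: insert_absorb)
  qed
  show ?case
  proof (cases "A 0 \<in> X \<or> B 0 \<in> X")
    case True
    thus ?thesis using caseA[of X] caseB[of X] Suc.prems by auto
  next
    case False
    obtain x Y where X: "X = insert x Y" "x \<notin> Y" "card Y = n" "finite Y"
      using Suc.prems(6,7) by (metis card_Suc_eq_finite)
    obtain c0 c1 where c: "\<And>y. y \<notin> Y \<Longrightarrow> y \<notin> Z \<Longrightarrow> F (insert y Y) = c0 + c1 * y"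
      using Suc.prems(1,8) X unfolding set_affine_def by (metis Int_insert_left_if0 inf_commute insert_disjoint(1) Int_commute)
    have 1: "A 0 \<notin> Y" "B 0 \<notin> Y" "A 0 \<notin> Z" "B 0 \<notin> Z" "x \<notin> Z" "Y \<inter> Z = {}"
      using False X Suc.prems(3,4)[of 0] Suc.prems(8) by auto
    have "F (insert (A 0) Y) = 0" "F (insert (B 0) Y) = 0"
      by (intro caseA caseB; use 1 X in auto)+
    hence "c0 + c1 * A 0 = 0" "c0 + c1 * B 0 = 0" using c[of "A 0"] c[of "B 0"] 1 by auto
    moreover have "A 0 \<noteq> B 0" using AB by auto
    ultimately have "c1 = 0" "c0 = 0"
      by (metis add_left_imp_eq mult_cancel_left, metis add.right_neutral add_left_imp_eq mult_cancel_left mult_zero_left)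
    thus ?thesis using c[of x] X 1 by simp
  qed
qed

text \<open>The products are symmetric and affine in each point, and there are \<open>m + 1\<close>
  coefficients, as many as chains of total length \<open>m\<close>.\<close>

definition interp_fun :: "nat \<Rightarrow> (nat \<Rightarrow> complex) \<Rightarrow> (nat \<Rightarrow> complex) \<Rightarrow> complex set \<Rightarrow> complex" where
  "interp_fun m \<kappa> A X = (\<Sum>k\<le>m. \<kappa> k * (\<Prod>y\<in>X. y - A k))"

text \<open>The system is triangular: the product for \<open>A k\<close> vanishes at chains with
  \<open>s > k\<close> but not at the one with \<open>s = k\<close>. Coefficients are fixed from
  \<open>k = m\<close> downwards; after \<open>j\<close> rounds the values with
  \<open>m < s + j\<close> are correct and stay so.\<close>

lemma interp_exists:
  assumes gen: "chain_generic A B (Suc m)"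
  obtains \<kappa> where "\<And>s r. s + r = m \<Longrightarrow> interp_fun m \<kappa> A (chain A B s r) = v s"
proof -
  have inj: "inj_on A {..<Suc m}" and AB: "\<And>i j. i \<le> m \<Longrightarrow> j \<le> m \<Longrightarrow> A i \<noteq> B j"
    using gen unfolding chain_generic_def by auto
  have vanish: "(\<Prod>y\<in>chain A B s r. y - A k) = 0" if "k < s" for k s r
    using that by (intro prod_zero) (auto simp: chain_def)
  have nonvanish: "(\<Prod>y\<in>chain A B s r. y - A s) \<noteq> 0" if "s + r = m" for s r
  proof -
    have "A i \<noteq> A s" if "i < s" for i
      using inj_onD[OF inj, of i s] that \<open>s + r = m\<close> by auto
    moreover have "B j \<noteq> A s" if "j < r" for j using AB[of s j] \<open>s + r = m\<close> that by auto
    ultimately have "A s \<notin> chain A B s r" unfolding chain_def by fastforce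
    thus ?thesis by (subst prod_zero_iff) auto
  qed
  have "\<exists>\<kappa>. \<forall>s r. s + r = m \<longrightarrow> m < s + j \<longrightarrow> interp_fun m \<kappa> A (chain A B s r) = v s" if "j \<le> Suc m" for j
    using that
  proof (induction j)
    case 0
    show ?case by auto
  next
    case (Suc j)
    then obtain \<kappa> where \<kappa>: "\<And>s r. s + r = m \<Longrightarrow> m < s + j \<Longrightarrow> interp_fun m \<kappa> A (chain A B s r) = v s" by auto
    define k where "k = m - j"
    have k: "k + j = m" "k \<le> m" using Suc.prems by (auto simp: k_def)
    define c where "c = (v k - interp_fun m \<kappa> A (chain A B k j)) / (\<Prod>y\<in>chain A B k j. y - A k)"
    have upd: "interp_fun m (\<kappa>(k := \<kappa> k + c)) A X = interp_fun m \<kappa> A X + c * (\<Prod>y\<in>X. y - A k)" for X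
    proof -
      have "interp_fun m (\<kappa>(k := \<kappa> k + c)) A X = (\<Sum>i\<le>m. \<kappa> i * (\<Prod>y\<in>X. y - A i) + (if i = k then c * (\<Prod>y\<in>X. y - A k) else 0))"
        unfolding interp_fun_def by (intro sum.cong) (auto simp: algebra_simps)
      thus ?thesis using k by (simp add: sum.distrib interp_fun_def)
    qed
    show ?case
    proof (intro exI allI impI)
      fix s r assume sr: "s + r = m" "m < s + Suc j"
      show "interp_fun m (\<kappa>(k := \<kappa> k + c)) A (chain A B s r) = v s"
      proof (cases "s = k")
        case True
        hence "r = j" using sr k by simp
        thus ?thesis unfolding upd unfolding c_def using True nonvanish[OF k(1)] by (simp del: prod_zero_iff)
      next
        case False
        hence "k < s" using sr k by simp
        thus ?thesis unfolding upd using \<kappa>[OF sr(1)] vanish[of k s r] sr k False by simp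
      qed
    qed
  qed
  from this[of "Suc m"] show ?thesis using that by auto
qed

lemma interp_fun_affine: "set_affine n {} (interp_fun m \<kappa> A)"
  unfolding set_affine_def
proof (intro allI impI)
  fix B :: "complex set" assume B: "finite B \<and> Suc (card B) = n \<and> B \<inter> {} = {}"
  have "interp_fun m \<kappa> A (insert x B) = (\<Sum>k\<le>m. - \<kappa> k * A k * (\<Prod>y\<in>B. y - A k)) + (\<Sum>k\<le>m. \<kappa> k * (\<Prod>y\<in>B. y - A k)) * x"
    if "x \<notin> B" for x
  proof -
    have "interp_fun m \<kappa> A (insert x B) = (\<Sum>k\<le>m. - \<kappa> k * A k * (\<Prod>y\<in>B. y - A k) + \<kappa> k * (\<Prod>y\<in>B. y - A k) * x)"
      unfolding interp_fun_def using B that by (intro sum.cong) (simp_all add: algebra_simps)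
    thus ?thesis by (simp only: sum.distrib sum_distrib_right)
  qed
  thus "\<exists>c0 c1. \<forall>x. x \<notin> B \<longrightarrow> x \<notin> {} \<longrightarrow> interp_fun m \<kappa> A (insert x B) = c0 + c1 * x"
    by blast
qed

section \<open>Lagrange sums\<close>

definition lagrange_sum :: "(complex \<Rightarrow> complex set \<Rightarrow> complex) \<Rightarrow> (complex set \<Rightarrow> complex) \<Rightarrow> complex set \<Rightarrow> complex" where
  "lagrange_sum Y f A = (\<Sum>x\<in>A. Y x (A - {x}) * f (A - {x}) / (\<Prod>y\<in>A - {x}. y - x))"

lemma poly_prod_roots_dvd:
  fixes p :: "complex poly"
  assumes "finite B" "\<And>b. b \<in> B \<Longrightarrow> poly p b = 0"
  shows "(\<Prod>b\<in>B. [:b, -1:]) dvd p"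
  using assms
proof (induction B arbitrary: p rule: finite_induct)
  case (insert b B)
  have "[:-b, 1:] dvd p" using insert.prems by (simp add: poly_eq_0_iff_dvd)
  moreover have "[:b, -1:] = - [:-b, 1:]" by simp
  ultimately have "[:b, -1:] dvd p" by (simp only: minus_dvd_iff)
  then obtain r where r: "p = [:b, -1:] * r" by (elim dvdE)
  have "poly r c = 0" if "c \<in> B" for c
    using insert.prems[of c] that insert(2) unfolding r by auto
  hence "(\<Prod>b\<in>B. [:b, -1:]) dvd r" by (rule insert.IH)
  thus ?case unfolding r prod.insert[OF insert(1,2)] by (rule mult_dvd_mono[OF dvd_refl])
qed auto

lemma degree_prod_le:
  fixes p :: "'b \<Rightarrow> complex poly"
  assumes "finite B" "\<And>b. b \<in> B \<Longrightarrow> degree (p b) \<le> 1"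
  shows "degree (\<Prod>b\<in>B. p b) \<le> card B"
  using degree_prod_sum_le[OF assms(1), of p] sum_mono[of B "degree \<circ> p" "\<lambda>_. 1"] assms(2) by auto

text \<open>Multiplied by the product of \<open>y - x\<close> over \<open>y\<close> in
  \<open>B\<close>, the sum becomes a polynomial \<open>R\<close> in the moving point
  \<open>x\<close> of degree at most \<open>n\<close>. The apparent poles cancel, so
  \<open>R\<close> vanishes at the \<open>n - 1\<close> points of \<open>B\<close>, and dividing by
  the corresponding linear factors leaves degree at most 1.\<close>

lemma lagrange_sum_affine:
  assumes Y1: "\<And>B. finite B \<Longrightarrow> Suc (card B) = n \<Longrightarrow> B \<inter> Z = {} \<Longrightarrow>
      \<exists>p. degree p \<le> n \<and> (\<forall>x. x \<notin> Z \<longrightarrow> Y x B = poly p x)"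
    and Y2: "\<And>x B. x \<notin> Z \<Longrightarrow> finite B \<Longrightarrow> Suc (Suc (card B)) = n \<Longrightarrow>
      \<exists>c0 c1. \<forall>y. y \<notin> B \<longrightarrow> Y x (insert y B) = c0 + c1 * y"
    and f: "set_affine (n - 1) {} f"
  shows "set_affine n Z (lagrange_sum Y f)"
  unfolding set_affine_def
proof (intro allI impI)
  fix B assume B: "finite B \<and> Suc (card B) = n \<and> B \<inter> Z = {}"
  obtain p where p: "degree p \<le> n" "\<And>x. x \<notin> Z \<Longrightarrow> Y x B = poly p x" using Y1[of B] B by auto
  have cardb: "Suc (Suc (card (B - {b}))) = n" if "b \<in> B" for b
    using B that by (metis card_Suc_Diff1)
  have "\<forall>b\<in>B. \<exists>P. degree P \<le> 1 \<and> (\<forall>y. y \<notin> B - {b} \<longrightarrow> Y b (insert y (B - {b})) = poly P y)"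
  proof
    fix b assume b: "b \<in> B"
    obtain c0 c1 where "\<And>y. y \<notin> B - {b} \<Longrightarrow> Y b (insert y (B - {b})) = c0 + c1 * y"
      using Y2[of b "B - {b}"] cardb[OF b] B b by auto
    thus "\<exists>P. degree P \<le> 1 \<and> (\<forall>y. y \<notin> B - {b} \<longrightarrow> Y b (insert y (B - {b})) = poly P y)"
      by (intro exI[of _ "[:c0, c1:]"]) auto
  qed
  then obtain P where P: "\<And>b. b \<in> B \<Longrightarrow> degree (P b) \<le> 1"
    "\<And>b y. b \<in> B \<Longrightarrow> y \<notin> B - {b} \<Longrightarrow> Y b (insert y (B - {b})) = poly (P b) y" by metis
  have "\<forall>b\<in>B. \<exists>P. degree P \<le> 1 \<and> (\<forall>y. y \<notin> B - {b} \<longrightarrow> f (insert y (B - {b})) = poly P y)"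
  proof
    fix b assume b: "b \<in> B"
    have "Suc (card (B - {b})) = n - 1" using cardb[OF b] by linarith
    then obtain c0 c1 where "\<And>y. y \<notin> B - {b} \<Longrightarrow> f (insert y (B - {b})) = c0 + c1 * y"
      using f B unfolding set_affine_def by (metis Int_empty_right empty_iff finite_Diff)
    thus "\<exists>P. degree P \<le> 1 \<and> (\<forall>y. y \<notin> B - {b} \<longrightarrow> f (insert y (B - {b})) = poly P y)"
      by (intro exI[of _ "[:c0, c1:]"]) auto
  qed
  then obtain G where G: "\<And>b. b \<in> B \<Longrightarrow> degree (G b) \<le> 1"
    "\<And>b y. b \<in> B \<Longrightarrow> y \<notin> B - {b} \<Longrightarrow> f (insert y (B - {b})) = poly (G b) y" by metis
  define c where "c = (\<lambda>b. 1 / (\<Prod>y\<in>B - {b}. y - b))"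
  define R where "R = smult (f B) p - (\<Sum>b\<in>B. smult (c b) (P b * G b * (\<Prod>y\<in>B - {b}. [:y, -1:])))"
  have "degree (P b * G b * (\<Prod>y\<in>B - {b}. [:y, -1:])) \<le> n" if b: "b \<in> B" for b
  proof -
    have "degree (\<Prod>y\<in>B - {b}. [:y, -1:]) \<le> card (B - {b})"
      by (rule degree_prod_le) (use B in auto)
    hence "degree (P b) + degree (G b) + degree (\<Prod>y\<in>B - {b}. [:y, -1:]) \<le> n"
      using P(1)[OF b] G(1)[OF b] cardb[OF b] by linarith
    thus ?thesis by (meson add_le_mono degree_mult_le order_refl order_trans)
  qed
  hence degR: "degree R \<le> n" unfolding R_def
    using p(1) B by (intro degree_diff_le degree_sum_le) (auto intro: order_trans[OF degree_smult_le])
  have polyR: "poly R x = f B * poly p x - (\<Sum>b\<in>B. c b * (poly (P b) x * poly (G b) x * (\<Prod>y\<in>B - {b}. y - x)))" for x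
    unfolding R_def by (simp add: poly_sum poly_prod)
  \<comment> \<open>At \<open>b\<close> only the summand of \<open>b\<close> survives; it cancels
    the first term because inserting \<open>b\<close> into \<open>B - {b}\<close> restores
    \<open>B\<close>.\<close>
  have "poly R b = 0" if b: "b \<in> B" for b
  proof -
    have "(\<Sum>b'\<in>B. c b' * (poly (P b') b * poly (G b') b * (\<Prod>y\<in>B - {b'}. y - b)))
        = (\<Sum>b'\<in>B. if b' = b then c b * (poly (P b) b * poly (G b) b * (\<Prod>y\<in>B - {b}. y - b)) else 0)"
      using B b by (intro sum.cong) auto
    also have "\<dots> = c b * (poly (P b) b * poly (G b) b * (\<Prod>y\<in>B - {b}. y - b))" using B b by simp
    also have "\<dots> = poly (P b) b * poly (G b) b" unfolding c_def using B by simp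
    also have "\<dots> = Y b B * f B" using P(2)[OF b, of b] G(2)[OF b, of b] b by (simp add: insert_absorb)
    finally show ?thesis unfolding polyR using p(2)[of b] B b by (simp add: disjoint_iff mult.commute)
  qed
  then obtain S where S: "R = (\<Prod>b\<in>B. [:b, -1:]) * S"
    using poly_prod_roots_dvd[of B R] B by (auto elim: dvdE)
  have degS: "degree S \<le> 1"
  proof (cases "S = 0")
    case False
    have "degree (\<Prod>b\<in>B. [:b, -1:]) = (\<Sum>b\<in>B. degree [:b, -1:])"
      by (rule degree_prod_eq_sum_degree) auto
    also have "\<dots> = card B" by simp
    finally have d: "degree (\<Prod>b\<in>B. [:b, -1:]) = card B" .
    have nz: "(\<Prod>b\<in>B. [:b, -1:]) \<noteq> 0" using B by (simp add: prod_zero_iff)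
    have "degree R = card B + degree S" unfolding S using degree_mult_eq[OF nz False] d by simp
    thus ?thesis using degR B by linarith
  qed simp
  have "lagrange_sum Y f (insert x B) = poly S x" if x: "x \<notin> B" "x \<notin> Z" for x
  proof -
    have piB: "(\<Prod>y\<in>B. y - x) \<noteq> 0" using B x by auto
    have tm: "Y b (insert x B - {b}) * f (insert x B - {b}) / (\<Prod>y\<in>insert x B - {b}. y - b)
        = - (c b * (poly (P b) x * poly (G b) x * (\<Prod>y\<in>B - {b}. y - x))) / (\<Prod>y\<in>B. y - x)" if b: "b \<in> B" for b
    proof -
      have e: "insert x B - {b} = insert x (B - {b})" using b x by auto
      have xb: "x \<noteq> b" using b x by auto
      have 1: "(\<Prod>y\<in>insert x B - {b}. y - b) = (x - b) * (\<Prod>y\<in>B - {b}. y - b)" unfolding e using B x by simp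
      have 2: "(\<Prod>y\<in>B. y - x) = (b - x) * (\<Prod>y\<in>B - {b}. y - x)" using B b by (intro prod.remove) auto
      have 3: "(\<Prod>y\<in>B - {b}. y - x) \<noteq> 0" using piB unfolding 2 by auto
      have 4: "Y b (insert x B - {b}) = poly (P b) x" "f (insert x B - {b}) = poly (G b) x"
        unfolding e using P(2)[OF b, of x] G(2)[OF b, of x] x by auto
      show ?thesis unfolding 1 2 4 c_def using xb 3 by (simp add: divide_simps) (simp add: algebra_simps)
    qed
    have "lagrange_sum Y f (insert x B) = Y x B * f B / (\<Prod>y\<in>B. y - x)
       + (\<Sum>b\<in>B. Y b (insert x B - {b}) * f (insert x B - {b}) / (\<Prod>y\<in>insert x B - {b}. y - b))"
      unfolding lagrange_sum_def using B x by simp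
    also have "\<dots> = poly R x / (\<Prod>y\<in>B. y - x)"
    proof -
      have "(\<Sum>b\<in>B. Y b (insert x B - {b}) * f (insert x B - {b}) / (\<Prod>y\<in>insert x B - {b}. y - b))
        = (\<Sum>b\<in>B. - (c b * (poly (P b) x * poly (G b) x * (\<Prod>y\<in>B - {b}. y - x))) / (\<Prod>y\<in>B. y - x))"
        by (intro sum.cong refl tm)
      thus ?thesis
        unfolding polyR p(2)[OF x(2)]
        by (simp add: sum_divide_distrib sum_negf diff_divide_distrib mult.commute)
    qed
    also have "\<dots> = poly S x" unfolding S using piB by (simp add: poly_prod)
    finally show ?thesis .
  qed
  moreover have "\<exists>c0 c1. S = [:c0, c1:]"
    using degS by (metis degree_0 degree_eq_zeroE degree_pCons_eq_if le_SucE le_zero_eq One_nat_def Suc_inject pCons_cases)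
  ultimately show "\<exists>c0 c1. \<forall>x. x \<notin> B \<longrightarrow> x \<notin> Z \<longrightarrow> lagrange_sum Y f (insert x B) = c0 + c1 * x"
    by (elim exE) (auto simp: mult.commute)
qed

section \<open>The algebraic two-term identity\<close>

text \<open>The integrand is invariant, up to simple factors, under \<open>g \<mapsto> e / g\<close> with \<open>g = e z\<^sub>i\<close>, so the natural
  coordinates are \<open>x\<^sub>i = jouk e (e z\<^sub>i)\<close>. The branch points of \<open>jouk e\<close> are excluded by \<open>degenerate\<close>.\<close>

definition jouk :: "complex \<Rightarrow> complex \<Rightarrow> complex" where "jouk e g = g + e / g"

lemma jouk_diff: "h \<noteq> 0 \<Longrightarrow> g \<noteq> 0 \<Longrightarrow> jouk e h - jouk e g = (h - g) * (1 - e / (h * g))"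
  unfolding jouk_def by (simp add: field_simps)

lemma jouk_eq_iff: "h \<noteq> 0 \<Longrightarrow> g \<noteq> 0 \<Longrightarrow> jouk e h = jouk e g \<longleftrightarrow> h = g \<or> e = h * g"
proof -
  assume nz: "h \<noteq> 0" "g \<noteq> 0"
  have "jouk e h = jouk e g \<longleftrightarrow> (h - g) * (1 - e / (h * g)) = 0"
    unfolding jouk_diff[OF nz, symmetric] by simp
  also have "\<dots> \<longleftrightarrow> h = g \<or> e = h * g" using nz by auto
  finally show ?thesis .
qed

lemma jouk_inv: "g \<noteq> 0 \<Longrightarrow> e \<noteq> 0 \<Longrightarrow> jouk e (e / g) = jouk e g"
  unfolding jouk_def by simp

definition degenerate :: "complex \<Rightarrow> complex set" where "degenerate e = {x. x\<^sup>2 = 4 * e}"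

lemma jouk_degenerate_iff: "g \<noteq> 0 \<Longrightarrow> jouk e g \<in> degenerate e \<longleftrightarrow> g\<^sup>2 = e"
proof -
  assume g: "g \<noteq> 0"
  have "(jouk e g)\<^sup>2 - 4 * e = (g - e / g)\<^sup>2"
    using g unfolding jouk_def by (simp add: power2_sum power2_diff)
  moreover have "jouk e g \<in> degenerate e \<longleftrightarrow> (jouk e g)\<^sup>2 - 4 * e = 0" unfolding degenerate_def by simp
  ultimately have "jouk e g \<in> degenerate e \<longleftrightarrow> g - e / g = 0" by simp
  thus ?thesis using g by (auto simp: field_simps power2_eq_square)
qed

lemma jouk_surj:
  assumes "e \<noteq> 0" obtains g where "g \<noteq> 0" "jouk e g = x"
proof -
  define g where "g = (x + csqrt (x\<^sup>2 - 4 * e)) / 2"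
  have "(2 * g - x)\<^sup>2 = x\<^sup>2 - 4 * e" unfolding g_def by (simp add: add_divide_distrib)
  hence "4 * (g * g + e) = 4 * (x * g)" by (simp add: power2_eq_square algebra_simps)
  hence eq: "g * g + e = x * g" by (simp only: mult_cancel_left) simp
  hence "g \<noteq> 0" using assms by auto
  moreover from this eq have "jouk e g = x" unfolding jouk_def by (simp add: field_simps)
  ultimately show ?thesis using that by blast
qed

text \<open>With \<open>g = e * z\<close> for the moving variable \<open>z\<close>, and
  \<open>B\<close> the coordinates of the other variables, \<open>sfun\<close> at \<open>g\<close>
  is the forward end of the contour shift relative to the weight, and \<open>sfun\<close> at
  \<open>e / g\<close> the backward end, up to factors common to both.\<close>

definition sfun :: "complex \<Rightarrow> complex \<Rightarrow> (complex \<Rightarrow> complex) \<Rightarrow> complex set \<Rightarrow> complex \<Rightarrow> complex" where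
  "sfun e t A B g = e / g * A g * (\<Prod>y\<in>B. y - jouk e (g / t))"

text \<open>Numerator and denominator are both odd under \<open>g \<mapsto> e / g\<close>, so the
  quotient is a function of \<open>jouk e g\<close>.\<close>

definition Yval :: "complex \<Rightarrow> complex \<Rightarrow> (complex \<Rightarrow> complex) \<Rightarrow> complex set \<Rightarrow> complex \<Rightarrow> complex" where
  "Yval e t A B g = (sfun e t A B g - sfun e t A B (e / g)) / (e / g - g)"

text \<open>The choice of \<open>g\<close> is irrelevant because \<open>Yval\<close> is invariant under \<open>g \<mapsto> e / g\<close>; on \<open>degenerate e\<close> the
  division by zero makes the value \<open>0\<close>.\<close>

definition Yfun :: "complex \<Rightarrow> complex \<Rightarrow> (complex \<Rightarrow> complex) \<Rightarrow> complex \<Rightarrow> complex set \<Rightarrow> complex" where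
  "Yfun e t A x B = Yval e t A B (SOME g. g \<noteq> 0 \<and> jouk e g = x)"

lemma Yval_inv:
  assumes "e \<noteq> 0" "g \<noteq> 0" shows "Yval e t A B (e / g) = Yval e t A B g"
proof -
  have "e / (e / g) = g" using assms by simp
  moreover have "(u - v) / (g - e / g) = (v - u) / (e / g - g)" for u v
    by (metis minus_diff_eq minus_divide_divide)
  ultimately show ?thesis unfolding Yval_def by simp
qed

lemma Yfun_jouk:
  assumes "e \<noteq> 0" "g \<noteq> 0" shows "Yfun e t A (jouk e g) B = Yval e t A B g"
proof -
  define h where "h = (SOME h. h \<noteq> 0 \<and> jouk e h = jouk e g)"
  have h: "h \<noteq> 0" "jouk e h = jouk e g"
    using someI[of "\<lambda>h. h \<noteq> 0 \<and> jouk e h = jouk e g" g] assms unfolding h_def by auto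
  hence "h = g \<or> h = e / g" using jouk_eq_iff[of h g e] assms by (auto simp: field_simps)
  thus ?thesis unfolding Yfun_def h_def[symmetric] using Yval_inv assms by auto
qed

text \<open>Chebyshev polynomials of the second kind: \<open>chebU e k\<close> at \<open>jouk e g\<close> is \<open>(g\<^sup>k - (e / g)\<^sup>k) / (g - e / g)\<close>.\<close>

fun chebU :: "complex \<Rightarrow> nat \<Rightarrow> complex poly" where
  "chebU e 0 = 0"
| "chebU e (Suc 0) = 1"
| "chebU e (Suc (Suc k)) = [:0, 1:] * chebU e (Suc k) - smult e (chebU e k)"

lemma degree_chebU: "degree (chebU e k) \<le> k - 1"
proof (induction e k rule: chebU.induct)
  case (3 e k)
  have "degree ([:0, 1:] * chebU e (Suc k)) \<le> Suc k"
    using degree_mult_le[of "[:0, 1:]" "chebU e (Suc k)"] 3 by simp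
  moreover have "degree (smult e (chebU e k)) \<le> Suc k"
    using degree_smult_le[of e "chebU e k"] 3 by simp
  ultimately show ?case unfolding chebU.simps(3) by (auto intro: degree_diff_le)
qed auto

lemma poly_chebU:
  assumes "g \<noteq> 0"
  shows "poly (chebU e k) (jouk e g) * (g - e / g) = g ^ k - (e / g) ^ k"
proof (induction e k rule: chebU.induct)
  case (3 e k)
  have "poly (chebU e (Suc (Suc k))) (jouk e g) * (g - e / g)
     = jouk e g * (poly (chebU e (Suc k)) (jouk e g) * (g - e / g)) - e * (poly (chebU e k) (jouk e g) * (g - e / g))"
    by (simp add: algebra_simps)
  also have "\<dots> = (g + e / g) * (g ^ Suc k - (e / g) ^ Suc k) - g * (e / g) * (g ^ k - (e / g) ^ k)"
    unfolding 3 unfolding jouk_def using assms by simp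
  also have "\<dots> = g ^ Suc (Suc k) - (e / g) ^ Suc (Suc k)"
    by (simp only: power_Suc ring_distribs) (simp only: mult_ac diff_diff_eq2 add_diff_eq, simp)
  finally show ?case .
qed auto

text \<open>\<open>S g / g ^ m\<close> is a Laurent polynomial with exponents from
  \<open>- m\<close> to \<open>m\<close>. Its odd part under \<open>g \<mapsto> e / g\<close> is a
  combination of \<open>g ^ k - (e / g) ^ k\<close>, and division by \<open>e / g - g\<close> gives
  Chebyshev polynomials of degree \<open>k - 1\<close>. The coefficient condition says
  \<open>c m = 0\<close>, which lowers the degree from \<open>m - 1\<close> to
  \<open>m - 2\<close>.\<close>

lemma laurent_symmetric:
  fixes S :: "complex poly"
  assumes "degree S \<le> 2 * m" "coeff S (2 * m) * e ^ m = coeff S 0" "e \<noteq> 0" "m \<ge> 2"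
  obtains p where "degree p \<le> m - 2"
    "\<And>g. g \<noteq> 0 \<Longrightarrow> g\<^sup>2 \<noteq> e \<Longrightarrow>
       poly p (jouk e g) = (poly S g / g ^ m - poly S (e / g) / (e / g) ^ m) / (e / g - g)"
proof -
  define c where "c = (\<lambda>k. coeff S (m - k) / e ^ k - coeff S (m + k))"
  define p where "p = (\<Sum>k=1..<m. smult (c k) (chebU e k))"
  have "degree p \<le> m - 2" unfolding p_def
  proof (rule degree_sum_le)
    fix k assume "k \<in> {1..<m}"
    thus "degree (smult (c k) (chebU e k)) \<le> m - 2"
      using degree_smult_le[of "c k" "chebU e k"] degree_chebU[of e k] by auto
  qed simp
  moreover have "poly p (jouk e g) = (poly S g / g ^ m - poly S (e / g) / (e / g) ^ m) / (e / g - g)"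
    if g: "g \<noteq> 0" "g\<^sup>2 \<noteq> e" for g
  proof -
    let ?h = "e / g"
    have gh: "g * ?h = e" "?h \<noteq> 0" using g assms by auto
    have dg: "g - ?h \<noteq> 0" using g by (auto simp: field_simps power2_eq_square)
    have Sg: "poly S x / x ^ m = coeff S m + (\<Sum>k=1..m. coeff S (m + k) * x ^ k + coeff S (m - k) / x ^ k)"
      if "x \<noteq> 0" for x
    proof -
      have "poly S x = (\<Sum>i\<le>2*m. coeff S i * x ^ i)"
        unfolding poly_altdef using assms(1)
        by (intro sum.mono_neutral_left) (auto simp: not_le coeff_eq_0)
      also have "{..2*m} = {..<m} \<union> {m} \<union> {m+1..2*m}" by auto
      also have "(\<Sum>i\<in>\<dots>. coeff S i * x ^ i) = (\<Sum>i<m. coeff S i * x ^ i) + coeff S m * x ^ m + (\<Sum>i=m+1..2*m. coeff S i * x ^ i)"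
        by (subst sum.union_disjoint; (subst sum.union_disjoint)?) auto
      also have "(\<Sum>i<m. coeff S i * x ^ i) = (\<Sum>k=1..m. coeff S (m - k) * x ^ (m - k))"
        by (rule sum.reindex_bij_witness[of _ "\<lambda>k. m - k" "\<lambda>i. m - i"]) auto
      also have "(\<Sum>i=m+1..2*m. coeff S i * x ^ i) = (\<Sum>k=1..m. coeff S (m + k) * x ^ (m + k))"
        by (rule sum.reindex_bij_witness[of _ "\<lambda>k. m + k" "\<lambda>i. i - m"]) auto
      finally have "poly S x / x ^ m = coeff S m + ((\<Sum>k=1..m. coeff S (m - k) * x ^ (m - k) / x ^ m) + (\<Sum>k=1..m. coeff S (m + k) * x ^ (m + k) / x ^ m))"
        using that by (simp add: add_divide_distrib sum_divide_distrib)
      also have "(\<Sum>k=1..m. coeff S (m - k) * x ^ (m - k) / x ^ m) + (\<Sum>k=1..m. coeff S (m + k) * x ^ (m + k) / x ^ m)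
        = (\<Sum>k=1..m. coeff S (m + k) * x ^ k + coeff S (m - k) / x ^ k)"
        unfolding sum.distrib[symmetric]
        by (rule sum.cong) (use that in \<open>auto simp: power_add power_diff\<close>)
      finally show ?thesis .
    qed
    have "poly S g / g ^ m - poly S ?h / ?h ^ m
      = (\<Sum>k=1..m. - c k * (g ^ k - ?h ^ k))"
      unfolding Sg[OF g(1)] Sg[OF gh(2)] add_diff_cancel_left sum_subtractf[symmetric]
    proof (rule sum.cong[OF refl])
      fix k
      have 1: "1 / g ^ k = ?h ^ k / e ^ k" "1 / ?h ^ k = g ^ k / e ^ k"
        using g assms by (auto simp: power_divide)
      have 2: "coeff S (m - k) / g ^ k = coeff S (m - k) * (?h ^ k / e ^ k)"
         "coeff S (m - k) / ?h ^ k = coeff S (m - k) * (g ^ k / e ^ k)"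
        unfolding 1[symmetric] by simp_all
      show "coeff S (m + k) * g ^ k + coeff S (m - k) / g ^ k - (coeff S (m + k) * ?h ^ k + coeff S (m - k) / ?h ^ k)
          = - c k * (g ^ k - ?h ^ k)"
        unfolding 2 c_def by (simp add: algebra_simps diff_divide_distrib add_divide_distrib)
    qed
    also have "\<dots> = (\<Sum>k=1..<m. - c k * (g ^ k - ?h ^ k))"
    proof -
      have "coeff S 0 / e ^ m = coeff S (m + m)" using assms(2,3) by (simp add: field_simps flip: mult_2)
      hence "c m = 0" unfolding c_def by simp
      moreover have "{1..m} = insert m {1..<m}" using assms(4) by auto
      ultimately show ?thesis by simp
    qed
    also have "\<dots> = (\<Sum>k=1..<m. c k * poly (chebU e k) (jouk e g)) * (?h - g)"
      unfolding sum_distrib_right poly_chebU[OF g(1), symmetric] by (rule sum.cong) (auto simp: algebra_simps)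
    also have "(\<Sum>k=1..<m. c k * poly (chebU e k) (jouk e g)) = poly p (jouk e g)"
      unfolding p_def by (simp add: poly_sum)
    finally show ?thesis using dg by (simp add: field_simps)
  qed
  ultimately show ?thesis using that by blast
qed

text \<open>The coefficient at a degree bound rather than the leading coefficient: it may be 0, so
  products need no case distinction.\<close>

definition top_coeff :: "complex poly \<Rightarrow> nat \<Rightarrow> complex \<Rightarrow> bool" where
  "top_coeff p d c \<longleftrightarrow> degree p \<le> d \<and> coeff p d = c"

lemma top_coeff_mult:
  assumes "top_coeff p a c" "top_coeff q b d"
  shows "top_coeff (p * q) (a + b) (c * d)"
proof -
  have d: "degree p \<le> a" "degree q \<le> b" using assms by (auto simp: top_coeff_def)
  have "coeff (p * q) (a + b) = (\<Sum>i\<le>a + b. coeff p i * coeff q (a + b - i))" by (simp add: coeff_mult)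
  also have "\<dots> = (\<Sum>i\<le>a + b. if i = a then coeff p a * coeff q b else 0)"
  proof (rule sum.cong[OF refl])
    fix i assume "i \<in> {..a + b}"
    show "coeff p i * coeff q (a + b - i) = (if i = a then coeff p a * coeff q b else 0)"
    proof (cases i a rule: linorder_cases)
      case less
      hence "degree q < a + b - i" using d by linarith
      thus ?thesis using less by (simp add: coeff_eq_0)
    next
      case greater
      hence "degree p < i" using d by linarith
      thus ?thesis using greater by (simp add: coeff_eq_0)
    qed auto
  qed
  also have "\<dots> = c * d" using assms by (simp add: top_coeff_def)
  finally show ?thesis using degree_mult_le[of p q] d unfolding top_coeff_def by simp
qed

lemma top_coeff_prod:
  assumes "finite B" "\<And>y. y \<in> B \<Longrightarrow> top_coeff (p y) k (c y)"
  shows "top_coeff (\<Prod>y\<in>B. p y) (k * card B) (\<Prod>y\<in>B. c y)"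
  using assms
proof (induction B rule: finite_induct)
  case empty
  show ?case by (simp add: top_coeff_def)
next
  case (insert y B)
  thus ?case using top_coeff_mult[of "p y" k "c y" "\<Prod>y\<in>B. p y" "k * card B"] by simp
qed

text \<open>At \<open>g = e * w\<close> this is the product of the one-variable factors that
  \<open>splus\<close> has in addition to \<open>sing\<close>: \<open>1 - a1 / w\<close>,
  \<open>1 - a2 / w\<close> and \<open>1 - e * w / b k\<close>.\<close>

definition Afun :: "complex \<Rightarrow> complex \<Rightarrow> complex \<Rightarrow> (nat \<Rightarrow> complex) \<Rightarrow> complex \<Rightarrow> complex" where
  "Afun e a1 a2 b g = (1 - a1 * e / g) * (1 - a2 * e / g) * (\<Prod>k=1..4. 1 - g / b k)"

text \<open>Clearing powers of \<open>g\<close> from \<open>sfun\<close> leaves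
  \<open>S1 * S2\<close> with degree bound \<open>6 + 2 * (n - 1) = 2 * m\<close>, where
  \<open>m = n + 2\<close>. Balancing is precisely the relation between its extreme coefficients in
  \<open>laurent_symmetric\<close>, and it brings the degree down from \<open>n + 1\<close> to the
  \<open>n\<close> that \<open>lagrange_sum_affine\<close> demands.\<close>

lemma Yfun_poly:
  assumes nz: "e \<noteq> 0" "t \<noteq> 0" "\<And>k. k \<in> {1..4} \<Longrightarrow> b k \<noteq> 0"
    and B: "finite B" "Suc (card B) = n"
    and balanced: "e = a1 * a2 * (\<Prod>k=1..4. b k) * t ^ (2 * n - 2)"
  shows "\<exists>p. degree p \<le> n \<and> (\<forall>x. x \<notin> degenerate e \<longrightarrow> Yfun e t (Afun e a1 a2 b) x B = poly p x)"
proof -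
  define S1 where "S1 = smult e ([:- a1 * e, 1:] * [:- a2 * e, 1:] * (\<Prod>k=1..4. [:1, - 1 / b k:]))"
  define S2 where "S2 = (\<Prod>y\<in>B. [:- e * t, y, - 1 / t:])"
  have n: "n \<ge> 1" using B by simp
  have top1: "top_coeff S1 6 (e * (\<Prod>k=1..4. - 1 / b k))"
  proof -
    have lin: "top_coeff [:u, v:] 1 v" for u v :: complex by (simp add: top_coeff_def)
    have "top_coeff ([:- a1 * e, 1:] * [:- a2 * e, 1:] * (\<Prod>k=1..4. [:1, - 1 / b k:])) (1 + 1 + 1 * card {1..4::nat}) (1 * 1 * (\<Prod>k=1..4. - 1 / b k))"
      by (intro top_coeff_mult top_coeff_prod lin) simp
    thus ?thesis unfolding S1_def top_coeff_def by (auto intro: order_trans[OF degree_smult_le])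
  qed
  have top2: "top_coeff S2 (2 * card B) (\<Prod>y\<in>B. - 1 / t)"
    unfolding S2_def using B(1) by (intro top_coeff_prod) (auto simp: top_coeff_def numeral_2_eq_2)
  have cB: "card B = n - 1" using B(2) by simp
  define m where "m = n + 2"
  have m6: "6 + 2 * card B = 2 * m" unfolding m_def B(2)[symmetric] by simp
  have top: "top_coeff (S1 * S2) (2 * m) (e * (\<Prod>k=1..4. - 1 / b k) * (- 1 / t) ^ (n - 1))"
    using top_coeff_mult[OF top1 top2] m6 cB by simp
  have c0: "coeff (S1 * S2) 0 = e * (a1 * e * (a2 * e)) * (- e * t) ^ (n - 1)"
    unfolding poly_0_coeff_0[symmetric] S1_def S2_def by (simp add: poly_prod cB)
  have P4: "(\<Prod>k=1..4. - 1 / b k) = 1 / (\<Prod>k=1..4. b k)"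
    by (simp add: numeral_eq_Suc prod.nat_ivl_Suc' field_simps)
  have Pnz: "(\<Prod>k=1..4. b k) \<noteq> 0" using nz(3) by simp
  have "coeff (S1 * S2) (2 * m) * e ^ m = coeff (S1 * S2) 0"
  proof -
    have "2 * n - 2 = (n - 1) + (n - 1)" using n by simp
    hence tt: "t ^ (2 * n - 2) = t ^ (n - 1) * t ^ (n - 1)" by (simp only: power_add)
    have em: "e ^ m = e ^ (n - 1) * (e * e * e)"
      unfolding m_def using n by (cases n) (simp_all add: power_add numeral_eq_Suc)
    have "coeff (S1 * S2) (2 * m) * e ^ m = e * e * e * (-1) ^ (n - 1) * e ^ (n - 1) / t ^ (n - 1) / (\<Prod>k=1..4. b k) * e"
      using top unfolding top_coeff_def P4 em power_divide by (simp add: mult_ac)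
    also have "\<dots> = e * e * e * (-1) ^ (n - 1) * e ^ (n - 1) / t ^ (n - 1) / (\<Prod>k=1..4. b k) * (a1 * a2 * (\<Prod>k=1..4. b k) * (t ^ (n - 1) * t ^ (n - 1)))"
      by (subst (5) balanced) (simp only: tt)
    also have "\<dots> = e * e * e * (-1) ^ (n - 1) * e ^ (n - 1) * a1 * a2 * t ^ (n - 1)"
      using Pnz nz(2) by (simp add: divide_simps)
    also have "\<dots> = coeff (S1 * S2) 0" unfolding c0 power_mult_distrib minus_mult_left[symmetric]
      by (simp add: power_minus[of "e * t"] power_mult_distrib)
    finally show ?thesis .
  qed
  then obtain p where p: "degree p \<le> m - 2"
    "\<And>g. g \<noteq> 0 \<Longrightarrow> g\<^sup>2 \<noteq> e \<Longrightarrow>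
       poly p (jouk e g) = (poly (S1 * S2) g / g ^ m - poly (S1 * S2) (e / g) / (e / g) ^ m) / (e / g - g)"
    using laurent_symmetric[of "S1 * S2" m e] top nz unfolding top_coeff_def by (auto simp: m_def)
  have s: "sfun e t (Afun e a1 a2 b) B g = poly (S1 * S2) g / g ^ m" if g: "g \<noteq> 0" for g
  proof -
    have gm: "g ^ m = g * g * g * g ^ card B" unfolding m_def using B(2)[symmetric] by (simp add: power_add numeral_eq_Suc)
    have "poly S1 g = e * (g * (1 - a1 * e / g) * (g * (1 - a2 * e / g)) * (\<Prod>k=1..4. 1 - g / b k))"
    proof -
      have l: "g * (1 - a * e / g) = poly [:- a * e, 1:] g" for a using g by (simp add: right_diff_distrib)
      show ?thesis unfolding l S1_def by (simp only: poly_smult poly_mult poly_prod) simp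
    qed
    also have "\<dots> = e * g * g * Afun e a1 a2 b g" by (simp add: Afun_def mult_ac)
    finally have 1: "poly S1 g = e * g * g * Afun e a1 a2 b g" .
    have "poly S2 g = (\<Prod>y\<in>B. g * (y - jouk e (g / t)))"
      unfolding S2_def poly_prod
      by (rule prod.cong) (use g nz in \<open>auto simp: jouk_def field_simps\<close>)
    also have "\<dots> = g ^ card B * (\<Prod>y\<in>B. y - jouk e (g / t))" by (simp add: prod.distrib)
    finally have 2: "poly S2 g = g ^ card B * (\<Prod>y\<in>B. y - jouk e (g / t))" .
    show ?thesis unfolding sfun_def poly_mult 1 2 gm using g by simp
  qed
  show ?thesis
  proof (intro exI[of _ p] conjI allI impI)
    show "degree p \<le> n" using p(1) by (simp add: m_def)
    fix x assume x: "x \<notin> degenerate e"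
    obtain g where g: "g \<noteq> 0" "jouk e g = x" using jouk_surj nz(1) by blast
    have "g\<^sup>2 \<noteq> e" using x jouk_degenerate_iff[OF g(1)] g(2) by auto
    thus "Yfun e t (Afun e a1 a2 b) x B = poly p x"
      using p(2)[of g] Yfun_jouk[OF nz(1) g(1)] g s[of g] s[of "e / g"] nz(1) unfolding Yval_def by simp
  qed
qed

lemma Yfun_affine:
  assumes "finite B"
  shows "\<exists>c0 c1. \<forall>y. y \<notin> B \<longrightarrow> Yfun e t A x (insert y B) = c0 + c1 * y"
proof -
  define g where "g = (SOME g. g \<noteq> 0 \<and> jouk e g = x)"
  have "Yfun e t A x (insert y B) = (- (sfun e t A B g * jouk e (g / t)) + sfun e t A B (e / g) * jouk e (e / g / t)) / (e / g - g)
     + (sfun e t A B g - sfun e t A B (e / g)) / (e / g - g) * y" if "y \<notin> B" for y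
  proof -
    have ins: "sfun e t A (insert y B) h = sfun e t A B h * y - sfun e t A B h * jouk e (h / t)" for h
      unfolding sfun_def using assms that by (simp add: algebra_simps)
    show ?thesis unfolding Yfun_def g_def[symmetric] Yval_def ins
      unfolding add_divide_distrib[symmetric] times_divide_eq_left by (simp add: algebra_simps)
  qed
  thus ?thesis by blast
qed

text \<open>\<open>\<alpha>\<close> and \<open>\<beta>\<close> play the roles of \<open>b 3\<close>
  and \<open>b 4\<close>, zeros of \<open>A\<close>, and \<open>c\<close> collects the other factors
  of \<open>A (e / g)\<close>. The inequalities make the points
  \<open>jouk e (t ^ i * \<alpha>)\<close> and \<open>jouk e (t ^ j * \<beta>)\<close> distinct and
  nondegenerate and keep the telescoping denominators from vanishing.\<close>

locale chain_setup =
  fixes e t \<alpha> \<beta> :: complex and A c :: "complex \<Rightarrow> complex" and n :: nat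
  assumes nz: "e \<noteq> 0" "t \<noteq> 0" "\<alpha> \<noteq> 0" "\<beta> \<noteq> 0"
    and Afac: "\<And>g. g \<noteq> 0 \<Longrightarrow> A (e / g) = c g * (1 - e / (\<alpha> * g)) * (1 - e / (\<beta> * g))"
    and Azero: "A \<alpha> = 0" "A \<beta> = 0"
    and tk: "\<And>k. 1 \<le> k \<Longrightarrow> t ^ k \<noteq> 1"
    and ab: "\<And>i j. i \<le> n \<Longrightarrow> j \<le> n \<Longrightarrow> t ^ i * \<alpha> \<noteq> t ^ j * \<beta>"
    and aa: "\<And>k. k \<le> 2 * n \<Longrightarrow> e \<noteq> t ^ k * (\<alpha> * \<alpha>)"
    and bb: "\<And>k. k \<le> 2 * n \<Longrightarrow> e \<noteq> t ^ k * (\<beta> * \<beta>)"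
    and abk: "\<And>k. k + 2 \<le> 2 * n \<Longrightarrow> e \<noteq> t ^ k * (\<alpha> * \<beta>)"
begin

lemma swap: "chain_setup e t \<beta> \<alpha> A c n"
proof
  show "A (e / g) = c g * (1 - e / (\<beta> * g)) * (1 - e / (\<alpha> * g))" if "g \<noteq> 0" for g
    using Afac[OF that] by simp
  show "e \<noteq> t ^ k * (\<beta> * \<alpha>)" if "k + 2 \<le> 2 * n" for k using abk[OF that] by (simp add: mult.commute)
  show "t ^ i * \<beta> \<noteq> t ^ j * \<alpha>" if "i \<le> n" "j \<le> n" for i j using ab[OF that(2,1)] by simp
qed (use nz Azero tk aa bb in auto)

abbreviation "CA \<equiv> \<lambda>i. jouk e (t ^ i * \<alpha>)"
abbreviation "CB \<equiv> \<lambda>i. jouk e (t ^ i * \<beta>)"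

lemma t_inj: "t ^ i = t ^ j \<Longrightarrow> i = j"
proof (induction i j rule: linorder_wlog)
  case (le i j)
  hence "t ^ i * t ^ (j - i) = t ^ i" by (metis le_add_diff_inverse power_add)
  hence "t ^ (j - i) = 1" using nz by simp
  thus ?case using tk[of "j - i"] le by force
qed auto

lemma CA_inj: "i < n \<Longrightarrow> j < n \<Longrightarrow> CA i = CA j \<Longrightarrow> i = j"
proof (rule ccontr)
  assume ij: "i < n" "j < n" "CA i = CA j" "i \<noteq> j"
  have "t ^ i * \<alpha> \<noteq> t ^ j * \<alpha>" using t_inj[of i j] ij nz by auto
  moreover have "e \<noteq> t ^ i * \<alpha> * (t ^ j * \<alpha>)" using aa[of "i + j"] ij by (simp add: power_add mult_ac)
  ultimately show False using ij jouk_eq_iff[of "t ^ i * \<alpha>" "t ^ j * \<alpha>" e] nz by auto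
qed

lemma CA_CB: "i < n \<Longrightarrow> j < n \<Longrightarrow> CA i \<noteq> CB j"
proof
  assume ij: "i < n" "j < n" "CA i = CB j"
  have "t ^ i * \<alpha> \<noteq> t ^ j * \<beta>" using ab[of i j] ij by auto
  moreover have "e \<noteq> t ^ i * \<alpha> * (t ^ j * \<beta>)" using abk[of "i + j"] ij by (simp add: power_add mult_ac)
  ultimately show False using ij jouk_eq_iff[of "t ^ i * \<alpha>" "t ^ j * \<beta>" e] nz by auto
qed

lemma CB_inj: "i < n \<Longrightarrow> j < n \<Longrightarrow> CB i = CB j \<Longrightarrow> i = j"
  by (rule chain_setup.CA_inj[OF swap])

lemma chain_generic_CA_CB: "chain_generic CA CB n"
  unfolding chain_generic_def using CA_inj CB_inj CA_CB by (auto simp: inj_on_def)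

lemma CA_nondegenerate: "i < n \<Longrightarrow> CA i \<notin> degenerate e"
proof -
  assume "i < n"
  hence "e \<noteq> t ^ i * t ^ i * (\<alpha> * \<alpha>)" using aa[of "i + i"] by (simp add: power_add)
  hence "(t ^ i * \<alpha>)\<^sup>2 \<noteq> e" by (auto simp: power2_eq_square mult_ac)
  thus ?thesis using jouk_degenerate_iff[of "t ^ i * \<alpha>" e] nz by simp
qed

lemma CB_nondegenerate: "i < n \<Longrightarrow> CB i \<notin> degenerate e"
  by (rule chain_setup.CA_nondegenerate[OF swap])

text \<open>The coefficient of \<open>f\<close> in the term of the Lagrange sum at the last
  \<open>\<alpha>\<close>-point of a chain, after the products over the two progressions have
  telescoped.\<close>

definition term_coeff :: "nat \<Rightarrow> nat \<Rightarrow> complex" where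
  "term_coeff k r = c (t ^ k * \<alpha>) * ((1 - t ^ Suc k) / (1 - t)) * (1 - e / (t ^ (r + k) * (\<alpha> * \<beta>)))
     * (t ^ r * (\<beta> - t ^ Suc k * \<alpha>) / (t ^ r * \<beta> - t ^ Suc k * \<alpha>))"

text \<open>By \<open>jouk_diff\<close> every difference splits into a difference of arguments
  (\<open>\<psi>\<close>) and a reflected factor (\<open>\<phi>\<close>). Replacing \<open>g\<close>
  by \<open>t * g\<close> moves the index of each by one, in opposite directions, so both products
  telescope. \<open>prod_beta_chain\<close> works alike, with a factor \<open>t\<close> left over
  per point.\<close>

lemma prod_alpha_chain:
  assumes k: "k < n"
  defines "g \<equiv> t ^ k * \<alpha>"
  shows "(1 - e / (\<alpha> * g)) * (\<Prod>i<k. (CA i - jouk e (t * g)) / (CA i - jouk e g)) = (1 - e / (g * g)) * ((1 - t ^ Suc k) / (1 - t))"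
proof -
  have g: "g \<noteq> 0" unfolding g_def using nz by simp
  define \<phi> where "\<phi> = (\<lambda>i. 1 - e / (t ^ i * (\<alpha> * g)))"
  define \<psi> where "\<psi> = (\<lambda>i. 1 - t ^ (Suc k - i))"
  have \<phi>nz: "\<phi> i \<noteq> 0" if "i \<le> k" for i
    using aa[of "i + k"] that k nz g unfolding \<phi>_def g_def by (auto simp: power_add mult_ac field_simps)
  have \<psi>nz: "\<psi> i \<noteq> 0" if "i \<le> k" for i
    using tk[of "Suc k - i"] that unfolding \<psi>_def by auto
  have "(\<Prod>i<k. (CA i - jouk e (t * g)) / (CA i - jouk e g)) = (\<Prod>i<k. (\<psi> i / \<psi> (Suc i)) * (\<phi> (Suc i) / \<phi> i))"
  proof (rule prod.cong[OF refl])
    fix i assume "i \<in> {..<k}"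
    hence i: "i < k" by simp
    have 1: "CA i - jouk e (t * g) = (t ^ i * \<alpha> - t * g) * \<phi> (Suc i)"
      by (subst jouk_diff) (use nz g in \<open>auto simp: \<phi>_def mult_ac\<close>)
    have 2: "CA i - jouk e g = (t ^ i * \<alpha> - g) * \<phi> i"
      by (subst jouk_diff) (use nz g in \<open>auto simp: \<phi>_def mult_ac\<close>)
    have ti: "t ^ k = t ^ i * t ^ (k - i)" using i by (simp flip: power_add)
    have 3: "t ^ i * \<alpha> - t * g = t ^ i * \<alpha> * \<psi> i"
      unfolding g_def \<psi>_def ti using i by (simp add: Suc_diff_le algebra_simps)
    have 4: "t ^ i * \<alpha> - g = t ^ i * \<alpha> * \<psi> (Suc i)"
      unfolding g_def \<psi>_def ti by (simp add: algebra_simps)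
    show "(CA i - jouk e (t * g)) / (CA i - jouk e g) = (\<psi> i / \<psi> (Suc i)) * (\<phi> (Suc i) / \<phi> i)"
      unfolding 1 2 3 4 using nz by simp
  qed
  also have "\<dots> = (\<psi> 0 / \<psi> k) * (\<phi> k / \<phi> 0)"
    unfolding prod.distrib using prod_lessThan_telescope'[of k \<psi>] prod_lessThan_telescope[of k \<phi>] \<phi>nz \<psi>nz by simp
  finally have *: "(\<Prod>i<k. (CA i - jouk e (t * g)) / (CA i - jouk e g)) = (\<psi> 0 / \<psi> k) * (\<phi> k / \<phi> 0)" .
  have "\<phi> 0 = 1 - e / (\<alpha> * g)" "\<phi> k = 1 - e / (g * g)" "\<psi> 0 = 1 - t ^ Suc k" "\<psi> k = 1 - t"
    unfolding \<phi>_def \<psi>_def g_def by (simp_all add: mult_ac)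
  thus ?thesis unfolding * using \<phi>nz[of 0] by simp
qed

lemma prod_beta_chain:
  assumes k: "k + r < n"
  defines "g \<equiv> t ^ k * \<alpha>"
  shows "(1 - e / (\<beta> * g)) * (\<Prod>j<r. (CB j - jouk e (t * g)) / (CB j - jouk e g))
     = (1 - e / (t ^ (r + k) * (\<alpha> * \<beta>))) * (t ^ r * (\<beta> - t ^ Suc k * \<alpha>) / (t ^ r * \<beta> - t ^ Suc k * \<alpha>))"
proof -
  have g: "g \<noteq> 0" unfolding g_def using nz by simp
  define \<phi> where "\<phi> = (\<lambda>i. 1 - e / (t ^ i * (\<beta> * g)))"
  define \<psi> where "\<psi> = (\<lambda>j. t ^ j * \<beta> - t ^ Suc k * \<alpha>)"
  have \<phi>nz: "\<phi> i \<noteq> 0" if "i \<le> r" for i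
    using abk[of "i + k"] that k nz g unfolding \<phi>_def g_def by (auto simp: power_add mult_ac field_simps)
  have \<psi>nz: "\<psi> j \<noteq> 0" if "j \<le> r" for j
    using ab[of "Suc k" j] that k unfolding \<psi>_def by auto
  have "(\<Prod>j<r. (CB j - jouk e (t * g)) / (CB j - jouk e g)) = (\<Prod>j<r. t * (\<psi> j / \<psi> (Suc j)) * (\<phi> (Suc j) / \<phi> j))"
  proof (rule prod.cong[OF refl])
    fix j assume "j \<in> {..<r}"
    have 1: "CB j - jouk e (t * g) = (t ^ j * \<beta> - t * g) * \<phi> (Suc j)"
      by (subst jouk_diff) (use nz g in \<open>auto simp: \<phi>_def mult_ac\<close>)
    have 2: "CB j - jouk e g = (t ^ j * \<beta> - g) * \<phi> j"
      by (subst jouk_diff) (use nz g in \<open>auto simp: \<phi>_def mult_ac\<close>)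
    have 3: "t ^ j * \<beta> - t * g = \<psi> j" unfolding g_def \<psi>_def by simp
    have 4: "t ^ j * \<beta> - g = \<psi> (Suc j) / t" unfolding g_def \<psi>_def using nz by (simp add: field_simps)
    show "(CB j - jouk e (t * g)) / (CB j - jouk e g) = t * (\<psi> j / \<psi> (Suc j)) * (\<phi> (Suc j) / \<phi> j)"
      unfolding 1 2 3 4 using nz by simp
  qed
  also have "\<dots> = t ^ r * (\<psi> 0 / \<psi> r) * (\<phi> r / \<phi> 0)"
    unfolding prod.distrib using prod_lessThan_telescope'[of r \<psi>] prod_lessThan_telescope[of r \<phi>] \<phi>nz \<psi>nz by simp
  finally have *: "(\<Prod>j<r. (CB j - jouk e (t * g)) / (CB j - jouk e g)) = t ^ r * (\<psi> 0 / \<psi> r) * (\<phi> r / \<phi> 0)" .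
  have "\<phi> 0 = 1 - e / (\<beta> * g)" "\<phi> r = 1 - e / (t ^ (r + k) * (\<alpha> * \<beta>))"
      "\<psi> 0 = \<beta> - t ^ Suc k * \<alpha>" "\<psi> r = t ^ r * \<beta> - t ^ Suc k * \<alpha>"
    unfolding \<phi>_def \<psi>_def g_def by (simp_all add: mult_ac power_add)
  thus ?thesis unfolding * using \<phi>nz[of 0] by simp
qed

definition lag_term :: "(complex set \<Rightarrow> complex) \<Rightarrow> complex set \<Rightarrow> complex \<Rightarrow> complex" where
  "lag_term f X x = Yfun e t A x (X - {x}) * f (X - {x}) / (\<Prod>y\<in>X - {x}. y - x)"

lemma sfun_zero1: "finite B \<Longrightarrow> jouk e (g / t) \<in> B \<Longrightarrow> sfun e t A B g = 0"
  unfolding sfun_def by (auto intro!: prod_zero)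

lemma sfun_zero2: "finite B \<Longrightarrow> g \<noteq> 0 \<Longrightarrow> jouk e (t * g) \<in> B \<Longrightarrow> sfun e t A B (e / g) = 0"
  using sfun_zero1[of B "e / g"] jouk_inv[of "t * g" e] nz by (simp add: mult_ac)

text \<open>Each point of the progression is killed by its predecessor,
  \<open>jouk e (t ^ i * \<alpha> / t)\<close>, and the first one by the zero of \<open>A\<close> at
  \<open>\<alpha>\<close>.\<close>

lemma sfun_plus_zero:
  assumes "i < s" "s \<le> n"
  shows "sfun e t A (chain CA CB s r - {CA i}) (t ^ i * \<alpha>) = 0"
proof (cases i)
  case 0
  thus ?thesis using Azero by (simp add: sfun_def)
next
  case (Suc l)
  have "CA l \<in> chain CA CB s r - {CA i}"
    using assms Suc CA_inj[of l i] unfolding chain_def by auto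
  moreover have "CA l = jouk e (t ^ i * \<alpha> / t)" using Suc nz by simp
  ultimately show ?thesis by (intro sfun_zero1) auto
qed

text \<open>The backward end at a point is killed by its successor in the progression. Together with
  \<open>sfun_plus_zero\<close>, only the last point of a progression contributes.\<close>

lemma lag_term_zero:
  assumes "Suc i < s" "s \<le> n"
  shows "lag_term f (chain CA CB s r) (CA i) = 0"
proof -
  let ?B = "chain CA CB s r - {CA i}"
  have "CA (Suc i) \<in> CA ` {..<s}" using assms by blast
  moreover have "CA (Suc i) \<noteq> CA i" using assms CA_inj[of "Suc i" i] by auto
  ultimately have "CA (Suc i) \<in> ?B" unfolding chain_def by blast
  hence "sfun e t A ?B (e / (t ^ i * \<alpha>)) = 0"
    using nz by (intro sfun_zero2) (auto simp: mult_ac)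
  thus ?thesis
    using sfun_plus_zero[of i s r] assms nz Yfun_jouk[of e "t ^ i * \<alpha>" t A ?B]
    unfolding lag_term_def Yval_def by simp
qed

lemma lag_term_last:
  assumes kr: "Suc k + r = n"
  shows "lag_term f (chain CA CB (Suc k) r) (CA k) = term_coeff k r * f (chain CA CB k r)"
proof -
  let ?g = "t ^ k * \<alpha>"
  have g: "?g \<noteq> 0" using nz by simp
  have B: "chain CA CB (Suc k) r - {CA k} = chain CA CB k r"
  proof -
    have "CA i \<noteq> CA k" if "i < k" for i using CA_inj[of i k] that kr by auto
    moreover have "CB j \<noteq> CA k" if "j < r" for j using CA_CB[of k j] that kr by auto
    ultimately show ?thesis unfolding chain_def lessThan_Suc by fastforce
  qed
  have gg: "1 - e / (?g * ?g) \<noteq> 0" using aa[of "k + k"] kr g by (auto simp: power_add mult_ac field_simps)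
  have "Yfun e t A (CA k) (chain CA CB k r) = - sfun e t A (chain CA CB k r) (e / ?g) / (e / ?g - ?g)"
    using sfun_plus_zero[of k "Suc k" r] kr unfolding B Yfun_jouk[OF nz(1) g] Yval_def by simp
  also have "sfun e t A (chain CA CB k r) (e / ?g) = ?g * A (e / ?g) * (\<Prod>y\<in>chain CA CB k r. y - jouk e (t * ?g))"
    using jouk_inv[of "t * ?g" e] nz unfolding sfun_def by (simp add: mult_ac)
  also have "- (?g * A (e / ?g) * (\<Prod>y\<in>chain CA CB k r. y - jouk e (t * ?g))) / (e / ?g - ?g)
      = A (e / ?g) * (\<Prod>y\<in>chain CA CB k r. y - jouk e (t * ?g)) / (1 - e / (?g * ?g))"
  proof -
    have "- (h * u * v) / (e / h - h) = u * v / (1 - e / (h * h))" if "h \<noteq> 0" "1 - e / (h * h) \<noteq> 0" for h u v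
    proof -
      have "e / h - h = - h * (1 - e / (h * h))" using that by (simp add: field_simps)
      thus ?thesis using that(1) by simp
    qed
    thus ?thesis using g gg by blast
  qed
  finally have "lag_term f (chain CA CB (Suc k) r) (CA k)
     = A (e / ?g) / (1 - e / (?g * ?g)) * (\<Prod>y\<in>chain CA CB k r. (y - jouk e (t * ?g)) / (y - jouk e ?g)) * f (chain CA CB k r)"
    unfolding lag_term_def B by (simp add: prod_dividef)
  also have "(\<Prod>y\<in>chain CA CB k r. (y - jouk e (t * ?g)) / (y - jouk e ?g))
     = (\<Prod>i<k. (CA i - jouk e (t * ?g)) / (CA i - jouk e ?g)) * (\<Prod>j<r. (CB j - jouk e (t * ?g)) / (CB j - jouk e ?g))"
  proof -
    have "inj_on CA {..<k}" "inj_on CB {..<r}" "CA ` {..<k} \<inter> CB ` {..<r} = {}"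
      using kr CA_inj CB_inj CA_CB by (auto simp: inj_on_def)
    thus ?thesis unfolding chain_def by (subst prod.union_disjoint) (auto simp: prod.reindex)
  qed
  also have "A (e / ?g) / (1 - e / (?g * ?g)) * ((\<Prod>i<k. (CA i - jouk e (t * ?g)) / (CA i - jouk e ?g)) * (\<Prod>j<r. (CB j - jouk e (t * ?g)) / (CB j - jouk e ?g)))
     = c ?g / (1 - e / (?g * ?g)) * ((1 - e / (\<alpha> * ?g)) * (\<Prod>i<k. (CA i - jouk e (t * ?g)) / (CA i - jouk e ?g)))
        * ((1 - e / (\<beta> * ?g)) * (\<Prod>j<r. (CB j - jouk e (t * ?g)) / (CB j - jouk e ?g)))"
    unfolding Afac[OF g] by simp
  also have "\<dots> = term_coeff k r"
  proof -
    have "a / d * (d * x) * (y * z) = a * x * y * z" if "d \<noteq> 0" for a d x y z :: complex using that by simp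
    moreover have "k < n" "k + r < n" using kr by auto
    ultimately show ?thesis using gg unfolding term_coeff_def prod_alpha_chain[OF \<open>k < n\<close>] prod_beta_chain[OF \<open>k + r < n\<close>] by blast
  qed
  finally show ?thesis .
qed

lemma lag_side:
  assumes "s + r = n"
  shows "(\<Sum>x\<in>CA ` {..<s}. lag_term f (chain CA CB s r) x) = (case s of 0 \<Rightarrow> 0 | Suc k \<Rightarrow> term_coeff k r * f (chain CA CB k r))"
proof (cases s)
  case (Suc k)
  have "inj_on CA {..<s}" using assms CA_inj by (auto simp: inj_on_def)
  hence "(\<Sum>x\<in>CA ` {..<s}. lag_term f (chain CA CB s r) x) = (\<Sum>i<Suc k. lag_term f (chain CA CB s r) (CA i))"
    using Suc by (simp add: sum.reindex)
  also have "\<dots> = lag_term f (chain CA CB s r) (CA k)"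
    using lag_term_zero[of _ s f r] assms Suc by simp
  finally show ?thesis using lag_term_last[of k r f] assms Suc by simp
qed simp

lemma chain_swap: "chain CB CA r s = chain CA CB s r" by (auto simp: chain_def)

lemma lagrange_chain:
  assumes "s + r = n"
  shows "lagrange_sum (Yfun e t A) f (chain CA CB s r)
    = (case s of 0 \<Rightarrow> 0 | Suc k \<Rightarrow> term_coeff k r * f (chain CA CB k r))
    + (case r of 0 \<Rightarrow> 0 | Suc k \<Rightarrow> chain_setup.term_coeff e t \<beta> \<alpha> c k s * f (chain CA CB s k))"
proof -
  have "CA ` {..<s} \<inter> CB ` {..<r} = {}" using assms CA_CB by auto
  hence "lagrange_sum (Yfun e t A) f (chain CA CB s r) = (\<Sum>x\<in>CA ` {..<s}. lag_term f (chain CA CB s r) x) + (\<Sum>x\<in>CB ` {..<r}. lag_term f (chain CA CB s r) x)"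
    unfolding lagrange_sum_def lag_term_def by (subst chain_def, subst sum.union_disjoint) auto
  moreover have "(\<Sum>x\<in>CB ` {..<r}. lag_term f (chain CA CB s r) x)
      = (case r of 0 \<Rightarrow> 0 | Suc k \<Rightarrow> chain_setup.term_coeff e t \<beta> \<alpha> c k s * f (chain CA CB s k))"
    using chain_setup.lag_side[OF swap, of r s f] assms
    unfolding chain_swap by (simp add: add.commute)
  ultimately show ?thesis using lag_side[OF assms] by simp
qed

end

lemma prod_if_mem: "finite X \<Longrightarrow> a \<in> X \<Longrightarrow> (\<Prod>y\<in>X. y - a) = (0::complex)"
  by (rule prod_zero) auto

context chain_setup
begin

text \<open>The factor that the products of coefficients along the pure
  \<open>\<alpha>\<close>-chain and along the pure \<open>\<beta>\<close>-chain have in common; the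
  difference equation depends on its being the same for both.\<close>

definition two_term_const :: "nat \<Rightarrow> complex" where
  "two_term_const m = (\<Prod>k<n. (1 - t ^ Suc k) / (1 - t)) * (\<Prod>k<n. 1 - e / (t ^ m * (\<alpha> * \<beta>))) * (\<Prod>k<n. t ^ (m - k))
      / (\<Prod>i<n. 1 - e / (t ^ i * (\<alpha> * \<beta>)))
      * ((\<beta> - t ^ n * \<alpha>) / ((\<beta> - \<alpha>) * (\<Prod>k<n. t ^ (m - k) * \<beta> - t ^ Suc k * \<alpha>)))"

lemma prod_shift_factor:
  assumes "u \<noteq> v" "\<And>i. i \<le> n \<Longrightarrow> t ^ i * u \<noteq> v"
  shows "(\<Prod>k<n. t ^ Suc k * u - v) = (t ^ n * u - v) / (u - v) * (\<Prod>k<n. t ^ k * u - v)"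
proof -
  have "(\<Prod>k<n. (t ^ Suc k * u - v) / (t ^ k * u - v)) = (t ^ n * u - v) / (u - v)"
    using prod_lessThan_telescope[of n "\<lambda>k. t ^ k * u - v"] assms(2) by simp
  moreover have "(\<Prod>k<n. t ^ k * u - v) \<noteq> 0" using assms(2) by auto
  ultimately show ?thesis unfolding prod_dividef by (simp add: field_simps)
qed

lemma chain_nz:
  assumes n: "n = Suc m"
  shows "\<And>i. i < n \<Longrightarrow> 1 - e / (t ^ i * (\<alpha> * \<beta>)) \<noteq> 0"
    "\<And>k. k < n \<Longrightarrow> t ^ (m - k) * \<beta> - t ^ Suc k * \<alpha> \<noteq> 0" "\<beta> - t ^ n * \<alpha> \<noteq> 0" "\<beta> - \<alpha> \<noteq> 0" "1 - t \<noteq> 0"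
proof -
  show "1 - e / (t ^ i * (\<alpha> * \<beta>)) \<noteq> 0" if "i < n" for i
    using abk[of i] that n nz by (auto simp: field_simps)
  show "t ^ (m - k) * \<beta> - t ^ Suc k * \<alpha> \<noteq> 0" if "k < n" for k
  proof -
    have "Suc k \<le> n" "m - k \<le> n" using that n by linarith+
    thus ?thesis using ab[of "Suc k" "m - k"] by force
  qed
  show "\<beta> - t ^ n * \<alpha> \<noteq> 0" using ab[of n 0] by auto
  show "\<beta> - \<alpha> \<noteq> 0" using ab[of 0 0] by auto
  show "1 - t \<noteq> 0" using tk[of 1] by auto
qed

lemma two_term_const_nz:
  assumes n: "n = Suc m" shows "two_term_const m \<noteq> 0"
proof -
  note z = chain_nz[OF n]
  have "1 - t ^ Suc k \<noteq> 0" for k using tk[of "Suc k"] by auto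
  moreover have "1 - e / (t ^ m * (\<alpha> * \<beta>)) \<noteq> 0" using z(1)[of m] n by simp
  ultimately show ?thesis
    using z nz unfolding two_term_const_def
    by (auto simp: prod_zero_iff simp del: power_Suc)
qed

lemma prod_term_coeff_alpha:
  assumes n: "n = Suc m"
  shows "(\<Prod>k<n. - term_coeff k (m - k)) = two_term_const m * (\<Prod>i<n. c (t ^ i * \<alpha>)) * (\<Prod>i<n. CA i - CB 0)"
proof -
  note z = chain_nz[OF n]
  let ?E = "1 - e / (t ^ m * (\<alpha> * \<beta>))"
  have "(\<Prod>k<n. - term_coeff k (m - k)) = (\<Prod>k<n. c (t ^ k * \<alpha>) * ((1 - t ^ Suc k) / (1 - t)) * ?E * t ^ (m - k) * (t ^ Suc k * \<alpha> - \<beta>) / (t ^ (m - k) * \<beta> - t ^ Suc k * \<alpha>))"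
  proof (rule prod.cong[OF refl])
    fix k assume "k \<in> {..<n}"
    hence k: "m - k + k = m" using n by auto
    have "- (a * (b * (u - v) / w)) = a * b * (v - u) / w" for a b u v w :: complex by (simp add: divide_simps algebra_simps)
    thus "- term_coeff k (m - k) = c (t ^ k * \<alpha>) * ((1 - t ^ Suc k) / (1 - t)) * ?E * t ^ (m - k) * (t ^ Suc k * \<alpha> - \<beta>) / (t ^ (m - k) * \<beta> - t ^ Suc k * \<alpha>)"
      unfolding term_coeff_def k by blast
  qed
  also have "\<dots> = (\<Prod>k<n. c (t ^ k * \<alpha>)) * (\<Prod>k<n. (1 - t ^ Suc k) / (1 - t)) * (\<Prod>k<n. ?E) * (\<Prod>k<n. t ^ (m - k))
      * (\<Prod>k<n. t ^ Suc k * \<alpha> - \<beta>) / (\<Prod>k<n. t ^ (m - k) * \<beta> - t ^ Suc k * \<alpha>)"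
    by (simp only: prod.distrib prod_dividef)
  also have "(\<Prod>k<n. t ^ Suc k * \<alpha> - \<beta>) = (t ^ n * \<alpha> - \<beta>) / (\<alpha> - \<beta>) * (\<Prod>k<n. t ^ k * \<alpha> - \<beta>)"
    by (rule prod_shift_factor) (use ab[of _ 0] ab[of 0 0] in auto)
  also have "(t ^ n * \<alpha> - \<beta>) / (\<alpha> - \<beta>) = (\<beta> - t ^ n * \<alpha>) / (\<beta> - \<alpha>)"
    by (metis minus_diff_eq minus_divide_divide)
  finally have L: "(\<Prod>k<n. - term_coeff k (m - k)) = (\<Prod>k<n. c (t ^ k * \<alpha>)) * (\<Prod>k<n. (1 - t ^ Suc k) / (1 - t)) * (\<Prod>k<n. ?E) * (\<Prod>k<n. t ^ (m - k))
      * ((\<beta> - t ^ n * \<alpha>) / (\<beta> - \<alpha>) * (\<Prod>k<n. t ^ k * \<alpha> - \<beta>)) / (\<Prod>k<n. t ^ (m - k) * \<beta> - t ^ Suc k * \<alpha>)" .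
  have "(\<Prod>i<n. CA i - CB 0) = (\<Prod>i<n. (t ^ i * \<alpha> - \<beta>) * (1 - e / (t ^ i * (\<alpha> * \<beta>))))"
    by (rule prod.cong[OF refl], subst jouk_diff) (use nz in \<open>auto simp: mult_ac\<close>)
  also have "\<dots> = (\<Prod>i<n. t ^ i * \<alpha> - \<beta>) * (\<Prod>i<n. 1 - e / (t ^ i * (\<alpha> * \<beta>)))" by (rule prod.distrib)
  finally have R: "(\<Prod>i<n. CA i - CB 0) = (\<Prod>i<n. t ^ i * \<alpha> - \<beta>) * (\<Prod>i<n. 1 - e / (t ^ i * (\<alpha> * \<beta>)))" .
  have P: "(\<Prod>i<n. 1 - e / (t ^ i * (\<alpha> * \<beta>))) \<noteq> 0" using z(1) by (simp add: prod_zero_iff)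
  have gen: "C0 * T * E * S * (u / w * Q) / H = T * E * S / P * (u / (w * H)) * C0 * (Q * P)" if "P \<noteq> 0" for C0 T E S u w Q H P :: complex
    using that by simp
  show ?thesis unfolding L R two_term_const_def by (rule gen[OF P])
qed

lemma prod_term_coeff_beta:
  assumes n: "n = Suc m"
  shows "(\<Prod>k<n. chain_setup.term_coeff e t \<beta> \<alpha> c k (m - k)) = two_term_const m * (\<Prod>i<n. c (t ^ i * \<beta>)) * (\<Prod>i<n. CB i - CA 0)"
proof -
  note z = chain_nz[OF n]
  let ?E = "1 - e / (t ^ m * (\<alpha> * \<beta>))"
  \<comment> \<open>The denominators for \<open>\<beta>\<close> are
    \<open>h 0, ..., h (n - 1)\<close> in reverse order, those in \<open>two_term_const\<close> are
    \<open>h 1, ..., h n\<close>. The ratio of the two products telescopes to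
    \<open>h n / h 0\<close>, which reconciles the asymmetric form of the constant.\<close>
  define h where "h = (\<lambda>k. t ^ (n - k) * \<beta> - t ^ k * \<alpha>)"
  have hnz: "h k \<noteq> 0" if "k \<le> n" for k
    using ab[of k "n - k"] that unfolding h_def by auto
  have "(\<Prod>k<n. chain_setup.term_coeff e t \<beta> \<alpha> c k (m - k)) = (\<Prod>k<n. c (t ^ k * \<beta>) * ((1 - t ^ Suc k) / (1 - t)) * ?E * t ^ (m - k) * (t ^ Suc k * \<beta> - \<alpha>) / h (m - k))"
  proof (rule prod.cong[OF refl])
    fix k assume "k \<in> {..<n}"
    hence k: "m - k + k = m" "n - (m - k) = Suc k" using n by auto
    have "a * (b * (u - v) / (x - y)) = a * b * (v - u) / (y - x)" for a b u v x y :: complex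
      by (metis (no_types, opaque_lifting) minus_diff_eq minus_divide_divide minus_mult_right times_divide_eq_right mult.assoc)
    thus "chain_setup.term_coeff e t \<beta> \<alpha> c k (m - k) = c (t ^ k * \<beta>) * ((1 - t ^ Suc k) / (1 - t)) * ?E * t ^ (m - k) * (t ^ Suc k * \<beta> - \<alpha>) / h (m - k)"
      unfolding chain_setup.term_coeff_def[OF swap] h_def k mult.commute[of \<beta> \<alpha>] by blast
  qed
  also have "\<dots> = (\<Prod>k<n. c (t ^ k * \<beta>)) * (\<Prod>k<n. (1 - t ^ Suc k) / (1 - t)) * (\<Prod>k<n. ?E) * (\<Prod>k<n. t ^ (m - k))
      * (\<Prod>k<n. t ^ Suc k * \<beta> - \<alpha>) / (\<Prod>k<n. h (m - k))"
    by (simp only: prod.distrib prod_dividef)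
  also have "(\<Prod>k<n. t ^ Suc k * \<beta> - \<alpha>) = (t ^ n * \<beta> - \<alpha>) / (\<beta> - \<alpha>) * (\<Prod>k<n. t ^ k * \<beta> - \<alpha>)"
    by (rule prod_shift_factor) (use ab[of 0] ab[of 0 0] in \<open>auto dest: sym\<close>)
  also have "(\<Prod>k<n. h (m - k)) = (\<Prod>k<n. h k)"
    by (rule prod.reindex_bij_witness[of _ "\<lambda>k. m - k" "\<lambda>k. m - k"]) (use n in auto)
  finally have L: "(\<Prod>k<n. chain_setup.term_coeff e t \<beta> \<alpha> c k (m - k)) = (\<Prod>k<n. c (t ^ k * \<beta>)) * (\<Prod>k<n. (1 - t ^ Suc k) / (1 - t)) * (\<Prod>k<n. ?E) * (\<Prod>k<n. t ^ (m - k))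
      * ((t ^ n * \<beta> - \<alpha>) / (\<beta> - \<alpha>) * (\<Prod>k<n. t ^ k * \<beta> - \<alpha>)) / (\<Prod>k<n. h k)" .
  have "(\<Prod>i<n. CB i - CA 0) = (\<Prod>i<n. (t ^ i * \<beta> - \<alpha>) * (1 - e / (t ^ i * (\<alpha> * \<beta>))))"
    by (rule prod.cong[OF refl], subst jouk_diff) (use nz in \<open>auto simp: mult_ac\<close>)
  also have "\<dots> = (\<Prod>i<n. t ^ i * \<beta> - \<alpha>) * (\<Prod>i<n. 1 - e / (t ^ i * (\<alpha> * \<beta>)))" by (rule prod.distrib)
  finally have R: "(\<Prod>i<n. CB i - CA 0) = (\<Prod>i<n. t ^ i * \<beta> - \<alpha>) * (\<Prod>i<n. 1 - e / (t ^ i * (\<alpha> * \<beta>)))" .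
  have H1: "(\<Prod>k<n. t ^ (m - k) * \<beta> - t ^ Suc k * \<alpha>) = (\<Prod>k<n. h (Suc k))"
    unfolding h_def by (rule prod.cong) (use n in auto)
  have "(\<Prod>k<n. h (Suc k)) / (\<Prod>k<n. h k) = h n / h 0"
    unfolding prod_dividef[symmetric] by (rule prod_lessThan_telescope) (rule hnz)
  moreover have hk: "(\<Prod>k<n. h k) \<noteq> 0" using hnz by (simp add: prod_zero_iff)
  moreover have "h n = \<beta> - t ^ n * \<alpha>" "h 0 = t ^ n * \<beta> - \<alpha>" unfolding h_def by simp_all
  ultimately have H2: "(\<Prod>k<n. h (Suc k)) = (\<Prod>k<n. h k) * ((\<beta> - t ^ n * \<alpha>) / (t ^ n * \<beta> - \<alpha>))"
    by (simp add: field_simps)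
  have w: "t ^ n * \<beta> - \<alpha> \<noteq> 0" using ab[of 0 n] by auto
  have P: "(\<Prod>i<n. 1 - e / (t ^ i * (\<alpha> * \<beta>))) \<noteq> 0" using z(1) by (simp add: prod_zero_iff)
  have gen: "C0 * T * E * S * (u / w * Q) / H = T * E * S / P * (v / (w * (H * (v / u)))) * C0 * (Q * P)"
    if "P \<noteq> 0" "v \<noteq> 0" "u \<noteq> 0" for C0 T E S u w Q H P v :: complex
    using that by simp
  show ?thesis unfolding L R two_term_const_def H1 H2 by (rule gen[OF P z(3) w])
qed

text \<open>Both sides are affine in each point of \<open>X\<close>, so it suffices to compare them at the mixed chains. There a
  Lagrange sum has at most two nonzero terms, and \<open>\<kappa>\<close> is chosen so that they cancel unless the chain is
  entirely of one kind.\<close>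

lemma two_term:
  assumes n: "n = Suc m"
    and Y1: "\<And>B. finite B \<Longrightarrow> Suc (card B) = n \<Longrightarrow>
      \<exists>p. degree p \<le> n \<and> (\<forall>x. x \<notin> degenerate e \<longrightarrow> Yfun e t A x B = poly p x)"
  obtains \<kappa> where "\<And>X. finite X \<Longrightarrow> card X = n \<Longrightarrow> X \<inter> degenerate e = {} \<Longrightarrow>
      lagrange_sum (Yfun e t A) (interp_fun m \<kappa> CA) X
      = two_term_const m * ((\<Prod>i<n. c (t ^ i * \<beta>)) * (\<Prod>y\<in>X. y - CA 0) - (\<Prod>i<n. c (t ^ i * \<alpha>)) * (\<Prod>y\<in>X. y - CB 0))"
proof -
  define T where "T = (\<lambda>k. term_coeff k (m - k))"
  define W where "W = (\<lambda>k. chain_setup.term_coeff e t \<beta> \<alpha> c k (m - k))"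
  \<comment> \<open>This solves \<open>T k * v k + W (m - Suc k) * v (Suc k) = 0\<close> for
    \<open>k < m\<close>, the cancellation of the two surviving terms at a mixed chain.\<close>
  define v where "v = (\<lambda>s. (\<Prod>k<s. - T k) * (\<Prod>l<m - s. W l))"
  obtain \<kappa> where \<kappa>: "\<And>s r. s + r = m \<Longrightarrow> interp_fun m \<kappa> CA (chain CA CB s r) = v s"
    using interp_exists[of CA CB m v] chain_generic_CA_CB n by metis
  let ?f = "interp_fun m \<kappa> CA"
  define PA where "PA = (\<lambda>X. (\<Prod>i<n. c (t ^ i * \<beta>)) * (\<Prod>y\<in>X. y - CA 0))"
  define PB where "PB = (\<lambda>X. (\<Prod>i<n. c (t ^ i * \<alpha>)) * (\<Prod>y\<in>X. y - CB 0))"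
  define F where "F = (\<lambda>X. lagrange_sum (Yfun e t A) ?f X - two_term_const m * (PA X - PB X))"
  have aff: "set_affine n (degenerate e) (lagrange_sum (Yfun e t A) ?f)"
    by (rule lagrange_sum_affine) (use Y1 Yfun_affine interp_fun_affine in auto)
  have "set_affine n (degenerate e) F"
    unfolding set_affine_def
  proof (intro allI impI)
    fix B assume B: "finite B \<and> Suc (card B) = n \<and> B \<inter> degenerate e = {}"
    obtain c0 c1 where c: "\<And>x. x \<notin> B \<Longrightarrow> x \<notin> degenerate e \<Longrightarrow> lagrange_sum (Yfun e t A) ?f (insert x B) = c0 + c1 * x"
      using aff[unfolded set_affine_def, rule_format, OF B] by blast
    define u where "u = two_term_const m * ((\<Prod>i<n. c (t ^ i * \<beta>)) * (\<Prod>y\<in>B. y - CA 0))"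
    define w where "w = two_term_const m * ((\<Prod>i<n. c (t ^ i * \<alpha>)) * (\<Prod>y\<in>B. y - CB 0))"
    have "F (insert x B) = (c0 + u * CA 0 - w * CB 0) + (c1 - u + w) * x" if "x \<notin> B" "x \<notin> degenerate e" for x
      unfolding F_def c[OF that] PA_def PB_def u_def w_def using B that by (simp add: algebra_simps)
    thus "\<exists>c0 c1. \<forall>x. x \<notin> B \<longrightarrow> x \<notin> degenerate e \<longrightarrow> F (insert x B) = c0 + c1 * x" by blast
  qed
  moreover have "F (chain CA CB s r) = 0" if sr: "s + r = n" for s r
  proof (cases s)
    case 0
    hence r: "r = Suc m" using sr n by simp
    have "lagrange_sum (Yfun e t A) ?f (chain CA CB s r) = W m * v 0"
      using lagrange_chain[OF sr, of ?f] \<kappa>[of 0 m] unfolding 0 r W_def by simp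
    also have "\<dots> = (\<Prod>l<n. W l)" unfolding v_def n by (simp add: mult.commute)
    also have "\<dots> = two_term_const m * (\<Prod>i<n. c (t ^ i * \<beta>)) * (\<Prod>i<n. CB i - CA 0)"
      unfolding W_def by (rule prod_term_coeff_beta[OF n])
    also have "(\<Prod>i<n. CB i - CA 0) = (\<Prod>y\<in>chain CA CB s r. y - CA 0)"
    proof -
      have "inj_on CB {..<n}" using CB_inj by (auto simp: inj_on_def)
      thus ?thesis unfolding chain_def using 0 r n by (simp add: prod.reindex)
    qed
    moreover have "PB (chain CA CB s r) = 0"
      unfolding PB_def using 0 r by (subst prod_if_mem) (auto simp: chain_def intro!: image_eqI[of _ _ 0])
    ultimately show ?thesis unfolding F_def PA_def by simp
  next
    case (Suc k)
    show ?thesis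
    proof (cases r)
      case 0
      hence k: "k = m" using sr n Suc by simp
      have "lagrange_sum (Yfun e t A) ?f (chain CA CB s r) = T m * v m"
        using lagrange_chain[OF sr, of ?f] \<kappa>[of m 0] unfolding 0 Suc k T_def by simp
      also have "\<dots> = - (\<Prod>l<n. - T l)" unfolding v_def n by (simp add: mult.commute)
      also have "(\<Prod>l<n. - T l) = two_term_const m * (\<Prod>i<n. c (t ^ i * \<alpha>)) * (\<Prod>i<n. CA i - CB 0)"
        unfolding T_def by (rule prod_term_coeff_alpha[OF n])
      also have "(\<Prod>i<n. CA i - CB 0) = (\<Prod>y\<in>chain CA CB s r. y - CB 0)"
      proof -
        have "inj_on CA {..<n}" using CA_inj by (auto simp: inj_on_def)
        thus ?thesis unfolding chain_def using 0 Suc k n by (simp add: prod.reindex)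
      qed
      moreover have "PA (chain CA CB s r) = 0"
        unfolding PA_def using Suc by (subst prod_if_mem) (auto simp: chain_def intro!: image_eqI[of _ _ 0])
      ultimately show ?thesis unfolding F_def PB_def by simp
    next
      case (Suc l)
      have kl: "k + r = m" "s + l = m" "m - k = Suc (m - s)" "m - s = l" "r = m - k" "s = m - l" 
        using sr n Suc \<open>s = Suc k\<close> by auto
      have "lagrange_sum (Yfun e t A) ?f (chain CA CB s r) = T k * v k + W l * v s"
        using lagrange_chain[OF sr, of ?f] \<kappa>[OF kl(1)] \<kappa>[OF kl(2)] Suc \<open>s = Suc k\<close> kl unfolding T_def W_def
        by (metis (no_types, lifting) nat.case(2))
      also have "\<dots> = 0" unfolding v_def kl(3) prod.lessThan_Suc kl(4) \<open>s = Suc k\<close>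
          using kl(4) \<open>s = Suc k\<close> by simp
      finally have "lagrange_sum (Yfun e t A) ?f (chain CA CB s r) = 0" .
      moreover have "PA (chain CA CB s r) = 0"
        unfolding PA_def using \<open>s = Suc k\<close> by (subst prod_if_mem) (auto simp: chain_def intro!: image_eqI[of _ _ 0])
      moreover have "PB (chain CA CB s r) = 0"
        unfolding PB_def using Suc by (subst prod_if_mem) (auto simp: chain_def intro!: image_eqI[of _ _ 0])
      ultimately show ?thesis unfolding F_def by simp
    qed
  qed
  ultimately have "F X = 0" if "finite X" "card X = n" "X \<inter> degenerate e = {}" for X
    using that CA_nondegenerate CB_nondegenerate
    by (intro set_affine_unique[OF _ chain_generic_CA_CB, of "degenerate e" F X]) auto
  thus ?thesis using that[of \<kappa>] unfolding F_def PA_def PB_def by simp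
qed

end

section \<open>The weight function\<close>

locale qtbase = qbase q for q +
  fixes t :: complex
  assumes t_nz: "t \<noteq> 0" and t_lt: "norm t < 1"
begin

text \<open>The factors with \<open>a\<^sub>3\<close> are already absorbed into \<open>b 4\<close>.
  \<open>c\<close> is a parameter of its own because weights in fewer variables occur together with
  the \<open>c\<close> of the full set.\<close>

definition sing :: "complex \<Rightarrow> complex \<Rightarrow> complex \<Rightarrow> complex \<Rightarrow> (nat \<Rightarrow> complex) \<Rightarrow> complex \<Rightarrow> complex \<Rightarrow> complex" where
  "sing e c a1 a2 b v w = (1 - e * w\<^sup>2) * (th (v * w) * th (c * v / w))
     / (qp (a1 * e * w) * qp (a1 / w) * (qp (a2 * e * w) * qp (a2 / w)))
     * (\<Prod>k=1..4. qp (q * e * w / b k) / qp (b k * w))"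

definition cross :: "complex \<Rightarrow> complex \<Rightarrow> complex \<Rightarrow> complex" where
  "cross e x y = (1 - e * x * y) * (qp (x / y) * qp (y / x)) / (qp (t * x / y) * qp (t * y / x))
     * (qp (q * e * x * y / t) / qp (t * e * x * y))"

definition wgt :: "nat set \<Rightarrow> complex \<Rightarrow> complex \<Rightarrow> complex \<Rightarrow> complex \<Rightarrow> (nat \<Rightarrow> complex) \<Rightarrow> complex \<Rightarrow> (nat \<Rightarrow> complex) \<Rightarrow> complex" where
  "wgt I e c a1 a2 b v z = (\<Prod>i\<in>I. sing e c a1 a2 b v (z i)) * (\<Prod>(j, k)\<in>pairs I. cross e (z j) (z k))"

definition wgt_integral :: "nat set \<Rightarrow> complex \<Rightarrow> complex \<Rightarrow> complex \<Rightarrow> (nat \<Rightarrow> complex) \<Rightarrow> complex \<Rightarrow> complex" where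
  "wgt_integral I e a1 a2 b v = TI I (wgt I e (t ^ (card I - 1) * a1 * a2) a1 a2 b v)"

definition admissible :: "complex \<Rightarrow> complex \<Rightarrow> complex \<Rightarrow> (nat \<Rightarrow> complex) \<Rightarrow> bool" where
  "admissible e a1 a2 b \<longleftrightarrow> e \<noteq> 0 \<and> norm e < 1 \<and> a1 \<noteq> 0 \<and> norm a1 < 1 \<and> a2 \<noteq> 0 \<and> norm a2 < 1 \<and>
     (\<forall>k\<in>{1..4}. b k \<noteq> 0 \<and> norm (b k) < 1)"

text \<open>\<open>splus\<close> and \<open>sminus\<close> are rational multiples of
  \<open>sing\<close> (\<open>splus_eq\<close>, \<open>sminus_eq\<close>), arranged so that the
  first turns into the second under \<open>w \<mapsto> q * w\<close>; \<open>cplus\<close> and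
  \<open>cminus\<close> do the same for \<open>cross\<close>. The prefactors \<open>w\<close> and
  \<open>c / w\<close> compensate the quasi-periodicity of the theta factors.\<close>

definition splus :: "complex \<Rightarrow> complex \<Rightarrow> complex \<Rightarrow> complex \<Rightarrow> (nat \<Rightarrow> complex) \<Rightarrow> complex \<Rightarrow> complex \<Rightarrow> complex" where
  "splus e c a1 a2 b v w = w * (th (v * w) * th (c * v / w))
     / (qp (a1 * e * w) * qp (q * a1 / w) * (qp (a2 * e * w) * qp (q * a2 / w)))
     * (\<Prod>k=1..4. qp (e * w / b k) / qp (b k * w))"

definition sminus :: "complex \<Rightarrow> complex \<Rightarrow> complex \<Rightarrow> complex \<Rightarrow> (nat \<Rightarrow> complex) \<Rightarrow> complex \<Rightarrow> complex \<Rightarrow> complex" where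
  "sminus e c a1 a2 b v w = c / w * (th (v * w) * th (c * v / w))
     / (qp (q * a1 * e * w) * qp (a1 / w) * (qp (q * a2 * e * w) * qp (a2 / w)))
     * (\<Prod>k=1..4. qp (q * e * w / b k) / qp (q * b k * w))"

definition cplus :: "complex \<Rightarrow> complex \<Rightarrow> complex \<Rightarrow> complex" where
  "cplus e w y = (qp (w / y) * qp (q * y / w)) / (qp (t * w / y) * qp (q * t * y / w))
     * (qp (e * w * y / t) / qp (t * e * w * y))"

definition cminus :: "complex \<Rightarrow> complex \<Rightarrow> complex \<Rightarrow> complex" where
  "cminus e w y = (qp (q * w / y) * qp (y / w)) / (qp (q * t * w / y) * qp (t * y / w))
     * (qp (q * e * w * y / t) / qp (q * t * e * w * y))"

text \<open>The theta factors contribute \<open>- 1 / (v * w)\<close> and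
  \<open>- c * v / (q * w)\<close>. Their product is free of \<open>v\<close>, and with the
  prefactor \<open>q * w\<close> it becomes \<open>c / w\<close>.\<close>

lemma splus_shift:
  assumes "w \<noteq> 0" "v \<noteq> 0" "c \<noteq> 0"
  shows "splus e c a1 a2 b v (q * w) = sminus e c a1 a2 b v w"
proof -
  have 1: "th (v * (q * w)) = - th (v * w) / (v * w)"
    using th_shift[of "v * w"] assms by (simp add: mult_ac)
  have "th (c * v / w) = - th (c * v / (q * w)) / (c * v / (q * w))"
    using th_shift[of "c * v / (q * w)"] assms q_nz by simp
  hence 2: "th (c * v / (q * w)) = - (c * v / (q * w)) * th (c * v / w)"
    using assms q_nz by (simp add: field_simps)
  have 3: "q * w * (th (v * (q * w)) * th (c * v / (q * w))) = c / w * (th (v * w) * th (c * v / w))"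
    unfolding 1 2 using assms q_nz by (simp add: field_simps)
  have 4: "q * a / (q * w) = a / w" for a using q_nz by simp
  show ?thesis unfolding splus_def sminus_def 3 4
    by (simp add: mult_ac)
qed

lemma cplus_shift: "y \<noteq> 0 \<Longrightarrow> cplus e (q * w) y = cminus e w y"
proof -
  have "q * x / (q * w) = x / w" for x using q_nz by simp
  from this[of y] this[of "t * y"] show ?thesis
    unfolding cplus_def cminus_def by (simp add: mult_ac)
qed

lemma splus_eq:
  assumes "1 - e * w\<^sup>2 \<noteq> 0" "qp (a1 / w) \<noteq> 0" "qp (a2 / w) \<noteq> 0"
  shows "splus e c a1 a2 b v w = sing e c a1 a2 b v w * w * ((1 - a1 / w) * (1 - a2 / w) * (\<Prod>k=1..4. 1 - e * w / b k)) / (1 - e * w\<^sup>2)"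
proof -
  have r: "qp (a / w) = (1 - a / w) * qp (q * a / w)" for a using qp_rec[of "a / w"] by simp
  have r2: "(\<Prod>k=1..4. qp (e * w / b k) / qp (b k * w)) = (\<Prod>k=1..4. 1 - e * w / b k) * (\<Prod>k=1..4. qp (q * e * w / b k) / qp (b k * w))"
    unfolding prod.distrib[symmetric]
    by (rule prod.cong[OF refl], subst qp_rec) (simp add: mult.assoc)
  have nz: "1 - a1 / w \<noteq> 0" "1 - a2 / w \<noteq> 0" using assms(2,3) unfolding r[of a1] r[of a2] by auto
  have gen: "w * T / (d1 * x1 * (d2 * x2)) * (P * Q) = s * T / (d1 * (n1 * x1) * (d2 * (n2 * x2))) * Q * w * (n1 * n2 * P) / s"
    if "s \<noteq> 0" "n1 \<noteq> 0" "n2 \<noteq> 0" for T d1 x1 d2 x2 P Q s n1 n2 :: complex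
    using that by (simp add: mult_ac)
  show ?thesis unfolding splus_def sing_def r2 r[of a1] r[of a2] by (rule gen[OF assms(1) nz])
qed

lemma sminus_eq:
  assumes "1 - e * w\<^sup>2 \<noteq> 0" "qp (a1 * e * w) \<noteq> 0" "qp (a2 * e * w) \<noteq> 0" "\<And>k. k \<in> {1..4} \<Longrightarrow> qp (b k * w) \<noteq> 0"
  shows "sminus e c a1 a2 b v w = sing e c a1 a2 b v w * (c / w) * ((1 - a1 * e * w) * (1 - a2 * e * w) * (\<Prod>k=1..4. 1 - b k * w)) / (1 - e * w\<^sup>2)"
proof -
  have r: "qp (a * e * w) = (1 - a * e * w) * qp (q * a * e * w)" for a using qp_rec[of "a * e * w"] by (simp add: mult_ac)
  have r2: "(\<Prod>k=1..4. qp (q * e * w / b k) / qp (q * b k * w)) = (\<Prod>k=1..4. 1 - b k * w) * (\<Prod>k=1..4. qp (q * e * w / b k) / qp (b k * w))"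
    unfolding prod.distrib[symmetric]
  proof (rule prod.cong[OF refl])
    fix k :: nat assume k: "k \<in> {1..4}"
    have "qp (b k * w) = (1 - b k * w) * qp (q * b k * w)" using qp_rec[of "b k * w"] by (simp add: mult_ac)
    thus "qp (q * e * w / b k) / qp (q * b k * w) = (1 - b k * w) * (qp (q * e * w / b k) / qp (b k * w))"
      using assms(4)[OF k] by simp
  qed
  have nz: "1 - a1 * e * w \<noteq> 0" "1 - a2 * e * w \<noteq> 0" using assms(2,3) unfolding r[of a1] r[of a2] by auto
  have gen: "c / w * T / (x1 * d1 * (x2 * d2)) * (P * Q) = s * T / (n1 * x1 * d1 * (n2 * x2 * d2)) * Q * (c / w) * (n1 * n2 * P) / s"
    if "s \<noteq> 0" "n1 \<noteq> 0" "n2 \<noteq> 0" for T d1 x1 d2 x2 P Q s n1 n2 :: complex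
    using that by (simp add: mult_ac)
  show ?thesis unfolding sminus_def sing_def r2 r[of a1] r[of a2] by (rule gen[OF assms(1) nz])
qed

lemma cplus_eq:
  assumes "w \<noteq> 0" "y \<noteq> 0" "w \<noteq> y" "1 - e * w * y \<noteq> 0" "qp (t * y / w) \<noteq> 0"
  shows "cplus e w y = cross e w y * ((1 - t * y / w) * (1 - e * w * y / t) / ((1 - y / w) * (1 - e * w * y)))"
proof -
  have 1: "qp (y / w) = (1 - y / w) * qp (q * y / w)" using qp_rec[of "y / w"] by simp
  have 2: "qp (t * y / w) = (1 - t * y / w) * qp (q * t * y / w)" using qp_rec[of "t * y / w"] by (simp add: mult_ac)
  have 3: "qp (e * w * y / t) = (1 - e * w * y / t) * qp (q * e * w * y / t)" using qp_rec[of "e * w * y / t"] by (simp add: mult_ac)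
  have nz: "1 - y / w \<noteq> 0" "1 - t * y / w \<noteq> 0" using assms unfolding 2 by auto
  have gen: "(A * X) / (B * Y) * (n3 * E / D) = (s * (A * (n1 * X))) / (B * (n2 * Y)) * (E / D) * (n2 * n3 / (n1 * s))"
    if "s \<noteq> 0" "n1 \<noteq> 0" "n2 \<noteq> 0" for A X B Y n3 E D s n1 n2 :: complex
    using that by (simp add: mult_ac)
  show ?thesis unfolding cplus_def cross_def 1 2 3 by (rule gen[OF assms(4) nz])
qed

lemma cminus_eq:
  assumes "w \<noteq> 0" "y \<noteq> 0" "w \<noteq> y" "1 - e * w * y \<noteq> 0" "qp (t * w / y) \<noteq> 0" "qp (t * e * w * y) \<noteq> 0"
  shows "cminus e w y = cross e w y * ((1 - t * w / y) * (1 - t * e * w * y) / ((1 - w / y) * (1 - e * w * y)))"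
proof -
  have 1: "qp (w / y) = (1 - w / y) * qp (q * w / y)" using qp_rec[of "w / y"] by simp
  have 2: "qp (t * w / y) = (1 - t * w / y) * qp (q * t * w / y)" using qp_rec[of "t * w / y"] by (simp add: mult_ac)
  have 3: "qp (t * e * w * y) = (1 - t * e * w * y) * qp (q * t * e * w * y)" using qp_rec[of "t * e * w * y"] by (simp add: mult_ac)
  have nz: "1 - w / y \<noteq> 0" "1 - t * w / y \<noteq> 0" "1 - t * e * w * y \<noteq> 0" using assms unfolding 2 3 by auto
  have gen: "(X * A) / (Y * B) * (E / D) = (s * (n1 * X * A)) / (n2 * Y * B) * (E / (n3 * D)) * (n2 * n3 / (n1 * s))"
    if "s \<noteq> 0" "n1 \<noteq> 0" "n2 \<noteq> 0" "n3 \<noteq> 0" for A X B Y n3 E D s n1 n2 :: complex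
    using that by (simp add: mult_ac)
  show ?thesis unfolding cminus_def cross_def 1 2 3 by (rule gen[OF assms(4) nz])
qed

lemma cross_sym: "cross e x y = cross e y x"
  unfolding cross_def by (simp add: mult_ac)

lemma qp_1 [simp]: "qp 1 = 0" using qp_rec[of 1] by simp

lemma cross_same: "x \<noteq> 0 \<Longrightarrow> cross e x x = 0" "x \<noteq> 0 \<Longrightarrow> cplus e x x = 0" "x \<noteq> 0 \<Longrightarrow> cminus e x x = 0"
  unfolding cross_def cplus_def cminus_def by simp_all

end

lemma norm_mult_less_one: "norm (a::complex) < 1 \<Longrightarrow> norm b \<le> 1 \<Longrightarrow> norm (a * b) < 1"
  unfolding norm_mult by (metis mult.right_neutral mult_left_mono norm_ge_zero order_le_less_trans)

context qtbase
begin

lemma circle_nz: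
  assumes admissible: "admissible e a1 a2 b" and w: "norm w = 1" and y: "norm y = 1"
  shows "w \<noteq> 0" "qp (a1 * e * w) \<noteq> 0" "qp (a1 / w) \<noteq> 0" "qp (a2 * e * w) \<noteq> 0" "qp (a2 / w) \<noteq> 0"
    "\<And>k. k \<in> {1..4} \<Longrightarrow> qp (b k * w) \<noteq> 0" "1 - e * w\<^sup>2 \<noteq> 0" "1 - e * w * y \<noteq> 0"
    "qp (t * w / y) \<noteq> 0" "qp (t * e * w * y) \<noteq> 0"
proof -
  note a = admissible[unfolded admissible_def]
  show "w \<noteq> 0" using w by auto
  have ae: "norm (a1 * e) < 1" "norm (a2 * e) < 1" "norm (t * e) < 1"
    using a t_lt by (auto intro!: norm_mult_less_one)
  show "qp (a1 * e * w) \<noteq> 0" "qp (a2 * e * w) \<noteq> 0" "qp (a1 / w) \<noteq> 0" "qp (a2 / w) \<noteq> 0" "qp (t * w / y) \<noteq> 0" "qp (t * e * w * y) \<noteq> 0"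
    using ae a t_lt w y by (auto intro!: qp_nonzero simp: norm_mult norm_divide)
  show "qp (b k * w) \<noteq> 0" if "k \<in> {1..4}" for k
    using a w that by (auto intro!: qp_nonzero simp: norm_mult)
  have "norm (e * w\<^sup>2) < 1" "norm (e * w * y) < 1" using a w y by (auto simp: norm_mult norm_power)
  thus "1 - e * w\<^sup>2 \<noteq> 0" "1 - e * w * y \<noteq> 0" by auto
qed

lemma wgt_remove:
  assumes "finite I" "i \<in> I"
  shows "wgt I e c a1 a2 b v z = sing e c a1 a2 b v (z i) * (\<Prod>j\<in>I - {i}. cross e (z i) (z j)) * wgt (I - {i}) e c a1 a2 b v z"
  unfolding wgt_def prod_pairs_remove[where f = "\<lambda>j k. cross e (z j) (z k)", OF assms cross_sym] prod.remove[OF assms] by simp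

lemma wgt_not_inj:
  assumes "finite I" "j \<in> I" "k \<in> I" "j \<noteq> k" "z j = z k" "z k \<noteq> 0"
  shows "wgt I e c a1 a2 b v z = 0"
proof -
  have "(\<Prod>l\<in>I - {j}. cross e (z j) (z l)) = 0"
    using assms cross_same(1)[of "z k"] by (intro prod_zero bexI[of _ k]) auto
  thus ?thesis unfolding wgt_remove[OF assms(1,2)] by simp
qed

lemma wgt_upd: "i \<notin> I \<Longrightarrow> wgt I e c a1 a2 b v (z(i := w)) = wgt I e c a1 a2 b v z"
  unfolding wgt_def by (intro arg_cong2[where f = "(*)"] prod.cong) (auto simp: pairs_def)

text \<open>One factor leaves the denominator and one joins the numerator, and together they are
  linear in the coordinate \<open>jouk e (e * w)\<close>. Hence the products of
  \<open>y - CA 0\<close> and \<open>y - CB 0\<close> in \<open>two_term\<close> stand for the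
  weights with \<open>b 3\<close> or \<open>b 4\<close> multiplied by \<open>q\<close>.\<close>

lemma sing_shift:
  assumes "w \<noteq> 0" "e \<noteq> 0" "l \<in> {1..4}" "b l \<noteq> 0" "qp (b l * w) \<noteq> 0"
  shows "sing e c a1 a2 (b(l := q * b l)) v w = sing e c a1 a2 b v w * (w * (jouk e (e * w) - jouk e (b l)))"
proof -
  have "qp (q * e * w / (q * b l)) = (1 - e * w / b l) * qp (q * e * w / b l)"
    using qp_rec[of "e * w / b l"] q_nz by (simp add: mult_ac)
  moreover have "qp (b l * w) = (1 - b l * w) * qp (q * b l * w)" using qp_rec[of "b l * w"] by (simp add: mult_ac)
  ultimately have r: "qp (q * e * w / (q * b l)) / qp (q * b l * w) = qp (q * e * w / b l) / qp (b l * w) * ((1 - e * w / b l) * (1 - b l * w))"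
    using assms(5) by simp
  have e: "(1 - e * w / b l) * (1 - b l * w) = w * (jouk e (e * w) - jouk e (b l))"
    using assms unfolding jouk_def by (simp add: field_simps)
  have rem: "(\<Prod>k=1..4. f k) = f l * (\<Prod>k\<in>{1..4} - {l}. f k)" for f :: "nat \<Rightarrow> complex"
    using assms(3) by (intro prod.remove) auto
  have P1: "(\<Prod>k\<in>{1..4} - {l}. qp (q * e * w / (b(l := q * b l)) k) / qp ((b(l := q * b l)) k * w))
    = (\<Prod>k\<in>{1..4} - {l}. qp (q * e * w / b k) / qp (b k * w))" by (rule prod.cong) auto
  have "(\<Prod>k=1..4. qp (q * e * w / (b(l := q * b l)) k) / qp ((b(l := q * b l)) k * w))
    = (\<Prod>k=1..4. qp (q * e * w / b k) / qp (b k * w)) * (w * (jouk e (e * w) - jouk e (b l)))"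
    unfolding rem[of "\<lambda>k. qp (q * e * w / (b(l := q * b l)) k) / qp ((b(l := q * b l)) k * w)"]
      rem[of "\<lambda>k. qp (q * e * w / b k) / qp (b k * w)"] e[symmetric] P1 fun_upd_same r
    by (simp only: mult_ac)
  thus ?thesis unfolding sing_def by simp
qed

lemma wgt_cont:
  fixes z :: "'s :: topological_space \<Rightarrow> nat \<Rightarrow> complex"
  assumes "continuous_on S e" "continuous_on S c" "continuous_on S a1" "continuous_on S a2" "continuous_on S v"
    and "\<And>k. k \<in> {1..4} \<Longrightarrow> continuous_on S (\<lambda>s. b s k)" "\<And>i. continuous_on S (\<lambda>s. z s i)"
    and admissible: "\<And>s. s \<in> S \<Longrightarrow> admissible (e s) (a1 s) (a2 s) (b s)" and cv: "\<And>s. s \<in> S \<Longrightarrow> c s \<noteq> 0" "\<And>s. s \<in> S \<Longrightarrow> v s \<noteq> 0"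
    and z: "\<And>s. s \<in> S \<Longrightarrow> z s \<in> Tor"
  shows "continuous_on S (\<lambda>s. wgt I (e s) (c s) (a1 s) (a2 s) (b s) (v s) (z s))"
proof -
  have nz: "s \<in> S \<Longrightarrow> z s i \<noteq> 0" for s i using z Tor_nz by blast
  note circ = circle_nz[OF admissible Tor_norm[OF z] Tor_norm[OF z]]
  have bnz: "s \<in> S \<Longrightarrow> k \<in> {1..4} \<Longrightarrow> b s k \<noteq> 0" for s k using admissible[unfolded admissible_def] by blast
  have s: "continuous_on S (\<lambda>s. sing (e s) (c s) (a1 s) (a2 s) (b s) (v s) (z s i))" for i
    unfolding sing_def by (intro continuous_intros assms ballI no_zero_divisors) (use circ bnz cv nz in auto)
  have x: "continuous_on S (\<lambda>s. cross (e s) (z s j) (z s k))" for j k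
    unfolding cross_def by (intro continuous_intros assms ballI no_zero_divisors) (use circ t_nz nz in auto)
  show ?thesis unfolding wgt_def split_beta by (intro continuous_intros s x)
qed

lemma wgt_cont_Tor:
  assumes "admissible e a1 a2 b" "c \<noteq> 0" "v \<noteq> 0"
  shows "continuous_on Tor (wgt I e c a1 a2 b v)"
  by (rule wgt_cont) (use assms in \<open>auto intro!: continuous_intros\<close>)

lemma admissible_bound:
  assumes "admissible e a1 a2 b"
  obtains m where "0 < m" "m < 1" "norm a1 \<le> m" "norm a2 \<le> m" "norm t \<le> m" "\<And>k. k \<in> {1..4} \<Longrightarrow> norm (b k) \<le> m"
proof -
  define M where "M = insert (norm a1) (insert (norm a2) (insert (norm t) ((\<lambda>k. norm (b k)) ` {1..4})))"
  have fin: "finite M" "M \<noteq> {}" unfolding M_def by auto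
  have lt: "\<And>x. x \<in> M \<Longrightarrow> x < 1" using assms t_lt unfolding M_def admissible_def by auto
  show ?thesis
  proof (rule that[of "Max M"])
    show "Max M < 1" using fin lt by simp
    have "0 < norm t" using t_nz by simp
    also have "norm t \<le> Max M" using fin by (intro Max_ge) (auto simp: M_def)
    finally show "0 < Max M" .
    have "norm a1 \<in> M" "norm a2 \<in> M" "norm t \<in> M" "\<And>k. k \<in> {1..4} \<Longrightarrow> norm (b k) \<in> M" unfolding M_def by auto
    thus "norm a1 \<le> Max M" "norm a2 \<le> Max M" "norm t \<le> Max M" "\<And>k. k \<in> {1..4} \<Longrightarrow> norm (b k) \<le> Max M"
      using Max_ge[OF fin(1)] by blast+
  qed
qed

text \<open>No pole is crossed: passing from the weight to \<open>splus\<close> and \<open>cplus\<close> moves the poles nearest to the unit circle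
  outside the annulus between \<open>1\<close> and \<open>norm q\<close>.\<close>

lemma shift_term:
  assumes admissible: "admissible e a1 a2 b" and cv: "c \<noteq> 0" "v \<noteq> 0" and I: "finite I" "i \<in> I"
    and R: "continuous_on Tor R" "\<And>z w. R (z(i := w)) = R z"
  shows "TI I (\<lambda>z. splus e c a1 a2 b v (z i) * (\<Prod>j\<in>I - {i}. cplus e (z i) (z j)) * R z)
       = TI I (\<lambda>z. sminus e c a1 a2 b v (z i) * (\<Prod>j\<in>I - {i}. cminus e (z i) (z j)) * R z)"
    and "continuous_on Tor (\<lambda>z. splus e c a1 a2 b v (z i) * (\<Prod>j\<in>I - {i}. cplus e (z i) (z j)) * R z)"
    and "continuous_on Tor (\<lambda>z. sminus e c a1 a2 b v (z i) * (\<Prod>j\<in>I - {i}. cminus e (z i) (z j)) * R z)"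
proof -
  obtain m where m: "0 < m" "m < 1" "norm a1 \<le> m" "norm a2 \<le> m" "norm t \<le> m" "\<And>k. k \<in> {1..4} \<Longrightarrow> norm (b k) \<le> m"
    using admissible_bound[OF admissible] by blast
  have e: "e \<noteq> 0" "norm e < 1" and bnz: "\<And>k. k \<in> {1..4} \<Longrightarrow> b k \<noteq> 0" using admissible unfolding admissible_def by auto
  define S :: "complex set" where "S = {w. norm q * m < norm w \<and> norm w * m < 1}"
  have "open S" unfolding S_def by (intro open_Collect_conj open_Collect_less continuous_intros)
  have sub: "{w. norm q \<le> norm w \<and> norm w \<le> 1} \<subseteq> S"
  proof
    fix w :: complex assume w: "w \<in> {w. norm q \<le> norm w \<and> norm w \<le> 1}"
    have "norm q * m < norm q * 1" using m q_nz by (intro mult_strict_left_mono) auto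
    moreover have "norm w * m \<le> 1 * m" using w m by (intro mult_right_mono) auto
    hence "norm w * m < 1" using m(2) by linarith
    ultimately show "w \<in> S" using w unfolding S_def by auto
  qed
  have Snz: "w \<noteq> 0" if "w \<in> S" for w
    using that m unfolding S_def by (auto simp: mult_less_0_iff not_less)
  have lo: "norm (x * w) < 1" if "w \<in> S" "norm x \<le> m" for x w
    using that mult_right_mono[of "norm x" m "norm w"] unfolding S_def norm_mult by (auto simp: mult.commute)
  have hi: "norm (q * x / w) < 1" if "w \<in> S" "norm x \<le> m" for x w
    using that Snz[OF that(1)] mult_left_mono[of "norm x" m "norm q"] unfolding S_def
    by (auto simp: norm_mult norm_divide divide_less_eq)
  have me: "norm (x * e) \<le> m" if "norm x \<le> m" for x
    using mult_mono[of "norm x" m "norm e" 1] that e m by (auto simp: norm_mult)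
  have nz1: "qp (x * w) \<noteq> 0" "qp (q * x / w) \<noteq> 0" if "w \<in> S" "norm x \<le> m" for x w
    by (intro qp_nonzero lo hi that)+
  have nzs: "qp (a1 * e * w) \<noteq> 0" "qp (a2 * e * w) \<noteq> 0" "qp (q * a1 / w) \<noteq> 0" "qp (q * a2 / w) \<noteq> 0"
     "\<And>k. k \<in> {1..4} \<Longrightarrow> qp (b k * w) \<noteq> 0" if "w \<in> S" for w
    using nz1 that m me by auto
  have nzc: "qp (t * w / y) \<noteq> 0" "qp (q * t * y / w) \<noteq> 0" "qp (t * e * w * y) \<noteq> 0" if "w \<in> S" "norm y = 1" for w y
    using nz1[OF that(1), of "t / y"] nz1[OF that(1), of "t * y"] nz1[OF that(1), of "t * e * y"] m me[of t] that
    by (auto simp: norm_mult norm_divide mult_ac)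
  have hs: "splus e c a1 a2 b v holomorphic_on S"
    unfolding splus_def[abs_def] by (intro holomorphic_intros no_zero_divisors) (use nzs bnz Snz cv in auto)
  have hc: "(\<lambda>w. cplus e w y) holomorphic_on S" if "norm y = 1" for y
    unfolding cplus_def[abs_def] by (intro holomorphic_intros no_zero_divisors) (use nzc that t_nz Snz in auto)
  have S1: "w \<in> S" if "norm w = 1" for w using that sub q_lt by auto
  have S2: "q * w \<in> S" if "norm w = 1" for w using that sub q_lt by (auto simp: norm_mult)
  note zz = Tor_norm Tor_nz
  show cp: "continuous_on Tor (\<lambda>z. splus e c a1 a2 b v (z i) * (\<Prod>j\<in>I - {i}. cplus e (z i) (z j)) * R z)"
    unfolding splus_def cplus_def
    by (intro continuous_intros R no_zero_divisors ballI) (use nzs nzc bnz S1 zz cv t_nz in auto)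
  have "continuous_on Tor (\<lambda>z. sminus e c a1 a2 b v (z i))"
  proof (rule continuous_on_eq)
    show "continuous_on Tor (\<lambda>z. splus e c a1 a2 b v (q * z i))"
      by (rule continuous_on_compose2[OF holomorphic_on_imp_continuous_on[OF hs]])
         (auto intro!: continuous_intros S2 simp: Tor_norm)
    show "splus e c a1 a2 b v (q * z i) = sminus e c a1 a2 b v (z i)" if "z \<in> Tor" for z
      by (rule splus_shift) (use that cv Tor_nz in auto)
  qed
  moreover have "continuous_on Tor (\<lambda>z. cminus e (z i) (z j))" for j
  proof -
    have "qp (q * t * w / y) \<noteq> 0" "qp (t * y / w) \<noteq> 0" "qp (q * t * e * w * y) \<noteq> 0" if "norm w = 1" "norm y = 1" for w y
      using nzc[OF S2[OF that(1)] that(2)] q_nz by (auto simp: mult_ac)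
    thus ?thesis unfolding cminus_def
      by (intro continuous_intros no_zero_divisors ballI) (use zz t_nz in auto)
  qed
  ultimately show cm: "continuous_on Tor (\<lambda>z. sminus e c a1 a2 b v (z i) * (\<Prod>j\<in>I - {i}. cminus e (z i) (z j)) * R z)"
    by (intro continuous_intros R)
  show "TI I (\<lambda>z. splus e c a1 a2 b v (z i) * (\<Prod>j\<in>I - {i}. cplus e (z i) (z j)) * R z)
       = TI I (\<lambda>z. sminus e c a1 a2 b v (z i) * (\<Prod>j\<in>I - {i}. cminus e (z i) (z j)) * R z)"
  proof (rule TI_shift[OF I cp cm q_nz])
    fix z assume z: "z \<in> Tor"
    let ?f = "\<lambda>w. splus e c a1 a2 b v w * (\<Prod>j\<in>I - {i}. cplus e w (z j)) * R z"
    have upd: "(\<Prod>j\<in>I - {i}. g ((z(i := w)) j)) = (\<Prod>j\<in>I - {i}. g (z j))" for g :: "complex \<Rightarrow> complex" and w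
      by (rule prod.cong) auto
    have "?f holomorphic_on S"
      by (intro holomorphic_intros hs hc Tor_norm z)
    moreover have "?f w = splus e c a1 a2 b v ((z(i := w)) i) * (\<Prod>j\<in>I - {i}. cplus e ((z(i := w)) i) ((z(i := w)) j)) * R (z(i := w))" for w
      using upd[of "cplus e w" w] R(2) by simp
    moreover have "?f (q * w) = sminus e c a1 a2 b v ((z(i := w)) i) * (\<Prod>j\<in>I - {i}. cminus e ((z(i := w)) i) ((z(i := w)) j)) * R (z(i := w))"
      if "norm w = 1" for w
    proof -
      have "w \<noteq> 0" using that by auto
      moreover have "(\<Prod>j\<in>I - {i}. cplus e (q * w) (z j)) = (\<Prod>j\<in>I - {i}. cminus e w (z j))"
        by (rule prod.cong[OF refl], rule cplus_shift) (rule Tor_nz[OF z])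
      ultimately show ?thesis using upd[of "cminus e w" w] R(2) splus_shift[of w v c e a1 a2 b] cv by simp
    qed
    ultimately show "\<exists>S f. open S \<and> {w. norm q \<le> norm w \<and> norm w \<le> 1} \<subseteq> S \<and> f holomorphic_on S \<and>
       (\<forall>w. norm w = 1 \<longrightarrow> f w = splus e c a1 a2 b v ((z(i := w)) i) * (\<Prod>j\<in>I - {i}. cplus e ((z(i := w)) i) ((z(i := w)) j)) * R (z(i := w))
         \<and> f (q * w) = sminus e c a1 a2 b v ((z(i := w)) i) * (\<Prod>j\<in>I - {i}. cminus e ((z(i := w)) i) ((z(i := w)) j)) * R (z(i := w)))"
      using \<open>open S\<close> sub by blast
  qed (use q_lt in auto)
qed

lemma admissible_q:
  assumes "admissible e a1 a2 b" shows "admissible e a1 a2 (b(l := q * b l))"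
  using assms norm_mult_less_one[of "b l" q] q_nz q_lt norm_mult_less_one[OF q_lt] unfolding admissible_def
  by (auto simp: norm_mult intro: less_imp_le) (metis less_imp_le mult.commute mult_left_le norm_ge_zero order_le_less_trans atLeastAtMost_iff)

lemma wgt_q:
  assumes admissible: "admissible e a1 a2 b" and z: "z \<in> Tor" and l: "l \<in> {1..4}" and I: "finite I"
  shows "wgt I e c a1 a2 (b(l := q * b l)) v z
    = wgt I e c a1 a2 b v z * ((\<Prod>i\<in>I. z i) * (\<Prod>i\<in>I. jouk e (e * z i) - jouk e (b l)))"
proof -
  have "(\<Prod>i\<in>I. sing e c a1 a2 (b(l := q * b l)) v (z i)) = (\<Prod>i\<in>I. sing e c a1 a2 b v (z i) * (z i * (jouk e (e * z i) - jouk e (b l))))"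
    by (intro prod.cong refl sing_shift) (use admissible z l Tor_nz circle_nz(6)[OF admissible Tor_norm[OF z] Tor_norm[OF z] l] in \<open>auto simp: admissible_def\<close>)
  thus ?thesis unfolding wgt_def by (simp add: prod.distrib mult_ac)
qed

lemma ratio_plus:
  assumes "w \<noteq> 0" "y \<noteq> 0" "e \<noteq> 0"
  shows "(1 - t * y / w) * (1 - e * w * y / t) / ((1 - y / w) * (1 - e * w * y))
    = (jouk e (e * y) - jouk e (e * w / t)) / (jouk e (e * y) - jouk e (e * w))"
proof -
  have "jouk e (e * y) - jouk e (e * w / t) = ((1 - t * y / w) * (1 - e * w * y / t)) / y"
    using assms t_nz unfolding jouk_def by (simp add: field_simps)
  moreover have "jouk e (e * y) - jouk e (e * w) = ((1 - y / w) * (1 - e * w * y)) / y"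
    using assms t_nz unfolding jouk_def by (simp add: field_simps)
  ultimately show ?thesis using assms by simp
qed

lemma ratio_minus:
  assumes "w \<noteq> 0" "y \<noteq> 0" "e \<noteq> 0"
  shows "(1 - t * w / y) * (1 - t * e * w * y) / ((1 - w / y) * (1 - e * w * y))
    = t * ((jouk e (e * y) - jouk e (1 / (w * t))) / (jouk e (e * y) - jouk e (e * w)))"
proof -
  have "jouk e (e * y) - jouk e (1 / (w * t)) = - ((1 - t * w / y) * (1 - t * e * w * y)) / (t * w)"
    using assms t_nz unfolding jouk_def by (simp add: field_simps)
  moreover have "jouk e (e * y) - jouk e (e * w) = - ((1 - w / y) * (1 - e * w * y)) / w"
    using assms t_nz unfolding jouk_def by (simp add: field_simps)
  ultimately show ?thesis using assms t_nz by (simp del: minus_divide_left)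
qed

lemma Afun_inv:
  assumes "w \<noteq> 0" "\<And>k. k \<in> {1..4} \<Longrightarrow> b k \<noteq> 0" "e \<noteq> 0"
  shows "Afun e a1 a2 b (e / (e * w)) = (1 - a1 * e * w) * (1 - a2 * e * w) * (\<Prod>k=1..4. 1 - b k * w) / (w ^ 4 * (\<Prod>k=1..4. b k))"
proof -
  have "(\<Prod>k=1..4. 1 - e / (e * w) / b k) = (\<Prod>k=1..4. (- 1) * ((1 - b k * w) / (w * b k)))"
    by (rule prod.cong[OF refl]) (use assms in \<open>auto simp: field_simps\<close>)
  also have "\<dots> = (\<Prod>k=1..4::nat. - 1) * (\<Prod>k=1..4. (1 - b k * w) / (w * b k))"
    by (rule prod.distrib)
  also have "\<dots> = (\<Prod>k=1..4. 1 - b k * w) / (w ^ 4 * (\<Prod>k=1..4. b k))"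
    by (simp add: prod_dividef prod.distrib)
  finally show ?thesis unfolding Afun_def using assms by simp
qed

section \<open>The difference equation\<close>

text \<open>The backward end carries the constant \<open>c\<close> from the theta factors and
  \<open>t ^ (card I - 1)\<close> from the cross factors. Balancing turns their product into
  \<open>e\<close> over the product of all \<open>b k\<close>, which is exactly what makes the
  backward end the image of the forward end under \<open>g \<mapsto> e / g\<close>; their difference
  is then a value of \<open>Yfun\<close>.\<close>

lemma shift_difference_lagrange:
  assumes admissible: "admissible e a1 a2 b" and cv: "v \<noteq> 0" and z: "z \<in> Tor" and I: "finite I" "i \<in> I" and inj: "inj_on z I"
    and balanced: "e = a1 * a2 * (\<Prod>k=1..4. b k) * t ^ (2 * card I - 2)"
  defines "X \<equiv> \<lambda>j. jouk e (e * z j)" and "c \<equiv> t ^ (card I - 1) * a1 * a2"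
  defines "B \<equiv> X ` (I - {i})"
  shows "(splus e c a1 a2 b v (z i) * (\<Prod>j\<in>I - {i}. cplus e (z i) (z j))
      - sminus e c a1 a2 b v (z i) * (\<Prod>j\<in>I - {i}. cminus e (z i) (z j))) * wgt (I - {i}) e c a1 a2 b v z
    = wgt I e c a1 a2 b v z * (z i * (Yfun e t (Afun e a1 a2 b) (X i) B / (\<Prod>y\<in>B. y - X i)))"
proof -
  define w where "w = z i"
  have nz: "e \<noteq> 0" "\<And>k. k \<in> {1..4} \<Longrightarrow> b k \<noteq> 0" "a1 \<noteq> 0" "a2 \<noteq> 0" using admissible unfolding admissible_def by auto
  note zz = Tor_norm[OF z] Tor_nz[OF z]
  have w: "w \<noteq> 0" "norm w = 1" unfolding w_def using zz by auto
  note circ = circle_nz[OF admissible w(2) zz(1)]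
  have cnz: "c \<noteq> 0" unfolding c_def using t_nz nz by simp
  have ne: "w \<noteq> z j" if "j \<in> I - {i}" for j using inj I(2) that unfolding w_def inj_on_def by auto
  have Xinj: "inj_on X I"
  proof (rule inj_onI)
    fix j k assume jk: "j \<in> I" "k \<in> I" "X j = X k"
    have "e * z j = e * z k \<or> e = e * z j * (e * z k)"
      using jk(3) jouk_eq_iff[of "e * z j" "e * z k" e] nz zz unfolding X_def by auto
    moreover have "e \<noteq> e * z j * (e * z k)"
    proof
      assume "e = e * z j * (e * z k)"
      hence "1 = e * z j * z k" using nz by (simp add: mult_ac)
      thus False using circle_nz(8)[OF admissible zz(1) zz(1), of j k] by simp
    qed
    ultimately show "j = k" using nz inj jk unfolding inj_on_def by auto
  qed
  have injB: "inj_on X (I - {i})" using Xinj by (rule inj_on_subset) auto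
  have prodB: "(\<Prod>y\<in>B. g y) = (\<Prod>j\<in>I - {i}. g (X j))" for g :: "complex \<Rightarrow> complex"
    unfolding B_def using injB by (simp add: prod.reindex)
  define D where "D = (\<Prod>j\<in>I - {i}. X j - X i)"
  define s where "s = 1 - e * w\<^sup>2"
  have s: "s \<noteq> 0" using circ(7) unfolding s_def .
  define W where "W = wgt I e c a1 a2 b v z"
  have W: "sing e c a1 a2 b v w * (\<Prod>j\<in>I - {i}. cross e w (z j)) * wgt (I - {i}) e c a1 a2 b v z = W"
    unfolding W_def w_def using wgt_remove[OF I] by simp
  have Pp: "(\<Prod>j\<in>I - {i}. cplus e w (z j)) = (\<Prod>j\<in>I - {i}. cross e w (z j)) * ((\<Prod>y\<in>B. y - jouk e (e * w / t)) / D)"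
  proof -
    have "(\<Prod>j\<in>I - {i}. cplus e w (z j)) = (\<Prod>j\<in>I - {i}. cross e w (z j) * ((X j - jouk e (e * w / t)) / (X j - X i)))"
    proof (rule prod.cong[OF refl])
      fix j assume j: "j \<in> I - {i}"
      have "qp (t * z j / w) \<noteq> 0" using circle_nz(9)[OF admissible zz(1) w(2)] .
      thus "cplus e w (z j) = cross e w (z j) * ((X j - jouk e (e * w / t)) / (X j - X i))"
        using cplus_eq[of w "z j" e] ratio_plus[of w "z j" e] w nz zz ne[OF j] circ(8) unfolding X_def w_def by simp
    qed
    thus ?thesis unfolding prodB D_def prod.distrib prod_dividef .
  qed
  have Pm: "(\<Prod>j\<in>I - {i}. cminus e w (z j)) = (\<Prod>j\<in>I - {i}. cross e w (z j)) * (t ^ (card I - 1) * ((\<Prod>y\<in>B. y - jouk e (1 / (w * t))) / D))"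
  proof -
    have "(\<Prod>j\<in>I - {i}. cminus e w (z j)) = (\<Prod>j\<in>I - {i}. cross e w (z j) * (t * ((X j - jouk e (1 / (w * t))) / (X j - X i))))"
    proof (rule prod.cong[OF refl])
      fix j assume j: "j \<in> I - {i}"
      show "cminus e w (z j) = cross e w (z j) * (t * ((X j - jouk e (1 / (w * t))) / (X j - X i)))"
        using cminus_eq[of w "z j" e] ratio_minus[of w "z j" e] w nz zz ne[OF j] circ(8,9,10) unfolding X_def w_def by simp
    qed
    also have "\<dots> = (\<Prod>j\<in>I - {i}. cross e w (z j)) * (t ^ card (I - {i}) * ((\<Prod>y\<in>B. y - jouk e (1 / (w * t))) / D))"
      unfolding prodB D_def prod.distrib prod_dividef prod_constant ..
    finally show ?thesis using I by (simp add: card_Diff_singleton)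
  qed
  define Tp where "Tp = (\<Prod>y\<in>B. y - jouk e (e * w / t))"
  define Tm where "Tm = (\<Prod>y\<in>B. y - jouk e (1 / (w * t)))"
  define Ap where "Ap = Afun e a1 a2 b (e * w)"
  define Am where "Am = Afun e a1 a2 b (e / (e * w))"
  have Ap: "(1 - a1 / w) * (1 - a2 / w) * (\<Prod>k=1..4. 1 - e * w / b k) = Ap"
    unfolding Ap_def Afun_def using nz by simp
  define Pb where "Pb = (\<Prod>k=1..4. b k)"
  have Pb: "Pb \<noteq> 0" unfolding Pb_def using nz by simp
  have Am: "(1 - a1 * e * w) * (1 - a2 * e * w) * (\<Prod>k=1..4. 1 - b k * w) = Am * (w ^ 4 * Pb)"
    unfolding Am_def Pb_def using Afun_inv[OF w(1) nz(2) nz(1), where ?a1.0 = a1 and ?a2.0 = a2] Pb w(1) unfolding Pb_def by simp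
  have first: "splus e c a1 a2 b v w * (\<Prod>j\<in>I - {i}. cplus e w (z j)) * wgt (I - {i}) e c a1 a2 b v z = W * (w * (Ap * Tp / s / D))"
    unfolding splus_eq[OF circ(7,3,5)] Pp Ap s_def[symmetric] Tp_def[symmetric] W[symmetric] by (simp add: mult_ac)
  have "c * t ^ (card I - 1) * Pb = e"
  proof -
    have "card I \<ge> 1" using I by (metis One_nat_def Suc_leI card_gt_0_iff empty_iff)
    hence "2 * card I - 2 = (card I - 1) + (card I - 1)" by simp
    hence "t ^ (2 * card I - 2) = t ^ (card I - 1) * t ^ (card I - 1)" by (simp only: power_add)
    thus ?thesis unfolding c_def Pb_def using balanced by (simp add: mult_ac)
  qed
  hence ct: "c * t ^ (card I - 1) = e / Pb" using Pb by (simp add: field_simps)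
  have sm: "sminus e c a1 a2 b v w = sing e c a1 a2 b v w * (c / w) * ((1 - a1 * e * w) * (1 - a2 * e * w) * (\<Prod>k=1..4. 1 - b k * w)) / (1 - e * w\<^sup>2)"
    by (rule sminus_eq) (use circ in auto)
  have "sminus e c a1 a2 b v w * (\<Prod>j\<in>I - {i}. cminus e w (z j)) * wgt (I - {i}) e c a1 a2 b v z
     = W * ((c * t ^ (card I - 1)) / w * (Am * (w ^ 4 * Pb)) * Tm / s / D)"
    unfolding sm Pm Am s_def[symmetric] Tm_def[symmetric] W[symmetric] by (simp add: mult_ac)
  also have "\<dots> = W * (w * (e * w\<^sup>2 * Am * Tm / s / D))"
    unfolding ct using Pb w(1) by (simp add: numeral_eq_Suc)
  finally have second: "sminus e c a1 a2 b v w * (\<Prod>j\<in>I - {i}. cminus e w (z j)) * wgt (I - {i}) e c a1 a2 b v z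
     = W * (w * (e * w\<^sup>2 * Am * Tm / s / D))" .
  have Y: "Yfun e t (Afun e a1 a2 b) (X i) B = (Ap * Tp - e * w\<^sup>2 * Am * Tm) / s"
  proof -
    have "Yfun e t (Afun e a1 a2 b) (X i) B = Yval e t (Afun e a1 a2 b) B (e * w)"
      unfolding X_def w_def using nz zz by (intro Yfun_jouk) auto
    also have "\<dots> = (1 / w * Ap * Tp - e * w * Am * Tm) / (1 / w - e * w)"
      unfolding Yval_def sfun_def Ap_def[symmetric] Am_def[symmetric] Tp_def Tm_def using nz w by simp
    also have "1 / w - e * w = s / w" unfolding s_def using w by (simp add: field_simps power2_eq_square)
    also have "(1 / w * Ap * Tp - e * w * Am * Tm) / (s / w) = (Ap * Tp - e * w\<^sup>2 * Am * Tm) / s"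
      using w s by (simp add: field_simps power2_eq_square)
    finally show ?thesis .
  qed
  have "(\<Prod>y\<in>B. y - X i) = D" unfolding D_def prodB ..
  thus ?thesis unfolding left_diff_distrib w_def[symmetric] first second Y W_def[symmetric]
    by (simp add: diff_divide_distrib right_diff_distrib)
qed

text \<open>Each variable is shifted with an interpolating multiplier, and the sum of the shift
  differences is, pointwise, the two-term identity times the weight. Here balancing reads
  \<open>e = ...\<close> rather than \<open>q * e = ...\<close>: the factor \<open>q\<close> appears
  once \<open>b 3\<close> or \<open>b 4\<close> has been multiplied by it.\<close>

lemma difference_equation:
  assumes admissible: "admissible e a1 a2 b" and v: "v \<noteq> 0" and I: "finite I" "card I = n" "n = Suc m"
    and balanced: "e = a1 * a2 * (\<Prod>k=1..4. b k) * t ^ (2 * n - 2)"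
    and ab: "\<And>i j. i \<le> n \<Longrightarrow> j \<le> n \<Longrightarrow> t ^ i * b 3 \<noteq> t ^ j * b 4"
    and aa: "\<And>k. k \<le> 2 * n \<Longrightarrow> e \<noteq> t ^ k * (b 3 * b 3)"
    and bb: "\<And>k. k \<le> 2 * n \<Longrightarrow> e \<noteq> t ^ k * (b 4 * b 4)"
  defines "c \<equiv> \<lambda>g. (1 - a1 * g) * (1 - a2 * g) * (1 - e / (b 1 * g)) * (1 - e / (b 2 * g))"
  shows "wgt_integral I e a1 a2 (b(3 := q * b 3)) v * (\<Prod>i<n. c (t ^ i * b 4)) = wgt_integral I e a1 a2 (b(4 := q * b 4)) v * (\<Prod>i<n. c (t ^ i * b 3))"
proof -
  define A where "A = Afun e a1 a2 b"
  have pnz: "e \<noteq> 0" "\<And>k. k \<in> {1..4} \<Longrightarrow> b k \<noteq> 0" "a1 \<noteq> 0" "a2 \<noteq> 0" using admissible unfolding admissible_def by auto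
  have s4: "{1..4::nat} = {1,2,3,4}" by auto
  interpret chain_setup e t "b 3" "b 4" A c n
  proof
    show "A (e / g) = c g * (1 - e / (b 3 * g)) * (1 - e / (b 4 * g))" if "g \<noteq> 0" for g
      unfolding A_def Afun_def c_def s4 using pnz that by (simp add: mult_ac)
    show "A (b 3) = 0" "A (b 4) = 0" unfolding A_def Afun_def s4 using pnz by auto
    show "t ^ k \<noteq> 1" if "1 \<le> k" for k
    proof
      assume "t ^ k = 1"
      hence "norm t ^ k = 1" by (metis norm_one norm_power)
      thus False using t_lt that power_less_one_iff[of "norm t" k] by auto
    qed
    \<comment> \<open>Otherwise balancing would write 1 as a product of \<open>a1\<close>,
      \<open>a2\<close>, \<open>b 1\<close>, \<open>b 2\<close> and a power of \<open>t\<close>,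
      which has modulus below 1.\<close>
    show "e \<noteq> t ^ k * (b 3 * b 4)" if "k + 2 \<le> 2 * n" for k
    proof
      assume ek: "e = t ^ k * (b 3 * b 4)"
      have "e = a1 * a2 * b 1 * b 2 * t ^ (2 * n - 2) * (b 3 * b 4)"
        using balanced unfolding s4 by (simp add: mult_ac)
      hence "t ^ k * (b 3 * b 4) = a1 * a2 * b 1 * b 2 * t ^ (2 * n - 2) * (b 3 * b 4)"
        using ek by (rule subst[rotated])
      moreover have "b 3 * b 4 \<noteq> 0" using pnz by simp
      ultimately have "t ^ k = a1 * a2 * b 1 * b 2 * t ^ (2 * n - 2)" using mult_right_cancel by blast
      also have "t ^ (2 * n - 2) = t ^ (2 * n - 2 - k) * t ^ k" using that by (simp flip: power_add)
      finally have "t ^ k * 1 = t ^ k * (a1 * (a2 * (b 1 * (b 2 * t ^ (2 * n - 2 - k)))))" by (simp add: mult_ac)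
      hence "1 = a1 * (a2 * (b 1 * (b 2 * t ^ (2 * n - 2 - k))))" using t_nz by (metis mult_cancel_left power_not_zero)
      moreover have "norm (a1 * (a2 * (b 1 * (b 2 * t ^ (2 * n - 2 - k))))) < 1"
        using admissible t_lt unfolding admissible_def
        by (intro norm_mult_less_one less_imp_le[OF norm_mult_less_one]) (auto simp: norm_power power_le_one)
      ultimately show False by (metis less_irrefl norm_one)
    qed
  qed (use pnz t_nz ab aa bb in auto)
  have Y1: "\<exists>p. degree p \<le> n \<and> (\<forall>x. x \<notin> degenerate e \<longrightarrow> Yfun e t A x B = poly p x)"
    if "finite B" "Suc (card B) = n" for B
    unfolding A_def by (rule Yfun_poly[OF pnz(1) t_nz pnz(2) that balanced])
  obtain \<kappa> where \<kappa>: "\<And>X. finite X \<Longrightarrow> card X = n \<Longrightarrow> X \<inter> degenerate e = {} \<Longrightarrow>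
      lagrange_sum (Yfun e t A) (interp_fun m \<kappa> CA) X
      = two_term_const m * ((\<Prod>i<n. c (t ^ i * b 4)) * (\<Prod>y\<in>X. y - CA 0) - (\<Prod>i<n. c (t ^ i * b 3)) * (\<Prod>y\<in>X. y - CB 0))"
    using two_term[OF I(3) Y1] by blast
  define cc where "cc = t ^ (card I - 1) * a1 * a2"
  have cc: "cc \<noteq> 0" unfolding cc_def using t_nz pnz by simp
  define W where "W = wgt I e cc a1 a2 b v"
  define X where "X = (\<lambda>(z :: nat \<Rightarrow> complex) j. jouk e (e * z j))"
  \<comment> \<open>The multiplier for variable \<open>i\<close> does not involve
    \<open>z i\<close>, so it passes through the shift of that contour. The product of the other
    \<open>z j\<close> supplies the monomial that appears in \<open>wgt_q\<close>.\<close>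
  define R where "R = (\<lambda>i z. wgt (I - {i}) e cc a1 a2 b v z * (\<Prod>j\<in>I - {i}. z j) * (\<Sum>k\<le>m. \<kappa> k * (\<Prod>j\<in>I - {i}. X z j - CA k)))"
  define Fp where "Fp = (\<lambda>i z. splus e cc a1 a2 b v (z i) * (\<Prod>j\<in>I - {i}. cplus e (z i) (z j)) * R i z)"
  define Fm where "Fm = (\<lambda>i z. sminus e cc a1 a2 b v (z i) * (\<Prod>j\<in>I - {i}. cminus e (z i) (z j)) * R i z)"
  have Rc: "continuous_on Tor (R i)" for i
    unfolding R_def X_def jouk_def
    by (intro continuous_intros wgt_cont_Tor admissible cc v) (use pnz Tor_nz in auto)
  have Ru: "R i (z(i := w)) = R i z" for i z w
    unfolding R_def X_def wgt_upd[of i "I - {i}", simplified]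
    by (intro arg_cong2[where f = "(*)"] sum.cong prod.cong) auto
  have Feq: "TI I (Fp i) = TI I (Fm i)" and Fpc: "continuous_on Tor (Fp i)" and Fmc: "continuous_on Tor (Fm i)" if "i \<in> I" for i
    unfolding Fp_def Fm_def using shift_term[OF admissible cc v I(1) that Rc Ru] by auto
  have point: "(\<Sum>i\<in>I. Fp i z - Fm i z) = two_term_const m *
      ((\<Prod>i<n. c (t ^ i * b 4)) * wgt I e cc a1 a2 (b(3 := q * b 3)) v z - (\<Prod>i<n. c (t ^ i * b 3)) * wgt I e cc a1 a2 (b(4 := q * b 4)) v z)"
    if z: "z \<in> Tor" for z
  proof -
    note zz = Tor_norm[OF z] Tor_nz[OF z]
    have q3: "wgt I e cc a1 a2 (b(3 := q * b 3)) v z = W z * ((\<Prod>i\<in>I. z i) * (\<Prod>i\<in>I. X z i - CA 0))"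
      "wgt I e cc a1 a2 (b(4 := q * b 4)) v z = W z * ((\<Prod>i\<in>I. z i) * (\<Prod>i\<in>I. X z i - CB 0))"
      unfolding W_def X_def using wgt_q[OF admissible z _ I(1)] by simp_all
    show ?thesis
    proof (cases "inj_on z I")
      case False
      then obtain j k where jk: "j \<in> I" "k \<in> I" "j \<noteq> k" "z j = z k" unfolding inj_on_def by auto
      have W0: "W z = 0" unfolding W_def using jk by (intro wgt_not_inj[OF I(1)] zz)
      have "Fp i z = 0 \<and> Fm i z = 0" if i: "i \<in> I" for i
      proof (cases "i = j \<or> i = k")
        case True
        then obtain l where l: "l \<in> I - {i}" "z l = z i" using jk by (metis DiffI singletonD)
        have "(\<Prod>j\<in>I - {i}. cplus e (z i) (z j)) = 0" "(\<Prod>j\<in>I - {i}. cminus e (z i) (z j)) = 0"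
          using I l cross_same(2,3)[OF zz(2), of e i] by (auto intro!: prod_zero bexI[of _ l])
        thus ?thesis unfolding Fp_def Fm_def by simp
      next
        case False
        have "wgt (I - {i}) e cc a1 a2 b v z = 0"
          using jk False I by (intro wgt_not_inj[of _ j k] zz) auto
        thus ?thesis unfolding Fp_def Fm_def R_def by simp
      qed
      thus ?thesis unfolding q3 W0 by simp
    next
      case True
      have e1: "1 - e * z j * z k \<noteq> 0" for j k by (rule circle_nz(8)[OF admissible zz(1) zz(1)])
      have Xinj: "inj_on (X z) I"
      proof (rule inj_onI)
        fix j k assume jk: "j \<in> I" "k \<in> I" "X z j = X z k"
        have "e * z j = e * z k \<or> e = e * z j * (e * z k)"
          using jk(3) jouk_eq_iff[of "e * z j" "e * z k" e] pnz zz unfolding X_def by auto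
        moreover have "e \<noteq> e * z j * (e * z k)"
        proof
          assume "e = e * z j * (e * z k)"
          hence "1 = e * z j * z k" using pnz by (simp add: mult_ac)
          thus False using e1[of j k] by simp
        qed
        ultimately show "j = k" using pnz True jk unfolding inj_on_def by auto
      qed
      have nd: "X z ` I \<inter> degenerate e = {}"
      proof -
        have "(e * z i)\<^sup>2 \<noteq> e" for i
        proof
          assume "(e * z i)\<^sup>2 = e"
          hence "e * (e * z i * z i) = e * 1" by (simp add: power2_eq_square mult_ac)
          hence "e * z i * z i = 1" using pnz(1) by (metis mult_cancel_left)
          thus False using e1[of i i] by simp
        qed
        thus ?thesis using jouk_degenerate_iff pnz zz unfolding X_def by auto
      qed
      have card: "card (X z ` I) = n" using Xinj I by (simp add: card_image)
      have inter: "(\<Sum>k\<le>m. \<kappa> k * (\<Prod>j\<in>I - {i}. X z j - CA k)) = interp_fun m \<kappa> CA (X z ` (I - {i}))" for i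
        unfolding interp_fun_def using inj_on_subset[OF Xinj, of "I - {i}"] by (simp add: prod.reindex)
      have "Fp i z - Fm i z = W z * (\<Prod>j\<in>I. z j) * (Yfun e t A (X z i) (X z ` I - {X z i}) * interp_fun m \<kappa> CA (X z ` I - {X z i})
           / (\<Prod>y\<in>X z ` I - {X z i}. y - X z i))" if i: "i \<in> I" for i
      proof -
        have im: "X z ` (I - {i}) = X z ` I - {X z i}" using Xinj i unfolding inj_on_def by auto
        have "Fp i z - Fm i z = (splus e cc a1 a2 b v (z i) * (\<Prod>j\<in>I - {i}. cplus e (z i) (z j))
            - sminus e cc a1 a2 b v (z i) * (\<Prod>j\<in>I - {i}. cminus e (z i) (z j))) * wgt (I - {i}) e cc a1 a2 b v z
            * ((\<Prod>j\<in>I - {i}. z j) * interp_fun m \<kappa> CA (X z ` (I - {i})))"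
          unfolding Fp_def Fm_def R_def inter by (simp add: algebra_simps)
        also have "\<dots> = W z * (z i * (Yfun e t A (X z i) (X z ` (I - {i})) / (\<Prod>y\<in>X z ` (I - {i}). y - X z i)))
            * ((\<Prod>j\<in>I - {i}. z j) * interp_fun m \<kappa> CA (X z ` (I - {i})))"
          using shift_difference_lagrange[OF admissible v z I(1) i True] balanced I unfolding cc_def W_def A_def X_def by simp
        also have "\<dots> = W z * (z i * (\<Prod>j\<in>I - {i}. z j)) * (Yfun e t A (X z i) (X z ` (I - {i})) * interp_fun m \<kappa> CA (X z ` (I - {i}))
           / (\<Prod>y\<in>X z ` (I - {i}). y - X z i))" by simp
        also have "z i * (\<Prod>j\<in>I - {i}. z j) = (\<Prod>j\<in>I. z j)" using prod.remove[OF I(1) i, of z] by simp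
        finally show ?thesis unfolding im .
      qed
      hence "(\<Sum>i\<in>I. Fp i z - Fm i z) = W z * (\<Prod>j\<in>I. z j) * lagrange_sum (Yfun e t A) (interp_fun m \<kappa> CA) (X z ` I)"
        unfolding lagrange_sum_def using Xinj by (simp add: sum_distrib_left sum.reindex)
      also have "\<dots> = W z * (\<Prod>j\<in>I. z j) * (two_term_const m * ((\<Prod>i<n. c (t ^ i * b 4)) * (\<Prod>y\<in>X z ` I. y - CA 0) - (\<Prod>i<n. c (t ^ i * b 3)) * (\<Prod>y\<in>X z ` I. y - CB 0)))"
        by (subst \<kappa>) (use I card nd in auto)
      finally show ?thesis unfolding q3 using Xinj by (simp add: prod.reindex algebra_simps)
    qed
  qed
  have admq: "admissible e a1 a2 (b(3 := q * b 3))" "admissible e a1 a2 (b(4 := q * b 4))" by (intro admissible_q admissible)+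
  have J: "wgt_integral I e a1 a2 (b(l := q * b l)) v = TI I (wgt I e cc a1 a2 (b(l := q * b l)) v)" for l
    unfolding wgt_integral_def cc_def ..
  have "0 = (\<Sum>i\<in>I. TI I (Fp i) - TI I (Fm i))" using Feq by simp
  also have "\<dots> = (\<Sum>i\<in>I. TI I (\<lambda>z. Fp i z - Fm i z))"
    by (intro sum.cong refl TI_diff[symmetric] Fpc Fmc)
  also have "\<dots> = TI I (\<lambda>z. \<Sum>i\<in>I. Fp i z - Fm i z)"
    by (rule TI_sum[symmetric]) (intro continuous_intros Fpc Fmc)
  also have "\<dots> = TI I (\<lambda>z. two_term_const m *
      ((\<Prod>i<n. c (t ^ i * b 4)) * wgt I e cc a1 a2 (b(3 := q * b 3)) v z - (\<Prod>i<n. c (t ^ i * b 3)) * wgt I e cc a1 a2 (b(4 := q * b 4)) v z))"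
    by (rule TI_cong) (rule point)
  also have "\<dots> = two_term_const m * ((\<Prod>i<n. c (t ^ i * b 4)) * wgt_integral I e a1 a2 (b(3 := q * b 3)) v - (\<Prod>i<n. c (t ^ i * b 3)) * wgt_integral I e a1 a2 (b(4 := q * b 4)) v)"
    unfolding J TI_cmult
    by (subst TI_diff) (auto intro!: continuous_intros wgt_cont_Tor admq cc v simp: TI_cmult)
  finally show ?thesis using two_term_const_nz[OF I(3)] by (simp add: mult.commute)
qed

end

section \<open>Constancy of the quotient\<close>

lemma continuous_eq_off_finite:
  fixes f g :: "complex \<Rightarrow> complex"
  assumes "open T" "continuous_on T f" "continuous_on T g" "finite F" "\<And>x. x \<in> T - F \<Longrightarrow> f x = g x" "x \<in> T"
  shows "f x = g x"
proof -
  have "eventually (\<lambda>y. y \<in> T - (F - {x})) (at x)"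
    using assms(1,4,6) by (intro eventually_at_in_open' open_Diff finite_imp_closed) auto
  moreover have "eventually (\<lambda>y. y \<noteq> x) (at x)" by (rule eventually_neq_at_within)
  ultimately have "eventually (\<lambda>y. f y = g y) (at x)"
    by eventually_elim (use assms(5) in auto)
  moreover have "(f \<longlongrightarrow> f x) (at x)" "(g \<longlongrightarrow> g x) (at x)"
    using assms(1,2,3,6) by (auto simp: continuous_on_eq_continuous_at isCont_def)
  ultimately have "(g \<longlongrightarrow> f x) (at x)" using tendsto_cong by blast
  thus ?thesis using \<open>(g \<longlongrightarrow> g x) (at x)\<close> tendsto_unique[OF at_neq_bot] by blast
qed

lemma finite_quadratic:
  assumes "c \<noteq> (0::complex)" shows "finite {u. c * u\<^sup>2 = d}"
proof -
  have "{u. c * u\<^sup>2 = d} \<subseteq> {u. poly [:- d, 0, c:] u = 0}"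
    by (auto simp: power2_eq_square algebra_simps)
  moreover have "finite {u. poly [:- d, 0, c:] u = 0}" by (rule poly_roots_finite) (use assms in simp)
  ultimately show ?thesis by (rule finite_subset)
qed

section \<open>Holomorphy in the parameters, and the explicit side of the difference
  equation\<close>

context qtbase
begin

lemma wgt_holo:
  assumes "e holomorphic_on S" "c holomorphic_on S" "a1 holomorphic_on S" "a2 holomorphic_on S" "v holomorphic_on S"
    and "\<And>k. k \<in> {1..4} \<Longrightarrow> (\<lambda>s. b s k) holomorphic_on S"
    and admissible: "\<And>s. s \<in> S \<Longrightarrow> admissible (e s) (a1 s) (a2 s) (b s)" and cv: "\<And>s. s \<in> S \<Longrightarrow> c s \<noteq> 0" "\<And>s. s \<in> S \<Longrightarrow> v s \<noteq> 0"
    and z: "z \<in> Tor"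
  shows "(\<lambda>s. wgt I (e s) (c s) (a1 s) (a2 s) (b s) (v s) z) holomorphic_on S"
proof -
  have nz: "z i \<noteq> 0" for i using z Tor_nz by blast
  note circ = circle_nz[OF admissible Tor_norm[OF z] Tor_norm[OF z]]
  have bnz: "s \<in> S \<Longrightarrow> k \<in> {1..4} \<Longrightarrow> b s k \<noteq> 0" for s k using admissible[unfolded admissible_def] by blast
  have s: "(\<lambda>s. sing (e s) (c s) (a1 s) (a2 s) (b s) (v s) (z i)) holomorphic_on S" for i
    unfolding sing_def by (intro holomorphic_intros assms ballI no_zero_divisors) (use circ bnz cv nz in auto)
  have x: "(\<lambda>s. cross (e s) (z j) (z k)) holomorphic_on S" for j k
    unfolding cross_def by (intro holomorphic_intros assms ballI no_zero_divisors) (use circ t_nz nz in auto)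
  show ?thesis unfolding wgt_def split_beta by (intro holomorphic_intros s x)
qed

lemma wgt_integral_holo:
  assumes S: "open S" and h: "e holomorphic_on S" "a1 holomorphic_on S" "a2 holomorphic_on S" "v holomorphic_on S"
    "\<And>k. k \<in> {1..4} \<Longrightarrow> (\<lambda>s. b s k) holomorphic_on S"
    and admissible: "\<And>s. s \<in> S \<Longrightarrow> admissible (e s) (a1 s) (a2 s) (b s)" and v: "\<And>s. s \<in> S \<Longrightarrow> v s \<noteq> 0"
  shows "(\<lambda>s. wgt_integral I (e s) (a1 s) (a2 s) (b s) (v s)) holomorphic_on S"
proof -
  have cnz: "t ^ (card I - 1) * a1 s * a2 s \<noteq> 0" if "s \<in> S" for s
    using admissible[OF that] t_nz unfolding admissible_def by auto
  have comp: "continuous_on (S \<times> Tor) (\<lambda>p. g (fst p))" if "g holomorphic_on S" for g :: "complex \<Rightarrow> complex"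
    by (rule continuous_on_compose2[OF holomorphic_on_imp_continuous_on[OF that]]) (auto intro!: continuous_intros)
  show ?thesis unfolding wgt_integral_def
  proof (rule TI_holomorphic[OF S])
    show "continuous_on (S \<times> Tor) (\<lambda>p. wgt I (e (fst p)) (t ^ (card I - 1) * a1 (fst p) * a2 (fst p)) (a1 (fst p)) (a2 (fst p)) (b (fst p)) (v (fst p)) (snd p))"
      by (intro wgt_cont comp h continuous_snd_coord continuous_on_mult continuous_on_const)
         (use admissible v cnz in auto)
    show "(\<lambda>w. wgt I (e w) (t ^ (card I - 1) * a1 w * a2 w) (a1 w) (a2 w) (b w) (v w) z) holomorphic_on S" if "z \<in> Tor" for z
      by (intro wgt_holo holomorphic_intros h admissible v cnz that)
  qed
qed

text \<open>One factor for each of the six pairs from \<open>b 1, ..., b 4\<close>. When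
  \<open>b 4 = a3 * e\<close>, the three pairs with index 4 are halves of the theta functions of
  \<open>a3 * b k\<close>.\<close>

definition poch_num :: "complex \<Rightarrow> (nat \<Rightarrow> complex) \<Rightarrow> nat \<Rightarrow> complex" where
  "poch_num e b i = qp (q * e / (t ^ i * b 1 * b 2)) * qp (q * e / (t ^ i * b 3 * b 4))
     * (qp (q * e / (t ^ i * b 1 * b 3)) * qp (q * e / (t ^ i * b 2 * b 3)))
     * (qp (q * e / (t ^ i * b 1 * b 4)) * qp (q * e / (t ^ i * b 2 * b 4)))"

definition poch_den :: "complex \<Rightarrow> complex \<Rightarrow> complex \<Rightarrow> (nat \<Rightarrow> complex) \<Rightarrow> nat \<Rightarrow> complex" where
  "poch_den e a1 a2 b i = qp (t ^ i * a1 * a2 * e) * (\<Prod>k=1..4. qp (t ^ i * a1 * b k) * qp (t ^ i * a2 * b k))"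

definition poch_part :: "nat \<Rightarrow> complex \<Rightarrow> complex \<Rightarrow> complex \<Rightarrow> (nat \<Rightarrow> complex) \<Rightarrow> complex" where
  "poch_part n e a1 a2 b = (\<Prod>i<n. poch_num e b i / poch_den e a1 a2 b i)"

definition balanced :: "nat \<Rightarrow> complex \<Rightarrow> complex \<Rightarrow> complex \<Rightarrow> (nat \<Rightarrow> complex) \<Rightarrow> bool" where
  "balanced n e a1 a2 b \<longleftrightarrow> q * e = a1 * a2 * (\<Prod>k=1..4. b k) * t ^ (2 * n - 2)"

lemma prod14: "(\<Prod>k=1..4::nat. f k) = f 1 * f 2 * f 3 * f 4"
proof -
  have "{1..4::nat} = {1,2,3,4}" by auto
  thus ?thesis by (simp add: mult_ac)
qed

lemma poch_den_nz:
  assumes "admissible e a1 a2 b" shows "poch_den e a1 a2 b i \<noteq> 0"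
proof -
  have p: "norm (t ^ i * x) < 1" if "norm x < 1" for x
    using norm_mult_less_one[OF that, of "t ^ i"] t_lt by (simp add: mult.commute norm_power power_le_one)
  have "norm (t ^ i * (a1 * (a2 * e))) < 1" "\<And>k. k \<in> {1..4} \<Longrightarrow> norm (t ^ i * (a1 * b k)) < 1" "\<And>k. k \<in> {1..4} \<Longrightarrow> norm (t ^ i * (a2 * b k)) < 1"
    using assms unfolding admissible_def by (auto intro!: p norm_mult_less_one less_imp_le[OF norm_mult_less_one] intro: less_imp_le)
  thus ?thesis unfolding poch_den_def by (auto simp: mult.assoc intro!: qp_nonzero)
qed

text \<open>Balancing rewrites each argument as \<open>a1 * a2\<close> times the complementary two
  \<open>b\<close>'s and a nonnegative power of \<open>t\<close>, since \<open>i < n\<close>; its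
  modulus is below 1.\<close>

lemma poch_num_nz:
  assumes admissible: "admissible e a1 a2 b" and b: "balanced n e a1 a2 b" and i: "i < n"
  shows "poch_num e b i \<noteq> 0"
proof -
  have nzb: "b k \<noteq> 0 \<and> norm (b k) < 1" if "k \<in> {1..4}" for k using admissible that unfolding admissible_def by auto
  have bs: "b 1 \<noteq> 0" "b 2 \<noteq> 0" "b 3 \<noteq> 0" "b 4 \<noteq> 0" "norm (b 1) < 1" "norm (b 2) < 1" "norm (b 3) < 1" "norm (b 4) < 1"
    using nzb by auto
  have a: "norm a1 < 1" "norm a2 < 1" using admissible unfolding admissible_def by auto
  have "2 * n - 2 = i + (2 * n - 2 - i)" using i by linarith
  hence ti: "t ^ (2 * n - 2) = t ^ i * t ^ (2 * n - 2 - i)" by (metis power_add)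
  have qe: "q * e = a1 * a2 * (b 1 * b 2 * b 3 * b 4) * (t ^ i * t ^ (2 * n - 2 - i))"
    using b unfolding balanced_def prod14 ti .
  have key: "qp (q * e / (t ^ i * x * y)) \<noteq> 0"
    if "x * y * (x' * y') = b 1 * b 2 * b 3 * b 4" "x \<noteq> 0" "y \<noteq> 0" "norm x' < 1" "norm y' < 1" for x y x' y'
  proof (rule qp_nonzero)
    have "q * e / (t ^ i * x * y) = a1 * (a2 * (x' * (y' * t ^ (2 * n - 2 - i))))"
    proof -
      have qe': "q * e = a1 * a2 * (x * y * (x' * y')) * (t ^ i * t ^ (2 * n - 2 - i))"
        unfolding that(1) by (rule qe)
      show ?thesis unfolding qe' using that(2,3) t_nz by simp
    qed
    also have "norm \<dots> < 1"
      using a that t_lt by (intro norm_mult_less_one less_imp_le[OF norm_mult_less_one]) (auto simp: norm_power power_le_one)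
    finally show "norm (q * e / (t ^ i * x * y)) < 1" .
  qed
  show ?thesis unfolding poch_num_def
    using key[of "b 1" "b 2" "b 3" "b 4"] key[of "b 3" "b 4" "b 1" "b 2"] key[of "b 1" "b 3" "b 2" "b 4"]
      key[of "b 2" "b 3" "b 1" "b 4"] key[of "b 1" "b 4" "b 2" "b 3"] key[of "b 2" "b 4" "b 1" "b 3"] bs
    by (simp add: mult_ac)
qed

lemma poch_part_nz: "admissible e a1 a2 b \<Longrightarrow> balanced n e a1 a2 b \<Longrightarrow> poch_part n e a1 a2 b \<noteq> 0"
  unfolding poch_part_def using poch_num_nz poch_den_nz by auto

text \<open>The pair \<open>(3, 4)\<close> sees \<open>q * b 3 * b 4\<close> on both sides. In each
  of the pairs of 3 or 4 with 1, 2, \<open>a1\<close> and \<open>a2\<close>, the shift releases one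
  linear factor, and these four factors make up \<open>c\<close>.\<close>

lemma poch_part_shift:
  fixes e a1 a2 :: complex and b :: "nat \<Rightarrow> complex"
  assumes admissible: "admissible e a1 a2 b"
  defines "c \<equiv> \<lambda>g. (1 - a1 * g) * (1 - a2 * g) * (1 - e / (b 1 * g)) * (1 - e / (b 2 * g))"
  shows "poch_part n e a1 a2 (b(3 := q * b 3)) * (\<Prod>i<n. c (t ^ i * b 4)) = poch_part n e a1 a2 (b(4 := q * b 4)) * (\<Prod>i<n. c (t ^ i * b 3))"
  unfolding poch_part_def prod.distrib[symmetric]
proof (rule prod.cong[OF refl])
  fix i
  let ?T = "t ^ i"
  have q: "qp (q * e / (?T * x * (q * y))) = (1 - e / (x * (?T * y))) * qp (q * e / (?T * x * y))" for x y
    using qp_rec[of "e / (?T * x * y)"] q_nz by (simp add: mult_ac)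
  have d: "qp (?T * a * y) = (1 - a * (?T * y)) * qp (?T * a * (q * y))" for a y
    using qp_rec[of "?T * a * y"] by (simp add: mult_ac)
  define C where "C = poch_den e a1 a2 b i"
  have Cnz: "poch_den e a1 a2 (b(3 := q * b 3)) i \<noteq> 0" "poch_den e a1 a2 (b(4 := q * b 4)) i \<noteq> 0" "C \<noteq> 0"
    unfolding C_def by (intro poch_den_nz admissible_q admissible)+
  have G3: "C = poch_den e a1 a2 (b(3 := q * b 3)) i * ((1 - a1 * (?T * b 3)) * (1 - a2 * (?T * b 3)))"
    unfolding C_def poch_den_def prod14 using d[of a1 "b 3"] d[of a2 "b 3"] by (simp add: mult_ac)
  have G4: "C = poch_den e a1 a2 (b(4 := q * b 4)) i * ((1 - a1 * (?T * b 4)) * (1 - a2 * (?T * b 4)))"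
    unfolding C_def poch_den_def prod14 using d[of a1 "b 4"] d[of a2 "b 4"] by (simp add: mult_ac)
  define M where "M = qp (q * e / (?T * b 1 * b 2)) * qp (q * e / (?T * b 3 * (q * b 4)))
     * (qp (q * e / (?T * b 1 * b 3)) * qp (q * e / (?T * b 2 * b 3)))
     * (qp (q * e / (?T * b 1 * b 4)) * qp (q * e / (?T * b 2 * b 4)))"
  have N3: "poch_num e (b(3 := q * b 3)) i = M * ((1 - e / (b 1 * (?T * b 3))) * (1 - e / (b 2 * (?T * b 3))))"
  proof -
    have "?T * (q * b 3) * b 4 = ?T * b 3 * (q * b 4)" by simp
    thus ?thesis unfolding poch_num_def M_def using q[of "b 1" "b 3"] q[of "b 2" "b 3"] by (simp add: mult_ac)
  qed
  have N4: "poch_num e (b(4 := q * b 4)) i = M * ((1 - e / (b 1 * (?T * b 4))) * (1 - e / (b 2 * (?T * b 4))))"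
    unfolding poch_num_def M_def using q[of "b 1" "b 4"] q[of "b 2" "b 4"] by (simp add: mult_ac)
  have nz3: "(1 - a1 * (?T * b 3)) * (1 - a2 * (?T * b 3)) \<noteq> 0" using Cnz G3 by auto
  have nz4: "(1 - a1 * (?T * b 4)) * (1 - a2 * (?T * b 4)) \<noteq> 0" using Cnz G4 by auto
  have gen: "M * x / D3 * (y * z * w1 * w2) = M * (w1 * w2) / D4 * (x1 * x2 * x3 * x4)"
    if "x = x3 * x4" "D3 * (x1 * x2) = D4 * (y * z)" "D3 \<noteq> 0" "D4 \<noteq> 0"
    for M x D3 y z w1 w2 D4 x1 x2 x3 x4 :: complex
  proof -
    have "D4 * (y * z) * (M * (x3 * x4) * (w1 * w2)) = D3 * (x1 * x2) * (M * (x3 * x4) * (w1 * w2))" using that(2) by simp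
    thus ?thesis using that(1,3,4) by (simp add: field_simps)
  qed
  show "poch_num e (b(3 := q * b 3)) i / poch_den e a1 a2 (b(3 := q * b 3)) i * c (t ^ i * b 4)
      = poch_num e (b(4 := q * b 4)) i / poch_den e a1 a2 (b(4 := q * b 4)) i * c (t ^ i * b 3)"
    unfolding N3 N4 c_def by (rule gen[OF refl _ Cnz(1,2)]) (use G3 G4 in simp)
qed

text \<open>Both parameter sets arise from \<open>B\<close>, which has \<open>b 3 / (q * u)\<close>
  and \<open>b 4 * u\<close>, by multiplying slot 3 or slot 4 by \<open>q\<close>. Integral and
  explicit side obey the same two-term equation at \<open>B\<close>, so their quotient
  agrees.\<close>

lemma ratio_q_periodic:
  assumes admissible: "admissible e a1 a2 (b(3 := b 3 / u, 4 := b 4 * u))" "admissible e a1 a2 (b(3 := b 3 / (q * u), 4 := b 4 * (q * u)))"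
    and balanced: "balanced n e a1 a2 b" and v: "v \<noteq> 0" and I: "finite I" "card I = n" "n = Suc m"
    and gen: "\<And>i j. i \<le> n \<Longrightarrow> j \<le> n \<Longrightarrow> t ^ i * (b 3 / (q * u)) \<noteq> t ^ j * (b 4 * u)"
       "\<And>k. k \<le> 2 * n \<Longrightarrow> e \<noteq> t ^ k * ((b 3 / (q * u)) * (b 3 / (q * u)))"
       "\<And>k. k \<le> 2 * n \<Longrightarrow> e \<noteq> t ^ k * ((b 4 * u) * (b 4 * u))"
  shows "wgt_integral I e a1 a2 (b(3 := b 3 / u, 4 := b 4 * u)) v / poch_part n e a1 a2 (b(3 := b 3 / u, 4 := b 4 * u))
    = wgt_integral I e a1 a2 (b(3 := b 3 / (q * u), 4 := b 4 * (q * u))) v / poch_part n e a1 a2 (b(3 := b 3 / (q * u), 4 := b 4 * (q * u)))"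
proof -
  define B where "B = b(3 := b 3 / (q * u), 4 := b 4 * u)"
  have a1: "\<forall>k\<in>{1..4}. (b(3 := b 3 / u, 4 := b 4 * u)) k \<noteq> 0 \<and> norm ((b(3 := b 3 / u, 4 := b 4 * u)) k) < 1"
    and a2: "\<forall>k\<in>{1..4}. (b(3 := b 3 / (q * u), 4 := b 4 * (q * u))) k \<noteq> 0 \<and> norm ((b(3 := b 3 / (q * u), 4 := b 4 * (q * u))) k) < 1"
    using admissible unfolding admissible_def by blast+
  have u: "u \<noteq> 0" using bspec[OF a1, of 4] by auto
  have "\<forall>k\<in>{1..4}. B k \<noteq> 0 \<and> norm (B k) < 1"
  proof
    fix k :: nat assume k: "k \<in> {1..4}"
    show "B k \<noteq> 0 \<and> norm (B k) < 1"
      using bspec[OF a1 k] bspec[OF a2 k] unfolding B_def by (cases "k = 3"; cases "k = 4") auto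
  qed
  hence admB: "admissible e a1 a2 B" using admissible(1) unfolding admissible_def by blast
  have B3: "B(3 := q * B 3) = b(3 := b 3 / u, 4 := b 4 * u)" unfolding B_def using q_nz u by (auto simp: fun_eq_iff)
  have B4: "B(4 := q * B 4) = b(3 := b 3 / (q * u), 4 := b 4 * (q * u))" unfolding B_def by (auto simp: fun_eq_iff)
  have balB: "e = a1 * a2 * (\<Prod>k=1..4. B k) * t ^ (2 * n - 2)"
    using balanced q_nz u unfolding balanced_def prod14 B_def by (simp add: field_simps)
  define c where "c = (\<lambda>g. (1 - a1 * g) * (1 - a2 * g) * (1 - e / (B 1 * g)) * (1 - e / (B 2 * g)))"
  have J: "wgt_integral I e a1 a2 (B(3 := q * B 3)) v * (\<Prod>i<n. c (t ^ i * B 4)) = wgt_integral I e a1 a2 (B(4 := q * B 4)) v * (\<Prod>i<n. c (t ^ i * B 3))"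
    unfolding c_def by (rule difference_equation[OF admB v I balB]) (use gen in \<open>auto simp: B_def\<close>)
  have G: "poch_part n e a1 a2 (B(3 := q * B 3)) * (\<Prod>i<n. c (t ^ i * B 4)) = poch_part n e a1 a2 (B(4 := q * B 4)) * (\<Prod>i<n. c (t ^ i * B 3))"
    unfolding c_def by (rule poch_part_shift[OF admB])
  have bals: "balanced n e a1 a2 (b(3 := b 3 / u, 4 := b 4 * u))" "balanced n e a1 a2 (b(3 := b 3 / (q * u), 4 := b 4 * (q * u)))"
    using balanced u q_nz unfolding balanced_def prod14 by auto
  have Gnz: "poch_part n e a1 a2 (B(3 := q * B 3)) \<noteq> 0" "poch_part n e a1 a2 (B(4 := q * B 4)) \<noteq> 0"
    unfolding B3 B4 using poch_part_nz admissible bals by blast+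
  have cnz: "(\<Prod>i<n. c (t ^ i * B 4)) \<noteq> 0"
  proof -
    have "c (t ^ i * B 4) \<noteq> 0" if i: "i < n" for i
    proof -
      have Bk: "B k \<noteq> 0" "norm (B k) < 1" if "k \<in> {1..4}" for k using admB that unfolding admissible_def by auto
      have n1: "norm (a1) < 1" "norm a2 < 1" using admissible unfolding admissible_def by auto
      have ti: "norm (t ^ i) \<le> 1" using t_lt by (simp add: norm_power power_le_one)
      have "norm (a1 * (t ^ i * B 4)) < 1" "norm (a2 * (t ^ i * B 4)) < 1"
      proof -
        have "norm (t ^ i * B 4) \<le> 1" unfolding norm_mult using ti Bk[of 4] by (intro mult_le_one) auto
        thus "norm (a1 * (t ^ i * B 4)) < 1" "norm (a2 * (t ^ i * B 4)) < 1" using n1 by (auto intro: norm_mult_less_one)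
      qed
      moreover have "2 * n - 2 = i + (2 * n - 2 - i)" using i by linarith
      hence tt: "t ^ (2 * n - 2) = t ^ i * t ^ (2 * n - 2 - i)" by (metis power_add)
      have "e / (B 1 * (t ^ i * B 4)) = a1 * (a2 * (B 2 * (B 3 * t ^ (2 * n - 2 - i))))"
        "e / (B 2 * (t ^ i * B 4)) = a1 * (a2 * (B 1 * (B 3 * t ^ (2 * n - 2 - i))))"
        using Bk[of 1] Bk[of 2] Bk[of 4] t_nz by (subst balB, unfold prod14 tt, simp)+
      moreover have "norm (a1 * (a2 * (B 2 * (B 3 * t ^ (2 * n - 2 - i))))) < 1" "norm (a1 * (a2 * (B 1 * (B 3 * t ^ (2 * n - 2 - i))))) < 1"
        using n1 Bk[of 1] Bk[of 2] Bk[of 3] t_lt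
        by (auto intro!: norm_mult_less_one less_imp_le[OF norm_mult_less_one] simp: norm_power power_le_one)
      ultimately show ?thesis unfolding c_def by (metis (no_types, lifting) diff_eq_eq add_0 less_irrefl mult_eq_0_iff norm_one)
    qed
    thus ?thesis by auto
  qed
  have "wgt_integral I e a1 a2 (B(3 := q * B 3)) v / poch_part n e a1 a2 (B(3 := q * B 3)) = wgt_integral I e a1 a2 (B(4 := q * B 4)) v / poch_part n e a1 a2 (B(4 := q * B 4))"
  proof -
    have gen: "x / g = y / h" if "x * p = y * r" "g * p = h * r" "g \<noteq> 0" "h \<noteq> 0" "p \<noteq> 0" for x g y h p r :: complex
    proof -
      have "x * h * (p * r) = (x * p) * (h * r)" by (simp add: mult_ac)
      also have "\<dots> = (y * r) * (g * p)" unfolding that(1) that(2)[symmetric] ..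
      also have "\<dots> = y * g * (p * r)" by (simp add: mult_ac)
      finally have "x * h * (p * r) = y * g * (p * r)" .
      moreover have "r \<noteq> 0" using that by auto
      ultimately have "x * h = y * g" using that by simp
      thus ?thesis using that by (simp add: field_simps)
    qed
    show ?thesis by (rule gen[OF J G Gnz cnz])
  qed
  thus ?thesis unfolding B3 B4 .
qed

end

lemma connected_annulus0:
  fixes r s :: real
  assumes "s > 0"
  shows "connected {w::complex. r < norm w \<and> norm w * s < 1}"
proof -
  have "{w::complex. r < norm w \<and> norm w * s < 1} = {w. r < norm (w - 0) \<and> norm (w - 0) < 1 / s}"
    using assms by (auto simp: field_simps)
  thus ?thesis using connected_annulus(1)[where a = "0::complex" and ?r1.0 = r and ?r2.0 = "1 / s"] by simp
qed

lemma open_annulus0: "open {w::complex. r < norm w \<and> norm w * s < 1}"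
  by (intro open_Collect_conj open_Collect_less continuous_intros)

context qtbase
begin

lemma poch_part_holo:
  assumes h: "e holomorphic_on S" "a1 holomorphic_on S" "a2 holomorphic_on S" "\<And>k. k \<in> {1..4} \<Longrightarrow> (\<lambda>s. b s k) holomorphic_on S"
    and admissible: "\<And>s. s \<in> S \<Longrightarrow> admissible (e s) (a1 s) (a2 s) (b s)"
  shows "(\<lambda>s. poch_part n (e s) (a1 s) (a2 s) (b s)) holomorphic_on S"
proof -
  have bnz: "s \<in> S \<Longrightarrow> k \<in> {1..4} \<Longrightarrow> b s k \<noteq> 0" for s k using admissible[unfolded admissible_def] by blast
  have "(\<lambda>s. poch_num (e s) (b s) i) holomorphic_on S" for i
    unfolding poch_num_def by (intro holomorphic_intros h no_zero_divisors) (use bnz t_nz in auto)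
  moreover have "(\<lambda>s. poch_den (e s) (a1 s) (a2 s) (b s) i) holomorphic_on S" for i
    unfolding poch_den_def by (intro holomorphic_intros h) auto
  ultimately show ?thesis unfolding poch_part_def
    by (intro holomorphic_intros poch_den_nz admissible) auto
qed

text \<open>By \<open>q\<close>-periodicity the maximum over the closed annulus \<open>norm q * \<rho> \<le> norm w \<le> \<rho>\<close> is a maximum over all
  \<open>w\<close> in the domain of holomorphy.\<close>

lemma ratio_const:
  assumes admissible: "admissible e a1 a2 b" and balanced: "balanced n e a1 a2 b" and v: "v \<noteq> 0" and I: "finite I" "card I = n" "n = Suc m"
    and small: "norm (b 3 * b 4) < norm q" and u: "norm (b 3) < norm u" "norm u * norm (b 4) < 1"
  shows "wgt_integral I e a1 a2 (b(3 := b 3 / u, 4 := b 4 * u)) v / poch_part n e a1 a2 (b(3 := b 3 / u, 4 := b 4 * u))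
    = wgt_integral I e a1 a2 b v / poch_part n e a1 a2 b"
proof -
  have bnz: "b k \<noteq> 0" "norm (b k) < 1" if "k \<in> {1..4}" for k using admissible that unfolding admissible_def by auto
  have b34: "b 3 \<noteq> 0" "b 4 \<noteq> 0" "norm (b 3) < 1" "norm (b 4) < 1" using bnz by auto
  define S :: "complex set" where "S = {w. norm (b 3) < norm w \<and> norm w * norm (b 4) < 1}"
  define B where "B = (\<lambda>w. b(3 := b 3 / w, 4 := b 4 * w))"
  have S: "open S" "connected S" unfolding S_def using b34 by (auto intro!: open_annulus0 connected_annulus0)
  have Snz: "w \<noteq> 0" if "w \<in> S" for w using that unfolding S_def by auto
  have admB: "admissible e a1 a2 (B w)" if w: "w \<in> S" for w
  proof -
    have "norm (b 3 / w) < 1" "norm (b 4 * w) < 1" "b 3 / w \<noteq> 0" "b 4 * w \<noteq> 0"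
      using w Snz[OF w] b34 unfolding S_def by (auto simp: norm_mult norm_divide mult.commute)
    thus ?thesis using admissible unfolding admissible_def B_def by auto
  qed
  have balB: "balanced n e a1 a2 (B w)" if w: "w \<in> S" for w
    using balanced Snz[OF w] unfolding balanced_def prod14 B_def by simp
  define R where "R = (\<lambda>w. wgt_integral I e a1 a2 (B w) v / poch_part n e a1 a2 (B w))"
  have Bh: "(\<lambda>w. B w k) holomorphic_on S" for k
    unfolding B_def using Snz by (cases "k = 3"; cases "k = 4") (auto intro!: holomorphic_intros)
  have Rh: "R holomorphic_on S" unfolding R_def
    by (intro holomorphic_intros wgt_integral_holo[OF S(1)] poch_part_holo Bh admB v poch_part_nz[OF _ balB])
  have Rc: "continuous_on S R" by (rule holomorphic_on_imp_continuous_on[OF Rh])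
  have per: "R (q * w) = R w" if w: "w \<in> S" "q * w \<in> S" for w
  proof -
    define T where "T = S \<inter> {w. q * w \<in> S}"
    \<comment> \<open>The values of \<open>w\<close> at which the genericity conditions fail are
      roots of finitely many quadratic equations; continuity extends periodicity across
      them.\<close>
    define F where "F = (\<Union>i\<in>{..n}. \<Union>j\<in>{..n}. {w. (t ^ j * b 4 * q) * w\<^sup>2 = t ^ i * b 3})
        \<union> (\<Union>k\<in>{..2*n}. {w. (e * q\<^sup>2) * w\<^sup>2 = t ^ k * (b 3)\<^sup>2}) \<union> (\<Union>k\<in>{..2*n}. {w. (t ^ k * (b 4)\<^sup>2) * w\<^sup>2 = e})"
    have enz: "e \<noteq> 0" using admissible unfolding admissible_def by simp
    have "finite F" unfolding F_def
      by (intro finite_UnI finite_UN_I finite_quadratic) (use t_nz q_nz b34 enz in auto)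
    moreover have opT: "open T"
    proof -
      have "open ((\<lambda>w. q * w) -` S)" by (intro open_vimage S continuous_intros)
      thus ?thesis unfolding T_def vimage_def using S(1) by auto
    qed
    moreover have "continuous_on T (\<lambda>w. R (q * w))"
      by (rule continuous_on_compose2[OF Rc]) (auto simp: T_def intro!: continuous_intros)
    moreover have "continuous_on T R" by (rule continuous_on_subset[OF Rc]) (auto simp: T_def)
    moreover have "R (q * x) = R x" if x: "x \<in> T - F" for x
    proof -
      have xS: "x \<in> S" "q * x \<in> S" and xF: "x \<notin> F" using x unfolding T_def by auto
      have xnz: "x \<noteq> 0" using Snz xS by auto
      show ?thesis unfolding R_def B_def
      proof (rule ratio_q_periodic[symmetric, OF _ _ balanced v I])
        show "admissible e a1 a2 (b(3 := b 3 / x, 4 := b 4 * x))" "admissible e a1 a2 (b(3 := b 3 / (q * x), 4 := b 4 * (q * x)))"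
          using admB xS unfolding B_def by auto
        show "t ^ i * (b 3 / (q * x)) \<noteq> t ^ j * (b 4 * x)" if ij: "i \<le> n" "j \<le> n" for i j
        proof
          assume "t ^ i * (b 3 / (q * x)) = t ^ j * (b 4 * x)"
          hence "(t ^ j * b 4 * q) * x\<^sup>2 = t ^ i * b 3" using xnz q_nz by (simp add: field_simps power2_eq_square)
          thus False using xF ij unfolding F_def by blast
        qed
        show "e \<noteq> t ^ k * ((b 3 / (q * x)) * (b 3 / (q * x)))" if "k \<le> 2 * n" for k
        proof
          assume "e = t ^ k * ((b 3 / (q * x)) * (b 3 / (q * x)))"
          hence "(e * q\<^sup>2) * x\<^sup>2 = t ^ k * (b 3)\<^sup>2" using xnz q_nz by (simp add: field_simps power2_eq_square)
          thus False using xF that unfolding F_def by blast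
        qed
        show "e \<noteq> t ^ k * ((b 4 * x) * (b 4 * x))" if "k \<le> 2 * n" for k
        proof
          assume "e = t ^ k * ((b 4 * x) * (b 4 * x))"
          hence "(t ^ k * (b 4)\<^sup>2) * x\<^sup>2 = e" by (simp add: field_simps power2_eq_square)
          thus False using xF that unfolding F_def by blast
        qed
      qed
    qed
    ultimately show ?thesis
      using continuous_eq_off_finite[of T "\<lambda>w. R (q * w)" R F w] w unfolding T_def by blast
  qed
  \<comment> \<open>The annulus \<open>S\<close> has ratio of radii
    \<open>1 / norm (b 3 * b 4)\<close>, which by \<open>small\<close> exceeds
    \<open>1 / norm q\<close>; so a closed annulus of ratio \<open>1 / norm q\<close> fits
    inside.\<close>
  obtain \<rho> where \<rho>: "norm (b 3) / norm q < \<rho>" "\<rho> < 1 / norm (b 4)"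
  proof -
    have "norm (b 3) / norm q < 1 / norm (b 4)" using small b34 q_nz by (simp add: norm_mult field_simps)
    thus ?thesis using that dense by blast
  qed
  have \<rho>0: "\<rho> > 0" using \<rho>(1) by (meson divide_nonneg_nonneg norm_ge_zero order_le_less_trans)
  have \<rho>': "norm (b 3) < norm q * \<rho>" "\<rho> * norm (b 4) < 1" using \<rho> q_nz b34 by (auto simp: field_simps)
  define K where "K = {w::complex. norm q * \<rho> \<le> norm w \<and> norm w \<le> \<rho>}"
  have KS: "K \<subseteq> S"
  proof
    fix w assume w: "w \<in> K"
    have "norm w * norm (b 4) \<le> \<rho> * norm (b 4)" using w unfolding K_def by (intro mult_right_mono) auto
    thus "w \<in> S" using w \<rho>' unfolding S_def K_def by auto
  qed
  have "K = cball 0 \<rho> - ball 0 (norm q * \<rho>)" unfolding K_def by auto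
  hence "compact K" by (simp add: compact_diff)
  have "of_real \<rho> \<in> K" unfolding K_def using \<rho>0 q_lt by auto
  obtain \<xi> where \<xi>: "\<xi> \<in> K" "\<And>w. w \<in> K \<Longrightarrow> norm (R w) \<le> norm (R \<xi>)"
    using continuous_attains_sup[OF \<open>compact K\<close>, of "\<lambda>w. norm (R w)"] \<open>of_real \<rho> \<in> K\<close>
      continuous_on_norm[OF continuous_on_subset[OF Rc KS]] by auto
  \<comment> \<open>A point of \<open>U\<close> outside \<open>K\<close> lies one step,
    \<open>w / q\<close> or \<open>q * w\<close>, away from \<open>K\<close>. Hence the maximum over
    \<open>K\<close> is attained at an interior point of the open set \<open>U\<close>, as the
    maximum principle requires.\<close>
  define U where "U = S \<inter> {w. norm q * (norm q * \<rho>) < norm w \<and> norm w * norm q < \<rho>}"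
  have opU: "open U" unfolding U_def
    by (intro open_Int S open_Collect_conj open_Collect_less continuous_intros)
  have "\<xi> \<in> U"
  proof -
    have "norm q * (norm q * \<rho>) < 1 * (norm q * \<rho>)" using q_lt q_nz \<rho>0 by (intro mult_strict_right_mono) auto
    moreover have "norm \<xi> * norm q \<le> \<rho> * norm q" using \<xi>(1) unfolding K_def by (intro mult_right_mono) auto
    moreover have "\<rho> * norm q < \<rho> * 1" using q_lt \<rho>0 by (intro mult_strict_left_mono) auto
    ultimately show ?thesis using \<xi>(1) KS unfolding U_def K_def by auto
  qed
  moreover have "norm (R w) \<le> norm (R \<xi>)" if w: "w \<in> U" for w
  proof (cases "w \<in> K")
    case True
    thus ?thesis by (rule \<xi>)
  next
    case False
    have wS: "w \<in> S" using w unfolding U_def by simp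
    consider "norm w < norm q * \<rho>" | "norm w > \<rho>" using False unfolding K_def by fastforce
    thus ?thesis
    proof cases
      case 1
      have "norm q * (norm q * \<rho>) < norm w" using w unfolding U_def by simp
      hence "norm q * \<rho> < norm w / norm q" using q_nz by (simp add: field_simps)
      moreover have "norm w / norm q < \<rho>" using 1 q_nz by (simp add: field_simps)
      ultimately have "w / q \<in> K" unfolding K_def by (simp add: norm_divide)
      moreover have "R w = R (w / q)" using per[of "w / q"] \<open>w / q \<in> K\<close> KS wS q_nz by auto
      ultimately show ?thesis using \<xi>(2) by simp
    next
      case 2
      have "norm q * \<rho> < norm q * norm w" using 2 q_nz by (intro mult_strict_left_mono) auto
      moreover have "norm q * norm w < \<rho>" using w unfolding U_def by (simp add: mult.commute)
      ultimately have "q * w \<in> K" unfolding K_def by (simp add: norm_mult)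
      thus ?thesis using \<xi>(2)[of "q * w"] per[OF wS] KS by auto
    qed
  qed
  ultimately have "R constant_on S"
    by (intro maximum_modulus_principle[OF Rh S opU]) (auto simp: U_def)
  moreover have "1 \<in> S" "u \<in> S" unfolding S_def using b34 u by auto
  ultimately have "R u = R 1" unfolding constant_on_def by auto
  moreover have "B 1 = b" unfolding B_def by auto
  ultimately show ?thesis unfolding R_def by (simp add: B_def)
qed

lemma wgt_near_circle:
  assumes admissible: "admissible e a1 a2 b" and cv: "c \<noteq> 0" "v \<noteq> 0" and I: "finite I" "i \<in> I" and z: "z \<in> Tor"
  shows "\<exists>S. open S \<and> sphere 0 1 \<subseteq> S \<and> (\<lambda>w. wgt I e c a1 a2 b v (z(i := w))) holomorphic_on S"
proof -
  obtain m where m: "0 < m" "m < 1" "norm a1 \<le> m" "norm a2 \<le> m" "norm t \<le> m" "\<And>k. k \<in> {1..4} \<Longrightarrow> norm (b k) \<le> m"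
    using admissible_bound[OF admissible] by blast
  have e: "e \<noteq> 0" "norm e < 1" and bnz: "\<And>k. k \<in> {1..4} \<Longrightarrow> b k \<noteq> 0" using admissible unfolding admissible_def by auto
  define S where "S = {w::complex. m < norm w \<and> norm w * m < 1}"
  have Snz: "w \<noteq> 0" if "w \<in> S" for w using that m unfolding S_def by auto
  have lo: "norm (x * w) < 1" if "w \<in> S" "norm x \<le> m" for x w
    using that mult_right_mono[of "norm x" m "norm w"] unfolding S_def norm_mult by (auto simp: mult.commute)
  have hi: "norm (x / w) < 1" if "w \<in> S" "norm x \<le> m" for x w
    using that Snz[OF that(1)] unfolding S_def by (auto simp: norm_divide divide_less_eq)
  have me: "norm (x * e) \<le> m" if "norm x \<le> m" for x
    using mult_mono[of "norm x" m "norm e" 1] that e m by (auto simp: norm_mult)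
  have nz1: "qp (x * w) \<noteq> 0" "qp (x / w) \<noteq> 0" if "w \<in> S" "norm x \<le> m" for x w
    by (intro qp_nonzero lo hi that)+
  have nzs: "qp (a1 * e * w) \<noteq> 0" "qp (a2 * e * w) \<noteq> 0" "qp (a1 / w) \<noteq> 0" "qp (a2 / w) \<noteq> 0"
     "\<And>k. k \<in> {1..4} \<Longrightarrow> qp (b k * w) \<noteq> 0" if "w \<in> S" for w
    using nz1 that m me by auto
  have nzc: "qp (t * w / y) \<noteq> 0" "qp (t * y / w) \<noteq> 0" "qp (t * e * w * y) \<noteq> 0" if "w \<in> S" "norm y = 1" for w y
    using nz1[OF that(1), of "t / y"] nz1[OF that(1), of "t * y"] nz1[OF that(1), of "t * e * y"] m me[of t] that
    by (auto simp: norm_mult norm_divide mult_ac)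
  have hs: "sing e c a1 a2 b v holomorphic_on S"
    unfolding sing_def[abs_def] by (intro holomorphic_intros no_zero_divisors) (use nzs bnz Snz cv in auto)
  have hc: "(\<lambda>w. cross e w (z j)) holomorphic_on S" for j
    unfolding cross_def[abs_def] using Tor_norm[OF z] Tor_nz[OF z]
    by (intro holomorphic_intros no_zero_divisors) (use nzc t_nz Snz in auto)
  have eq: "wgt I e c a1 a2 b v (z(i := w)) = sing e c a1 a2 b v w * (\<Prod>j\<in>I - {i}. cross e w (z j)) * wgt (I - {i}) e c a1 a2 b v z" for w
  proof -
    have "(\<Prod>j\<in>I - {i}. cross e ((z(i := w)) i) ((z(i := w)) j)) = (\<Prod>j\<in>I - {i}. cross e w (z j))"
      by (rule prod.cong) auto
    thus ?thesis unfolding wgt_remove[OF I] by (simp add: wgt_upd)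
  qed
  show ?thesis
  proof (intro exI conjI)
    show "open S" unfolding S_def by (rule open_annulus0)
    show "sphere 0 1 \<subseteq> S" unfolding S_def using m by auto
    show "(\<lambda>w. wgt I e c a1 a2 b v (z(i := w))) holomorphic_on S"
      unfolding eq by (intro holomorphic_intros hs hc)
  qed
qed

section \<open>Rescaling the variables\<close>

lemma sing_scale:
  assumes "l \<noteq> 0"
  shows "sing (e / l\<^sup>2) (l\<^sup>2 * c) (l * a1) (l * a2) (\<lambda>k. b k / l) (v / l) w = sing e c a1 a2 b v (w / l)"
proof -
  have 1: "e / l\<^sup>2 * w\<^sup>2 = e * (w / l)\<^sup>2" by (simp add: power_divide)
  have 2: "v / l * w = v * (w / l)" "l\<^sup>2 * c * (v / l) / w = c * v / (w / l)"
    "l * a * (e / l\<^sup>2) * w = a * e * (w / l)" "l * a / w = a / (w / l)"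
    "q * (e / l\<^sup>2) * w / (x / l) = q * e * (w / l) / x" "x / l * w = x * (w / l)" for a x
    using assms by (simp_all add: power2_eq_square)
  show ?thesis unfolding sing_def by (simp only: 1 2)
qed

lemma cross_scale:
  assumes "l \<noteq> 0"
  shows "cross (e / l\<^sup>2) x y = cross e (x / l) (y / l)"
  unfolding cross_def using assms by (simp add: power2_eq_square)

lemma wgt_scale:
  assumes "l \<noteq> 0"
  shows "wgt I (e / l\<^sup>2) (l\<^sup>2 * c) (l * a1) (l * a2) (\<lambda>k. b k / l) (v / l) z = wgt I e c a1 a2 b v (\<lambda>i. z i / l)"
  unfolding wgt_def sing_scale[OF assms] cross_scale[OF assms] ..

text \<open>For \<open>norm l = 1\<close> this is a rotation of the torus. The left side is
  holomorphic in \<open>l\<close> as long as the rescaled parameters stay admissible, and the unit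
  circle has limit points, so the identity theorem gives the remaining \<open>l\<close>.\<close>

lemma wgt_integral_scale:
  assumes admissible: "admissible e a1 a2 b" and v: "v \<noteq> 0" and I: "finite I"
    and l: "norm l \<ge> 1" "norm (l * a1) < 1" "norm (l * a2) < 1"
  shows "wgt_integral I (e / l\<^sup>2) (l * a1) (l * a2) (\<lambda>k. b k / l) (v / l) = wgt_integral I e a1 a2 b v"
proof -
  have a: "a1 \<noteq> 0" "a2 \<noteq> 0" "e \<noteq> 0" "norm e < 1" "norm a1 < 1" "norm a2 < 1" using admissible unfolding admissible_def by auto
  have bk: "b k \<noteq> 0" "norm (b k) < 1" if "k \<in> {1..4}" for k using admissible that unfolding admissible_def by auto
  \<comment> \<open>Rescaling by \<open>w\<close> divides \<open>e\<close> and the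
    \<open>b k\<close> by powers of \<open>w\<close> and multiplies \<open>a1\<close>,
    \<open>a2\<close> by \<open>w\<close>: the former stay in the unit disc for
    \<open>norm w > m1\<close>, the latter for \<open>norm w < 1 / m2\<close>.\<close>
  define m1 where "m1 = Max (insert (sqrt (norm e)) ((\<lambda>k. norm (b k)) ` {1..4}))"
  define m2 where "m2 = max (norm a1) (norm a2)"
  have m1: "sqrt (norm e) \<le> m1" "\<And>k. k \<in> {1..4} \<Longrightarrow> norm (b k) \<le> m1"
    unfolding m1_def by (rule Max_ge; blast intro: finite_imageI finite.intros)+
  have m1': "m1 < 1" unfolding m1_def using a bk by (subst Max_less_iff) auto
  have m10: "0 < m1" using m1(1) a(3) by (meson less_le_trans real_sqrt_gt_0_iff zero_less_norm_iff)
  have m2: "0 < m2" "m2 < 1" "norm a1 \<le> m2" "norm a2 \<le> m2" unfolding m2_def using a by (auto simp: less_max_iff_disj)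
  define S where "S = {w::complex. m1 < norm w \<and> norm w * m2 < 1}"
  have S: "open S" "connected S" unfolding S_def using m2 by (auto intro!: open_annulus0 connected_annulus0)
  have Snz: "w \<noteq> 0" if "w \<in> S" for w using that m10 unfolding S_def by auto
  have admS: "admissible (e / w\<^sup>2) (w * a1) (w * a2) (\<lambda>k. b k / w)" if w: "w \<in> S" for w
  proof -
    have "norm (w * a1) < 1" "norm (w * a2) < 1"
      using w mult_left_mono[OF m2(3), of "norm w"] mult_left_mono[OF m2(4), of "norm w"] unfolding S_def by (auto simp: norm_mult)
    moreover have "norm (b k / w) < 1" if "k \<in> {1..4}" for k
      using w m1(2)[OF that] Snz[OF w] unfolding S_def by (auto simp: norm_divide)
    moreover have "norm (e / w\<^sup>2) < 1"
    proof -
      have "sqrt (norm e) < norm w" using m1(1) w unfolding S_def by auto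
      hence "norm e < (norm w)\<^sup>2" by (metis norm_ge_zero real_less_lsqrt real_sqrt_less_iff real_sqrt_unique order_less_le_trans not_le real_le_lsqrt)
      thus ?thesis using Snz[OF w] by (simp add: norm_divide norm_power)
    qed
    ultimately show ?thesis unfolding admissible_def using a bk Snz[OF w] by auto
  qed
  define f where "f = (\<lambda>w. wgt_integral I (e / w\<^sup>2) (w * a1) (w * a2) (\<lambda>k. b k / w) (v / w) - wgt_integral I e a1 a2 b v)"
  have fh: "f holomorphic_on S" unfolding f_def
    by (intro holomorphic_intros wgt_integral_holo[OF S(1)] admS) (use Snz v in auto)
  have f0: "f w = 0" if w: "w \<in> sphere 0 1" for w
  proof -
    have wnz: "w \<noteq> 0" using w by auto
    define c where "c = t ^ (card I - 1) * a1 * a2"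
    have cnz: "c \<noteq> 0" unfolding c_def using a t_nz by simp
    have "wgt_integral I (e / w\<^sup>2) (w * a1) (w * a2) (\<lambda>k. b k / w) (v / w) = TI I (wgt I (e / w\<^sup>2) (w\<^sup>2 * c) (w * a1) (w * a2) (\<lambda>k. b k / w) (v / w))"
      unfolding wgt_integral_def c_def by (simp add: power2_eq_square mult_ac)
    also have "\<dots> = TI I (\<lambda>z. wgt I e c a1 a2 b v (\<lambda>i. if i \<in> I then (1 / w) * z i else z i))"
      unfolding wgt_scale[OF wnz] unfolding wgt_def
      by (intro arg_cong2[where f = TI] refl ext arg_cong2[where f = "(*)"] prod.cong) (auto simp: pairs_def)
    also have "\<dots> = TI I (wgt I e c a1 a2 b v)"
      by (rule TI_rotate[OF I wgt_cont_Tor[OF admissible cnz v]])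
         (use w wgt_near_circle[OF admissible cnz v I] in \<open>auto simp: norm_divide\<close>)
    finally show ?thesis unfolding f_def wgt_integral_def c_def by simp
  qed
  have "f l = 0"
  proof (rule analytic_continuation[OF fh S])
    show "sphere 0 1 \<subseteq> S" unfolding S_def using m1' m2 by auto
    thus "1 \<in> S" by auto
    have "connected (sphere (0::complex) 1)" by (intro connected_sphere) simp
    moreover have "sphere (0::complex) 1 \<noteq> {x}" for x
    proof
      assume "sphere (0::complex) 1 = {x}"
      moreover have "\<i> \<in> sphere 0 1" "(1::complex) \<in> sphere 0 1" by simp_all
      ultimately have "\<i> = 1" by (metis singletonD)
      thus False by (simp add: complex_eq_iff)
    qed
    ultimately show "1 islimpt sphere (0::complex) 1"
      by (intro connected_imp_perfect) auto
    show "l \<in> S" unfolding S_def m2_def using l m1' by (auto simp: norm_mult max_def)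
  qed (rule f0)
  thus ?thesis unfolding f_def by simp
qed

lemma poch_part_scale:
  assumes "l \<noteq> 0"
  shows "poch_part n (e / l\<^sup>2) (l * a1) (l * a2) (\<lambda>k. b k / l) = poch_part n e a1 a2 b"
proof -
  have 1: "q * (e / l\<^sup>2) / (t ^ i * (x / l) * (y / l)) = q * e / (t ^ i * x * y)"
    "t ^ i * (l * a1) * (l * a2) * (e / l\<^sup>2) = t ^ i * a1 * a2 * e" "t ^ i * (l * x) * (y / l) = t ^ i * x * y" for i x y
    using assms by (simp_all add: power2_eq_square)
  show ?thesis unfolding poch_part_def poch_num_def poch_den_def 1 ..
qed

section \<open>The pinching limit\<close>

text \<open>The prefix \<open>s\<close> marks the factors that stay regular when \<open>a1 = b 3 = 1\<close>.\<close>

definition ssing :: "complex \<Rightarrow> complex \<Rightarrow> complex \<Rightarrow> complex \<Rightarrow> (nat \<Rightarrow> complex) \<Rightarrow> complex \<Rightarrow> complex \<Rightarrow> complex" where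
  "ssing e c a1 a2 b v w = (1 - e * w\<^sup>2) * (th (v * w) * th (c * v / w))
     / (qp (a1 * e * w) * qp (q * a1 / w) * (qp (a2 * e * w) * qp (a2 / w)))
     * (qp (q * e * w / b 1) / qp (b 1 * w) * (qp (q * e * w / b 2) / qp (b 2 * w))
        * (qp (q * e * w / b 3) / qp (q * b 3 * w)) * (qp (q * e * w / b 4) / qp (b 4 * w)))"

definition scross :: "complex \<Rightarrow> complex \<Rightarrow> complex \<Rightarrow> complex" where
  "scross e x y = (1 - e * x * y) * (qp (q * x / y) * qp (q * y / x)) / (qp (t * x / y) * qp (t * y / x))
     * (qp (q * e * x * y / t) / qp (t * e * x * y))"

definition swgt :: "nat set \<Rightarrow> complex \<Rightarrow> complex \<Rightarrow> complex \<Rightarrow> complex \<Rightarrow> (nat \<Rightarrow> complex) \<Rightarrow> complex \<Rightarrow> (nat \<Rightarrow> complex) \<Rightarrow> complex" where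
  "swgt I e c a1 a2 b v z = (\<Prod>i\<in>I. ssing e c a1 a2 b v (z i)) * (\<Prod>(j, k)\<in>pairs I. scross e (z j) (z k))"

text \<open>With \<open>a1 = b 3 = r\<close>, the leading factors of \<open>qp (a1 / w)\<close> and
  \<open>qp (b 3 * w)\<close> combine to a Poisson denominator. This is why both parameters approach
  1 along the same real number.\<close>

lemma sing_ssing: "sing e c (of_real r) a2 b v w = 1 / pden r w * ssing e c (of_real r) a2 b v w"
  if "b 3 = of_real r"
proof -
  have r1: "qp (of_real r / w) = (1 - of_real r / w) * qp (q * of_real r / w)" using qp_rec[of "of_real r / w"] by simp
  have r2: "qp (b 3 * w) = (1 - of_real r * w) * qp (q * b 3 * w)" using qp_rec[of "b 3 * w"] that by (simp add: mult_ac)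
  have gen: "s * T / (d1 * (n1 * x1) * d2) * (P1 * P2 * (N3 / (n2 * x3)) * P4) = 1 / (n1 * n2) * (s * T / (d1 * x1 * d2) * (P1 * P2 * (N3 / x3) * P4))"
    for s T d1 n1 x1 d2 P1 P2 N3 n2 x3 P4 :: complex by (simp add: mult_ac)
  show ?thesis unfolding sing_def ssing_def prod14 pden_def r1 r2 by (rule gen)
qed

lemma cross_scross: "cross e x y = ((1 - x / y) * (1 - y / x)) * scross e x y"
proof -
  have "qp (x / y) = (1 - x / y) * qp (q * x / y)" for x y using qp_rec[of "x / y"] by simp
  from this[of x y] this[of y x] show ?thesis unfolding cross_def scross_def by (simp add: mult_ac)
qed

lemma scross_sym: "scross e x y = scross e y x"
  unfolding scross_def by (simp add: mult_ac)

lemma wgt_swgt: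
  assumes "b 3 = of_real r"
  shows "wgt I e c (of_real r) a2 b v z = (\<Prod>i\<in>I. 1 / pden r (z i)) * vdm I z * swgt I e c (of_real r) a2 b v z"
proof -
  have s: "(\<Prod>i\<in>I. sing e c (of_real r) a2 b v (z i)) = (\<Prod>i\<in>I. 1 / pden r (z i)) * (\<Prod>i\<in>I. ssing e c (of_real r) a2 b v (z i))"
    unfolding prod.distrib[symmetric] sing_ssing[where b = b and r = r, OF assms] ..
  have x: "(\<Prod>(j, k)\<in>pairs I. cross e (z j) (z k)) = vdm I z * (\<Prod>(j, k)\<in>pairs I. scross e (z j) (z k))"
    unfolding vdm_def split_beta cross_scross prod.distrib ..
  show ?thesis unfolding wgt_def swgt_def s x by (simp only: mult_ac)
qed

definition pinch_admissible :: "complex \<Rightarrow> complex \<Rightarrow> complex \<Rightarrow> (nat \<Rightarrow> complex) \<Rightarrow> bool" where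
  "pinch_admissible e a1 a2 b \<longleftrightarrow> e \<noteq> 0 \<and> norm e < 1 \<and> norm a1 \<le> 1 \<and> a2 \<noteq> 0 \<and> norm a2 < 1 \<and> b 3 \<noteq> 0 \<and> norm (b 3) \<le> 1 \<and>
     (\<forall>k\<in>{1,2,4}. b k \<noteq> 0 \<and> norm (b k) < 1)"

lemma swgt_cont:
  fixes z :: "'s :: topological_space \<Rightarrow> nat \<Rightarrow> complex"
  assumes "continuous_on S e" "continuous_on S c" "continuous_on S a1" "continuous_on S a2" "continuous_on S v"
    and "\<And>k. k \<in> {1..4} \<Longrightarrow> continuous_on S (\<lambda>s. b s k)" "\<And>i. continuous_on S (\<lambda>s. z s i)"
    and admissible: "\<And>s. s \<in> S \<Longrightarrow> pinch_admissible (e s) (a1 s) (a2 s) (b s)" and cv: "\<And>s. s \<in> S \<Longrightarrow> c s \<noteq> 0" "\<And>s. s \<in> S \<Longrightarrow> v s \<noteq> 0"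
    and z: "\<And>s. s \<in> S \<Longrightarrow> z s \<in> Tor"
  shows "continuous_on S (\<lambda>s. swgt I (e s) (c s) (a1 s) (a2 s) (b s) (v s) (z s))"
proof -
  have nz: "s \<in> S \<Longrightarrow> z s i \<noteq> 0" "s \<in> S \<Longrightarrow> norm (z s i) = 1" for s i using z Tor_nz Tor_norm by blast+
  note a = admissible[unfolded pinch_admissible_def]
  have small: "norm (x * y) < 1" if "norm x \<le> 1" "norm y < 1" for x y :: complex
    using norm_mult_less_one[OF that(2,1)] by (simp add: mult.commute)
  have n1: "qp (a1 s * e s * z s i) \<noteq> 0" "qp (q * a1 s / z s i) \<noteq> 0" "qp (a2 s * e s * z s i) \<noteq> 0" "qp (a2 s / z s i) \<noteq> 0"
    "qp (b s 1 * z s i) \<noteq> 0" "qp (b s 2 * z s i) \<noteq> 0" "qp (q * b s 3 * z s i) \<noteq> 0" "qp (b s 4 * z s i) \<noteq> 0"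
    "qp (t * z s i / z s j) \<noteq> 0" "qp (t * e s * z s i * z s j) \<noteq> 0" if s: "s \<in> S" for s i j
  proof -
    have "norm (a1 s * e s) < 1" "norm (a2 s * e s) < 1" "norm (t * e s) < 1"
      using a[OF s] t_lt by (auto intro!: small)
    moreover have "norm (q * a1 s) < 1" "norm (q * b s 3) < 1"
      using a[OF s] q_lt by (auto intro!: norm_mult_less_one)
    ultimately show "qp (a1 s * e s * z s i) \<noteq> 0" "qp (q * a1 s / z s i) \<noteq> 0" "qp (a2 s * e s * z s i) \<noteq> 0" "qp (a2 s / z s i) \<noteq> 0"
    "qp (b s 1 * z s i) \<noteq> 0" "qp (b s 2 * z s i) \<noteq> 0" "qp (q * b s 3 * z s i) \<noteq> 0" "qp (b s 4 * z s i) \<noteq> 0"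
    "qp (t * z s i / z s j) \<noteq> 0" "qp (t * e s * z s i * z s j) \<noteq> 0"
      using a[OF s] t_lt nz[OF s] by (auto intro!: qp_nonzero simp: norm_mult norm_divide)
  qed
  have bnz: "s \<in> S \<Longrightarrow> b s 1 \<noteq> 0 \<and> b s 2 \<noteq> 0 \<and> b s 3 \<noteq> 0 \<and> b s 4 \<noteq> 0" for s using a by auto
  have bc: "continuous_on S (\<lambda>s. b s 1)" "continuous_on S (\<lambda>s. b s 2)" "continuous_on S (\<lambda>s. b s 3)" "continuous_on S (\<lambda>s. b s 4)"
    using assms(6) by auto
  have s: "continuous_on S (\<lambda>s. ssing (e s) (c s) (a1 s) (a2 s) (b s) (v s) (z s i))" for i
    unfolding ssing_def by (intro continuous_intros assms(1-5,7) bc ballI no_zero_divisors) (use n1 bnz cv nz in auto)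
  have x: "continuous_on S (\<lambda>s. scross (e s) (z s j) (z s k))" for j k
    unfolding scross_def by (intro continuous_intros assms(1-5,7) ballI no_zero_divisors) (use n1 t_nz nz in auto)
  show ?thesis unfolding swgt_def split_beta by (intro continuous_intros s x)
qed

text \<open>The value of \<open>ssing\<close> at \<open>w = 1\<close> for
  \<open>a1 = b 3 = 1\<close> and \<open>c = t ^ m * a2\<close>, after cancelling
  \<open>qp e\<close> against \<open>(1 - e) * qp (q * e)\<close>.\<close>

definition pinch_residue :: "nat \<Rightarrow> complex \<Rightarrow> complex \<Rightarrow> (nat \<Rightarrow> complex) \<Rightarrow> complex \<Rightarrow> complex" where
  "pinch_residue m e a2 b v = th v * th (t ^ m * a2 * v) * (qp (q * e / b 1) * qp (q * e / b 2) * qp (q * e / b 4))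
     / (qp q * qp q * qp (a2 * e) * qp a2 * (qp (b 1) * qp (b 2) * qp (b 4)))"

text \<open>Fixing one variable at 1 attaches \<open>scross e 1 w\<close> to every other variable
  \<open>w\<close>. It cancels the factors of \<open>a1 = b 3 = 1\<close> and supplies those of
  \<open>a1 = b 3 = t\<close>, so that the weight in one variable fewer appears.\<close>

lemma residue_integrand:
  assumes admissible: "pinch_admissible e 1 a2 b" and b3: "b 3 = 1" and v: "v \<noteq> 0" and I: "finite I" "i \<in> I" "card I = Suc m" and z: "z \<in> Tor"
  shows "vdm (I - {i}) z * swgt I e (t ^ m * a2) 1 a2 b v (z(i := 1))
    = pinch_residue m e a2 b v * wgt (I - {i}) e (t ^ (card (I - {i}) - 1) * t * a2) t a2 (b(3 := t)) v z"
proof -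
  note a = admissible[unfolded pinch_admissible_def]
  define c where "c = t ^ m * a2"
  \<comment> \<open>For an empty remainder the truncated exponent \<open>card (I - {i}) - 1\<close>
    is 0 and this identity can fail; the weight is then an empty product, so \<open>c\<close> does
    not enter it.\<close>
  have cE: "t ^ (card (I - {i}) - 1) * t * a2 = c" if "I - {i} \<noteq> {}"
  proof -
    have "card (I - {i}) = m" using I by simp
    moreover have "m \<noteq> 0" using that I \<open>card (I - {i}) = m\<close> by (metis card_0_eq finite_Diff)
    ultimately have "t ^ (card (I - {i}) - 1) * t = t ^ m" by (cases m) (auto simp: mult.commute)
    thus ?thesis unfolding c_def by simp
  qed
  note zz = Tor_norm[OF z] Tor_nz[OF z]
  have e1: "1 - e \<noteq> 0" using a by auto
  have qe: "qp (q * e) \<noteq> 0" using a q_lt by (intro qp_nonzero norm_mult_less_one) auto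
  have qq: "qp q \<noteq> 0" using q_lt by (rule qp_nonzero)
  have s1: "ssing e c 1 a2 b v 1 = pinch_residue m e a2 b v"
  proof -
    have r: "qp e = (1 - e) * qp (q * e)" by (rule qp_rec)
    have "ssing e c 1 a2 b v 1 = (1 - e) * (th v * th (c * v)) / ((1 - e) * qp (q * e) * qp q * (qp (a2 * e) * qp a2))
     * (qp (q * e / b 1) / qp (b 1) * (qp (q * e / b 2) / qp (b 2)) * (qp (q * e) / qp q) * (qp (q * e / b 4) / qp (b 4)))"
      unfolding ssing_def b3 by (simp add: r)
    also have "\<dots> = pinch_residue m e a2 b v" unfolding pinch_residue_def c_def using e1 qe by (simp add: mult_ac)
    finally show ?thesis .
  qed
  have sx: "ssing e c 1 a2 b v w * scross e 1 w = sing e c t a2 (b(3 := t)) v w" if w: "norm w = 1" for w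
  proof -
    have wnz: "w \<noteq> 0" using w by auto
    have r: "qp (e * w) = (1 - e * w) * qp (q * e * w)" using qp_rec[of "e * w"] by (simp add: mult.assoc)
    have nz: "1 - e * w \<noteq> 0" "qp (q * e * w) \<noteq> 0" "qp (q * w) \<noteq> 0" "qp (q / w) \<noteq> 0"
    proof -
      have "norm (e * w) < 1" using a w by (simp add: norm_mult)
      thus "1 - e * w \<noteq> 0" by auto
      have "norm (q * e) < 1" using a q_lt by (intro norm_mult_less_one) auto
      thus "qp (q * e * w) \<noteq> 0" using w by (intro qp_nonzero) (simp add: norm_mult)
      show "qp (q * w) \<noteq> 0" "qp (q / w) \<noteq> 0" using w q_lt by (auto intro!: qp_nonzero simp: norm_mult norm_divide)
    qed
    have gen: "s * T / (n1 * x1 * x2 * d2) * (P1 * P2 * (x1 / x3) * P4) * (n1 * (x2 * x3) / (y1 * y2) * (E / D))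
       = s * T / (D * y1 * d2) * (P1 * P2 * (E / y2) * P4)" if "n1 \<noteq> 0" "x1 \<noteq> 0" "x2 \<noteq> 0" "x3 \<noteq> 0"
      for s T n1 x1 x2 d2 P1 P2 x3 P4 y1 y2 E D :: complex using that by (simp add: mult_ac)
    have L: "ssing e c 1 a2 b v w * scross e 1 w = (1 - e * w\<^sup>2) * (th (v * w) * th (c * v / w))
       / ((1 - e * w) * qp (q * e * w) * qp (q / w) * (qp (a2 * e * w) * qp (a2 / w)))
       * (qp (q * e * w / b 1) / qp (b 1 * w) * (qp (q * e * w / b 2) / qp (b 2 * w)) * (qp (q * e * w) / qp (q * w)) * (qp (q * e * w / b 4) / qp (b 4 * w)))
       * ((1 - e * w) * (qp (q / w) * qp (q * w)) / (qp (t / w) * qp (t * w)) * (qp (q * e * w / t) / qp (t * e * w)))"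
      unfolding ssing_def scross_def b3 by (simp add: r)
    have R: "sing e c t a2 (b(3 := t)) v w = (1 - e * w\<^sup>2) * (th (v * w) * th (c * v / w))
       / (qp (t * e * w) * qp (t / w) * (qp (a2 * e * w) * qp (a2 / w)))
       * (qp (q * e * w / b 1) / qp (b 1 * w) * (qp (q * e * w / b 2) / qp (b 2 * w)) * (qp (q * e * w / t) / qp (t * w)) * (qp (q * e * w / b 4) / qp (b 4 * w)))"
      unfolding sing_def prod14 by simp
    show ?thesis unfolding L R by (rule gen[OF nz(1,2,4,3)])
  qed
  have p1: "(\<Prod>j\<in>I. ssing e c 1 a2 b v ((z(i := 1)) j)) = ssing e c 1 a2 b v 1 * (\<Prod>j\<in>I - {i}. ssing e c 1 a2 b v (z j))"
    unfolding prod.remove[OF I(1,2)] by (intro arg_cong2[where f = "(*)"] prod.cong) auto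
  have p2: "(\<Prod>(j, k)\<in>pairs I. scross e ((z(i := 1)) j) ((z(i := 1)) k))
     = (\<Prod>j\<in>I - {i}. scross e 1 (z j)) * (\<Prod>(j, k)\<in>pairs (I - {i}). scross e (z j) (z k))"
    unfolding prod_pairs_remove[where f = "\<lambda>j k. scross e ((z(i := 1)) j) ((z(i := 1)) k)", OF I(1,2) scross_sym]
    by (intro arg_cong2[where f = "(*)"] prod.cong) (auto simp: pairs_def)
  have p3: "vdm (I - {i}) z * (\<Prod>(j, k)\<in>pairs (I - {i}). scross e (z j) (z k)) = (\<Prod>(j, k)\<in>pairs (I - {i}). cross e (z j) (z k))"
    unfolding vdm_def prod.distrib[symmetric] split_beta cross_scross ..
  have p4: "(\<Prod>j\<in>I - {i}. ssing e c 1 a2 b v (z j)) * (\<Prod>j\<in>I - {i}. scross e 1 (z j)) = (\<Prod>j\<in>I - {i}. sing e (t ^ (card (I - {i}) - 1) * t * a2) t a2 (b(3 := t)) v (z j))"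
    unfolding prod.distrib[symmetric]
  proof (rule prod.cong[OF refl])
    fix j assume "j \<in> I - {i}"
    hence "t ^ (card (I - {i}) - 1) * t * a2 = c" using cE by blast
    thus "ssing e c 1 a2 b v (z j) * scross e 1 (z j) = sing e (t ^ (card (I - {i}) - 1) * t * a2) t a2 (b(3 := t)) v (z j)"
      using sx[OF zz(1)] by simp
  qed
  have "vdm (I - {i}) z * swgt I e c 1 a2 b v (z(i := 1))
    = ssing e c 1 a2 b v 1 * ((\<Prod>j\<in>I - {i}. ssing e c 1 a2 b v (z j)) * (\<Prod>j\<in>I - {i}. scross e 1 (z j)))
      * (vdm (I - {i}) z * (\<Prod>(j, k)\<in>pairs (I - {i}). scross e (z j) (z k)))"
    unfolding swgt_def p1 p2 by (simp only: mult_ac)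
  also have "\<dots> = pinch_residue m e a2 b v * wgt (I - {i}) e (t ^ (card (I - {i}) - 1) * t * a2) t a2 (b(3 := t)) v z"
    unfolding p3 p4 s1 wgt_def by (simp only: mult_ac)
  finally show ?thesis unfolding c_def .
qed

lemma wgt_integral_pinch:
  assumes I: "finite I" "card I = Suc m" and \<rho>: "0 < r0" "\<And>n. \<rho> n \<in> {r0..<1}" "\<rho> \<longlonglongrightarrow> 1"
    and cont: "continuous_on {r0..1} e" "continuous_on {r0..1} a2" "continuous_on {r0..1} v"
      "\<And>k. k \<in> {1..4} \<Longrightarrow> continuous_on {r0..1} (\<lambda>r. b r k)"
    and admissible: "\<And>r. r \<in> {r0..1} \<Longrightarrow> pinch_admissible (e r) (of_real r) (a2 r) (b r)" and v: "\<And>r. r \<in> {r0..1} \<Longrightarrow> v r \<noteq> 0"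
    and b3: "\<And>r. r \<in> {r0..1} \<Longrightarrow> b r 3 = of_real r"
  shows "(\<lambda>n. (1 - (of_real (\<rho> n))\<^sup>2) * wgt_integral I (e (\<rho> n)) (of_real (\<rho> n)) (a2 (\<rho> n)) (b (\<rho> n)) (v (\<rho> n)))
    \<longlonglongrightarrow> (\<Sum>i\<in>I. pinch_residue m (e 1) (a2 1) (b 1) (v 1) * wgt_integral (I - {i}) (e 1) t (a2 1) ((b 1)(3 := t)) (v 1))"
proof -
  have r1: "1 \<in> {r0..1}" and \<rho>r: "\<rho> n \<in> {r0..1}" for n using \<rho>(2)[of n] by auto
  define S where "S = (\<lambda>r z. swgt I (e r) (t ^ m * of_real r * a2 r) (of_real r) (a2 r) (b r) (v r) z)"
  have comp: "continuous_on ({r0..1} \<times> Tor) (\<lambda>p. g (fst p))" if "continuous_on {r0..1} g" for g :: "real \<Rightarrow> complex"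
    by (rule continuous_on_compose2[OF that]) (auto intro!: continuous_intros)
  have rpos: "r \<noteq> 0" if "r \<in> {r0..1}" for r using that \<rho>(1) by auto
  have Sc: "continuous_on ({r0..1} \<times> Tor) (\<lambda>p. S (fst p) (snd p))"
    unfolding S_def
    by (intro swgt_cont comp cont continuous_snd_coord continuous_on_mult continuous_on_const continuous_on_of_real continuous_on_id)
       (use admissible v t_nz rpos in \<open>auto simp: pinch_admissible_def\<close>)
  have "I \<noteq> {}" using I by auto
  have "(\<lambda>n. (1 - (of_real (\<rho> n))\<^sup>2) * TI I (\<lambda>z. (\<Prod>i\<in>I. 1 / pden (\<rho> n) (z i)) * vdm I z * S (\<rho> n) z))
    \<longlonglongrightarrow> (\<Sum>i\<in>I. TI (I - {i}) (\<lambda>z. vdm (I - {i}) z * S 1 (z(i := 1))))"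
    by (rule TI_pinch[OF I(1) \<open>I \<noteq> {}\<close> \<rho> Sc])
  also have "(\<lambda>n. (1 - (of_real (\<rho> n))\<^sup>2) * TI I (\<lambda>z. (\<Prod>i\<in>I. 1 / pden (\<rho> n) (z i)) * vdm I z * S (\<rho> n) z))
     = (\<lambda>n. (1 - (of_real (\<rho> n))\<^sup>2) * wgt_integral I (e (\<rho> n)) (of_real (\<rho> n)) (a2 (\<rho> n)) (b (\<rho> n)) (v (\<rho> n)))"
  proof (intro ext arg_cong2[where f = "(*)"] refl)
    show "TI I (\<lambda>z. (\<Prod>i\<in>I. 1 / pden (\<rho> n) (z i)) * vdm I z * S (\<rho> n) z)
      = wgt_integral I (e (\<rho> n)) (of_real (\<rho> n)) (a2 (\<rho> n)) (b (\<rho> n)) (v (\<rho> n))" for n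
      unfolding wgt_integral_def S_def by (rule TI_cong) (use I wgt_swgt[where b = "b (\<rho> n)" and r = "\<rho> n", OF b3[OF \<rho>r]] in simp)
  qed
  also have "(\<Sum>i\<in>I. TI (I - {i}) (\<lambda>z. vdm (I - {i}) z * S 1 (z(i := 1))))
     = (\<Sum>i\<in>I. pinch_residue m (e 1) (a2 1) (b 1) (v 1) * wgt_integral (I - {i}) (e 1) t (a2 1) ((b 1)(3 := t)) (v 1))"
  proof (rule sum.cong[OF refl])
    fix i assume i: "i \<in> I"
    show "TI (I - {i}) (\<lambda>z. vdm (I - {i}) z * S 1 (z(i := 1))) = pinch_residue m (e 1) (a2 1) (b 1) (v 1) * wgt_integral (I - {i}) (e 1) t (a2 1) ((b 1)(3 := t)) (v 1)"
      unfolding wgt_integral_def TI_cmult[symmetric]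
    proof (rule TI_cong)
      fix z assume "z \<in> Tor"
      thus "vdm (I - {i}) z * S 1 (z(i := 1)) = pinch_residue m (e 1) (a2 1) (b 1) (v 1) * wgt (I - {i}) (e 1) (t ^ (card (I - {i}) - 1) * t * a2 1) t (a2 1) ((b 1)(3 := t)) (v 1) z"
        unfolding S_def using residue_integrand[of "e 1" "a2 1" "b 1" "v 1" I i m z] admissible[OF r1] b3[OF r1] v[OF r1] I i by simp
    qed
  qed
  finally show ?thesis .
qed

section \<open>Evaluation\<close>

text \<open>\<open>poch_den\<close> at \<open>i = 0\<close> with the factor
  \<open>1 - a1 * b 3\<close> taken out, the only one that vanishes at \<open>a1 = b 3 = 1\<close>.
  \<open>poch_lim\<close> is thus \<open>poch_part\<close> times this factor and stays continuous up
  to the limit.\<close>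

definition poch_den0 :: "complex \<Rightarrow> complex \<Rightarrow> complex \<Rightarrow> (nat \<Rightarrow> complex) \<Rightarrow> complex" where
  "poch_den0 e a1 a2 b = qp (a1 * a2 * e) * (qp (a1 * b 1) * qp (a2 * b 1) * (qp (a1 * b 2) * qp (a2 * b 2))
     * (qp (q * (a1 * b 3)) * qp (a2 * b 3)) * (qp (a1 * b 4) * qp (a2 * b 4)))"

definition poch_lim :: "nat \<Rightarrow> complex \<Rightarrow> complex \<Rightarrow> complex \<Rightarrow> (nat \<Rightarrow> complex) \<Rightarrow> complex" where
  "poch_lim m e a1 a2 b = poch_num e b 0 / poch_den0 e a1 a2 b * (\<Prod>i<m. poch_num e b (Suc i) / poch_den e a1 a2 b (Suc i))"

text \<open>The part of the evaluation that does not depend on the \<open>b k\<close>, with the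
  \<open>n!\<close> of the claimed formula moved to this side.\<close>

definition theta_part :: "nat \<Rightarrow> complex \<Rightarrow> complex \<Rightarrow> complex \<Rightarrow> complex" where
  "theta_part n v a1 a2 = fact n * ((\<Prod>i<n. qp t / (qp q * qp (t ^ Suc i))) * ((\<Prod>i<n. th (t ^ i * (a1 * v))) * (\<Prod>i<n. th (t ^ i * (a2 * v)))))"

lemma poch_part_poch_lim:
  assumes "1 - a1 * b 3 \<noteq> 0"
  shows "(1 - a1 * b 3) * poch_part (Suc m) e a1 a2 b = poch_lim m e a1 a2 b"
proof -
  have "poch_den e a1 a2 b 0 = (1 - a1 * b 3) * poch_den0 e a1 a2 b"
    unfolding poch_den_def poch_den0_def prod14 using qp_rec[of "a1 * b 3"] by (simp add: mult_ac)
  thus ?thesis unfolding poch_part_def poch_lim_def prod.lessThan_Suc_shift using assms by simp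
qed

lemma pinch_admissible_nz:
  assumes admissible: "pinch_admissible e a1 a2 b"
  shows "poch_den0 e a1 a2 b \<noteq> 0" "poch_den e a1 a2 b (Suc i) \<noteq> 0"
proof -
  note a = admissible[unfolded pinch_admissible_def]
  have small: "norm (x * y) < 1" if "norm x \<le> 1" "norm y < 1" for x y :: complex
    using norm_mult_less_one[OF that(2,1)] by (simp add: mult.commute)
  have le: "norm e \<le> 1" "norm (b 1) \<le> 1" "norm (b 2) \<le> 1" "norm (b 3) \<le> 1" "norm (b 4) \<le> 1" using a by auto
  have lt: "norm a1 \<le> 1" "norm a2 < 1" "norm (b 1) < 1" "norm (b 2) < 1" "norm (b 4) < 1" using a by auto
  have ab: "norm (a1 * b 3) \<le> 1" using lt(1) le(4) by (simp add: norm_mult mult_le_one)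
  have l: "norm (a1 * (a2 * e)) < 1" "norm (a2 * b 3) < 1" "norm (a1 * b 1) < 1" "norm (a1 * b 2) < 1" "norm (a1 * b 4) < 1"
     "norm (a2 * b 1) < 1" "norm (a2 * b 2) < 1" "norm (a2 * b 4) < 1" "norm (q * (a1 * b 3)) < 1"
    by (fact small[OF lt(1) norm_mult_less_one[OF lt(2) le(1)]] norm_mult_less_one[OF lt(2) le(4)] small[OF lt(1) lt(3)] small[OF lt(1) lt(4)]
       small[OF lt(1) lt(5)] norm_mult_less_one[OF lt(2) le(2)] norm_mult_less_one[OF lt(2) le(3)] norm_mult_less_one[OF lt(2) le(5)] norm_mult_less_one[OF q_lt ab])+
  show "poch_den0 e a1 a2 b \<noteq> 0" unfolding poch_den0_def mult.assoc[of a1 a2 e] using l[THEN qp_nonzero] by simp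
  have ti: "norm (t ^ Suc i) < 1" using t_lt t_nz by (simp add: norm_power power_Suc_less_one del: power_Suc)
  have p: "qp (t ^ Suc i * x * y) \<noteq> 0" if "norm (x * y) \<le> 1" for x y
    using qp_nonzero[OF norm_mult_less_one[OF ti that]] by (simp add: mult.assoc del: power_Suc)
  have "qp (t ^ Suc i * a1 * a2 * e) \<noteq> 0"
    using qp_nonzero[OF norm_mult_less_one[OF ti less_imp_le[OF l(1)]]] by (simp add: mult.assoc del: power_Suc)
  thus "poch_den e a1 a2 b (Suc i) \<noteq> 0" unfolding poch_den_def prod14
    using p[OF ab] l(2-8)[THEN less_imp_le, THEN p] by (simp del: power_Suc)
qed

lemma poch_lim_cont:
  fixes e :: "'s :: topological_space \<Rightarrow> complex"
  assumes c: "continuous_on S e" "continuous_on S a1" "continuous_on S a2" "\<And>k. k \<in> {1..4} \<Longrightarrow> continuous_on S (\<lambda>s. b s k)"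
    and admissible: "\<And>s. s \<in> S \<Longrightarrow> pinch_admissible (e s) (a1 s) (a2 s) (b s)"
  shows "continuous_on S (\<lambda>s. poch_lim m (e s) (a1 s) (a2 s) (b s))"
proof -
  have bc: "continuous_on S (\<lambda>s. b s 1)" "continuous_on S (\<lambda>s. b s 2)" "continuous_on S (\<lambda>s. b s 3)" "continuous_on S (\<lambda>s. b s 4)"
    using c(4) by auto
  have bnz: "s \<in> S \<Longrightarrow> b s 1 \<noteq> 0 \<and> b s 2 \<noteq> 0 \<and> b s 3 \<noteq> 0 \<and> b s 4 \<noteq> 0" for s using admissible unfolding pinch_admissible_def by auto
  have 1: "continuous_on S (\<lambda>s. poch_num (e s) (b s) i)" for i
    unfolding poch_num_def by (intro continuous_intros c(1-3) bc ballI no_zero_divisors) (use bnz t_nz in auto)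
  have 2: "continuous_on S (\<lambda>s. poch_den0 (e s) (a1 s) (a2 s) (b s))"
    unfolding poch_den0_def by (intro continuous_intros c(1-3) bc)
  have 3: "continuous_on S (\<lambda>s. poch_den (e s) (a1 s) (a2 s) (b s) i)" for i
    unfolding poch_den_def prod14 by (intro continuous_intros c(1-3) bc)
  show ?thesis unfolding poch_lim_def
    by (intro continuous_on_mult continuous_on_divide continuous_on_prod 1 2 3 ballI pinch_admissible_nz admissible) auto
qed

text \<open>The factors of index \<open>Suc i\<close> at \<open>a1 = b 3 = 1\<close> and those of
  index \<open>i\<close> at \<open>a1 = b 3 = t\<close> agree except for \<open>X\<close>,
  \<open>Y\<close> and \<open>Z\<close>, whose ratios telescope. Balancing gives
  \<open>X m = Y m\<close>, which removes the end terms except those absorbed by index 0 and the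
  quotient of \<open>qp (t ^ Suc m)\<close> and \<open>qp t\<close>.\<close>

lemma poch_lim_recursion:
  assumes admissible: "pinch_admissible e 1 a2 b" and b3: "b 3 = 1" and balanced: "q * e = a2 * b 1 * b 2 * b 4 * t ^ (2 * m)"
  shows "pinch_residue m e a2 b v * poch_part m e t a2 (b(3 := t))
    = qp t / (qp q * qp (t ^ Suc m)) * (th v * th (t ^ m * a2 * v)) * poch_lim m e 1 a2 b"
proof -
  note a = admissible[unfolded pinch_admissible_def]
  have bs: "b 1 \<noteq> 0" "b 2 \<noteq> 0" "b 4 \<noteq> 0" "norm (b 1) < 1" "norm (b 2) < 1" "norm (b 4) < 1" "norm a2 < 1" "a2 \<noteq> 0" using a by auto
  define X where "X = (\<lambda>i. qp (q * e / (t ^ i * b 1 * b 2)) * qp (q * e / (t ^ i * b 1 * b 4)) * qp (q * e / (t ^ i * b 2 * b 4)))"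
  define Y where "Y = (\<lambda>i. qp (t ^ i * a2 * b 1) * qp (t ^ i * a2 * b 2) * qp (t ^ i * a2 * b 4))"
  define Z where "Z = (\<lambda>i. qp (t ^ Suc i))"
  have ti: "norm (t ^ i) \<le> 1" for i using t_lt by (simp add: norm_power power_le_one)
  have p: "norm (t ^ i * x) < 1" if "norm x < 1" for x i
    using norm_mult_less_one[OF that ti] by (simp add: mult.commute)
  have Znz: "Z i \<noteq> 0" for i unfolding Z_def using t_lt t_nz
    by (intro qp_nonzero) (simp add: norm_power power_Suc_less_one del: power_Suc)
  have Ynz: "Y i \<noteq> 0" for i
    unfolding Y_def using bs by (auto intro!: qp_nonzero p norm_mult_less_one less_imp_le simp: mult.assoc)
  have Xarg: "q * e / (t ^ i * x * y) = t ^ (2 * m - i) * a2 * z" if "x * y * z = b 1 * b 2 * b 4" "x \<noteq> 0" "y \<noteq> 0" "i \<le> m" for x y z i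
  proof -
    have "2 * m = i + (2 * m - i)" using that(4) by linarith
    hence "t ^ (2 * m) = t ^ i * t ^ (2 * m - i)" by (metis power_add)
    hence "q * e = a2 * (x * y * z) * (t ^ i * t ^ (2 * m - i))" unfolding that(1) using balanced by (simp add: mult_ac)
    thus ?thesis using that(2,3) t_nz by simp
  qed
  have X: "X i = qp (t ^ (2 * m - i) * a2 * b 4) * qp (t ^ (2 * m - i) * a2 * b 2) * qp (t ^ (2 * m - i) * a2 * b 1)" if "i \<le> m" for i
    unfolding X_def using Xarg[of "b 1" "b 2" "b 4" i] Xarg[of "b 1" "b 4" "b 2" i] Xarg[of "b 2" "b 4" "b 1" i] bs that by simp
  have Xnz: "X i \<noteq> 0" if "i \<le> m" for i
    unfolding X[OF that] using bs by (auto intro!: qp_nonzero p norm_mult_less_one less_imp_le simp: mult.assoc)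
  have XY: "X m = Y m" unfolding X[OF order_refl] Y_def by (simp add: mult_2 mult_ac)
  have adm': "poch_den e t a2 (b(3 := t)) i \<noteq> 0" for i
  proof -
    have "norm (t * (a2 * e)) < 1" "norm (t * b 1) < 1" "norm (t * b 2) < 1" "norm (t * b 4) < 1" "norm (t * t) < 1"
      "norm (a2 * b 1) < 1" "norm (a2 * b 2) < 1" "norm (a2 * b 4) < 1" "norm (a2 * t) < 1"
      using a bs t_lt by (auto intro!: norm_mult_less_one less_imp_le[OF norm_mult_less_one] intro: less_imp_le)
    thus ?thesis unfolding poch_den_def prod14 by (auto intro!: qp_nonzero p simp: mult.assoc)
  qed
  have step: "poch_num e b (Suc i) / poch_den e 1 a2 b (Suc i)
     = poch_num e (b(3 := t)) i / poch_den e t a2 (b(3 := t)) i * (X (Suc i) / X i) * (Y i / Y (Suc i)) * (Z (Suc i) / Z i)" if i: "i < m" for i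
  proof -
    define P where "P = qp (q * e / (t ^ Suc i * b 1)) * qp (q * e / (t ^ Suc i * b 2)) * qp (q * e / (t ^ Suc i * b 4))"
    define D where "D = qp (t ^ Suc i * a2 * e) * (qp (t ^ Suc i * b 1) * qp (t ^ Suc i * b 2) * qp (t ^ Suc i * a2) * qp (t ^ Suc i * b 4))"
    have N1: "poch_num e b (Suc i) = X (Suc i) * P" unfolding poch_num_def X_def P_def b3 by (simp add: mult_ac)
    have N2: "poch_num e (b(3 := t)) i = X i * P" unfolding poch_num_def X_def P_def by (simp add: mult_ac)
    have D1: "poch_den e 1 a2 b (Suc i) = D * Y (Suc i) * Z i"
      unfolding poch_den_def D_def Y_def Z_def prod14 b3 by (simp add: mult_ac)
    have D2: "poch_den e t a2 (b(3 := t)) i = D * Y i * Z (Suc i)"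
      unfolding poch_den_def D_def Y_def Z_def prod14 by (simp add: mult_ac)
    have "D \<noteq> 0" using adm'[of i] unfolding D2 by auto
    thus ?thesis unfolding N1 N2 D1 D2 using Xnz[of i] i Ynz Znz by simp
  qed
  have "(\<Prod>i<m. poch_num e b (Suc i) / poch_den e 1 a2 b (Suc i))
     = (\<Prod>i<m. poch_num e (b(3 := t)) i / poch_den e t a2 (b(3 := t)) i * (X (Suc i) / X i) * (Y i / Y (Suc i)) * (Z (Suc i) / Z i))"
    by (rule prod.cong[OF refl]) (use step in auto)
  also have "\<dots> = poch_part m e t a2 (b(3 := t)) * (\<Prod>i<m. X (Suc i) / X i) * (\<Prod>i<m. Y i / Y (Suc i)) * (\<Prod>i<m. Z (Suc i) / Z i)"
    unfolding prod.distrib poch_part_def ..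
  also have "\<dots> = poch_part m e t a2 (b(3 := t)) * (X m / X 0) * (Y 0 / Y m) * (Z m / Z 0)"
    using prod_lessThan_telescope[of m X] prod_lessThan_telescope'[of m Y] prod_lessThan_telescope[of m Z] Xnz Ynz Znz by simp
  also have "\<dots> = poch_part m e t a2 (b(3 := t)) * Y 0 / X 0 * (qp (t ^ Suc m) / qp t)"
    unfolding XY using Ynz[of m] unfolding Z_def by simp
  finally have tele: "(\<Prod>i<m. poch_num e b (Suc i) / poch_den e 1 a2 b (Suc i)) = poch_part m e t a2 (b(3 := t)) * Y 0 / X 0 * (qp (t ^ Suc m) / qp t)" .
  define N0 where "N0 = qp (q * e / b 1) * qp (q * e / b 2) * qp (q * e / b 4)"
  define D0 where "D0 = qp (a2 * e) * qp a2 * (qp (b 1) * qp (b 2) * qp (b 4))"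
  have g0: "poch_num e b 0 = X 0 * N0" unfolding poch_num_def X_def N0_def b3 by (simp add: mult_ac)
  have d0: "poch_den0 e 1 a2 b = D0 * Y 0 * qp q" unfolding poch_den0_def D0_def Y_def b3 by (simp add: mult_ac)
  have D0: "D0 \<noteq> 0" using pinch_admissible_nz(1)[OF admissible] unfolding d0 by auto
  have G: "poch_lim m e 1 a2 b = N0 / (D0 * qp q) * poch_part m e t a2 (b(3 := t)) * (qp (t ^ Suc m) / qp t)"
  proof -
    have gen: "x * N / (D * y * k) * (F * y / x * w) = N / (D * k) * F * w" if "x \<noteq> 0" "y \<noteq> 0" for x N D y k F w :: complex
      using that by simp
    show ?thesis unfolding poch_lim_def g0 d0 tele by (rule gen[OF Xnz[OF le0] Ynz])
  qed
  have r: "pinch_residue m e a2 b v = th v * th (t ^ m * a2 * v) * N0 / (qp q * qp q * D0)"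
    unfolding pinch_residue_def N0_def D0_def by (simp add: mult_ac)
  have qn: "qp q \<noteq> 0" "qp t \<noteq> 0" "qp (t ^ Suc m) \<noteq> 0" using qp_nonzero[OF q_lt] qp_nonzero[OF t_lt] Znz[of m] unfolding Z_def by auto
  have gen: "T * N / (Q * Q * D) * F = tt / (Q * u) * T * (N / (D * Q) * F * (u / tt))"
    if "tt \<noteq> 0" "u \<noteq> 0" for T N Q D F tt u :: complex using that by (simp add: mult_ac)
  show ?thesis unfolding G r by (rule gen[OF qn(2,3)])
qed

lemma theta_part_recursion:
  "theta_part (Suc m) v 1 a2 = of_nat (Suc m) * theta_part m v t a2 * (qp t / (qp q * qp (t ^ Suc m)) * (th v * th (t ^ m * a2 * v)))"
proof -
  have 1: "(\<Prod>i<Suc m. th (t ^ i * (1 * v))) = th v * (\<Prod>i<m. th (t ^ i * (t * v)))"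
    unfolding prod.lessThan_Suc_shift by (simp add: mult_ac)
  show ?thesis unfolding theta_part_def 1 by (simp add: mult_ac del: power_Suc)
qed

lemma theta_part_scale: "l \<noteq> 0 \<Longrightarrow> theta_part n (v / l) (l * a1) (l * a2) = theta_part n v a1 a2"
  unfolding theta_part_def by simp

text \<open>Neither rescaling to \<open>a1 = r\<close> nor moving \<open>b 3\<close> to
  \<open>r\<close> changes the quotient of the integral by \<open>poch_part\<close>, so it can be
  computed in the limit \<open>r \<rightarrow> 1\<close>. \<open>a21\<close> keeps the rescaled
  \<open>a2\<close> in the unit disc; \<open>b34\<close> makes \<open>ratio_const\<close> applicable
  and keeps the new \<open>b 4\<close> in the disc.\<close>

lemma evaluation_step:
  assumes IH: "\<And>I e a1 a2 b v. finite I \<Longrightarrow> card I = m \<Longrightarrow> admissible e a1 a2 b \<Longrightarrow> m = 0 \<or> balanced m e a1 a2 b \<Longrightarrow> v \<noteq> 0 \<Longrightarrow>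
      wgt_integral I e a1 a2 b v = theta_part m v a1 a2 * poch_part m e a1 a2 b"
    and I: "finite I" "card I = Suc m" and admissible: "admissible e a1 a2 b" and balanced: "balanced (Suc m) e a1 a2 b" and v: "v \<noteq> 0"
    and a21: "norm a2 < norm a1" and b34: "norm (b 3 * b 4) < norm q"
  shows "wgt_integral I e a1 a2 b v = theta_part (Suc m) v a1 a2 * poch_part (Suc m) e a1 a2 b"
proof -
  have a: "a1 \<noteq> 0" "a2 \<noteq> 0" "e \<noteq> 0" "norm e < 1" "norm a1 < 1" "norm a2 < 1" using admissible unfolding admissible_def by auto
  have bk: "b k \<noteq> 0" "norm (b k) < 1" if "k \<in> {1..4}" for k using admissible that unfolding admissible_def by auto
  have b: "b 1 \<noteq> 0" "b 2 \<noteq> 0" "b 3 \<noteq> 0" "b 4 \<noteq> 0" "norm (b 1) < 1" "norm (b 2) < 1" "norm (b 3) < 1" "norm (b 4) < 1"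
    using bk by auto
  \<comment> \<open>\<open>r \<ge> norm a1\<close> gives \<open>norm (l r) \<ge> 1\<close>, the
    range of the rescaling lemma, and \<open>r \<ge> norm q\<close> gives
    \<open>norm (B r 4) < 1\<close>.\<close>
  define r0 where "r0 = max (norm a1) (norm q)"
  have r0: "0 < r0" "r0 < 1" "norm a1 \<le> r0" "norm q \<le> r0" unfolding r0_def using a q_lt by (auto simp: less_max_iff_disj)
  define l where "l = (\<lambda>r::real. of_real r / a1)"
  define E where "E = (\<lambda>r. e / (l r)\<^sup>2)"
  define A2 where "A2 = (\<lambda>r. l r * a2)"
  define V where "V = (\<lambda>r. v / l r)"
  define B' where "B' = (\<lambda>r k. b k / l r)"
  \<comment> \<open>Chosen so that \<open>B r 3 = B' r 3 / u r\<close> equals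
    \<open>r\<close>.\<close>
  define u where "u = (\<lambda>r. B' r 3 / of_real r)"
  define B where "B = (\<lambda>r. (B' r)(3 := B' r 3 / u r, 4 := B' r 4 * u r))"
  have lnz: "l r \<noteq> 0" "r > 0" "r \<noteq> 0" if "r \<in> {r0..1}" for r using that r0 a unfolding l_def by auto
  have lge: "norm (l r) \<ge> 1" if "r \<in> {r0..1}" for r
    using that r0 a unfolding l_def by (auto simp: norm_divide field_simps)
  have la1: "l r * a1 = of_real r" for r unfolding l_def using a by simp
  have lA2: "norm (l r * a2) < 1" if r: "r \<in> {r0..1}" for r
  proof -
    have "norm (l r * a2) = r * (norm a2 / norm a1)" unfolding l_def using lnz[OF r] by (simp add: norm_mult norm_divide)
    also have "\<dots> \<le> 1 * (norm a2 / norm a1)" using r by (intro mult_right_mono) auto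
    also have "\<dots> < 1" using a21 a by simp
    finally show ?thesis .
  qed
  have div: "norm (x / l r) < 1" if "norm x < 1" "r \<in> {r0..1}" for x r
  proof -
    have "norm x < norm (l r)" using that(1) lge[OF that(2)] by linarith
    thus ?thesis using lnz[OF that(2)] by (simp add: norm_divide)
  qed
  have E1: "norm (E r) < 1" if r: "r \<in> {r0..1}" for r
    using div[OF div[OF a(4) r] r] unfolding E_def by (simp add: power2_eq_square divide_divide_eq_left)
  have B3: "B r 3 = of_real r" if r: "r \<in> {r0..1}" for r
    unfolding B_def u_def B'_def using lnz[OF r] b by simp
  have B4: "B r 4 = b 3 * b 4 / (l r * l r * of_real r)" for r
    unfolding B_def u_def B'_def by (simp add: mult_ac)
  have u1: "norm (u r) = norm (B' r 3) / r" if "r \<in> {r0..1}" for r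
    unfolding u_def using lnz[OF that] by (simp add: norm_divide)
  have small': "norm (B' r 3 * B' r 4) < norm q" if r: "r \<in> {r0..1}" for r
  proof -
    have "1 \<le> norm (l r * l r)" using lge[OF r] mult_mono[of 1 "norm (l r)" 1 "norm (l r)"] by (simp add: norm_mult)
    hence "norm (b 3 * b 4) < norm q * norm (l r * l r)"
      using b34 by (metis less_le_trans mult.right_neutral mult_left_mono norm_ge_zero)
    moreover have "norm (B' r 3 * B' r 4) = norm (b 3 * b 4) / norm (l r * l r)"
      unfolding B'_def by (simp add: norm_mult norm_divide)
    ultimately show ?thesis using lnz[OF r] by (simp add: divide_less_eq)
  qed
  have B4n: "norm (B r 4) < 1" if r: "r \<in> {r0..1}" for r
  proof -
    have "norm (B r 4) = norm (B' r 3 * B' r 4) / r"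
      unfolding B_def u_def using lnz[OF r] by (simp add: norm_mult norm_divide)
    also have "\<dots> < norm q / r" using small'[OF r] lnz[OF r] by (simp add: divide_strict_right_mono)
    also have "\<dots> \<le> 1" using r r0 lnz[OF r] by simp
    finally show ?thesis .
  qed
  have pinch_admissible: "pinch_admissible (E r) (of_real r) (A2 r) (B r)" if r: "r \<in> {r0..1}" for r
    unfolding pinch_admissible_def
  proof (intro conjI ballI)
    show "E r \<noteq> 0" "A2 r \<noteq> 0" unfolding E_def A2_def using a lnz[OF r] by auto
    show "norm (E r) < 1" "norm (A2 r) < 1" using E1[OF r] lA2[OF r] unfolding A2_def by auto
    show "norm (complex_of_real r) \<le> 1" "B r 3 \<noteq> 0" "norm (B r 3) \<le> 1" using r lnz[OF r] unfolding B3[OF r] by auto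
    fix k :: nat assume k: "k \<in> {1, 2, 4}"
    have "B r k \<noteq> 0" unfolding B_def u_def B'_def using k b lnz[OF r] by auto
    moreover have "norm (B r k) < 1"
    proof (cases "k = 4")
      case False
      hence "B r k = b k / l r" using k unfolding B_def B'_def by auto
      thus ?thesis using div[of "b k"] k b r by auto
    qed (use B4n[OF r] in simp)
    ultimately show "B r k \<noteq> 0" "norm (B r k) < 1" by auto
  qed
  have adm': "admissible (E r) (of_real r) (A2 r) (B' r)" if r: "r \<in> {r0..<1}" for r
    unfolding admissible_def
  proof (intro conjI ballI)
    have r': "r \<in> {r0..1}" using r by auto
    show "E r \<noteq> 0" "A2 r \<noteq> 0" unfolding E_def A2_def using a lnz[OF r'] by auto
    show "norm (E r) < 1" "norm (A2 r) < 1" using E1[OF r'] lA2[OF r'] unfolding A2_def by auto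
    show "complex_of_real r \<noteq> 0" "norm (complex_of_real r) < 1" using r lnz[OF r'] by auto
    fix k :: nat assume k: "k \<in> {1..4}"
    show "B' r k \<noteq> 0" "norm (B' r k) < 1" unfolding B'_def using div[OF bk(2)[OF k] r'] bk(1)[OF k] lnz[OF r'] by auto
  qed
  have bal': "balanced (Suc m) (E r) (of_real r) (A2 r) (B' r)" if r: "r \<in> {r0..1}" for r
  proof -
    have "q * E r = (l r * a1) * (l r * a2) * (\<Prod>k=1..4. B' r k) * t ^ (2 * Suc m - 2)"
      using balanced lnz(1)[OF r] unfolding balanced_def E_def B'_def prod14 by (simp add: field_simps power2_eq_square)
    thus ?thesis unfolding balanced_def A2_def la1 .
  qed
  define C where "C = wgt_integral I e a1 a2 b v / poch_part (Suc m) e a1 a2 b"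
  have C: "wgt_integral I (E r) (of_real r) (A2 r) (B r) (V r) = C * poch_part (Suc m) (E r) (of_real r) (A2 r) (B r)" if r: "r \<in> {r0..<1}" for r
  proof -
    have r': "r \<in> {r0..1}" using r by auto
    have Vnz: "V r \<noteq> 0" unfolding V_def using v lnz[OF r'] by simp
    have un: "norm (B' r 3) < norm (u r)" "norm (u r) * norm (B' r 4) < 1"
    proof -
      have "norm (B' r 3) * r < norm (B' r 3) * 1" using r b lnz[OF r'] unfolding B'_def by (intro mult_strict_left_mono) auto
      thus "norm (B' r 3) < norm (u r)" unfolding u1[OF r'] using lnz[OF r'] by (simp add: field_simps)
      have "norm (u r) * norm (B' r 4) = norm (B r 4)" unfolding B_def by (simp add: norm_mult mult.commute)
      thus "norm (u r) * norm (B' r 4) < 1" using B4n[OF r'] by simp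
    qed
    have "wgt_integral I (E r) (of_real r) (A2 r) (B r) (V r) / poch_part (Suc m) (E r) (of_real r) (A2 r) (B r)
       = wgt_integral I (E r) (of_real r) (A2 r) (B' r) (V r) / poch_part (Suc m) (E r) (of_real r) (A2 r) (B' r)"
      unfolding B_def by (rule ratio_const[OF adm'[OF r] bal'[OF r'] Vnz I refl small'[OF r'] un])
    also have "wgt_integral I (E r) (of_real r) (A2 r) (B' r) (V r) = wgt_integral I e a1 a2 b v"
      using wgt_integral_scale[OF admissible v I(1) lge[OF r'] _ lA2[OF r']] r lnz[OF r'] unfolding E_def A2_def B'_def V_def la1 by simp
    also have "poch_part (Suc m) (E r) (of_real r) (A2 r) (B' r) = poch_part (Suc m) e a1 a2 b"
      using poch_part_scale[OF lnz(1)[OF r'], of "Suc m" e a1 a2 b] unfolding E_def A2_def B'_def la1 .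
    finally have ratio: "wgt_integral I (E r) (of_real r) (A2 r) (B r) (V r) / poch_part (Suc m) (E r) (of_real r) (A2 r) (B r) = C" unfolding C_def .
    have "admissible (E r) (of_real r) (A2 r) (B r)"
    proof -
      have "B r k \<noteq> 0 \<and> norm (B r k) < 1" if "k \<in> {1..4}" for k
      proof -
        have "k \<in> {1,2,4} \<or> k = 3" using that by auto
        thus ?thesis using pinch_admissible[OF r'] B3[OF r'] r lnz[OF r'] unfolding pinch_admissible_def by auto
      qed
      thus ?thesis using adm'[OF r] unfolding admissible_def by blast
    qed
    moreover have "balanced (Suc m) (E r) (of_real r) (A2 r) (B r)"
    proof -
      have "u r \<noteq> 0" unfolding u_def B'_def using b lnz[OF r'] by simp
      thus ?thesis using bal'[OF r'] unfolding balanced_def prod14 B_def by simp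
    qed
    ultimately have "poch_part (Suc m) (E r) (of_real r) (A2 r) (B r) \<noteq> 0" by (rule poch_part_nz)
    thus ?thesis using ratio by (simp add: field_simps)
  qed
  have cl: "continuous_on {r0..1} l" unfolding l_def by (intro continuous_intros) (use a in auto)
  have cE: "continuous_on {r0..1} E" unfolding E_def by (intro continuous_intros cl) (use lnz in auto)
  have cA: "continuous_on {r0..1} A2" unfolding A2_def by (intro continuous_intros cl)
  have cV: "continuous_on {r0..1} V" unfolding V_def by (intro continuous_intros cl) (use lnz in auto)
  have cB: "continuous_on {r0..1} (\<lambda>r. B r k)" if "k \<in> {1..4}" for k
  proof -
    consider "k = 3" | "k = 4" | "k \<noteq> 3" "k \<noteq> 4" by blast
    thus ?thesis
    proof cases
      case 1
      have "continuous_on {r0..1} (\<lambda>r. B r 3) \<longleftrightarrow> continuous_on {r0..1} (\<lambda>r. complex_of_real r)"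
        by (rule continuous_on_cong) (auto simp: B3)
      thus ?thesis unfolding 1 by (auto intro!: continuous_intros)
    next
      case 2
      show ?thesis unfolding 2 B4 by (intro continuous_intros cl) (use lnz in auto)
    next
      case 3
      hence Bk: "(\<lambda>r. B r k) = (\<lambda>r. b k / l r)" unfolding B_def B'_def by (auto simp: fun_eq_iff)
      show ?thesis unfolding Bk by (intro continuous_intros cl) (use lnz in auto)
    qed
  qed
  have Vnz: "V r \<noteq> 0" if "r \<in> {r0..1}" for r unfolding V_def using v lnz[OF that] by simp
  define \<rho> where "\<rho> = (\<lambda>n. 1 - (1 - r0) / real (Suc n))"
  have \<rho>: "\<rho> n \<in> {r0..<1}" for n
  proof -
    have "(1 - r0) / real (Suc n) \<le> (1 - r0) / 1" using r0 by (intro divide_left_mono) auto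
    moreover have "0 < (1 - r0) / real (Suc n)" using r0 by simp
    ultimately show ?thesis unfolding \<rho>_def by auto
  qed
  have \<rho>1: "\<rho> \<longlonglongrightarrow> 1"
  proof -
    have "(\<lambda>n. 1 - (1 - r0) * inverse (real (Suc n))) \<longlonglongrightarrow> 1 - (1 - r0) * 0"
      by (intro tendsto_intros LIMSEQ_inverse_real_of_nat)
    thus ?thesis unfolding \<rho>_def by (simp add: divide_inverse)
  qed
  have \<rho>': "\<rho> n \<in> {r0..1}" for n using \<rho>[of n] by auto
  have r1: "(1::real) \<in> {r0..1}" using r0 by auto
  have B31: "B 1 3 = 1" using B3[OF r1] by simp
  have sadm1: "pinch_admissible (E 1) 1 (A2 1) (B 1)" using pinch_admissible[OF r1] by simp
  have lim1: "(\<lambda>n. (1 - (of_real (\<rho> n))\<^sup>2) * wgt_integral I (E (\<rho> n)) (of_real (\<rho> n)) (A2 (\<rho> n)) (B (\<rho> n)) (V (\<rho> n)))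
    \<longlonglongrightarrow> (\<Sum>i\<in>I. pinch_residue m (E 1) (A2 1) (B 1) (V 1) * wgt_integral (I - {i}) (E 1) t (A2 1) ((B 1)(3 := t)) (V 1))"
    by (rule wgt_integral_pinch[OF I r0(1) \<rho> \<rho>1 cE cA cV cB pinch_admissible Vnz B3])
  \<comment> \<open>With \<open>a1 = b 3 = \<rho> n\<close> the normalisation of the Poisson kernel
    coincides with \<open>1 - a1 * b 3\<close>, which \<open>poch_part_poch_lim\<close> removes from
    the explicit side.\<close>
  have eqn: "(1 - (of_real (\<rho> n))\<^sup>2) * wgt_integral I (E (\<rho> n)) (of_real (\<rho> n)) (A2 (\<rho> n)) (B (\<rho> n)) (V (\<rho> n))
     = C * poch_lim m (E (\<rho> n)) (of_real (\<rho> n)) (A2 (\<rho> n)) (B (\<rho> n))" for n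
  proof -
    have "(1 - (complex_of_real (\<rho> n))\<^sup>2) = 1 - of_real (\<rho> n) * B (\<rho> n) 3"
      unfolding B3[OF \<rho>'] by (simp add: power2_eq_square)
    moreover have "1 - of_real (\<rho> n) * B (\<rho> n) 3 \<noteq> 0"
    proof -
      have "\<rho> n * \<rho> n < 1" using \<rho>[of n] r0 mult_strict_mono[of "\<rho> n" 1 "\<rho> n" 1] by auto
      hence "complex_of_real (\<rho> n * \<rho> n) \<noteq> 1" by (metis less_irrefl of_real_eq_1_iff)
      thus ?thesis unfolding B3[OF \<rho>'] by simp
    qed
    ultimately show ?thesis unfolding C[OF \<rho>] using poch_part_poch_lim by (metis mult.left_commute)
  qed
  have lim2: "(\<lambda>n. C * poch_lim m (E (\<rho> n)) (of_real (\<rho> n)) (A2 (\<rho> n)) (B (\<rho> n))) \<longlonglongrightarrow> C * poch_lim m (E 1) (of_real 1) (A2 1) (B 1)"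
  proof -
    have "continuous_on {r0..1} (\<lambda>r. poch_lim m (E r) (of_real r) (A2 r) (B r))"
      by (intro poch_lim_cont cE cA cB pinch_admissible continuous_intros)
    from continuous_on_tendsto_compose[OF this \<rho>1 r1 always_eventually] \<rho>'
    have "(\<lambda>n. poch_lim m (E (\<rho> n)) (of_real (\<rho> n)) (A2 (\<rho> n)) (B (\<rho> n))) \<longlonglongrightarrow> poch_lim m (E 1) (of_real 1) (A2 1) (B 1)"
      by blast
    thus ?thesis by (rule tendsto_mult_left)
  qed
  have eq1: "(\<Sum>i\<in>I. pinch_residue m (E 1) (A2 1) (B 1) (V 1) * wgt_integral (I - {i}) (E 1) t (A2 1) ((B 1)(3 := t)) (V 1)) = C * poch_lim m (E 1) 1 (A2 1) (B 1)"
    using LIMSEQ_unique[OF lim1[unfolded eqn] lim2] unfolding of_real_1 .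
  have bal1: "q * E 1 = A2 1 * B 1 1 * B 1 2 * B 1 4 * t ^ (2 * m)"
  proof -
    have "u 1 \<noteq> 0" unfolding u_def B'_def using b lnz[OF r1] by simp
    hence e: "A2 1 * B 1 1 * B 1 2 * B 1 4 = A2 1 * (\<Prod>k=1..4. B' 1 k)" using B31 unfolding prod14 B_def by simp
    show ?thesis using bal'[OF r1] unfolding balanced_def e by simp
  qed
  have admt: "admissible (E 1) t (A2 1) ((B 1)(3 := t))"
    unfolding admissible_def
  proof (intro conjI ballI)
    fix k :: nat assume "k \<in> {1..4}"
    hence "k \<in> {1,2,4} \<or> k = 3" by auto
    thus "((B 1)(3 := t)) k \<noteq> 0" "norm (((B 1)(3 := t)) k) < 1" using sadm1 t_nz t_lt unfolding pinch_admissible_def by auto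
  qed (use sadm1 t_nz t_lt in \<open>auto simp: pinch_admissible_def\<close>)
  have balt: "m = 0 \<or> balanced m (E 1) t (A2 1) ((B 1)(3 := t))"
  proof (cases m)
    case (Suc k)
    have "t ^ (2 * m) = t * t * t ^ (2 * m - 2)" unfolding Suc by simp
    thus ?thesis using bal1 unfolding balanced_def prod14 by (simp add: mult_ac)
  qed simp
  \<comment> \<open>By the induction hypothesis the contribution does not depend on which variable
    is pinched; the \<open>Suc m\<close> choices build up the factorial in
    \<open>theta_part\<close>.\<close>
  have "(\<Sum>i\<in>I. pinch_residue m (E 1) (A2 1) (B 1) (V 1) * wgt_integral (I - {i}) (E 1) t (A2 1) ((B 1)(3 := t)) (V 1))
      = (\<Sum>i\<in>I. pinch_residue m (E 1) (A2 1) (B 1) (V 1) * (theta_part m (V 1) t (A2 1) * poch_part m (E 1) t (A2 1) ((B 1)(3 := t))))"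
    by (intro sum.cong refl arg_cong2[where f = "(*)"] IH admt balt Vnz r1) (use I in auto)
  also have "\<dots> = of_nat (Suc m) * theta_part m (V 1) t (A2 1) * (pinch_residue m (E 1) (A2 1) (B 1) (V 1) * poch_part m (E 1) t (A2 1) ((B 1)(3 := t)))"
    using I by (simp add: mult_ac)
  also have "\<dots> = theta_part (Suc m) (V 1) 1 (A2 1) * poch_lim m (E 1) 1 (A2 1) (B 1)"
    unfolding poch_lim_recursion[OF sadm1 B31 bal1] theta_part_recursion by (simp only: mult_ac)
  finally have "C * poch_lim m (E 1) 1 (A2 1) (B 1) = theta_part (Suc m) (V 1) 1 (A2 1) * poch_lim m (E 1) 1 (A2 1) (B 1)"
    unfolding eq1 .
  \<comment> \<open>Balancing writes each argument in the numerator as \<open>A2 1\<close> times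
    factors of modulus at most 1, so nothing vanishes even at the limit and the common factor can be
    cancelled.\<close>
  moreover have "poch_lim m (E 1) 1 (A2 1) (B 1) \<noteq> 0"
  proof -
    have key: "qp (q * E 1 / (t ^ i * x * y)) \<noteq> 0" if "x * y * z = B 1 1 * B 1 2 * B 1 4" "x \<noteq> 0" "y \<noteq> 0" "norm z \<le> 1" "i \<le> m" for x y z i
    proof (rule qp_nonzero)
      have "2 * m = i + (2 * m - i)" using that(5) by linarith
      hence "t ^ (2 * m) = t ^ i * t ^ (2 * m - i)" by (metis power_add)
      hence "q * E 1 = A2 1 * (x * y * z) * (t ^ i * t ^ (2 * m - i))" unfolding that(1) using bal1 by (simp add: mult_ac)
      hence "q * E 1 / (t ^ i * x * y) = A2 1 * (z * t ^ (2 * m - i))" using that(2,3) t_nz by simp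
      also have "norm \<dots> < 1" using sadm1 that(4) t_lt unfolding pinch_admissible_def
        by (intro norm_mult_less_one) (auto simp: norm_mult norm_power power_le_one mult_le_one)
      finally show "norm (q * E 1 / (t ^ i * x * y)) < 1" .
    qed
    have s1: "B 1 1 \<noteq> 0" "B 1 2 \<noteq> 0" "B 1 4 \<noteq> 0" "norm (B 1 1) \<le> 1" "norm (B 1 2) \<le> 1" "norm (B 1 4) \<le> 1"
      using sadm1 unfolding pinch_admissible_def by (auto intro: less_imp_le)
    have pr: "norm (B 1 1 * B 1 2) \<le> 1" "norm (B 1 1 * B 1 4) \<le> 1" "norm (B 1 2 * B 1 4) \<le> 1"
      using s1 by (auto simp: norm_mult mult_le_one)
    have "poch_num (E 1) (B 1) i \<noteq> 0" if i: "i \<le> m" for i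
      unfolding poch_num_def B31
      using key[of "B 1 1" "B 1 2" "B 1 4" i] key[of 1 "B 1 4" "B 1 1 * B 1 2" i] key[of "B 1 1" 1 "B 1 2 * B 1 4" i]
        key[of "B 1 2" 1 "B 1 1 * B 1 4" i] key[of "B 1 1" "B 1 4" "B 1 2" i] key[of "B 1 2" "B 1 4" "B 1 1" i] s1 pr i
      by (simp add: mult_ac)
    thus ?thesis unfolding poch_lim_def using pinch_admissible_nz[OF sadm1] by auto
  qed
  ultimately have "C = theta_part (Suc m) (V 1) 1 (A2 1)" by simp
  also have "\<dots> = theta_part (Suc m) v a1 a2"
    using theta_part_scale[OF lnz(1)[OF r1], of "Suc m" v a1 a2] unfolding V_def A2_def la1 by simp
  finally have "wgt_integral I e a1 a2 b v / poch_part (Suc m) e a1 a2 b = theta_part (Suc m) v a1 a2" unfolding C_def .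
  thus ?thesis using poch_part_nz[OF admissible balanced] by (simp add: field_simps)
qed

text \<open>Replacing \<open>e\<close>, \<open>a2\<close>, \<open>b 4\<close> by
  \<open>e * s\<^sup>2\<close>, \<open>a2 * s\<close>, \<open>b 4 * s\<close> preserves balancing.
  Small \<open>s\<close> satisfy the size restrictions, \<open>s = 1\<close> is the given case, and
  both sides are holomorphic in \<open>s\<close> on a punctured disc that contains both.\<close>

lemma evaluation_continuation:
  assumes step: "\<And>e a2 b. admissible e a1 a2 b \<Longrightarrow> balanced n e a1 a2 b \<Longrightarrow> norm a2 < norm a1 \<Longrightarrow> norm (b 3 * b 4) < norm q \<Longrightarrow>
      wgt_integral I e a1 a2 b v = theta_part n v a1 a2 * poch_part n e a1 a2 b"
    and admissible: "admissible e a1 a2 b" and balanced: "balanced n e a1 a2 b" and v: "v \<noteq> 0"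
  shows "wgt_integral I e a1 a2 b v = theta_part n v a1 a2 * poch_part n e a1 a2 b"
proof -
  have a: "a1 \<noteq> 0" "norm a1 < 1" "a2 \<noteq> 0" "norm a2 < 1" "e \<noteq> 0" "norm e < 1" using admissible unfolding admissible_def by auto
  have b: "b k \<noteq> 0" "norm (b k) < 1" if "k \<in> {1..4}" for k using admissible that unfolding admissible_def by auto
  have b4: "b 4 \<noteq> 0" "norm (b 4) < 1" using b by auto
  \<comment> \<open>The parameters remain admissible for \<open>0 < norm s < 1 / M\<close>, and the
    size restrictions hold in addition for \<open>norm s < 1 / M'\<close>; \<open>M < 1\<close>
    places \<open>s = 1\<close> in the larger region.\<close>
  define M where "M = max (norm a2) (max (norm (b 4)) (sqrt (norm e)))"
  define M' where "M' = max M (max (norm a2 / norm a1) (norm (b 3 * b 4) / norm q))"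
  have sqe: "sqrt (norm e) < 1" "0 < sqrt (norm e)" using a by auto
  have M: "0 < M" "M < 1" "norm a2 \<le> M" "norm (b 4) \<le> M" "sqrt (norm e) \<le> M"
    unfolding M_def using a(2-4,6) b4 sqe by (auto simp: less_max_iff_disj simp del: real_sqrt_lt_1_iff real_sqrt_gt_0_iff)
  have M': "M \<le> M'" "norm a2 / norm a1 \<le> M'" "norm (b 3 * b 4) / norm q \<le> M'" unfolding M'_def by auto
  have M'pos: "0 < M'" using M M' by linarith
  define S where "S = {w::complex. 0 < norm w \<and> norm w * M < 1}"
  define S' where "S' = {w::complex. 0 < norm w \<and> norm w * M' < 1}"
  define B where "B = (\<lambda>s. b(4 := b 4 * s))"
  have S: "open S" "connected S" "open S'" unfolding S_def S'_def by (fact open_annulus0 connected_annulus0[OF M(1)])+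
  have sub: "S' \<subseteq> S"
  proof
    fix w assume w: "w \<in> S'"
    have "norm w * M \<le> norm w * M'" using M' by (intro mult_left_mono) auto
    from le_less_trans[OF this] show "w \<in> S" using w unfolding S_def S'_def by blast
  qed
  have small: "norm (x * w) < 1" if "w \<in> S" "norm x \<le> M" for x w
  proof -
    have "norm w * norm x \<le> norm w * M" using that by (intro mult_left_mono) auto
    moreover have "norm w * M < 1" using that(1) unfolding S_def by blast
    ultimately have "norm w * norm x < 1" by (rule le_less_trans)
    thus ?thesis by (simp add: norm_mult mult.commute)
  qed
  have admS: "admissible (e * w\<^sup>2) a1 (a2 * w) (B w)" if w: "w \<in> S" for w
    unfolding admissible_def
  proof (intro conjI ballI)
    have wnz: "w \<noteq> 0" using w unfolding S_def by auto
    show "e * w\<^sup>2 \<noteq> 0" "a2 * w \<noteq> 0" "a1 \<noteq> 0" "norm a1 < 1" using a wnz by auto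
    show "norm (a2 * w) < 1" by (rule small[OF w M(3)])
    have "norm (of_real (sqrt (norm e)) * w) < 1" by (rule small[OF w]) (use M(5) in simp)
    hence "(sqrt (norm e) * norm w)\<^sup>2 < 1" using abs_square_less_1[of "sqrt (norm e) * norm w"] by (simp add: norm_mult abs_mult)
    thus "norm (e * w\<^sup>2) < 1" by (simp add: norm_mult norm_power power_mult_distrib)
    fix k :: nat assume k: "k \<in> {1..4}"
    show "B w k \<noteq> 0" "norm (B w k) < 1" unfolding B_def using b[OF k] b4 wnz small[OF w M(4)] by auto
  qed
  have balS: "balanced n (e * w\<^sup>2) a1 (a2 * w) (B w)" for w
  proof -
    have "q * (e * w\<^sup>2) = (q * e) * w\<^sup>2" by simp
    also have "\<dots> = (a1 * a2 * (b 1 * b 2 * b 3 * b 4) * t ^ (2 * n - 2)) * w\<^sup>2" using balanced unfolding balanced_def prod14 by simp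
    finally show ?thesis unfolding balanced_def prod14 B_def by (simp add: power2_eq_square mult_ac)
  qed
  define f where "f = (\<lambda>s. wgt_integral I (e * s\<^sup>2) a1 (a2 * s) (B s) v)"
  define g where "g = (\<lambda>s. theta_part n v a1 (a2 * s) * poch_part n (e * s\<^sup>2) a1 (a2 * s) (B s))"
  have Bh: "(\<lambda>s. B s k) holomorphic_on S" for k
    unfolding B_def by (cases "k = 4") (auto intro!: holomorphic_intros)
  have "f 1 = g 1"
  proof (rule analytic_continuation_open[where f = f and g = g, OF S(3,1) _ S(2) sub])
    have "complex_of_real (1 / (2 * M')) \<in> S'" unfolding S'_def using M'pos by (simp add: norm_divide norm_mult)
    thus "S' \<noteq> {}" by blast
    show "f holomorphic_on S" unfolding f_def
      by (rule wgt_integral_holo[where v = "\<lambda>_. v", OF S(1)]) (use admS v Bh in \<open>auto intro!: holomorphic_intros\<close>)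
    have "(\<lambda>s. poch_part n (e * s\<^sup>2) a1 (a2 * s) (B s)) holomorphic_on S"
      by (rule poch_part_holo) (use admS Bh in \<open>auto intro!: holomorphic_intros\<close>)
    moreover have "(\<lambda>s. theta_part n v a1 (a2 * s)) holomorphic_on S"
      unfolding theta_part_def by (intro holomorphic_intros) (use a v t_nz in \<open>auto simp: S_def\<close>)
    ultimately show "g holomorphic_on S" unfolding g_def by (intro holomorphic_on_mult)
    show "1 \<in> S" unfolding S_def using M by simp
    fix w assume w: "w \<in> S'"
    have wpos: "0 < norm w" "norm w * M' < 1" using w unfolding S'_def by auto
    have lt1: "norm w * x < 1" if "x \<le> M'" for x
    proof -
      have "norm w * x \<le> norm w * M'" using that by (intro mult_left_mono) auto
      thus ?thesis using wpos by linarith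
    qed
    have "norm w * (norm a2 / norm a1) < 1" "norm w * (norm (b 3 * b 4) / norm q) < 1" by (fact lt1[OF M'(2)] lt1[OF M'(3)])+
    hence l: "norm (a2 * w) < norm a1" "norm (B w 3 * B w 4) < norm q"
      unfolding B_def using a q_nz by (auto simp: norm_mult field_simps)
    have "w \<in> S" using w sub by blast
    thus "f w = g w" unfolding f_def g_def by (intro step admS balS l)
  qed
  thus ?thesis unfolding f_def g_def B_def by simp
qed

text \<open>In dimension \<open>0\<close> the condition \<open>balanced\<close> is meaningless since \<open>2 * n - 2\<close> is truncated, and it is not imposed.\<close>

theorem evaluation:
  assumes "finite I" "card I = n" "admissible e a1 a2 b" "n = 0 \<or> balanced n e a1 a2 b" "v \<noteq> 0"
  shows "wgt_integral I e a1 a2 b v = theta_part n v a1 a2 * poch_part n e a1 a2 b"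
  using assms
proof (induction n arbitrary: I e a1 a2 b v)
  case 0
  thus ?case by (simp add: wgt_integral_def TI_empty wgt_def theta_part_def poch_part_def)
next
  case (Suc m)
  have balanced: "balanced (Suc m) e a1 a2 b" using Suc.prems(4) by simp
  show ?case
    by (rule evaluation_continuation[OF evaluation_step[OF Suc.IH Suc.prems(1,2) _ _ Suc.prems(5)] Suc.prems(3) balanced Suc.prems(5)])
qed

end

section \<open>Translation to the stated integrand and product\<close>

lemma torus_integral_TI: "torus_integral n f = TI {1..n} f"
proof -
  have "vector_derivative circ (at x) / circ x = 2 * complex_of_real pi * \<i>" for x
    unfolding vector_derivative_circlepath by (simp add: circlepath)
  thus ?thesis unfolding torus_integral_def TI_def by simp
qed

lemma index_pairs_pairs: "index_pairs n = pairs {1..n}"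
  unfolding index_pairs_def pairs_def by auto

lemma prod13: "(\<Prod>k=1..3::nat. f k) = f 1 * f 2 * f 3"
proof -
  have "{1..3::nat} = {1,2,3}" by auto
  thus ?thesis by (simp add: mult_ac)
qed

lemma prod_index_pairs_3: "(\<Prod>(j, k)\<in>index_pairs 3. f j k) = f 1 2 * f 1 3 * f 2 3"
proof -
  have "index_pairs 3 = {(1,2),(1,3),(2,3)}" unfolding index_pairs_def by auto
  thus ?thesis by (simp add: mult_ac)
qed

context qtbase
begin

text \<open>One half of \<open>th (a3 / w)\<close> cancels the denominator
  \<open>qp (a3 / w)\<close>; the other half, \<open>qp (q * w / a3)\<close>, is the numerator
  \<open>qp (q * e * w / b 4)\<close> of the fourth parameter.\<close>

lemma sing_integrand:
  assumes admissible: "admissible e a1 a2 b" and b4: "b 4 = a3 * e" and a3: "norm a3 < 1" and w: "norm w = 1"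
  shows "qp (e * w\<^sup>2) * (th (c * v * inverse w) * th (v * w) * th (a3 * inverse w))
     / (qp (q * e * w\<^sup>2) * (qp (a1 * e * w) * qp (a1 * inverse w) * (qp (a2 * e * w) * qp (a2 * inverse w)) * (qp (a3 * e * w) * qp (a3 * inverse w))))
     * (qp (q * inverse (b 1) * e * w) / qp (b 1 * w) * (qp (q * inverse (b 2) * e * w) / qp (b 2 * w)) * (qp (q * inverse (b 3) * e * w) / qp (b 3 * w)))
   = sing e c a1 a2 b v w"
proof -
  have wnz: "w \<noteq> 0" using w by auto
  have e: "e \<noteq> 0" "norm e < 1" using admissible unfolding admissible_def by auto
  have 1: "qp (e * w\<^sup>2) = (1 - e * w\<^sup>2) * qp (q * e * w\<^sup>2)" using qp_rec[of "e * w\<^sup>2"] by (simp add: mult.assoc)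
  have 2: "th (a3 / w) = qp (a3 / w) * qp (q * e * w / (a3 * e))" unfolding th_def using e by simp
  have "norm (q * e) < 1" using e q_lt by (intro norm_mult_less_one) auto
  hence nz: "qp (q * e * w\<^sup>2) \<noteq> 0" "qp (a3 / w) \<noteq> 0"
    using a3 w by (auto intro!: qp_nonzero simp: norm_mult norm_divide norm_power)
  have gen: "s * x * (T1 * T2 * (y * N4)) / (x * (A * B * (C * D) * (D4 * y))) * (P1 * P2 * P3)
      = s * (T2 * T1) / (A * B * (C * D)) * (P1 * P2 * P3 * (N4 / D4))" if "x \<noteq> 0" "y \<noteq> 0"
    for s x T1 T2 y N4 A B C D D4 P1 P2 P3 :: complex using that by (simp add: mult_ac)
  have 3: "q / x * e * w = q * e * w / x" for x by simp
  show ?thesis unfolding sing_def prod14 b4 1 divide_inverse[symmetric] 2 3 by (rule gen[OF nz])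
qed

lemma cross_integrand:
  assumes e: "norm e < 1" and x: "norm x = 1" and y: "norm y = 1"
  shows "qp (e * x * y) / qp (q * e * x * y) * (qp (x / y) * qp (y / x) / (qp (t * x / y) * qp (t * y / x)))
      * (qp (q * inverse t * e * x * y) / qp (t * e * x * y)) = cross e x y"
proof -
  have 1: "qp (e * x * y) = (1 - e * x * y) * qp (q * e * x * y)" using qp_rec[of "e * x * y"] by (simp add: mult.assoc)
  have "norm (q * e) < 1" using e q_lt by (intro norm_mult_less_one) auto
  hence nz: "qp (q * e * x * y) \<noteq> 0"
    using x y by (auto intro!: qp_nonzero simp: norm_mult)
  have 2: "q * inverse t * e * x * y = q * e * x * y / t" by (simp add: divide_inverse mult_ac)
  show ?thesis unfolding 1 2 cross_def using nz by simp
qed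

text \<open>Here too each theta function splits: one half of \<open>th (t ^ i * a3 * b k)\<close>
  cancels a denominator, and the other supplies the numerator factor of the pair
  \<open>(k, 4)\<close>.\<close>

lemma poch_part_factor:
  assumes admissible: "admissible e a1 a2 b" and b4: "b 4 = a3 * e" and a3: "norm a3 < 1" "a3 \<noteq> 0"
  shows "th (t ^ i * a3 * b 1) * th (t ^ i * a3 * b 2) * th (t ^ i * a3 * b 3)
      * (qp (q * inverse (t ^ i) * inverse (b 1) * inverse (b 2) * e) * qp (q * inverse (t ^ i) * inverse (b 1) * inverse (b 3) * e)
         * qp (q * inverse (t ^ i) * inverse (b 2) * inverse (b 3) * e))
      / (qp (t ^ i * a1 * a2 * e) * qp (t ^ i * a1 * a3 * e) * qp (t ^ i * a2 * a3 * e)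
         * (qp (t ^ i * a1 * b 1) * qp (t ^ i * a1 * b 2) * qp (t ^ i * a1 * b 3)
            * (qp (t ^ i * a2 * b 1) * qp (t ^ i * a2 * b 2) * qp (t ^ i * a2 * b 3))
            * (qp (t ^ i * a3 * b 1) * qp (t ^ i * a3 * b 2) * qp (t ^ i * a3 * b 3))))
    = poch_num e b i / poch_den e a1 a2 b i"
proof -
  define T where "T = t ^ i"
  have e: "e \<noteq> 0" using admissible unfolding admissible_def by auto
  have bk: "b k \<noteq> 0 \<and> norm (b k) < 1" if "k \<in> {1..4}" for k using admissible that unfolding admissible_def by auto
  have T: "norm T \<le> 1" "T \<noteq> 0" unfolding T_def using t_lt t_nz by (auto simp: norm_power power_le_one)
  have nz: "qp (T * a3 * b k) \<noteq> 0" if "k \<in> {1..4}" for k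
  proof -
    have "norm (a3 * T * b k) < 1" using bk[OF that] a3 T by (intro norm_mult_less_one) auto
    thus ?thesis by (intro qp_nonzero) (simp add: mult_ac)
  qed
  have th: "th (T * a3 * x) = qp (T * a3 * x) * qp (q * e / (T * x * (a3 * e)))" for x
    unfolding th_def using e by (simp add: mult_ac)
  have i: "q * inverse T * inverse x * inverse y * e = q * e / (T * x * y)" for x y
    by (simp add: divide_inverse mult_ac)
  have gen: "y1 * n14 * (y2 * n24) * (y3 * n34) * (n12 * n13 * n23)
     / (d12 * d14 * d24 * (d11 * d21 * d31 * (c1 * c2 * c3) * (y1 * y2 * y3)))
   = n12 * n34 * (n13 * n23) * (n14 * n24) / (d12 * (d11 * c1 * (d21 * c2) * (d31 * c3) * (d14 * d24)))"
    if "y1 \<noteq> 0" "y2 \<noteq> 0" "y3 \<noteq> 0" for y1 n14 y2 n24 y3 n34 n12 n13 n23 d12 d14 d24 d11 d21 d31 c1 c2 c3 :: complex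
    using that by (simp add: mult_ac)
  have a: "T * x * a3 * e = T * x * (a3 * e)" for x by simp
  show ?thesis unfolding poch_num_def poch_den_def prod14 b4 T_def[symmetric] th i a
    by (rule gen) (use nz in auto)
qed

end

theorem corollary1p2:
  fixes n :: nat and q \<epsilon> t v :: complex and a b :: "nat \<Rightarrow> complex"
  assumes "n \<ge> 1"
    and "q \<noteq> 0" and "norm q < 1"
    and "0 < norm \<epsilon>" and "norm \<epsilon> < 1"
    and "\<And>i. i \<in> {1..3} \<Longrightarrow> norm (a i) < 1"
    and "\<And>j. j \<in> {1..3} \<Longrightarrow> norm (b j) < 1"
    and "norm t < 1"
    and "q = a 1 * a 2 * a 3 * b 1 * b 2 * b 3 * t ^ (2 * n - 2)"
    and "v \<noteq> 0"
  shows
    "1 / fact n * torus_integral n (\<lambda>z.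
        (\<Prod>i=1..n.
            qpoch [\<epsilon>^2 * (z i)^2] q
              * theta [t ^ (n - 1) * a 1 * a 2 * v * inverse (z i), v * z i, a 3 * inverse (z i)] q
            / (qpoch [q * \<epsilon>^2 * (z i)^2] q
              * (\<Prod>j=1..3. qpoch [a j * \<epsilon>^2 * z i, a j * inverse (z i)] q))
            * (\<Prod>k=1..3. qpoch [q * inverse (b k) * \<epsilon>^2 * z i] q / qpoch [b k * z i] q))
        * (\<Prod>(j, k)\<in>index_pairs n.
            qpoch [\<epsilon>^2 * z j * z k] q / qpoch [q * \<epsilon>^2 * z j * z k] q
            * (qpoch [z j / z k, z k / z j] q / qpoch [t * z j / z k, t * z k / z j] q)
            * (qpoch [q * inverse t * \<epsilon>^2 * z j * z k] q / qpoch [t * \<epsilon>^2 * z j * z k] q)))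
     = (\<Prod>i=1..n.
          qpoch [t] q * (\<Prod>l=1..2. theta [t ^ (i - 1) * a l * v] q)
            * (\<Prod>k=1..3. theta [t ^ (i - 1) * a 3 * b k] q)
            * (\<Prod>(j, k)\<in>index_pairs 3.
                qpoch [q * inverse (t ^ (i - 1)) * inverse (b j) * inverse (b k) * \<epsilon>^2] q)
          / (qpoch [q, t ^ i] q
            * (\<Prod>(j, k)\<in>index_pairs 3. qpoch [t ^ (i - 1) * a j * a k * \<epsilon>^2] q)
            * (\<Prod>j=1..3. \<Prod>k=1..3. qpoch [t ^ (i - 1) * a j * b k] q)))"
proof -
  note n = assms(1) and q_nz = assms(2) and q_lt = assms(3) and balanced = assms(9) and vnz = assms(10)
  have al: "norm (a 1) < 1" "norm (a 2) < 1" "norm (a 3) < 1" using assms(6) by auto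
  have t0: "n = 1" if "t = 0"
  proof (rule ccontr)
    assume "n \<noteq> 1"
    hence "2 * n - 2 \<noteq> 0" using n by linarith
    thus False using balanced q_nz that by (simp add: power_0_left)
  qed
  \<comment> \<open>For \<open>t = 0\<close> and \<open>n = 1\<close> nothing depends on \<open>t\<close>, which may then be replaced by any nonzero number.\<close>
  define s where "s = (if t = 0 then 1 / 2 else t)"
  have s: "s \<noteq> 0" "norm s < 1" unfolding s_def using assms(8) by (auto simp: norm_divide)
  have st: "s = t \<or> n = 1" using t0 unfolding s_def by auto
  interpret qtbase q s by unfold_locales (fact q_nz q_lt s)+
  define e where "e = \<epsilon>\<^sup>2"
  define B where "B = b(4 := a 3 * e)"
  have e: "e \<noteq> 0" "norm e < 1"
    unfolding e_def using assms(4,5) abs_square_less_1[of "norm \<epsilon>"] by (auto simp: norm_power)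
  have nz: "a 1 \<noteq> 0" "a 2 \<noteq> 0" "a 3 \<noteq> 0" "b 1 \<noteq> 0" "b 2 \<noteq> 0" "b 3 \<noteq> 0" using balanced q_nz by auto
  have admissible: "admissible e (a 1) (a 2) B"
    unfolding admissible_def
  proof (intro conjI ballI e nz al)
    fix k :: nat assume k: "k \<in> {1..4}"
    hence "k \<in> {1, 2, 3} \<or> k = 4" by auto
    moreover have "norm (a 3 * e) < 1" using al e by (intro norm_mult_less_one) auto
    ultimately show "B k \<noteq> 0" "norm (B k) < 1" unfolding B_def using nz e assms(7)[of k] by auto
  qed
  \<comment> \<open>For \<open>n = 1\<close> the powers rewritten with this fact have exponent 0, so
    the choice of \<open>s\<close> does not affect them.\<close>
  have pow: "t ^ k = s ^ k" if "k = 0 \<or> n \<noteq> 1" for k using st that by auto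
  have bal': "balanced n e (a 1) (a 2) B"
  proof -
    have "t ^ (2 * n - 2) = s ^ (2 * n - 2)" by (rule pow) auto
    thus ?thesis using balanced unfolding balanced_def prod14 B_def by (simp add: mult_ac)
  qed
  have B4: "B 4 = a 3 * e" and Bk: "B 1 = b 1" "B 2 = b 2" "B 3 = b 3" unfolding B_def by auto
  note qs = qpoch_def theta_th list.map prod_list.Cons prod_list.Nil mult_1_right prod13 prod.lessThan_Suc
  have lhs: "torus_integral n (\<lambda>z.
        (\<Prod>i=1..n.
            qpoch [\<epsilon>^2 * (z i)^2] q
              * theta [t ^ (n - 1) * a 1 * a 2 * v * inverse (z i), v * z i, a 3 * inverse (z i)] q
            / (qpoch [q * \<epsilon>^2 * (z i)^2] q
              * (\<Prod>j=1..3. qpoch [a j * \<epsilon>^2 * z i, a j * inverse (z i)] q))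
            * (\<Prod>k=1..3. qpoch [q * inverse (b k) * \<epsilon>^2 * z i] q / qpoch [b k * z i] q))
        * (\<Prod>(j, k)\<in>index_pairs n.
            qpoch [\<epsilon>^2 * z j * z k] q / qpoch [q * \<epsilon>^2 * z j * z k] q
            * (qpoch [z j / z k, z k / z j] q / qpoch [t * z j / z k, t * z k / z j] q)
            * (qpoch [q * inverse t * \<epsilon>^2 * z j * z k] q / qpoch [t * \<epsilon>^2 * z j * z k] q)))
    = wgt_integral {1..n} e (a 1) (a 2) B v"
    unfolding torus_integral_TI wgt_integral_def index_pairs_pairs wgt_def
  proof (intro TI_cong arg_cong2[where f = "(*)"] prod.cong refl)
    fix z i assume z: "z \<in> Tor"
    have p: "t ^ (n - 1) = s ^ (card {1..n} - 1)" using pow[of "n - 1"] n by auto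
    show "qpoch [\<epsilon>^2 * (z i)^2] q
              * theta [t ^ (n - 1) * a 1 * a 2 * v * inverse (z i), v * z i, a 3 * inverse (z i)] q
            / (qpoch [q * \<epsilon>^2 * (z i)^2] q
              * (\<Prod>j=1..3. qpoch [a j * \<epsilon>^2 * z i, a j * inverse (z i)] q))
            * (\<Prod>k=1..3. qpoch [q * inverse (b k) * \<epsilon>^2 * z i] q / qpoch [b k * z i] q)
      = sing e (s ^ (card {1..n} - 1) * a 1 * a 2) (a 1) (a 2) B v (z i)"
      unfolding sing_integrand[OF admissible B4 al(3) Tor_norm[OF z], symmetric] Bk p e_def[symmetric] qs
      by (simp only: mult.assoc)
  next
    fix z and x :: "nat \<times> nat" assume z: "z \<in> Tor" and x: "x \<in> pairs {1..n}"
    \<comment> \<open>A pair of distinct indices exists only for \<open>n \<ge> 2\<close>, and then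
      \<open>s\<close> is \<open>t\<close>.\<close>
    have "n \<noteq> 1" using x unfolding pairs_def by auto
    hence t: "t = s" using st by auto
    show "(case x of (j, k) \<Rightarrow>
            qpoch [\<epsilon>^2 * z j * z k] q / qpoch [q * \<epsilon>^2 * z j * z k] q
            * (qpoch [z j / z k, z k / z j] q / qpoch [t * z j / z k, t * z k / z j] q)
            * (qpoch [q * inverse t * \<epsilon>^2 * z j * z k] q / qpoch [t * \<epsilon>^2 * z j * z k] q))
       = (case x of (j, k) \<Rightarrow> cross e (z j) (z k))"
      unfolding split_beta cross_integrand[OF e(2) Tor_norm[OF z] Tor_norm[OF z], symmetric] t e_def[symmetric] qs ..
  qed
  have shift: "(\<Prod>i=1..n. f i) = (\<Prod>i<n. f (Suc i))" for f :: "nat \<Rightarrow> complex"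
    by (simp add: prod.atLeast1_atMost_eq)
  have rhs: "(\<Prod>i=1..n.
          qpoch [t] q * (\<Prod>l=1..2. theta [t ^ (i - 1) * a l * v] q)
            * (\<Prod>k=1..3. theta [t ^ (i - 1) * a 3 * b k] q)
            * (\<Prod>(j, k)\<in>index_pairs 3.
                qpoch [q * inverse (t ^ (i - 1)) * inverse (b j) * inverse (b k) * \<epsilon>^2] q)
          / (qpoch [q, t ^ i] q
            * (\<Prod>(j, k)\<in>index_pairs 3. qpoch [t ^ (i - 1) * a j * a k * \<epsilon>^2] q)
            * (\<Prod>j=1..3. \<Prod>k=1..3. qpoch [t ^ (i - 1) * a j * b k] q)))
      = (\<Prod>i<n. qp s / (qp q * qp (s ^ Suc i)) * (th (s ^ i * (a 1 * v)) * th (s ^ i * (a 2 * v))) * (poch_num e B i / poch_den e (a 1) (a 2) B i))"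
    unfolding shift
  proof (rule prod.cong[OF refl])
    fix i assume i: "i \<in> {..<n}"
    have p: "t ^ (Suc i - 1) = s ^ i" using pow[of i] i by auto
    \<comment> \<open>This quotient is where positive powers of \<open>t\<close> remain when
      \<open>n = 1\<close>; there \<open>i = 0\<close> and both sides equal 1.\<close>
    have pq: "qp t / qp (t ^ Suc i) = qp s / qp (s ^ Suc i)"
    proof (cases "s = t")
      case False
      hence "i = 0" using st i by auto
      thus ?thesis using qp_nonzero[OF assms(8)] qp_nonzero[OF s(2)] by simp
    qed simp
    have p12: "(\<Prod>l=1..2::nat. f l) = f 1 * f 2" for f :: "nat \<Rightarrow> complex"
      by (simp add: numeral_2_eq_2)
    have gen: "pt * T * X * Y / (Q * pi * D * E) = ps / (Q * pj) * T * (X * Y / (D * E))"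
      if "pt / pi = ps / pj" for pt T X Y Q pi D E ps pj :: complex
    proof -
      have "pt * T * X * Y / (Q * pi * D * E) = pt / pi * (T / Q * (X * Y / (D * E)))" by (simp add: mult_ac)
      thus ?thesis unfolding that by (simp add: mult_ac)
    qed
    show "qpoch [t] q * (\<Prod>l=1..2. theta [t ^ (Suc i - 1) * a l * v] q)
            * (\<Prod>k=1..3. theta [t ^ (Suc i - 1) * a 3 * b k] q)
            * (\<Prod>(j, k)\<in>index_pairs 3.
                qpoch [q * inverse (t ^ (Suc i - 1)) * inverse (b j) * inverse (b k) * \<epsilon>^2] q)
          / (qpoch [q, t ^ Suc i] q
            * (\<Prod>(j, k)\<in>index_pairs 3. qpoch [t ^ (Suc i - 1) * a j * a k * \<epsilon>^2] q)
            * (\<Prod>j=1..3. \<Prod>k=1..3. qpoch [t ^ (Suc i - 1) * a j * b k] q))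
      = qp s / (qp q * qp (s ^ Suc i)) * (th (s ^ i * (a 1 * v)) * th (s ^ i * (a 2 * v))) * (poch_num e B i / poch_den e (a 1) (a 2) B i)"
      unfolding poch_part_factor[OF admissible B4 al(3) nz(3), of i, symmetric] Bk p e_def[symmetric] qs p12 prod_index_pairs_3 mult.assoc[of "s ^ i" _ v, symmetric]
      by (rule gen[OF pq])
  qed
  have ev: "wgt_integral {1..n} e (a 1) (a 2) B v = theta_part n v (a 1) (a 2) * poch_part n e (a 1) (a 2) B"
    by (rule evaluation) (use admissible bal' vnz in auto)
  show ?thesis unfolding lhs rhs ev unfolding theta_part_def poch_part_def prod.distrib by simp
qed

end
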